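(* Let $1\leq s\leq\infty$ and $n\geq 2$. Let $\gamma:\mathbb{T}\to\mathbb{C}^n$ be a simple closed curve of class $\mathcal{C}^s$, let $\varepsilon>0$, and let $B$ be an open ball in $\mathbb{C}^n$ that intersects $\gamma(\mathbb{T})$. Then there is a simple closed curve $\gamma_a:\mathbb{T}\to\mathbb{C}^n$ of class $\mathcal{C}^s$ whose image is polynomially convex and which satisfies $d_{\mathcal{C}^s}(\gamma,\gamma_a)<\varepsilon$ and $\gamma(\mathbb{T})\setminus B=\gamma_a(\mathbb{T})\setminus B$.
   Context: $\mathbb{T}$ is the unit circle. A simple closed curve of class $\mathcal{C}^s$ is an injective map $\mathbb{T}\to\mathbb{C}^n$ of class $\mathcal{C}^s$ with nowhere-vanishing derivative. $d_{\mathcal{C}^s}$ denotes the distance in $\mathcal{C}^s(\mathbb{T})$ (the $\mathcal{C}^s$ norm distance for finite $s$, and the standard metric inducing the $\mathcal{C}^\infty$ topology for $s=\infty$). A compact set $X$ is polynomially convex if $X=\{z\in\mathbb{C}^n: |P(z)|\leq\sup_X|P| \text{ for all holomorphic polynomials } P\}$. *)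

theory Defs
  imports "HOL-Analysis.Analysis" "HOL-Library.Extended_Nat"
begin

text \<open>The unit circle T is identified with R/Z: curves on T are 1-periodic maps real => complex^'n.\<close>

definition periodic1 :: "(real \<Rightarrow> 'a) \<Rightarrow> bool" where
  "periodic1 f \<longleftrightarrow> (\<forall>t. f (t + 1) = f t)"

fun iter_vderiv :: "nat \<Rightarrow> (real \<Rightarrow> 'a::real_normed_vector) \<Rightarrow> real \<Rightarrow> 'a" where
  "iter_vderiv 0 f = f"
| "iter_vderiv (Suc k) f = (\<lambda>t. vector_derivative (iter_vderiv k f) (at t))"

definition C_k :: "nat \<Rightarrow> (real \<Rightarrow> 'a::real_normed_vector) \<Rightarrow> bool" where
  "C_k k f \<longleftrightarrow>
     (\<forall>j<k. \<forall>t. (iter_vderiv j f has_vector_derivative iter_vderiv (Suc j) f t) (at t))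
     \<and> continuous_on UNIV (iter_vderiv k f)"

definition C_s :: "enat \<Rightarrow> (real \<Rightarrow> 'a::real_normed_vector) \<Rightarrow> bool" where
  "C_s s f \<longleftrightarrow> (\<forall>k. enat k \<le> s \<longrightarrow> C_k k f)"

definition simple_closed_curve :: "enat \<Rightarrow> (real \<Rightarrow> 'a::real_normed_vector) \<Rightarrow> bool" where
  "simple_closed_curve s \<gamma> \<longleftrightarrow>
     periodic1 \<gamma> \<and> C_s s \<gamma> \<and> inj_on \<gamma> {0..<1} \<and>
     (\<forall>t. vector_derivative \<gamma> (at t) \<noteq> 0)"

definition Ck_norm :: "nat \<Rightarrow> (real \<Rightarrow> 'a::real_normed_vector) \<Rightarrow> real" where
  "Ck_norm k f = (\<Sum>j\<le>k. (SUP t\<in>{0..1}. norm (iter_vderiv j f t)))"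

definition dist_Cs :: "enat \<Rightarrow> (real \<Rightarrow> 'a::real_normed_vector) \<Rightarrow> (real \<Rightarrow> 'a) \<Rightarrow> real" where
  "dist_Cs s f g =
     (case s of enat k \<Rightarrow> Ck_norm k (\<lambda>t. f t - g t)
      | \<infinity> \<Rightarrow> (\<Sum>k. (1/2)^k * min 1 (Ck_norm k (\<lambda>t. f t - g t))))"

definition holo_poly :: "(complex^'n \<Rightarrow> complex) \<Rightarrow> bool" where
  "holo_poly P \<longleftrightarrow> (\<exists>c :: ('n \<Rightarrow> nat) \<Rightarrow> complex. finite {\<alpha>. c \<alpha> \<noteq> 0} \<and>
      P = (\<lambda>z. \<Sum>\<alpha>\<in>{\<alpha>. c \<alpha> \<noteq> 0}. c \<alpha> * (\<Prod>i\<in>UNIV. (z $ i) ^ (\<alpha> i))))"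

definition polynomially_convex :: "(complex^'n) set \<Rightarrow> bool" where
  "polynomially_convex X \<longleftrightarrow> compact X \<and>
     X = {z. \<forall>P. holo_poly P \<longrightarrow> norm (P z) \<le> (SUP x\<in>X. norm (P x))}"

end

theory Submission
  imports Defs "HOL-Complex_Analysis.Complex_Analysis" "HOL-Real_Asymp.Real_Asymp" "Jordan_Normal_Form.Determinant"
begin

text \<open>
  Let \<open>t1\<close> be a parameter mapped into the ball, and let \<open>a\<close> be a coordinate with \<open>\<gamma>_a'(t1) \<noteq> 0\<close>. For another coordinate
  \<open>b\<close> there is a polynomial \<open>Q\<close> such that \<open>u = \<gamma>_b - Q(\<gamma>_a)\<close> is flat at \<open>t1\<close> to any prescribed order, so subtracting a
  cutoff of \<open>u\<close> from \<open>\<gamma>_b\<close> is a small perturbation. On the new curve \<open>G = z_b - Q(z_a)\<close> vanishes along an arc but not identically.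

  Suppose that polynomials are dense in the continuous functions on every proper subarc. Then for a point \<open>q\<close> off a
  subarc there is a polynomial that is 1 at \<open>q\<close> and at most 1/2 on the subarc. If \<open>G(q) \<noteq> 0\<close>, multiply \<open>G\<close> by a high power of
  such a polynomial for the subarc outside the zero set of \<open>G\<close>. If \<open>G(q) = 0\<close>, multiply such a polynomial for a subarc
  containing the zeros of \<open>G\<close> by \<open>1 - G s\<close>, where the polynomial \<open>s\<close> approximates \<open>1/G\<close> where \<open>G\<close> is not small.
  Either product separates \<open>q\<close> from the curve.

  Density on an arc: let \<open>H\<close> be the uniform closure of the polynomials and \<open>p\<close> a generic linear form. For a functional \<open>L\<close>
  annihilating \<open>H\<close>, the minors of the matrices \<open>L(g_i h_j / (p - w))\<close> are holomorphic in \<open>w\<close> off the plane curve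
  traced by \<open>p\<close>. They vanish near infinity, and by the rank-one jump of Cauchy transforms the rank grows by at most one whenever
  \<open>w\<close> crosses the curve at a simple transversal point. So the rank is bounded for each \<open>w\<close>, and this makes
  \<open>{h \<in> H. h / (p - w) \<in> H}\<close> of finite codimension in \<open>H\<close>. The functions multiplying a subspace of finite codimension of \<open>H\<close>
  into \<open>H\<close> form an algebra containing all \<open>1 / (p - w)\<close>, which is dense by the jump relation. Deforming
  \<open>p - w = exp u\<close> to 1 inside this algebra shows that multiplication by \<open>p - w\<close> has index 0 on \<open>H\<close>. Hence it is onto, \<open>1 / (p - w)\<close>
  belongs to \<open>H\<close>, and the jump relation gives that \<open>H\<close> contains all continuous functions.
\<close>

subsection \<open>Determinants of functions\<close>

text \<open>The rank of the form \<open>(g, h) \<mapsto> L (g * h / (p - w))\<close> is a substitute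
  for the hull of the arc: heuristically it counts the hull points that could lie above
  \<open>w\<close>, with multiplicity, and a crossing of the plane curve can create only one more.
  Counting by rank needs no geometry of the hull, so a single continuous derivative is enough.
  Nothing is known about \<open>L\<close> beyond boundedness; instead of a representing measure the
  estimates use integrals in the Banach space of continuous functions and a duality argument for
  means of absolute values. The decisive difference between an arc and a closed curve is the
  logarithm of \<open>p - w\<close>: on a closed curve \<open>p\<close> may wind around
  \<open>w\<close>, the index need not vanish and density can fail. Hence density is used only on
  proper subarcs, and \<open>G\<close> glues the subarcs together. Finitely many derivatives suffice
  in every smoothness class, because the terms of the metric for \<open>s = \<infinity>\<close> are
  capped by powers of 1/2. The perturbation therefore only has to be flat to a finite order
  \<open>N\<close>, and \<open>N <= s\<close> keeps all constructions within the class of the given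
  curve.\<close>

definition detf :: "nat => (nat => nat => complex) => complex" where
  "detf n X = Determinant.det (Matrix.mat n n (%(i,j). X i j))"

definition bordered :: "nat => (nat => nat => complex) => (nat => complex) => (nat => complex)
    => complex => nat => nat => complex" where
  "bordered n X e f c = (%i j. if i < n then (if j < n then X i j else e i) else (if j < n then f j else c))"

lemma detf_cong: "(\<And>i j. i < n ==> j < n ==> X i j = Y i j) ==> detf n X = detf n Y"
  unfolding detf_def by (rule arg_cong[where f = Determinant.det]) (auto intro!: eq_matI)

lemma detf_leibniz: "detf n X = (\<Sum>p | p permutes {0..<n}. signof p * (\<Prod>i = 0..<n. X i (p i)))"
proof -
  have "(\<Prod>i = 0..<n. Matrix.mat n n (%(i,j). X i j) $$ (i, p i)) = (\<Prod>i = 0..<n. X i (p i))"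
    if "p permutes {0..<n}" for p
    using permutes_in_image[OF that] by (intro prod.cong) auto
  then show ?thesis
    unfolding detf_def Determinant.det_def by simp
qed

lemma detf_mult: "detf n (%i j. \<Sum>k<n. X i k * Y k j) = detf n X * detf n Y"
proof -
  have "Matrix.mat n n (%(i,j). \<Sum>k<n. X i k * Y k j)
      = Matrix.mat n n (%(i,j). X i j) * Matrix.mat n n (%(i,j). Y i j)"
    by (rule eq_matI) (auto simp: scalar_prod_def atLeast0LessThan)
  then show ?thesis unfolding detf_def by (simp add: det_mult[of _ n])
qed

definition dele :: "nat => nat => (nat => nat => complex) => nat => nat => complex" where
  "dele a b X = (%i j. X (if i < a then i else Suc i) (if j < b then j else Suc j))"

lemma mat_delete_mat:
  "mat_delete (Matrix.mat (Suc n) (Suc n) (%(i,j). X i j)) a b = Matrix.mat n n (%(i,j). dele a b X i j)"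
  unfolding mat_delete_def dele_def by (rule eq_matI) auto

lemma detf_row: 
  assumes "a < Suc n"
  shows "detf (Suc n) X = (\<Sum>j<Suc n. X a j * ((-1)^(a+j) * detf n (dele a j X)))"
proof -
  let ?A = "Matrix.mat (Suc n) (Suc n) (%(i,j). X i j)"
  have "Determinant.det ?A = (\<Sum>j<Suc n. ?A $$ (a,j) * cofactor ?A a j)"
    by (rule laplace_expansion_row) (use assms in auto)
  then show ?thesis
    unfolding detf_def cofactor_def mat_delete_mat using assms by simp
qed

lemma detf_col: 
  assumes "b < Suc n"
  shows "detf (Suc n) X = (\<Sum>i<Suc n. X i b * ((-1)^(i+b) * detf n (dele i b X)))"
proof -
  let ?A = "Matrix.mat (Suc n) (Suc n) (%(i,j). X i j)"
  have "Determinant.det ?A = (\<Sum>i<Suc n. ?A $$ (i,b) * cofactor ?A i b)"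
    by (rule laplace_expansion_column) (use assms in auto)
  then show ?thesis
    unfolding detf_def cofactor_def mat_delete_mat using assms by simp
qed

lemma detf_bordered_zero_row: "detf (Suc n) (bordered n X e (%_. 0) c) = c * detf n X"
proof -
  have "detf n (dele n n (bordered n X e (%_. 0) c)) = detf n X"
    by (rule detf_cong) (auto simp: dele_def bordered_def)
  then show ?thesis
    by (subst detf_row[of n]) (auto simp: bordered_def)
qed

lemma detf_bordered_zero_col: "detf (Suc n) (bordered n X (%_. 0) f c) = c * detf n X"
proof -
  have "detf n (dele n n (bordered n X (%_. 0) f c)) = detf n X"
    by (rule detf_cong) (auto simp: dele_def bordered_def)
  then show ?thesis
    by (subst detf_col[of n]) (auto simp: bordered_def)
qed

text \<open>Linearity in the last column, \<open>(s e, c) = s (e, 0) + c (0, 1)\<close>, read off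
  from the expansion along that column, whose cofactors do not involve it.\<close>

lemma detf_bordered_split:
  "detf (Suc n) (bordered n X (%i. s * e i) f c) = s * detf (Suc n) (bordered n X e f 0) + c * detf n X"
proof -
  have d: "detf n (dele a n (bordered n X (%i. s * e i) f c)) = detf n (dele a n (bordered n X e f 0))"
    if "a < n" for a
    by (rule detf_cong) (auto simp: dele_def bordered_def)
  have d': "detf n (dele n n (bordered n X (%i. s * e i) f c)) = detf n X"
    by (rule detf_cong) (auto simp: dele_def bordered_def)
  have "detf (Suc n) (bordered n X (%i. s * e i) f c)
      = (\<Sum>i<n. s * e i * ((-1)^(i+n) * detf n (dele i n (bordered n X e f 0)))) + c * detf n X"
    by (subst detf_col[of n]) (auto simp: bordered_def d[unfolded bordered_def] d'[unfolded bordered_def])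
  moreover have "detf (Suc n) (bordered n X e f 0)
      = (\<Sum>i<n. e i * ((-1)^(i+n) * detf n (dele i n (bordered n X e f 0))))"
    by (subst detf_col[of n]) (auto simp: bordered_def)
  ultimately show ?thesis by (simp add: sum_distrib_left mult.assoc)
qed

lemma detf_id: "detf n (%i j. if i = j then 1 else 0) = 1"
proof -
  have "Matrix.mat n n (%(i,j). if i = j then 1 else 0) = (1\<^sub>m n :: complex mat)"
    by (rule eq_matI) auto
  then show ?thesis unfolding detf_def by simp
qed

text \<open>The matrix determinant lemma in a form that needs no inverse of \<open>X\<close>. Left
  multiplication by the unipotent \<open>?U\<close> clears the last column of \<open>?W\<close>
  above the corner and leaves the updated matrix as the main block.\<close>

lemma detf_rank_one_update:
  "detf n (%i j. X i j + s * e i * f j) = detf n X - s * detf (Suc n) (bordered n X e f 0)"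
proof -
  let ?U = "bordered n (%i j. if i = j then 1 else 0) (%i. s * e i) (%_. 0) 1"
  let ?W = "bordered n X (%i. - s * e i) f 1"
  have "detf (Suc n) (%i j. \<Sum>k<Suc n. ?U i k * ?W k j)
      = detf (Suc n) (bordered n (%i j. X i j + s * e i * f j) (%_. 0) f 1)"
    by (rule detf_cong) (auto simp: bordered_def mult_if_delta cong: sum.cong_simp)
  also have "\<dots> = detf n (%i j. X i j + s * e i * f j)"
    by (simp add: detf_bordered_zero_col)
  finally have "detf n (%i j. X i j + s * e i * f j) = detf (Suc n) ?U * detf (Suc n) ?W"
    unfolding detf_mult by simp
  also have "detf (Suc n) ?U = 1" by (simp add: detf_bordered_zero_row detf_id)
  also have "detf (Suc n) ?W = - s * detf (Suc n) (bordered n X e f 0) + detf n X"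
    using detf_bordered_split[of n X "-s" e f 1] by simp
  finally show ?thesis by simp
qed

text \<open>Multiples of the border row are added to the other rows and multiples of the border
  column to the other columns. The zero corner keeps the border itself fixed. This is how bordering
  removes the rank-one part of a jump.\<close>

lemma detf_bordered_invariant:
  "detf (Suc n) (bordered n (%i j. X i j + e i * \<beta> j + \<alpha> i * f j) e f 0) = detf (Suc n) (bordered n X e f 0)"
proof -
  let ?U = "bordered n (%i j. if i = j then 1 else 0) \<alpha> (%_. 0) 1"
  let ?V = "bordered n (%i j. if i = j then 1 else 0) (%_. 0) \<beta> 1"
  let ?B = "bordered n X e f 0"
  have "detf (Suc n) (%i j. \<Sum>k<Suc n. ?U i k * ?B k j) = detf (Suc n) (bordered n (%i j. X i j + \<alpha> i * f j) e f 0)"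
    by (rule detf_cong) (auto simp: bordered_def mult_if_delta cong: sum.cong_simp)
  then have 1: "detf (Suc n) (bordered n (%i j. X i j + \<alpha> i * f j) e f 0) = detf (Suc n) ?B"
    unfolding detf_mult by (simp add: detf_bordered_zero_row detf_id)
  let ?C = "bordered n (%i j. X i j + \<alpha> i * f j) e f 0"
  have "detf (Suc n) (%i j. \<Sum>k<Suc n. ?C i k * ?V k j)
     = detf (Suc n) (bordered n (%i j. X i j + e i * \<beta> j + \<alpha> i * f j) e f 0)"
    by (rule detf_cong) (auto simp: bordered_def if_distrib[of "%x. _ * x"] cong: sum.cong_simp if_cong)
  then show ?thesis
    using 1 unfolding detf_mult by (simp add: detf_bordered_zero_col detf_id)
qed

text \<open>Expansion along the border column and then along the border row leaves only minors of
  order \<open>n - 1\<close> of \<open>X\<close>.\<close>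

lemma detf_bordered_minors_zero:
  assumes "\<And>a b. a < n ==> b < n ==> detf (n - 1) (dele a b X) = 0"
  shows "detf (Suc n) (bordered n X e f 0) = 0"
proof -
  have "detf n (dele a n (bordered n X e f 0)) = 0" if a: "a < n" for a
  proof -
    obtain m where m: "n = Suc m" using a by (cases n) auto
    have "detf m (dele m b (dele a n (bordered n X e f 0))) = 0" if "b < n" for b
    proof -
      have "detf m (dele m b (dele a n (bordered n X e f 0))) = detf m (dele a b X)"
        using a that by (intro detf_cong) (auto simp: dele_def bordered_def m)
      then show ?thesis using assms[OF a that] m by simp
    qed
    then show ?thesis unfolding m by (subst detf_row[of m]) (auto simp: m)
  qed
  then show ?thesis
    by (subst detf_col[of n]) (auto simp: bordered_def)
qed

text \<open>Telescoping: the factors are exchanged one at a time.\<close>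

lemma norm_prod_diff_le:
  fixes z w :: "'i => complex"
  assumes "finite I" "B >= 1" "\<And>i. i \<in> I ==> norm (z i) <= B" "\<And>i. i \<in> I ==> norm (w i) <= B"
  shows "norm (prod z I - prod w I) <= B ^ card I * (\<Sum>i\<in>I. norm (z i - w i))"
  using assms
proof (induction I rule: finite_induct)
  case (insert a I)
  have pw: "norm (prod w I) <= B ^ card I"
  proof -
    have "norm (prod w I) = (\<Prod>i\<in>I. norm (w i))" by (simp add: prod_norm)
    also have "\<dots> <= (\<Prod>i\<in>I. B)" by (rule prod_mono) (use insert.prems in auto)
    finally show ?thesis by simp
  qed
  have IH: "norm (prod z I - prod w I) <= B ^ card I * (\<Sum>i\<in>I. norm (z i - w i))"
    using insert by auto
  have "norm (prod z (insert a I) - prod w (insert a I))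
      = norm (z a * (prod z I - prod w I) + (z a - w a) * prod w I)"
    using insert.hyps by (simp add: algebra_simps)
  also have "\<dots> <= B * (B ^ card I * (\<Sum>i\<in>I. norm (z i - w i))) + norm (z a - w a) * B ^ card I"
  proof (rule norm_triangle_mono)
    show "norm (z a * (prod z I - prod w I)) <= B * (B ^ card I * (\<Sum>i\<in>I. norm (z i - w i)))"
      unfolding norm_mult using IH insert.prems by (intro mult_mono) auto
    show "norm ((z a - w a) * prod w I) <= norm (z a - w a) * B ^ card I"
      unfolding norm_mult using pw by (intro mult_left_mono) auto
  qed
  also have "\<dots> <= B ^ card (insert a I) * (\<Sum>i\<in>insert a I. norm (z i - w i))"
  proof -
    have "norm (z a - w a) * B ^ card I <= norm (z a - w a) * (B * B ^ card I)"
      using insert.prems(1) by (intro mult_left_mono) auto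
    then show ?thesis using insert.hyps by (simp add: algebra_simps)
  qed
  finally show ?case .
qed auto

lemma detf_lipschitz:
  assumes "B >= 1" "\<And>i j. i < n ==> j < n ==> norm (X i j) <= B"
    "\<And>i j. i < n ==> j < n ==> norm (Y i j) <= B"
  shows "norm (detf n X - detf n Y) <= fact n * B ^ n * (\<Sum>i<n. \<Sum>j<n. norm (X i j - Y i j))"
proof -
  let ?S = "\<Sum>i<n. \<Sum>j<n. norm (X i j - Y i j)"
  have fin: "finite {p. p permutes {0..<n}}" by (simp add: finite_permutations)
  have eq: "detf n X - detf n Y
      = (\<Sum>p | p permutes {0..<n}. signof p * ((\<Prod>i = 0..<n. X i (p i)) - (\<Prod>i = 0..<n. Y i (p i))))"
    unfolding detf_leibniz by (simp add: sum_subtractf algebra_simps)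
  have "norm (detf n X - detf n Y) <= (\<Sum>p | p permutes {0..<n}. B ^ n * ?S)"
    unfolding eq
  proof (rule sum_norm_le)
    fix p assume "p \<in> {p. p permutes {0..<n}}"
    then have p: "p i < n" if "i < n" for i using permutes_in_image[of p "{0..<n}" i] that by auto
    have "norm (signof p * ((\<Prod>i = 0..<n. X i (p i)) - (\<Prod>i = 0..<n. Y i (p i))))
        = norm ((\<Prod>i = 0..<n. X i (p i)) - (\<Prod>i = 0..<n. Y i (p i)))"
      by (simp add: norm_mult sign_def)
    also have "\<dots> <= B ^ card {0..<n} * (\<Sum>i=0..<n. norm (X i (p i) - Y i (p i)))"
      by (rule norm_prod_diff_le) (use assms p in auto)
    also have "\<dots> <= B ^ n * ?S"
    proof -
      have "(\<Sum>i=0..<n. norm (X i (p i) - Y i (p i))) <= ?S"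
        unfolding atLeast0LessThan
        by (intro sum_mono member_le_sum) (use p in auto)
      then show ?thesis using assms(1) by (simp add: mult_left_mono)
    qed
    finally show "norm (signof p * ((\<Prod>i = 0..<n. X i (p i)) - (\<Prod>i = 0..<n. Y i (p i)))) <= B ^ n * ?S" .
  qed
  also have "\<dots> = fact n * B ^ n * ?S"
  proof -
    have "card {p. p permutes {0..<n}} = fact n" by (rule card_permutations) auto
    then show ?thesis by (simp only: sum_constant of_nat_fact mult.assoc)
  qed
  finally show ?thesis .
qed

lemma detf_holomorphic:
  assumes "\<And>i j. i < n ==> j < n ==> (%w. X w i j) holomorphic_on S"
  shows "(%w. detf n (X w)) holomorphic_on S"
  unfolding detf_leibniz
proof (intro holomorphic_on_sum holomorphic_intros)
  fix p i assume "p \<in> {p. p permutes {0..<n}}" "i \<in> {0..<n}"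
  then show "(%w. X w i (p i)) holomorphic_on S"
    using permutes_in_image[of p "{0..<n}" i] by (intro assms) auto
qed

text \<open>The \<open>r\<close> equations in \<open>r + 1\<close> unknowns are completed by a zero
  row to a singular square matrix; a kernel vector gives the coefficients.\<close>

lemma linear_dependence:
  fixes v :: "nat => nat => complex"
  shows "\<exists>c. (\<exists>l\<le>r. c l ~= 0) \<and> (\<forall>j<r. (\<Sum>l\<le>r. c l * v l j) = 0)"
proof -
  let ?A = "Matrix.mat (Suc r) (Suc r) (%(j,l). if j < r then v l j else 0)"
  have "detf (Suc r) (%j l. if j < r then v l j else 0) = 0"
    by (subst detf_row[of r]) auto
  then have "Determinant.det ?A = 0" unfolding detf_def by simp
  then obtain x where x: "x \<in> carrier_vec (Suc r)" "x ~= 0\<^sub>v (Suc r)" "?A *\<^sub>v x = 0\<^sub>v (Suc r)"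
    using det_0_iff_vec_prod_zero[of ?A "Suc r"] by auto
  have nz: "\<exists>l\<le>r. vec_index x l ~= 0"
    using x(1,2) by (metis carrier_vecD eq_vecI index_zero_vec(1) index_zero_vec(2) less_Suc_eq_le)
  have "(\<Sum>l\<le>r. vec_index x l * v l j) = 0" if "j < r" for j
  proof -
    have "vec_index (?A *\<^sub>v x) j = 0" using x(3) that by simp
    then show ?thesis
      using that x(1) by (simp add: scalar_prod_def atLeast0LessThan lessThan_Suc_atMost mult.commute)
  qed
  then show ?thesis using nz by blast
qed

subsection \<open>Functionals on the continuous functions on the unit interval\<close>

definition sublin :: "('a::real_vector => real) => bool" where
  "sublin p \<longleftrightarrow> (\<forall>x y. p (x + y) <= p x + p y) \<and> (\<forall>c x. c >= 0 --> p (c *\<^sub>R x) = c * p x)"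

lemma sublin_add: "sublin p ==> p (x + y) <= p x + p y"
  and sublin_scale: "sublin p ==> c >= 0 ==> p (c *\<^sub>R x) = c * p x"
  by (auto simp: sublin_def)

lemma sublin_zero: "sublin p ==> p 0 = 0"
  using sublin_scale[of p 0 0] by simp

lemma sublin_neg: "sublin p ==> - p (- x) <= p x"
  using sublin_add[of p x "-x"] sublin_zero[of p] by simp

text \<open>For sublinear \<open>q\<close>, the choice \<open>t = 0\<close> shows that the new
  functional lies below \<open>q\<close>, and \<open>t = 1\<close> at \<open>x = - g\<close> shows
  that its value at \<open>- g\<close> is at most \<open>- q g\<close>. Lowering thus forces
  linearity in the direction \<open>g\<close>.\<close>

definition lowered :: "('a::real_vector => real) => 'a => 'a => real" where
  "lowered q g x = (INF t\<in>{0..}. q (x + t *\<^sub>R g) - t * q g)"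

lemma lowered_bound:
  assumes "sublin q" "t >= 0"
  shows "- q (- x) <= q (x + t *\<^sub>R g) - t * q g"
  using sublin_add[OF assms(1), of "x + t *\<^sub>R g" "- x"] sublin_scale[OF assms, of g] by simp

lemma lowered_le:
  assumes "sublin q" "t >= 0"
  shows "lowered q g x <= q (x + t *\<^sub>R g) - t * q g"
  unfolding lowered_def
  by (rule cINF_lower) (use assms lowered_bound[OF assms(1)] in \<open>auto intro!: bdd_belowI2[where m = "- q (- x)"]\<close>)

lemma lowered_greatest:
  assumes "\<And>t. t >= 0 ==> m <= q (x + t *\<^sub>R g) - t * q g"
  shows "m <= lowered q g x"
  unfolding lowered_def by (rule cINF_greatest) (use assms in auto)

lemma lowered_scale_le:
  assumes q: "sublin q" and c: "c > 0"
  shows "c * lowered q g x <= lowered q g (c *\<^sub>R x)"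
proof (rule lowered_greatest)
  fix t :: real assume t: "t >= 0"
  have "lowered q g x <= q (x + (t/c) *\<^sub>R g) - (t/c) * q g"
    by (rule lowered_le) (use q t c in auto)
  then have "c * lowered q g x <= c * q (x + (t/c) *\<^sub>R g) - t * q g"
    using mult_left_mono[of _ _ c] c by (fastforce simp: right_diff_distrib)
  also have "c * q (x + (t/c) *\<^sub>R g) = q (c *\<^sub>R x + t *\<^sub>R g)"
    using sublin_scale[OF q, of c "x + (t/c) *\<^sub>R g"] c by (simp add: scaleR_right_distrib)
  finally show "c * lowered q g x <= q (c *\<^sub>R x + t *\<^sub>R g) - t * q g" .
qed

lemma sublin_lowered:
  assumes q: "sublin q"
  shows "sublin (lowered q g)"
  unfolding sublin_def
proof (intro conjI allI impI)
  fix x y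
  have *: "lowered q g (x + y) - (q (x + s *\<^sub>R g) - s * q g) <= q (y + t *\<^sub>R g) - t * q g"
    if "s >= 0" "t >= 0" for s t
  proof -
    have "lowered q g (x + y) <= q (x + y + (s + t) *\<^sub>R g) - (s + t) * q g"
      by (rule lowered_le) (use q that in auto)
    moreover have "q (x + y + (s + t) *\<^sub>R g) <= q (x + s *\<^sub>R g) + q (y + t *\<^sub>R g)"
      using sublin_add[OF q, of "x + s *\<^sub>R g" "y + t *\<^sub>R g"] by (simp add: algebra_simps)
    ultimately show ?thesis by (simp add: algebra_simps)
  qed
  have "lowered q g (x + y) - lowered q g y <= lowered q g x"
  proof (rule lowered_greatest)
    fix s :: real assume s: "s >= 0"
    have "lowered q g (x + y) - (q (x + s *\<^sub>R g) - s * q g) <= lowered q g y"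
      by (rule lowered_greatest) (rule *[OF s])
    then show "lowered q g (x + y) - lowered q g y <= q (x + s *\<^sub>R g) - s * q g" by simp
  qed
  then show "lowered q g (x + y) <= lowered q g x + lowered q g y" by simp
next
  fix c :: real and x assume c: "c >= 0"
  show "lowered q g (c *\<^sub>R x) = c * lowered q g x"
  proof (cases "c = 0")
    case True
    have "lowered q g 0 = 0"
    proof (rule antisym)
      show "lowered q g 0 <= 0" using lowered_le[OF q, of 0 g 0] sublin_zero[OF q] by simp
      show "0 <= lowered q g 0" by (rule lowered_greatest) (simp add: sublin_scale[OF q])
    qed
    then show ?thesis using True by simp
  next
    case False
    then have c: "c > 0" using c by simp
    have "(1/c) * lowered q g (c *\<^sub>R x) <= lowered q g ((1/c) *\<^sub>R (c *\<^sub>R x))"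
      by (rule lowered_scale_le) (use q c in auto)
    then have "lowered q g (c *\<^sub>R x) <= c * lowered q g x" using c by (simp add: field_simps)
    with lowered_scale_le[OF q c, of g x] show ?thesis by simp
  qed
qed

text \<open>A minimal sublinear functional \<open>m\<close> below \<open>p\<close> is linear:
  lowering it in a direction \<open>g\<close> cannot change it, which gives
  \<open>m (- g) = - m g\<close>, and an odd sublinear functional is additive.\<close>

lemma sublinear_dominates_linear:
  fixes p :: "'a::real_vector => real"
  assumes p: "sublin p"
  shows "\<exists>L. linear L \<and> (\<forall>x. L x <= p x)"
proof -
  define A where "A = {q. sublin q \<and> (\<forall>x. q x <= p x)}"
  \<comment> \<open>The order is reversed, so that a maximal element for Zorn is a minimal
    functional.\<close>
  define P where "P = (%(q :: 'a => real) q'. \<forall>x. q' x <= q x)"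
  have po: "partial_order_on A (relation_of P A)"
    unfolding partial_order_on_def preorder_on_def refl_on_def trans_on_def antisym_on_def relation_of_def P_def
    by (auto intro: order_trans intro!: ext antisym)
  have "\<exists>u\<in>A. \<forall>a\<in>C. P a u" if C: "C \<in> Chains (relation_of P A)" for C
  proof (cases "C = {}")
    case True
    then show ?thesis using p by (auto simp: A_def)
  next
    case False
    have CA: "C \<subseteq> A" and tot: "\<And>a b. a \<in> C ==> b \<in> C ==> P a b \<or> P b a"
      using C unfolding Chains_def relation_of_def by auto
    define u where "u = (%x. INF q\<in>C. q x)"
    have bdd: "bdd_below ((%q. q x) ` C)" for x
    proof (rule bdd_belowI2[where m = "- p (- x)"])
      fix q assume "q \<in> C"
      then have "sublin q" "q (- x) <= p (- x)" using CA by (auto simp: A_def)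
      then show "- p (- x) <= q x" using sublin_neg[of q x] by linarith
    qed
    have low: "u x <= q x" if "q \<in> C" for q x
      unfolding u_def by (rule cINF_lower[OF bdd that])
    have gre: "m <= u x" if "\<And>q. q \<in> C ==> m <= q x" for m x
      unfolding u_def by (rule cINF_greatest) (use that False in auto)
    have "sublin u"
      unfolding sublin_def
    proof (intro conjI allI impI)
      fix x y
      \<comment> \<open>In a chain one of \<open>q1\<close>, \<open>q2\<close> lies below the other
        everywhere, so a single member can serve at both points.\<close>
      have *: "u (x + y) - q1 x <= q2 y" if "q1 \<in> C" "q2 \<in> C" for q1 q2
      proof -
        obtain q where q: "q \<in> C" "q x <= q1 x" "q y <= q2 y"
          using tot[OF \<open>q1 \<in> C\<close> \<open>q2 \<in> C\<close>] \<open>q1 \<in> C\<close> \<open>q2 \<in> C\<close> unfolding P_def by blast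
        have "u (x + y) <= q (x + y)" by (rule low[OF q(1)])
        also have "\<dots> <= q x + q y" using q(1) CA by (auto simp: A_def intro: sublin_add)
        finally show ?thesis using q by linarith
      qed
      have "u (x + y) - u y <= u x"
      proof (rule gre)
        fix q1 assume q1: "q1 \<in> C"
        have "u (x + y) - q1 x <= u y" by (rule gre) (rule *[OF q1])
        then show "u (x + y) - u y <= q1 x" by simp
      qed
      then show "u (x + y) <= u x + u y" by simp
    next
      fix c :: real and x assume c: "c >= 0"
      show "u (c *\<^sub>R x) = c * u x"
      proof (cases "c = 0")
        case True
        have "u 0 = (INF q\<in>C. (0::real))"
          unfolding u_def using CA sublin_zero by (intro arg_cong[where f = Inf] image_cong) (auto simp: A_def)
        then show ?thesis using True False by simp
      next
        case c0: False
        have le: "d * u z <= u (d *\<^sub>R z)" if "d > 0" for d z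
        proof (rule gre)
          fix q assume q: "q \<in> C"
          have "d * u z <= d * q z" using low[OF q] that by (simp add: mult_left_mono)
          also have "d * q z = q (d *\<^sub>R z)"
            using that q CA by (auto simp: A_def sublin_scale)
          finally show "d * u z <= q (d *\<^sub>R z)" .
        qed
        have "(1/c) * u (c *\<^sub>R x) <= u ((1/c) *\<^sub>R (c *\<^sub>R x))" by (rule le) (use c c0 in auto)
        then have "u (c *\<^sub>R x) <= c * u x" using c c0 by (simp add: field_simps)
        moreover have "c * u x <= u (c *\<^sub>R x)" using le c c0 by simp
        ultimately show ?thesis by simp
      qed
    qed
    moreover have "u x <= p x" for x
    proof -
      obtain q where q: "q \<in> C" using False by auto
      then have "q x <= p x" using CA by (auto simp: A_def)
      then show ?thesis using low[OF q, of x] by linarith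
    qed
    ultimately have "u \<in> A" by (auto simp: A_def)
    then show ?thesis using low unfolding P_def by auto
  qed
  from predicate_Zorn[OF po this] obtain m where m: "m \<in> A" "\<And>a. a \<in> A ==> P m a ==> a = m"
    by blast
  have sm: "sublin m" and mp: "\<And>x. m x <= p x" using m(1) by (auto simp: A_def)
  have neg: "m (- g) = - m g" for g
  proof -
    have le: "lowered m g x <= m x" for x using lowered_le[OF sm, of 0 g x] by simp
    have "lowered m g \<in> A"
      using sublin_lowered[OF sm] le mp order_trans unfolding A_def by blast
    then have "lowered m g = m" using m(2) le unfolding P_def by blast
    then have "m (- g) <= m (- g + 1 *\<^sub>R g) - 1 * m g"
      using lowered_le[OF sm, of 1 g "- g"] by simp
    then show ?thesis using sublin_neg[OF sm, of g] sublin_zero[OF sm] by simp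
  qed
  have "linear m"
  proof (rule linearI)
    fix x y
    have "m (- (x + y)) <= m (- x) + m (- y)" using sublin_add[OF sm, of "- x" "- y"] by simp
    then show "m (x + y) = m x + m y"
      using sublin_add[OF sm, of x y] unfolding neg by simp
  next
    fix c x
    show "m (c *\<^sub>R x) = c *\<^sub>R m x"
    proof (cases "c >= 0")
      case False
      then have "m ((- c) *\<^sub>R x) = (- c) * m x" by (intro sublin_scale[OF sm]) auto
      then show ?thesis using neg[of "c *\<^sub>R x"] by simp
    qed (use sublin_scale[OF sm] in auto)
  qed
  then show ?thesis using mp by blast
qed

text \<open>The distance to \<open>W\<close> is sublinear, vanishes on \<open>W\<close>, is
  dominated by the norm and is positive at \<open>g\<close> because \<open>W\<close> is
  closed.\<close>

lemma hahn_banach_separation: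
  fixes W :: "'a::real_normed_vector set"
  assumes W: "subspace W" "closed W" and g: "g \<notin> W"
  shows "\<exists>L::'a => real. bounded_linear L \<and> (\<forall>w\<in>W. L w = 0) \<and> L g ~= 0"
proof -
  have W0: "0 \<in> W" and ne: "W ~= {}" using W(1) subspace_0 by auto
  define p where "p = (%x. infdist x W)"
  have pe: "\<exists>w\<in>W. norm (x - w) < p x + e" if "e > 0" for x e
  proof -
    have "(INF a\<in>W. dist x a) < p x + e" unfolding p_def using that ne by (simp add: infdist_notempty)
    then show ?thesis using ne
      by (subst (asm) cINF_less_iff) (auto simp: dist_norm intro!: bdd_belowI2[where m=0])
  qed
  have ple: "p x <= norm (x - w)" if "w \<in> W" for x w
    unfolding p_def using infdist_le[OF that, of x] by (simp add: dist_norm)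
  have p0: "p x >= 0" for x unfolding p_def by (rule infdist_nonneg)
  have pscale: "p (c *\<^sub>R x) <= c * p x" if c: "c > 0" for c x
  proof (rule field_le_epsilon)
    fix e :: real assume "e > 0"
    then obtain w where w: "w \<in> W" "norm (x - w) < p x + e / c" using pe[of "e/c" x] c by auto
    have "p (c *\<^sub>R x) <= norm (c *\<^sub>R x - c *\<^sub>R w)" by (rule ple) (use w W in \<open>auto intro: subspace_scale\<close>)
    also have "\<dots> = c * norm (x - w)" using c by (simp flip: scaleR_right_diff_distrib)
    also have "\<dots> <= c * (p x + e / c)" using w c by (intro mult_left_mono) auto
    also have "\<dots> = c * p x + e" using c by (simp add: field_simps)
    finally show "p (c *\<^sub>R x) <= c * p x + e" .
  qed
  have sp: "sublin p"
    unfolding sublin_def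
  proof (intro conjI allI impI)
    fix x y
    show "p (x + y) <= p x + p y"
    proof (rule field_le_epsilon)
      fix e :: real assume "e > 0"
      then obtain v w where vw: "v \<in> W" "w \<in> W" "norm (x - v) < p x + e/2" "norm (y - w) < p y + e/2"
        using pe[of "e/2"] by (meson half_gt_zero)
      have "p (x + y) <= norm (x + y - (v + w))" by (rule ple) (use vw W in \<open>auto intro: subspace_add\<close>)
      also have "\<dots> <= norm (x - v) + norm (y - w)"
        using norm_triangle_ineq[of "x - v" "y - w"] by (simp add: algebra_simps)
      finally show "p (x + y) <= p x + p y + e" using vw by linarith
    qed
  next
    fix c :: real and x assume c: "c >= 0"
    show "p (c *\<^sub>R x) = c * p x"
    proof (cases "c = 0")
      case True
      then show ?thesis using ple[OF W0, of 0] p0[of 0] by simp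
    next
      case False
      then have c: "c > 0" using c by simp
      have "p ((1/c) *\<^sub>R (c *\<^sub>R x)) <= (1/c) * p (c *\<^sub>R x)" by (rule pscale) (use c in auto)
      then have "c * p x <= p (c *\<^sub>R x)" using c by (simp add: field_simps)
      then show ?thesis using pscale[OF c, of x] by simp
    qed
  qed
  \<comment> \<open>A functional below the distance \<open>p\<close> alone could vanish at
    \<open>g\<close>. Staying below \<open>lowered p g\<close> forces
    \<open>L g >= p g > 0\<close>.\<close>
  obtain L where L: "linear L" "\<And>x. L x <= lowered p g x"
    using sublinear_dominates_linear[OF sublin_lowered[OF sp, of g]] by auto
  have Lp: "L x <= p x" for x
    using L(2)[of x] lowered_le[OF sp, of 0 g x] by simp
  have pn: "p x <= norm x" for x using ple[OF W0, of x] by simp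
  have "bounded_linear L"
  proof (rule bounded_linear_intro[where K = 1])
    fix x
    have "L x <= norm x" using Lp[of x] pn[of x] by linarith
    moreover have "- L x <= norm x"
      using Lp[of "-x"] pn[of "-x"] linear_neg[OF L(1), of x] by simp
    ultimately show "norm (L x) <= norm x * 1" by simp
  qed (use L(1) in \<open>auto simp: linear_add linear_scale\<close>)
  moreover have "L w = 0" if "w \<in> W" for w
  proof -
    have "p w <= 0" using ple[OF that, of w] by simp
    moreover have "p (- w) <= 0" using ple[of "- w" "- w"] that W(1) by (simp add: subspace_neg)
    ultimately show ?thesis using Lp[of w] Lp[of "- w"] linear_neg[OF L(1), of w] by simp
  qed
  moreover have "L g ~= 0"
  proof -
    have "L (- g) <= p (- g + 1 *\<^sub>R g) - 1 * p g"
      using L(2)[of "- g"] lowered_le[OF sp, of 1 g "- g"] by linarith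
    then have "L g >= p g" using sublin_zero[OF sp] linear_neg[OF L(1), of g] by simp
    moreover have "p g > 0"
      unfolding p_def using W(2) ne g in_closed_iff_infdist_zero infdist_nonneg
      by (metis order_less_le)
    ultimately show ?thesis by simp
  qed
  ultimately show ?thesis by blast
qed

lemma subspace_closure':
  fixes W :: "'a::real_normed_vector set"
  assumes "subspace W"
  shows "subspace (closure W)"
  unfolding subspace_def
proof (intro conjI ballI allI)
  show "0 \<in> closure W" using assms subspace_0 closure_subset by blast
  fix x assume x: "x \<in> closure W"
  then obtain f where f: "\<And>n. f n \<in> W" "f \<longlonglongrightarrow> x" unfolding closure_sequential by auto
  { fix y assume "y \<in> closure W"
    then obtain g where g: "\<And>n. g n \<in> W" "g \<longlonglongrightarrow> y" unfolding closure_sequential by auto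
    show "x + y \<in> closure W"
      unfolding closure_sequential using f g assms
      by (intro exI[of _ "%n. f n + g n"]) (auto intro: tendsto_add subspace_add) }
  { fix c :: real
    show "c *\<^sub>R x \<in> closure W"
      unfolding closure_sequential using f assms
      by (intro exI[of _ "%n. c *\<^sub>R f n"]) (auto intro: tendsto_intros subspace_scale) }
qed

instance bcontfun :: (metric_space, banach) banach ..

section \<open>The Banach space of continuous functions on the unit interval\<close>

definition clamp01 :: "real => real" where "clamp01 t = max 0 (min 1 t)"

lemma clamp01_in [simp]: "clamp01 t \<in> {0..1}" and clamp01_id: "t \<in> {0..1} ==> clamp01 t = t"
  by (auto simp: clamp01_def)

lemma continuous_clamp01: "continuous_on S clamp01"
  unfolding clamp01_def by (intro continuous_intros)

text \<open>The restriction of \<open>u\<close> to the unit interval, extended by its end values, as an element of the Banach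
  space of bounded continuous functions.\<close>

definition ext :: "(real => complex) => (real \<Rightarrow>\<^sub>C complex)" where
  "ext u = Bcontfun (%t. u (clamp01 t))"

lemma apply_ext:
  assumes "continuous_on {0..1} u"
  shows "apply_bcontfun (ext u) t = u (clamp01 t)"
proof -
  have "continuous_on UNIV (%t. u (clamp01 t))"
    by (rule continuous_on_compose2[OF assms continuous_clamp01]) (use clamp01_in in blast)
  moreover have "bounded (range (%t. u (clamp01 t)))"
    using compact_imp_bounded[OF compact_continuous_image[OF assms compact_Icc]]
    by (rule bounded_subset) (use clamp01_in in blast)
  ultimately have "(%t. u (clamp01 t)) \<in> bcontfun" unfolding bcontfun_def by simp
  then show ?thesis unfolding ext_def by (simp add: Bcontfun_inverse)
qed

lemma ext_cong: "(\<And>t. t \<in> {0..1} ==> u t = v t) ==> ext u = ext v"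
  unfolding ext_def by (rule arg_cong[where f = Bcontfun]) (use clamp01_in in blast)

lemma norm_ext_le:
  assumes "continuous_on {0..1} u" "\<And>t. t \<in> {0..1} ==> norm (u t) <= B"
  shows "norm (ext u) <= B"
  by (rule norm_bound) (use assms clamp01_in in \<open>simp add: apply_ext\<close>)

lemma norm_le_norm_ext:
  assumes "continuous_on {0..1} u" "t \<in> {0..1}"
  shows "norm (u t) <= norm (ext u)"
  using norm_bounded[of "ext u" t] assms by (simp add: apply_ext clamp01_id)

lemma ext_add: "continuous_on {0..1} u ==> continuous_on {0..1} v ==> ext (%t. u t + v t) = ext u + ext v"
  by (rule bcontfun_eqI) (simp add: apply_ext continuous_on_add)

lemma ext_diff: "continuous_on {0..1} u ==> continuous_on {0..1} v ==> ext (%t. u t - v t) = ext u - ext v"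
  by (rule bcontfun_eqI) (simp add: apply_ext continuous_on_diff)

lemma ext_scaleR: "continuous_on {0..1} u ==> ext (%t. c *\<^sub>R u t) = c *\<^sub>R ext u"
  by (rule bcontfun_eqI) (simp add: apply_ext continuous_on_scaleR continuous_on_const)

definition bm :: "(real \<Rightarrow>\<^sub>C complex) => (real \<Rightarrow>\<^sub>C complex) => (real \<Rightarrow>\<^sub>C complex)" where
  "bm u v = Bcontfun (%t. apply_bcontfun u t * apply_bcontfun v t)"

lemma apply_bm: "apply_bcontfun (bm u v) t = apply_bcontfun u t * apply_bcontfun v t"
proof -
  have "(%t. apply_bcontfun u t * apply_bcontfun v t) \<in> bcontfun"
  proof (rule bcontfun_normI)
    show "continuous_on UNIV (%t. apply_bcontfun u t * apply_bcontfun v t)" by (intro continuous_intros) auto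
    fix t show "norm (apply_bcontfun u t * apply_bcontfun v t) <= norm u * norm v"
      unfolding norm_mult by (intro mult_mono norm_bounded) auto
  qed
  then show ?thesis unfolding bm_def by (simp add: Bcontfun_inverse)
qed

lemma norm_bm: "norm (bm u v) <= norm u * norm v"
  by (rule norm_bound) (auto simp: apply_bm norm_mult intro!: mult_mono norm_bounded)

lemma bounded_bilinear_bm: "bounded_bilinear bm"
proof
  show "\<exists>K. \<forall>a b. norm (bm a b) <= norm a * norm b * K"
    using norm_bm by (intro exI[of _ 1]) simp
qed (auto intro!: bcontfun_eqI simp: apply_bm algebra_simps)

lemma ext_mult: "continuous_on {0..1} u ==> continuous_on {0..1} v ==> ext (%t. u t * v t) = bm (ext u) (ext v)"
  by (rule bcontfun_eqI) (simp add: apply_ext apply_bm continuous_on_mult)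

lemma bm_assoc: "bm a (bm b c) = bm (bm a b) c"
  by (rule bcontfun_eqI) (simp add: apply_bm)

lemma bm_commute: "bm a b = bm b a"
  by (rule bcontfun_eqI) (simp add: apply_bm)

text \<open>Bounded complex-linear functionals on the continuous functions on the unit interval; the value at a
  function that is not continuous there is arbitrary.\<close>

definition cdual :: "((real => complex) => complex) => bool" where
  "cdual L \<longleftrightarrow> (\<exists>\<Lambda>. bounded_linear \<Lambda> \<and> (\<forall>u. continuous_on {0..1} u --> L u = \<Lambda> (ext u))) \<and>
     (\<forall>u. continuous_on {0..1} u --> L (%t. \<i> * u t) = \<i> * L u)"

lemma cdual_rep:
  assumes "cdual L"
  obtains \<Lambda> where "bounded_linear \<Lambda>" "\<And>u. continuous_on {0..1} u ==> L u = \<Lambda> (ext u)"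
  using assms unfolding cdual_def by blast

lemma cdual_add:
  assumes "cdual L" "continuous_on {0..1} u" "continuous_on {0..1} v"
  shows "L (%t. u t + v t) = L u + L v"
  using assms unfolding cdual_def
  by (auto simp: ext_add continuous_on_add bounded_linear.linear linear_add)

lemma cdual_cmult:
  assumes L: "cdual L" and u: "continuous_on {0..1} u"
  shows "L (%t. c * u t) = c * L u"
proof -
  obtain \<Lambda> where \<Lambda>: "bounded_linear \<Lambda>" "\<And>u. continuous_on {0..1} u ==> L u = \<Lambda> (ext u)"
    using cdual_rep[OF L] by blast
  have r: "L (%t. a *\<^sub>R v t) = a *\<^sub>R L v" if "continuous_on {0..1} v" for a v
    using that \<Lambda> by (simp add: ext_scaleR continuous_on_scaleR continuous_on_const bounded_linear.linear linear_scale)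
  have iu: "continuous_on {0..1} (%t. \<i> * u t)" using u by (intro continuous_intros)
  have i: "L (%t. \<i> * u t) = \<i> * L u" using L u unfolding cdual_def by blast
  have "(%t. c * u t) = (%t. Re c *\<^sub>R u t + Im c *\<^sub>R (\<i> * u t))"
    by (auto simp: complex_eq_iff algebra_simps)
  then have "L (%t. c * u t) = Re c *\<^sub>R L u + Im c *\<^sub>R (\<i> * L u)"
    using cdual_add[OF L, of "%t. Re c *\<^sub>R u t" "%t. Im c *\<^sub>R (\<i> * u t)"] r[OF u] r[OF iu] i u iu
    by (simp add: continuous_on_scaleR continuous_on_const)
  also have "\<dots> = c * L u" by (auto simp: complex_eq_iff algebra_simps)
  finally show ?thesis .
qed

lemma cdual_cong:
  assumes "cdual L" "continuous_on {0..1} u" "\<And>t. t \<in> {0..1} ==> u t = v t"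
  shows "L u = L v"
proof -
  have "continuous_on {0..1} v" using assms(2,3) continuous_on_cong by metis
  then show ?thesis
    using assms ext_cong[of u v] unfolding cdual_def by metis
qed

lemma cdual_diff:
  assumes "cdual L" "continuous_on {0..1} u" "continuous_on {0..1} v"
  shows "L (%t. u t - v t) = L u - L v"
  using cdual_add[OF assms(1,2), of "%t. (-1) * v t"] cdual_cmult[OF assms(1,3), of "-1"] assms(3)
  by (simp add: continuous_on_minus)

lemma cdual_zero: "cdual L ==> L (%t. 0) = 0"
  using cdual_cmult[of L "%t. 0" 0] by simp

lemma cdual_sum:
  assumes "cdual L" "finite I" "\<And>i. i \<in> I ==> continuous_on {0..1} (u i)"
  shows "L (%t. \<Sum>i\<in>I. u i t) = (\<Sum>i\<in>I. L (u i))"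
  using assms(2,3)
proof (induction I rule: finite_induct)
  case (insert a I)
  have "L (%t. u a t + (\<Sum>i\<in>I. u i t)) = L (u a) + L (%t. \<Sum>i\<in>I. u i t)"
    by (rule cdual_add[OF assms(1)]) (use insert in \<open>auto intro!: continuous_intros\<close>)
  then show ?case using insert by simp
qed (simp add: cdual_zero[OF assms(1)])

lemma cdual_bound:
  assumes "cdual L"
  obtains C :: real where "C > 0" "\<And>(u :: real => complex) B. continuous_on {0..1} u ==> (\<And>t. t \<in> {0..1} ==> norm (u t) <= B) ==> norm (L u) <= C * B"
proof -
  obtain \<Lambda> where \<Lambda>: "bounded_linear \<Lambda>" "\<And>u. continuous_on {0..1} u ==> L u = \<Lambda> (ext u)"
    using cdual_rep[OF assms] by blast
  obtain C where C: "C > 0" "\<And>x. norm (\<Lambda> x) <= norm x * C"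
    using bounded_linear.pos_bounded[OF \<Lambda>(1)] by blast
  show ?thesis
  proof (rule that[OF C(1)])
    fix u :: "real => complex" and B assume u: "continuous_on {0..1} u" and B: "\<And>t. t \<in> {0..1} ==> norm (u t) <= B"
    have "norm (L u) <= norm (ext u) * C" using \<Lambda>(2)[OF u] C(2) by simp
    also have "\<dots> <= B * C" using norm_ext_le[OF u B] C(1) by (intro mult_right_mono) auto
    finally show "norm (L u) <= C * B" by (simp add: mult.commute)
  qed
qed

lemma cdual_multiplier:
  assumes L: "cdual L" and a: "continuous_on {0..1} a"
  shows "cdual (%u. L (%t. a t * u t))"
proof -
  obtain \<Lambda> where \<Lambda>: "bounded_linear \<Lambda>" "\<And>u. continuous_on {0..1} u ==> L u = \<Lambda> (ext u)"
    using cdual_rep[OF L] by blast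
  have "bounded_linear (%x. \<Lambda> (bm (ext a) x))"
    by (intro bounded_linear_compose[OF \<Lambda>(1)] bounded_bilinear.bounded_linear_right[OF bounded_bilinear_bm])
  moreover have "L (%t. a t * u t) = \<Lambda> (bm (ext a) (ext u))" if "continuous_on {0..1} u" for u
    using that a \<Lambda>(2) by (simp add: ext_mult continuous_on_mult)
  moreover have "L (%t. a t * (\<i> * u t)) = \<i> * L (%t. a t * u t)" if "continuous_on {0..1} u" for u
    using cdual_cmult[OF L, of "%t. a t * u t" \<i>] that a by (simp add: continuous_on_mult mult.left_commute)
  ultimately show ?thesis unfolding cdual_def by blast
qed

lemma cdual_lincomb:
  assumes L: "cdual L" and M: "cdual M"
  shows "cdual (%u. L u + c * M u)"
proof -
  obtain \<Lambda> where \<Lambda>: "bounded_linear \<Lambda>" "\<And>u. continuous_on {0..1} u ==> L u = \<Lambda> (ext u)"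
    using cdual_rep[OF L] by blast
  obtain \<Lambda>' where \<Lambda>': "bounded_linear \<Lambda>'" "\<And>u. continuous_on {0..1} u ==> M u = \<Lambda>' (ext u)"
    using cdual_rep[OF M] by blast
  have "bounded_linear (%x. \<Lambda> x + c * \<Lambda>' x)"
    using \<Lambda> \<Lambda>' by (intro bounded_linear_add bounded_linear_compose[OF bounded_linear_mult_right])
  moreover have "L (%t. \<i> * u t) = \<i> * L u" "M (%t. \<i> * u t) = \<i> * M u"
    if "continuous_on {0..1} u" for u
    using L M that unfolding cdual_def by blast+
  ultimately show ?thesis
    unfolding cdual_def using \<Lambda>(2) \<Lambda>'(2)
    by (auto simp: algebra_simps intro!: exI[of _ "%x. \<Lambda> x + c * \<Lambda>' x"])
qed

text \<open>Real separation in the Banach space, followed by the usual complexification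
  \<open>R x - \<i> * R (\<i> x)\<close>. The uniform gap \<open>d\<close> is what keeps
  \<open>g\<close> out of the closure of \<open>W\<close>.\<close>

lemma cdual_separation:
  assumes W: "\<And>u. u \<in> W ==> continuous_on {0..1} u" "(%t. 0) \<in> W"
    "\<And>u v. u \<in> W ==> v \<in> W ==> (%t. u t + v t) \<in> W"
    "\<And>c u. u \<in> W ==> (%t. c * u t) \<in> W"
    and g: "continuous_on {0..1} g" and d: "d > 0" "\<And>u. u \<in> W ==> \<exists>t\<in>{0..1}. norm (g t - u t) >= d"
  shows "\<exists>L. cdual L \<and> (\<forall>u\<in>W. L u = 0) \<and> L g ~= 0"
proof -
  let ?W = "ext ` W"
  have "subspace ?W"
    unfolding subspace_def
  proof (intro conjI ballI allI)
    have "ext (%t. 0) = 0" by (rule bcontfun_eqI) (simp add: apply_ext)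
    then show "0 \<in> ?W" using W(2) by (metis imageI)
    fix x assume "x \<in> ?W"
    then obtain u where u: "u \<in> W" "x = ext u" by auto
    { fix y assume "y \<in> ?W"
      then obtain v where v: "v \<in> W" "y = ext v" by auto
      show "x + y \<in> ?W" using u v W(1) W(3)[OF u(1) v(1)] by (auto simp flip: ext_add) }
    { fix c :: real
      have "c *\<^sub>R x = ext (%t. of_real c * u t)" using u W(1) ext_scaleR[of u c] by (simp add: scaleR_conv_of_real)
      then show "c *\<^sub>R x \<in> ?W" using W(4)[OF u(1)] by simp }
  qed
  then have sub: "subspace (closure ?W)" by (rule subspace_closure')
  have "ext g \<notin> closure ?W"
  proof
    assume "ext g \<in> closure ?W"
    then obtain u where u: "u \<in> W" "dist (ext u) (ext g) < d" using d(1) unfolding closure_approachable by auto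
    obtain t where t: "t \<in> {0..1}" "norm (g t - u t) >= d" using d(2)[OF u(1)] by auto
    have "norm (g t - u t) <= norm (ext (%t. g t - u t))"
      by (rule norm_le_norm_ext) (use g W(1)[OF u(1)] t in \<open>auto intro: continuous_on_diff\<close>)
    also have "\<dots> = dist (ext u) (ext g)"
      using g W(1)[OF u(1)] by (simp add: ext_diff dist_norm norm_minus_commute)
    finally show False using u t by simp
  qed
  then obtain R :: "(real \<Rightarrow>\<^sub>C complex) => real" where R: "bounded_linear R" "\<And>w. w \<in> closure ?W ==> R w = 0" "R (ext g) ~= 0"
    using hahn_banach_separation[OF sub closed_closure] by blast
  define I where "I = ext (%t. \<i>)"
  define \<Lambda> where "\<Lambda> = (%x. of_real (R x) - \<i> * of_real (R (bm I x)))"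
  have bI: "bounded_linear (bm I)" by (rule bounded_bilinear.bounded_linear_right[OF bounded_bilinear_bm])
  have "bounded_linear \<Lambda>"
    unfolding \<Lambda>_def
    by (intro bounded_linear_sub bounded_linear_compose[OF bounded_linear_of_real]
        bounded_linear_compose[OF bounded_linear_mult_right] R(1) bounded_linear_compose[OF R(1)] bI)
  have Iu: "bm I (ext u) = ext (%t. \<i> * u t)" if "continuous_on {0..1} u" for u
    using that unfolding I_def by (simp add: ext_mult continuous_on_const)
  have II: "bm I (bm I x) = - x" for x
    by (rule bcontfun_eqI) (simp add: apply_bm I_def apply_ext)
  define L where "L = (%u. \<Lambda> (ext u))"
  have Rn: "R (- x) = - R x" for x using R(1) by (simp add: bounded_linear.linear linear_neg)
  have "cdual L"
    unfolding cdual_def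
  proof (intro conjI allI impI exI)
    show "bounded_linear \<Lambda>" by fact
    fix u :: "real => complex" assume u: "continuous_on {0..1} u"
    show "L u = \<Lambda> (ext u)" by (simp add: L_def)
    show "L (%t. \<i> * u t) = \<i> * L u"
      unfolding L_def Iu[OF u, symmetric] \<Lambda>_def II Rn by (simp add: algebra_simps)
  qed
  moreover have "L u = 0" if u: "u \<in> W" for u
  proof -
    have "R (ext u) = 0" using R(2) u closure_subset by blast
    moreover have "R (bm I (ext u)) = 0"
      unfolding Iu[OF W(1)[OF u]] using R(2) W(4)[OF u, of \<i>] closure_subset by blast
    ultimately show ?thesis unfolding L_def \<Lambda>_def by simp
  qed
  moreover have "L g ~= 0"
    using R(3) unfolding L_def \<Lambda>_def by (auto simp: complex_eq_iff)
  ultimately show ?thesis by blast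
qed

text \<open>Uniform continuity of \<open>k\<close> on the compact rectangle makes the slices a
  norm-continuous family, so the integral exists in the Banach space. Point evaluations are bounded
  and linear, hence they identify it with the pointwise integral.\<close>

lemma ext_integral:
  fixes k :: "real => real => complex"
  assumes k: "continuous_on ({0..1} \<times> {a..b}) (%(t,s). k t s)"
  shows "continuous_on {a..b} (%s. ext (%t. k t s))"
    and "ext (%t. integral {a..b} (k t)) = integral {a..b} (%s. ext (%t. k t s))"
    and "continuous_on {0..1} (%t. integral {a..b} (k t))"
proof -
  have kt: "continuous_on {0..1} (%t. k t s)" if "s \<in> {a..b}" for s
    using continuous_on_compose2[OF k, of "{0..1}" "%t. (t,s)"] that by (fastforce intro: continuous_intros)
  have ks: "continuous_on {a..b} (k t)" if "t \<in> {0..1}" for t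
    using continuous_on_compose2[OF k, of "{a..b}" "%s. (t,s)"] that by (fastforce intro: continuous_intros)
  have uc: "uniformly_continuous_on ({0..1} \<times> {a..b}) (%(t,s). k t s)"
    by (rule compact_uniformly_continuous[OF k]) (auto intro: compact_Times)
  show c: "continuous_on {a..b} (%s. ext (%t. k t s))"
    unfolding continuous_on_iff
  proof (intro ballI allI impI)
    fix s and e :: real assume s: "s \<in> {a..b}" and e: "e > 0"
    obtain d where d: "d > 0" "\<And>x y. x \<in> {0..1} \<times> {a..b} ==> y \<in> {0..1} \<times> {a..b} ==> dist y x < d ==>
        dist (case y of (t,s) => k t s) (case x of (t,s) => k t s) < e/2"
      using uc e unfolding uniformly_continuous_on_def by (metis half_gt_zero)
    show "\<exists>d>0. \<forall>x'\<in>{a..b}. dist x' s < d --> dist (ext (%t. k t x')) (ext (%t. k t s)) < e"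
    proof (intro exI[of _ d] conjI ballI impI d(1))
      fix s' assume s': "s' \<in> {a..b}" "dist s' s < d"
      have "norm (ext (%t. k t s' - k t s)) <= e/2"
      proof (rule norm_ext_le)
        show "continuous_on {0..1} (%t. k t s' - k t s)" using kt s s' by (intro continuous_intros) auto
        fix t :: real assume "t \<in> {0..1}"
        then show "norm (k t s' - k t s) <= e/2"
          using d(2)[of "(t,s)" "(t,s')"] s s' by (auto simp: dist_Pair_Pair dist_norm)
      qed
      then show "dist (ext (%t. k t s')) (ext (%t. k t s)) < e"
        using kt[OF s] kt[OF s'(1)] e by (simp add: ext_diff dist_norm)
    qed
  qed
  let ?I = "integral {a..b} (%s. ext (%t. k t s))"
  have int: "(%s. ext (%t. k t s)) integrable_on {a..b}" by (rule integrable_continuous_real[OF c])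
  have ev: "bounded_linear (%x::real \<Rightarrow>\<^sub>C complex. apply_bcontfun x t)" for t
    by (rule bounded_linear_intro[where K = 1]) (auto simp: norm_bounded)
  have app: "apply_bcontfun ?I t = integral {a..b} (k (clamp01 t))" for t
  proof -
    have "integral {a..b} ((%x. apply_bcontfun x t) \<circ> (%s. ext (%t. k t s))) = apply_bcontfun ?I t"
      by (rule integral_linear[OF int ev])
    moreover have "integral {a..b} ((%x. apply_bcontfun x t) \<circ> (%s. ext (%t. k t s))) = integral {a..b} (k (clamp01 t))"
      by (rule integral_cong) (simp add: apply_ext kt)
    ultimately show ?thesis by simp
  qed
  show c2: "continuous_on {0..1} (%t. integral {a..b} (k t))"
  proof -
    have "continuous_on {0..1} (apply_bcontfun ?I)" by simp
    moreover have "apply_bcontfun ?I t = integral {a..b} (k t)" if "t \<in> {0..1}" for t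
      using app[of t] that by (simp add: clamp01_id)
    ultimately show ?thesis by (metis (no_types, lifting) continuous_on_cong)
  qed
  show "ext (%t. integral {a..b} (k t)) = ?I"
    by (rule bcontfun_eqI) (simp add: apply_ext[OF c2] app)
qed

text \<open>Bounded linear maps commute with Banach-valued integrals. This is Fubini's theorem for
  \<open>L\<close> without a representing measure.\<close>

lemma cdual_integral:
  fixes k :: "real => real => complex"
  assumes L: "cdual L" and k: "continuous_on ({0..1} \<times> {a..b}) (%(t,s). k t s)"
  shows "continuous_on {a..b} (%s. L (%t. k t s))"
    and "integral {a..b} (%s. L (%t. k t s)) = L (%t. integral {a..b} (k t))"
proof -
  obtain \<Lambda> where \<Lambda>: "bounded_linear \<Lambda>" "\<And>u. continuous_on {0..1} u ==> L u = \<Lambda> (ext u)"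
    using cdual_rep[OF L] by blast
  have kt: "continuous_on {0..1} (%t. k t s)" if "s \<in> {a..b}" for s
    using continuous_on_compose2[OF k, of "{0..1}" "%t. (t,s)"] that by (fastforce intro: continuous_intros)
  note E = ext_integral[OF k]
  have "continuous_on {a..b} (%s. \<Lambda> (ext (%t. k t s)))"
    using bounded_linear.continuous_on[OF \<Lambda>(1) E(1)] .
  moreover have "L (%t. k t s) = \<Lambda> (ext (%t. k t s))" if "s \<in> {a..b}" for s
    using \<Lambda>(2) kt that by blast
  ultimately show "continuous_on {a..b} (%s. L (%t. k t s))"
    by (metis (no_types, lifting) continuous_on_cong)
  have "integral {a..b} (%s. L (%t. k t s)) = integral {a..b} (\<Lambda> \<circ> (%s. ext (%t. k t s)))"
    by (rule integral_cong) (simp add: \<Lambda>(2) kt)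
  also have "\<dots> = \<Lambda> (integral {a..b} (%s. ext (%t. k t s)))"
    by (rule integral_linear[OF integrable_continuous_real[OF E(1)] \<Lambda>(1)])
  finally show "integral {a..b} (%s. L (%t. k t s)) = L (%t. integral {a..b} (k t))"
    using \<Lambda>(2)[OF E(3)] E(2) by simp
qed

text \<open>For a measure this would be Fubini applied to absolute values. Here the absolute value
  of \<open>F\<close> is produced by duality: \<open>F\<close> is multiplied by a continuous phase
  of modulus at most 1, and the phase is moved inside \<open>L\<close>.\<close>

lemma cdual_L1_bound:
  fixes k :: "real => real => complex"
  assumes L: "cdual L" and k: "continuous_on ({0..1} \<times> {a..b}) (%(t,s). k t s)" and ab: "a <= b"
    and C: "C > 0" "\<And>u B. continuous_on {0..1} u ==> (\<And>t. t \<in> {0..1} ==> norm (u t) <= B) ==> norm (L u) <= C * B"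
    and B: "\<And>t. t \<in> {0..1} ==> integral {a..b} (%s. norm (k t s)) <= B"
  shows "integral {a..b} (%s. norm (L (%t. k t s))) <= C * B"
proof (rule field_le_epsilon)
  fix e0 :: real assume e0: "e0 > 0"
  define e where "e = e0 / (b - a + 1)"
  have e: "e > 0" "e * (b - a) <= e0" using e0 ab by (auto simp: e_def field_simps)
  define F where "F = (%s. L (%t. k t s))"
  have F: "continuous_on {a..b} F" unfolding F_def by (rule cdual_integral(1)[OF L k])
  \<comment> \<open>A continuous replacement for the conjugate phase of \<open>F\<close>. The
    summand \<open>e\<close> avoids division by zero at zeros of \<open>F\<close> and costs at most
    \<open>e\<close> in \<open>thF\<close>.\<close>
  define th where "th = (%s. cnj (F s) / of_real (norm (F s) + e))"
  have thc: "continuous_on {a..b} th"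
    unfolding th_def using F e by (intro continuous_intros) (auto simp: add_nonneg_eq_0_iff simp flip: of_real_add)
  have th1: "norm (th s) <= 1" for s
  proof -
    have "norm (th s) = norm (F s) / (norm (F s) + e)"
      unfolding th_def using e norm_ge_zero[of "F s"] by (simp add: norm_divide add_nonneg_nonneg flip: of_real_add)
    then show ?thesis using e by (simp add: divide_le_eq_1 add_nonneg_pos)
  qed
  have thF: "norm (F s) - e <= Re (th s * F s)" for s
  proof -
    have "th s * F s = of_real ((norm (F s))\<^sup>2 / (norm (F s) + e))"
      unfolding th_def by (simp add: complex_norm_square[symmetric] mult.commute)
    moreover have "norm (F s) - e <= (norm (F s))\<^sup>2 / (norm (F s) + e)"
      using e by (simp add: pos_le_divide_eq add_nonneg_pos) (simp add: algebra_simps power2_eq_square)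
    ultimately show ?thesis by simp
  qed
  have kt: "continuous_on {0..1} (%t. k t s)" if "s \<in> {a..b}" for s
    using continuous_on_compose2[OF k, of "{0..1}" "%t. (t,s)"] that by (fastforce intro: continuous_intros)
  have ks: "continuous_on {a..b} (k t)" if "t \<in> {0..1}" for t
    using continuous_on_compose2[OF k, of "{a..b}" "%s. (t,s)"] that by (fastforce intro: continuous_intros)
  have k2: "continuous_on ({0..1} \<times> {a..b}) (%(t,s). th s * k t s)"
  proof -
    have "continuous_on ({0..1::real} \<times> {a..b}) (%x. th (snd x))"
      by (rule continuous_on_compose2[OF thc]) (auto intro!: continuous_intros)
    then show ?thesis using k unfolding case_prod_beta by (intro continuous_intros)
  qed
  have "integral {a..b} (%s. norm (F s) - e) <= integral {a..b} (%s. Re (th s * F s))"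
    by (rule integral_le[OF _ _ thF]) (intro integrable_continuous_real continuous_intros F thc)+
  also have "\<dots> = Re (integral {a..b} (%s. th s * F s))"
    using integral_linear[OF _ bounded_linear_Re, of "%s. th s * F s" "{a..b}"]
    by (simp add: o_def integrable_continuous_real continuous_on_mult thc F)
  also have "integral {a..b} (%s. th s * F s) = integral {a..b} (%s. L (%t. th s * k t s))"
    by (rule integral_cong) (simp add: F_def cdual_cmult[OF L] kt)
  also have "\<dots> = L (%t. integral {a..b} (%s. th s * k t s))"
    using cdual_integral(2)[OF L k2] .
  also have "Re \<dots> <= norm \<dots>" by (rule complex_Re_le_cmod)
  also have "\<dots> <= C * B"
  proof (rule C(2))
    show "continuous_on {0..1} (%t. integral {a..b} (%s. th s * k t s))" by (rule ext_integral(3)[OF k2])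
    fix t :: real assume t: "t \<in> {0..1}"
    have "norm (integral {a..b} (%s. th s * k t s)) <= integral {a..b} (%s. norm (k t s))"
    proof (rule integral_norm_bound_integral)
      fix s show "norm (th s * k t s) <= norm (k t s)"
        unfolding norm_mult using th1[of s] by (simp add: mult_left_le_one_le)
    qed (auto intro!: integrable_continuous_real continuous_intros thc ks t)
    then show "norm (integral {a..b} (%s. th s * k t s)) <= B" using B[OF t] by linarith
  qed
  finally have "integral {a..b} (%s. norm (F s) - e) <= C * B" .
  moreover have "integral {a..b} (%s. norm (F s) - e) = integral {a..b} (%s. norm (F s)) - e * (b - a)"
    using ab by (subst integral_diff) (auto intro!: integrable_continuous_real continuous_intros F)
  ultimately show "integral {a..b} (%s. norm (L (%t. k t s))) <= C * B + e0"
    using e(2) unfolding F_def by linarith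
qed

subsection \<open>Plane curves near a transversal parameter\<close>

locale C1_curve =
  fixes p p' :: "real => complex"
  assumes der: "\<And>t. (p has_vector_derivative p' t) (at t)"
    and cont': "continuous_on UNIV p'"
begin

lemma cont: "continuous_on S p"
  using der by (meson continuous_at_imp_continuous_on has_vector_derivative_continuous)

lemma derivative_bounded: obtains K where "K > 0" "\<And>t. t \<in> {a..b} ==> norm (p' t) <= K"
proof -
  have "compact (p' ` {a..b})"
    by (rule compact_continuous_image[OF continuous_on_subset[OF cont']]) auto
  then obtain K where "K > 0" "\<And>x. x \<in> p' ` {a..b} ==> norm x <= K"
    using compact_imp_bounded bounded_pos by metis
  then show ?thesis using that by blast
qed

lemma lipschitz:
  assumes "\<And>t. t \<in> {a..b} ==> norm (p' t) <= K" "s \<in> {a..b}" "t \<in> {a..b}"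
  shows "norm (p s - p t) <= K * \<bar>s - t\<bar>"
proof -
  have "norm (p s - p t) <= K * norm (s - t)"
  proof (rule differentiable_bound[of "{a..b}" p "%t h. h *\<^sub>R p' t"])
    fix x assume "x \<in> {a..b}"
    show "(p has_derivative (%h. h *\<^sub>R p' x)) (at x within {a..b})"
      using der[of x] unfolding has_vector_derivative_def by (rule has_derivative_at_withinI)
    have "onorm (%h. h *\<^sub>R p' x) <= norm (p' x)"
      by (rule onorm_le) simp
    then show "onorm (%h. h *\<^sub>R p' x) <= K" using assms(1)[OF \<open>x \<in> {a..b}\<close>] by linarith
  qed (use assms in auto)
  then show ?thesis by simp
qed

text \<open>The sign \<open>s\<close> records the direction in which the curve crosses horizontal
  lines. The bound \<open>d <= 1\<close> keeps the window around a parameter of the unit interval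
  inside \<open>{-1..2}\<close>, where the Lipschitz bounds of the function algebra are
  available.\<close>

definition transversal :: "real => real => real => real => real => bool" where
  "transversal t0 d m K s \<longleftrightarrow> 0 < d \<and> d <= 1 \<and> 0 < m \<and> 0 < K \<and> (s = 1 \<or> s = -1) \<and>
     (\<forall>t\<in>{t0-d..t0+d}. norm (p' t) <= K) \<and>
     (\<forall>a\<in>{t0-d..t0+d}. \<forall>b\<in>{t0-d..t0+d}. a <= b --> m * (b - a) <= s * Im (p b - p a))"

lemma transversal_mono: "transversal t0 d m K s ==> 0 < e ==> e <= d ==> transversal t0 e m K s"
  unfolding transversal_def by auto

lemma transversalD:
  assumes "transversal t0 d m K s"
  shows "0 < d" "d <= 1" "0 < m" "0 < K" "s = 1 \<or> s = -1"
    "\<And>t. t \<in> {t0-d..t0+d} ==> norm (p' t) <= K"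
    "\<And>a b. a \<in> {t0-d..t0+d} ==> b \<in> {t0-d..t0+d} ==> a <= b ==> m * (b - a) <= s * Im (p b - p a)"
    "\<And>a b. a \<in> {t0-d..t0+d} ==> b \<in> {t0-d..t0+d} ==> m * \<bar>b - a\<bar> <= \<bar>Im (p b - p a)\<bar>"
    "\<And>a b. a \<in> {t0-d..t0+d} ==> b \<in> {t0-d..t0+d} ==> norm (p b - p a) <= K * \<bar>b - a\<bar>"
proof -
  show 1: "0 < d" "d <= 1" "0 < m" "0 < K" "s = 1 \<or> s = -1"
    "\<And>t. t \<in> {t0-d..t0+d} ==> norm (p' t) <= K"
    "\<And>a b. a \<in> {t0-d..t0+d} ==> b \<in> {t0-d..t0+d} ==> a <= b ==> m * (b - a) <= s * Im (p b - p a)"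
    using assms unfolding transversal_def by auto
  show "m * \<bar>b - a\<bar> <= \<bar>Im (p b - p a)\<bar>" if "a \<in> {t0-d..t0+d}" "b \<in> {t0-d..t0+d}" for a b
    using 1(7)[OF that] 1(7)[OF that(2,1)] 1(5) by (cases "a <= b") auto
  show "norm (p b - p a) <= K * \<bar>b - a\<bar>" if "a \<in> {t0-d..t0+d}" "b \<in> {t0-d..t0+d}" for a b
    using lipschitz[OF 1(6) that(2,1)] by simp
qed

lemma transversal_exists:
  assumes "Im (p' t0) ~= 0"
  obtains d m K s where "transversal t0 d m K s"
proof -
  define s where "s = sgn (Im (p' t0))"
  define m where "m = \<bar>Im (p' t0)\<bar> / 2"
  have s: "s = 1 \<or> s = -1" and m: "m > 0" using assms by (auto simp: s_def m_def sgn_if)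
  have "continuous_on UNIV (%t. s * Im (p' t))" by (intro continuous_intros cont')
  then obtain d where d: "d > 0" "\<And>t. dist t t0 < d ==> dist (s * Im (p' t)) (s * Im (p' t0)) < m"
    using m unfolding continuous_on_iff by (metis UNIV_I)
  define e where "e = min (d/2) 1"
  have pos: "s * Im (p' t) > m" if "t \<in> {t0-e..t0+e}" for t
  proof -
    have "dist t t0 < d" using that d(1) by (auto simp: e_def dist_real_def)
    then have "dist (s * Im (p' t)) (s * Im (p' t0)) < m" by (rule d(2))
    moreover have "s * Im (p' t0) = 2 * m" by (auto simp: s_def m_def sgn_if)
    ultimately show ?thesis by (auto simp: dist_real_def)
  qed
  obtain K where K: "K > 0" "\<And>t. t \<in> {t0-e..t0+e} ==> norm (p' t) <= K"
    using derivative_bounded[of "t0-e" "t0+e"] by blast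
  have "m * (b - a) <= s * Im (p b - p a)"
    if ab: "a \<in> {t0-e..t0+e}" "b \<in> {t0-e..t0+e}" "a <= b" for a b
  proof (cases "a = b")
    case False
    have "((%t. s * Im (p t)) has_real_derivative s * Im (p' t)) (at t)" for t
    proof -
      have "((%t. Im (p t)) has_vector_derivative Im (p' t)) (at t)"
        by (rule bounded_linear.has_vector_derivative[OF bounded_linear_Im der])
      then show ?thesis
        unfolding has_real_derivative_iff_has_vector_derivative[symmetric] by (rule DERIV_cmult)
    qed
    then obtain z where z: "z > a" "z < b" "s * Im (p b) - s * Im (p a) = (b - a) * (s * Im (p' z))"
      using MVT2[of a b "%t. s * Im (p t)" "%t. s * Im (p' t)"] False ab(3) by auto
    have "(b - a) * m <= (b - a) * (s * Im (p' z))"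
      using pos[of z] z ab by (intro mult_left_mono) auto
    then show ?thesis using z(3) by (simp add: algebra_simps)
  qed simp
  then have "transversal t0 e m K s"
    unfolding transversal_def using s m K d(1) by (auto simp: e_def)
  then show ?thesis by (rule that)
qed

text \<open>If \<open>t\<close> is away from \<open>t0\<close>, compactness and simplicity of
  \<open>p t0\<close> keep \<open>p t\<close> at a positive distance. If \<open>t\<close> is close,
  the imaginary part controls \<open>t - a\<close>, and then the triangle inequality controls
  \<open>x\<close>. The estimate makes Cauchy kernels at \<open>p a + x\<close> comparable with
  those of a straight line.\<close>

lemma kernel_bound:
  assumes T: "transversal t0 d0 m K s" and t0: "t0 \<in> {0..1}"
    and simple: "\<And>t. t \<in> {0..1} ==> p t = p t0 ==> t = t0"
  obtains d c where "0 < d" "d <= d0" "0 < c"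
    "\<And>t a x. t \<in> {0..1} ==> a \<in> {t0-d..t0+d} ==> \<bar>x\<bar> <= d ==>
       c * sqrt ((t - a)\<^sup>2 + x\<^sup>2) <= norm (p t - p a - of_real x)"
proof -
  note TD = transversalD[OF T]
  define F where "F = {0..1} - {t0-d0<..<t0+d0}"
  have cF: "compact F" unfolding F_def by (intro compact_diff) auto
  obtain g where g: "g > 0" "\<And>t. t \<in> F ==> norm (p t - p t0) >= g"
  proof (cases "F = {}")
    case False
    have "continuous_on F (%t. norm (p t - p t0))" by (intro continuous_intros cont)
    then obtain u where u: "u \<in> F" "\<And>t. t \<in> F ==> norm (p u - p t0) <= norm (p t - p t0)"
      using continuous_attains_inf[OF cF False] by blast
    have "p u ~= p t0" using simple[of u] u(1) TD(1) by (auto simp: F_def)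
    then show ?thesis using that[of "norm (p u - p t0)"] u(2) by simp
  qed (use that[of 1] in auto)
  \<comment> \<open>The displacement of \<open>p a\<close> from \<open>p t0\<close>, at most
    \<open>K * d\<close>, and \<open>x\<close>, at most \<open>d\<close>, then use up no more than
    half of the gap \<open>g\<close>.\<close>
  define d where "d = min d0 (g / (2 * (K + 1)))"
  define c where "c = min (1 / (1/m + 1 + K/m)) (g / 8)"
  have "d <= g / (2 * (K + 1))" by (simp add: d_def)
  then have "d * (2 * (K + 1)) <= g" using TD(4) by (subst (asm) pos_le_divide_eq) auto
  then have d: "0 < d" "d <= d0" "d * (K + 1) <= g/2"
    using TD(1,4) g(1) by (auto simp: d_def algebra_simps)
  have A: "1/m + 1 + K/m > 0" using TD(3,4) by (simp add: add_pos_pos)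
  have c: "0 < c" using A g(1) by (auto simp: c_def)
  have "c * sqrt ((t - a)\<^sup>2 + x\<^sup>2) <= norm (p t - p a - of_real x)"
    if t: "t \<in> {0..1}" and a: "a \<in> {t0-d..t0+d}" and x: "\<bar>x\<bar> <= d" for t a x
  proof -
    let ?N = "norm (p t - p a - of_real x)"
    have sq: "sqrt ((t - a)\<^sup>2 + x\<^sup>2) <= \<bar>t - a\<bar> + \<bar>x\<bar>" by (rule sqrt_sum_squares_le_sum_abs)
    show ?thesis
    proof (cases "t \<in> F")
      case True
      have pa: "norm (p a - p t0) <= K * d"
      proof -
        have "norm (p a - p t0) <= K * \<bar>a - t0\<bar>" by (rule TD(9)) (use a d TD(1) in auto)
        also have "\<dots> <= K * d" using a TD(4) by (intro mult_left_mono) auto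
        finally show ?thesis .
      qed
      have "norm (p t - p t0) <= ?N + norm (p a - p t0) + \<bar>x\<bar>"
        using norm_triangle_ineq[of "p t - p a - of_real x" "(p a - p t0) + of_real x"]
          norm_triangle_ineq[of "p a - p t0" "of_real x"] by simp
      then have "?N >= g / 2" using g(2)[OF True] pa x d(3) by (simp add: algebra_simps)
      moreover have "\<bar>t - a\<bar> + \<bar>x\<bar> <= 4" using t a x t0 d TD(2) by auto
      moreover have "c <= g/8" by (simp add: c_def)
      ultimately have "c * (\<bar>t - a\<bar> + \<bar>x\<bar>) <= ?N"
        using mult_mono[of c "g/8" "\<bar>t - a\<bar> + \<bar>x\<bar>" 4] g(1) by simp
      then show ?thesis using mult_left_mono[OF sq, of c] c by linarith
    next
      case False
      then have t': "t \<in> {t0-d0..t0+d0}" using t by (auto simp: F_def)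
      have a': "a \<in> {t0-d0..t0+d0}" using a d by auto
      have 1: "m * \<bar>t - a\<bar> <= ?N"
      proof -
        have "\<bar>Im (p t - p a)\<bar> = \<bar>Im (p t - p a - of_real x)\<bar>" by simp
        also have "\<dots> <= ?N" by (rule abs_Im_le_cmod)
        finally show ?thesis using TD(8)[OF a' t'] by linarith
      qed
      have "\<bar>x\<bar> = norm (p t - p a - (p t - p a - of_real x))" by simp
      also have "\<dots> <= norm (p t - p a) + ?N" by (rule norm_triangle_ineq4)
      finally have 2: "\<bar>x\<bar> <= K * \<bar>t - a\<bar> + ?N" using TD(9)[OF a' t'] by linarith
      have 3: "\<bar>t - a\<bar> <= ?N / m" using 1 TD(3) by (simp add: field_simps)
      have "K * \<bar>t - a\<bar> <= K * (?N / m)" using 3 TD(4) by (intro mult_left_mono) auto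
      with 2 3 have "\<bar>t - a\<bar> + \<bar>x\<bar> <= ?N * (1/m + 1 + K/m)" by (simp add: algebra_simps)
      then have "(1 / (1/m + 1 + K/m)) * (\<bar>t - a\<bar> + \<bar>x\<bar>) <= ?N" using A by (simp add: pos_divide_le_eq)
      moreover have "c * (\<bar>t - a\<bar> + \<bar>x\<bar>) <= (1 / (1/m + 1 + K/m)) * (\<bar>t - a\<bar> + \<bar>x\<bar>)"
        by (intro mult_right_mono) (auto simp: c_def)
      ultimately show ?thesis using mult_left_mono[OF sq, of c] c by linarith
    qed
  qed
  with d c show ?thesis using that[of d c] by blast
qed

text \<open>\<open>M\<close> need not have pointwise limits at the arc. Its primitive
  \<open>N\<close>, however, extends continuously to the arc and is constant there, since the
  integrals of \<open>M\<close> along the translated arcs tend to 0. After subtracting the constant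
  and extending by 0 across the arc, a maximum modulus argument shows that the primitive vanishes
  near the arc.\<close>

lemma boundary_uniqueness:
  assumes T: "transversal t0 d m K s" and s0: "s0 > 0"
    and hol: "M holomorphic_on U" "open U"
    and sub: "\<And>t x. t \<in> {t0-d..t0+d} ==> 0 < x ==> x <= s0 ==> p t + of_real x \<in> U"
    and bd: "\<And>t x. t \<in> {t0-d..t0+d} ==> 0 < x ==> x <= s0 ==> norm (M (p t + of_real x)) <= C"
    and lim: "((%x. integral {t0-d..t0+d} (%t. norm (M (p t + of_real x)))) \<longlongrightarrow> 0) (at_right 0)"
  shows "\<exists>x1 r. 0 < x1 \<and> x1 < s0 \<and> 0 < r \<and> (\<forall>w\<in>ball (p t0 + of_real x1) r. M w = 0)"
proof -
  note TD = transversalD[OF T]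
  \<comment> \<open>\<open>q\<close> bounds the slope of the arc as a graph over the imaginary
    axis.\<close>
  define q where "q = K / m"
  have q: "q > 0" using TD by (simp add: q_def)
  let ?T = "{t0-d..t0+d}"
  define x0 y0 where "x0 = Re (p t0)" and "y0 = Im (p t0)"
  have t0T: "t0 \<in> ?T" using TD(1) by simp
  have cone: "\<bar>Re (p b - p a)\<bar> <= q * \<bar>Im (p b - p a)\<bar>" if "a \<in> ?T" "b \<in> ?T" for a b
  proof -
    have "\<bar>Re (p b - p a)\<bar> <= K * \<bar>b - a\<bar>" using TD(9)[OF that] abs_Re_le_cmod order_trans by blast
    also have "\<dots> = q * (m * \<bar>b - a\<bar>)" using TD(3) by (simp add: q_def)
    also have "\<dots> <= q * \<bar>Im (p b - p a)\<bar>" using TD(8)[OF that] q by (intro mult_left_mono) auto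
    finally show ?thesis .
  qed
  \<comment> \<open>McShane extension: the upper envelope of cones of slope \<open>q\<close> extends
    the graph function from the heights of the arc to all heights, with the same Lipschitz
    constant.\<close>
  define al where "al = (%y. SUP t\<in>?T. Re (p t) - q * \<bar>y - Im (p t)\<bar>)"
  have bdd: "bdd_above ((%t. Re (p t) - q * \<bar>y - Im (p t)\<bar>) ` ?T)" for y
  proof -
    have "compact ((%t. Re (p t) - q * \<bar>y - Im (p t)\<bar>) ` ?T)"
      by (intro compact_continuous_image continuous_intros cont) auto
    then show ?thesis by (intro bounded_imp_bdd_above compact_imp_bounded)
  qed
  have al_ge: "Re (p t) - q * \<bar>y - Im (p t)\<bar> <= al y" if "t \<in> ?T" for t y
    unfolding al_def by (rule cSUP_upper[OF that bdd])
  have al_le: "al y <= v" if "\<And>t. t \<in> ?T ==> Re (p t) - q * \<bar>y - Im (p t)\<bar> <= v" for y v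
    unfolding al_def by (rule cSUP_least) (use t0T that in auto)
  have al_p: "al (Im (p t)) = Re (p t)" if "t \<in> ?T" for t
  proof (rule antisym)
    show "al (Im (p t)) <= Re (p t)"
      by (rule al_le) (use cone[OF that] in \<open>fastforce simp: abs_minus_commute abs_le_iff\<close>)
    show "Re (p t) <= al (Im (p t))" using al_ge[OF that, of "Im (p t)"] by simp
  qed
  have al_lip1: "al y <= al z + q * \<bar>y - z\<bar>" for y z
  proof (rule al_le)
    fix t assume t: "t \<in> ?T"
    have "q * \<bar>z - Im (p t)\<bar> <= q * (\<bar>y - z\<bar> + \<bar>y - Im (p t)\<bar>)"
      using q by (intro mult_left_mono) auto
    then show "Re (p t) - q * \<bar>y - Im (p t)\<bar> <= al z + q * \<bar>y - z\<bar>"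
      using al_ge[OF t, of z] by (simp add: algebra_simps)
  qed
  have al_lip: "\<bar>al y - al z\<bar> <= q * \<bar>y - z\<bar>" for y z
    using al_lip1[of y z] al_lip1[of z y] by (simp add: abs_le_iff abs_minus_commute)
  have "q-lipschitz_on UNIV al"
    by (rule lipschitz_onI) (use al_lip q in \<open>auto simp: dist_real_def\<close>)
  then have al_cont: "continuous_on UNIV al" by (rule lipschitz_on_continuous_on)
  have al_y0: "al y0 = x0" using al_p[OF t0T] by (simp add: x0_def y0_def)
  \<comment> \<open>The first bound makes all heights within \<open>h\<close> of \<open>y0\<close>
    occur on the arc; the second keeps the region \<open>R\<close> within horizontal distance
    \<open>s0\<close> of the arc, where the hypotheses on \<open>M\<close> apply.\<close>
  define h where "h = min (m * d) (s0 / (4 * q + 1))"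
  have "h <= s0 / (4 * q + 1)" by (simp add: h_def)
  then have "h * (4 * q + 1) <= s0" using q by (subst (asm) pos_le_divide_eq) auto
  then have h: "h > 0" "h <= m * d" "(4 * q + 1) * h <= s0"
    using TD(1,3) s0 q by (auto simp: h_def mult.commute)
  have ivt: "\<exists>t\<in>?T. Im (p t) = y" if "\<bar>y - y0\<bar> <= h" for y
  proof -
    have "\<exists>t. t0 - d <= t \<and> t <= t0 + d \<and> s * Im (p t) = s * y"
    proof (rule IVT')
      show "s * Im (p (t0 - d)) <= s * y"
        using TD(7)[of "t0-d" t0] TD(1,5) that h(2) unfolding y0_def by (auto simp: algebra_simps abs_le_iff)
      show "s * y <= s * Im (p (t0 + d))"
        using TD(7)[of t0 "t0+d"] TD(1,5) that h(2) unfolding y0_def by (auto simp: algebra_simps abs_le_iff)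
    qed (use TD(1) in \<open>auto intro!: continuous_intros cont\<close>)
    then show ?thesis using TD(5) by auto
  qed
  define X where "X = 3 * q * h + h"
  define R where "R = {w. \<bar>Im w - y0\<bar> < h \<and> al (Im w) < Re w \<and> Re w < x0 + X}"
  have openR: "open R"
  proof -
    have "continuous_on UNIV (%w. al (Im w))"
      by (rule continuous_on_compose2[OF al_cont]) (auto intro!: continuous_intros)
    then have "open {w. \<bar>Im w - y0\<bar> < h}" "open {w. al (Im w) < Re w}" "open {w. Re w < x0 + X}"
      by (auto intro!: open_Collect_less continuous_intros)
    then have "open ({w. \<bar>Im w - y0\<bar> < h} \<inter> {w. al (Im w) < Re w} \<inter> {w. Re w < x0 + X})"
      by (intro open_Int)
    moreover have "R = {w. \<bar>Im w - y0\<bar> < h} \<inter> {w. al (Im w) < Re w} \<inter> {w. Re w < x0 + X}"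
      unfolding R_def by auto
    ultimately show ?thesis by simp
  qed
  have al_near: "\<bar>al y - x0\<bar> <= q * h" if "\<bar>y - y0\<bar> <= h" for y
    using al_lip[of y y0] mult_left_mono[OF that, of q] q unfolding al_y0 by linarith
  have Rrep: "\<exists>t\<in>?T. w = p t + of_real (Re w - al (Im w)) \<and> Re w - al (Im w) <= s0"
    if w: "\<bar>Im w - y0\<bar> < h" "Re w < x0 + X" for w
  proof -
    obtain t where t: "t \<in> ?T" "Im (p t) = Im w" using ivt[of "Im w"] w by auto
    have "Re (p t) = al (Im w)" using al_p[OF t(1)] t(2) by simp
    then have "w = p t + of_real (Re w - al (Im w))" using t(2) by (simp add: complex_eq_iff)
    moreover have "Re w - al (Im w) <= s0"
      using al_near[of "Im w"] w h(3) unfolding X_def by (auto simp: algebra_simps)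
    ultimately show ?thesis using t(1) by blast
  qed
  have RU: "w \<in> U" and RC: "norm (M w) <= C" if "w \<in> R" for w
  proof -
    have w: "\<bar>Im w - y0\<bar> < h" "Re w < x0 + X" "al (Im w) < Re w" using that by (auto simp: R_def)
    obtain t where t: "t \<in> ?T" "w = p t + of_real (Re w - al (Im w))" "Re w - al (Im w) <= s0"
      using Rrep[OF w(1,2)] by blast
    show "w \<in> U" using sub[OF t(1) _ t(3)] w(3) t(2) by simp
    show "norm (M w) <= C" using bd[OF t(1) _ t(3)] w(3) t(2) by simp
  qed
  \<comment> \<open>A star centre. Over heights within \<open>h\<close> of \<open>y0\<close> the
    graph stays below \<open>x0 + q * h\<close>, and moving a fraction \<open>u\<close> towards the
    centre raises it by at most \<open>q * u * h\<close>; the abscissa \<open>x0 + 3 * q * h\<close>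
    leaves a surplus of \<open>q * h\<close>.\<close>
  define ws where "ws = Complex (x0 + 3 * q * h) y0"
  have starR: "starlike R"
    unfolding starlike_def
  proof (intro bexI ballI)
    show "ws \<in> R" using h(1) q unfolding R_def ws_def X_def al_y0[symmetric] by simp
    fix w assume w: "w \<in> R"
    show "closed_segment ws w \<subseteq> R"
    proof
      fix z assume "z \<in> closed_segment ws w"
      then have "z \<in> closed_segment w ws" by (simp add: closed_segment_commute)
      then obtain u where u: "0 <= u" "u <= 1" "z = (1 - u) *\<^sub>R w + u *\<^sub>R ws" unfolding in_segment by auto
      have Rez: "Re z = (1 - u) * Re w + u * (x0 + 3 * q * h)" and Imz: "Im z = (1 - u) * Im w + u * y0"
        using u by (auto simp: ws_def)
      have Iz: "\<bar>Im z - y0\<bar> <= \<bar>Im w - y0\<bar>" "\<bar>Im z - Im w\<bar> = u * \<bar>Im w - y0\<bar>"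
      proof -
        have "Im z - y0 = (1 - u) * (Im w - y0)" unfolding Imz by (simp add: algebra_simps)
        then have "\<bar>Im z - y0\<bar> = (1 - u) * \<bar>Im w - y0\<bar>" using u by (simp add: abs_mult)
        then show "\<bar>Im z - y0\<bar> <= \<bar>Im w - y0\<bar>" using u by (simp add: mult_left_le_one_le)
        have "Im z - Im w = u * (y0 - Im w)" unfolding Imz by (simp add: algebra_simps)
        then show "\<bar>Im z - Im w\<bar> = u * \<bar>Im w - y0\<bar>" using u by (simp add: abs_mult abs_minus_commute)
      qed
      have wR: "\<bar>Im w - y0\<bar> < h" "al (Im w) < Re w" "Re w < x0 + X" using w by (auto simp: R_def)
      have "Re z < x0 + X"
      proof -
        have "(1 - u) * Re w + u * (x0 + 3 * q * h) < x0 + X"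
        proof (cases "u = 1")
          case True then show ?thesis using h(1) by (simp add: X_def)
        next
          case False
          have "(1 - u) * Re w < (1 - u) * (x0 + X)" using False u wR by (intro mult_strict_left_mono) auto
          moreover have "u * (x0 + 3 * q * h) <= u * (x0 + X)" using u h by (intro mult_left_mono) (auto simp: X_def)
          ultimately show ?thesis by (simp add: algebra_simps)
        qed
        then show ?thesis unfolding Rez .
      qed
      moreover have "al (Im z) < Re z"
      proof -
        have "al (Im z) <= al (Im w) + q * (u * h)"
        proof -
          have "u * \<bar>Im w - y0\<bar> <= u * h" using wR(1) u(1) by (intro mult_left_mono) auto
          then have "q * \<bar>Im z - Im w\<bar> <= q * (u * h)" unfolding Iz(2) using q by (rule mult_left_mono[OF _ less_imp_le])
          then show ?thesis using al_lip1[of "Im z" "Im w"] by linarith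
        qed
        moreover have "Re z - al (Im w) - q * (u * h)
            = (1 - u) * (Re w - al (Im w)) + u * (x0 + 3 * q * h - al (Im w) - q * h)"
          unfolding Rez by (simp add: algebra_simps)
        moreover have "0 < (1 - u) * (Re w - al (Im w)) + u * (x0 + 3 * q * h - al (Im w) - q * h)"
        proof (cases "u = 0")
          case True then show ?thesis using wR by simp
        next
          case False
          have "x0 + 3 * q * h - al (Im w) - q * h >= q * h"
            using al_near[OF less_imp_le[OF wR(1)]] by linarith
          moreover have "q * h > 0" using q h by simp
          ultimately have "x0 + 3 * q * h - al (Im w) - q * h > 0" by linarith
          then have "u * (x0 + 3 * q * h - al (Im w) - q * h) > 0" using False u(1) by (intro mult_pos_pos) auto
          moreover have "(1 - u) * (Re w - al (Im w)) >= 0" using u wR by simp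
          ultimately show ?thesis by linarith
        qed
        ultimately show ?thesis by linarith
      qed
      ultimately show "z \<in> R" using Iz(1) wR(1) by (simp add: R_def)
    qed
  qed
  have RUs: "R \<subseteq> U" using RU by auto
  have "\<exists>N. \<forall>x\<in>R. (N has_field_derivative M x) (at x)"
  proof (rule holomorphic_starlike_primitive[OF _ starR openR, of _ "{}"])
    show "continuous_on R M" using hol(1) RUs by (meson continuous_on_subset holomorphic_on_imp_continuous_on)
    show "M field_differentiable at x" if "x \<in> R - {}" for x
      using hol RUs that holomorphic_on_imp_differentiable_at by blast
  qed auto
  then obtain N where N: "\<And>x. x \<in> R ==> (N has_field_derivative M x) (at x)" by auto
  have horiz: "norm (N (Complex x y) - N (Complex x' y)) <= C * \<bar>x - x'\<bar>"
    if "Complex x y \<in> R" "Complex x' y \<in> R" for x x' y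
  proof -
    have seg: "closed_segment (Complex x y) (Complex x' y) \<subseteq> R"
    proof
      fix z assume "z \<in> closed_segment (Complex x y) (Complex x' y)"
      then obtain u where u: "0 <= u" "u <= 1" "z = (1 - u) *\<^sub>R Complex x y + u *\<^sub>R Complex x' y"
        unfolding in_segment by auto
      have Re: "Re z = (1 - u) * x + u * x'" and "Im z = y" unfolding u(3) by (auto simp: algebra_simps)
      have x: "al y < x" "x < x0 + X" "al y < x'" "x' < x0 + X" "\<bar>y - y0\<bar> < h" using that by (auto simp: R_def)
      have "Re z \<in> {al y<..<x0+X}"
        using convexD[OF convex_real_interval(8)[of "al y" "x0+X"], of x x' "1-u" u] x u unfolding Re by auto
      then show "z \<in> R" using x \<open>Im z = y\<close> by (simp add: R_def)
    qed
    have "norm (N (Complex x y) - N (Complex x' y)) <= C * norm (Complex x y - Complex x' y)"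
      by (rule field_differentiable_bound[of "closed_segment (Complex x y) (Complex x' y)" N M])
        (use seg N RC has_field_derivative_at_within in \<open>auto, blast+\<close>)
    also have "Complex x y - Complex x' y = of_real (x - x')" by (simp add: complex_eq_iff)
    finally show ?thesis by (simp add: norm_of_real del: of_real_diff)
  qed
  have inR: "p t + of_real x \<in> R" if "t \<in> ?T" "\<bar>Im (p t) - y0\<bar> < h" "0 < x" "x < 2 * q * h + h" for t x
  proof -
    have "Re (p t) <= x0 + q * h" using al_near[OF less_imp_le[OF that(2)]] al_p[OF that(1)] by linarith
    then show ?thesis using that al_p[OF that(1)] unfolding R_def X_def by auto
  qed
  \<comment> \<open>Positive offsets tending to 0 along which the arc is approached from the
    right.\<close>
  define sq where "sq = (%n. h / real (n + 2))"
  have sqp: "0 < sq n" "sq n < h" "sq n <= h" for n using h(1) by (auto simp: sq_def field_simps add_pos_nonneg)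
  have sq0: "sq \<longlonglongrightarrow> 0" unfolding sq_def by real_asymp
  have qh: "q * h > 0" using q h by simp
  have "Cauchy (%n. N (p t0 + of_real (sq n)))"
  proof (rule metric_CauchyI)
    fix e :: real assume e: "e > 0"
    have C0: "C >= 0" using bd[OF t0T, of s0] s0 norm_ge_zero order_trans by blast
    obtain n0 where n0: "\<And>n. n >= n0 ==> \<bar>sq n\<bar> < e / (2 * (C + 1))"
      using LIMSEQ_D[OF sq0, of "e / (2 * (C + 1))"] e C0 by auto
    show "\<exists>M. \<forall>m\<ge>M. \<forall>n\<ge>M. dist (N (p t0 + of_real (sq m))) (N (p t0 + of_real (sq n))) < e"
    proof (intro exI[of _ n0] allI impI)
      fix i j assume ij: "i >= n0" "j >= n0"
      have cx: "p t0 + of_real (sq k) = Complex (x0 + sq k) y0" for k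
        by (simp add: complex_eq_iff x0_def y0_def)
      have R: "Complex (x0 + sq k) y0 \<in> R" for k
        using inR[OF t0T, of "sq k"] sqp[of k] qh h(1) cx[of k] by (simp add: y0_def)
      have "dist (N (p t0 + of_real (sq i))) (N (p t0 + of_real (sq j))) <= C * \<bar>sq i - sq j\<bar>"
        using horiz[OF R[of i] R[of j]] unfolding cx dist_norm by simp
      also have "\<dots> <= (C + 1) * \<bar>sq i - sq j\<bar>" by (intro mult_right_mono) auto
      also have "\<dots> < (C + 1) * (e / (C + 1))"
      proof (rule mult_strict_left_mono)
        have "\<bar>sq i - sq j\<bar> < e / (2 * (C + 1)) + e / (2 * (C + 1))"
          using n0[OF ij(1)] n0[OF ij(2)] by linarith
        also have "e / (2 * (C + 1)) + e / (2 * (C + 1)) = e / (C + 1)"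
        proof -
          have "e / (2 * (C + 1)) = e / (C + 1) / 2" by (metis divide_divide_eq_left mult.commute)
          then show ?thesis by (simp only: field_sum_of_halves)
        qed
        finally show "\<bar>sq i - sq j\<bar> < e / (C + 1)" .
      qed (use C0 in auto)
      finally show "dist (N (p t0 + of_real (sq i))) (N (p t0 + of_real (sq j))) < e" using C0 by simp
    qed
  qed
  then obtain c where c: "(%n. N (p t0 + of_real (sq n))) \<longlonglongrightarrow> c"
    using Cauchy_convergent_iff convergent_def by metis
  define J where "J = (%x. integral ?T (%t. norm (M (p t + of_real x))))"
  have J0: "(%n. J (sq n)) \<longlonglongrightarrow> 0"
  proof -
    have "filterlim sq (at_right 0) sequentially"
      using sq0 sqp(1) by (auto simp: filterlim_at intro!: always_eventually) (metis less_irrefl)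
    then show ?thesis using lim unfolding J_def by (rule filterlim_compose[rotated])
  qed
  have Mcont: "continuous_on ?T (%t. M (p t + of_real x))" if "0 < x" "x <= s0" for x
    by (rule continuous_on_compose2[OF holomorphic_on_imp_continuous_on[OF hol(1)]])
      (use sub that in \<open>auto intro!: continuous_intros cont\<close>)
  \<comment> \<open>The mean condition on \<open>M\<close> enters here: between two points of the
    same translated arc \<open>N\<close> changes by at most \<open>K * J x\<close>, which tends to
    0. So the boundary limit \<open>c\<close> at \<open>t0\<close> is the limit at all nearby points
    of the arc.\<close>
  have along: "norm (N (p b + of_real x) - N (p a + of_real x)) <= K * J x"
    if ab: "a \<in> ?T" "b \<in> ?T" "a <= b" "\<bar>Im (p a) - y0\<bar> < h" "\<bar>Im (p b) - y0\<bar> < h" and x: "0 < x" "x < h" for a b x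
  proof -
    have xs: "x <= s0"
    proof -
      have "h <= (4 * q + 1) * h" using qh by (simp add: algebra_simps)
      then show ?thesis using x h(3) by linarith
    qed
    have Imt: "\<bar>Im (p t) - y0\<bar> < h" if "t \<in> {a..b}" for t
    proof -
      have tT: "t \<in> ?T" using that ab by auto
      have "0 <= m * (t - a)" "0 <= m * (b - t)" using that TD(3) by auto
      then have "s * Im (p a) <= s * Im (p t)" "s * Im (p t) <= s * Im (p b)"
        using TD(7)[OF ab(1) tT] TD(7)[OF tT ab(2)] that by (auto simp: algebra_simps)
      then show ?thesis using TD(5) ab(4,5) by auto
    qed
    have inR': "p t + of_real x \<in> R" if "t \<in> {a..b}" for t
      by (rule inR[OF _ Imt[OF that]]) (use that ab x qh in auto)
    have "((%t. M (p t + of_real x) * p' t) has_integral N (p b + of_real x) - N (p a + of_real x)) {a..b}"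
    proof (rule fundamental_theorem_of_calculus[OF ab(3)])
      fix t assume t: "t \<in> {a..b}"
      have 1: "((%t. p t + of_real x) has_vector_derivative p' t) (at t within {a..b})"
        using has_vector_derivative_add[OF has_vector_derivative_at_within[OF der] has_vector_derivative_const] by simp
      have "(N \<circ> (%t. p t + of_real x) has_vector_derivative p' t * M (p t + of_real x)) (at t within {a..b})"
        by (rule field_vector_diff_chain_within[OF 1]) (use N[OF inR'[OF t]] in \<open>rule has_field_derivative_at_within\<close>)
      then show "((%t. N (p t + of_real x)) has_vector_derivative M (p t + of_real x) * p' t) (at t within {a..b})"
        by (simp add: o_def mult.commute)
    qed
    then have eq: "N (p b + of_real x) - N (p a + of_real x) = integral {a..b} (%t. M (p t + of_real x) * p' t)"
      by (simp add: integral_unique)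
    have abT: "{a..b} \<subseteq> ?T" using ab by auto
    have Mc: "continuous_on {a..b} (%t. M (p t + of_real x))" by (rule continuous_on_subset[OF Mcont[OF x(1) xs] abT])
    have "norm (integral {a..b} (%t. M (p t + of_real x) * p' t)) <= integral {a..b} (%t. K * norm (M (p t + of_real x)))"
    proof (rule integral_norm_bound_integral)
      fix t assume "t \<in> {a..b}"
      then show "norm (M (p t + of_real x) * p' t) <= K * norm (M (p t + of_real x))"
        using TD(6)[of t] abT by (simp add: norm_mult mult.commute mult_right_mono subset_iff)
    qed (auto intro!: integrable_continuous_real continuous_intros Mc continuous_on_subset[OF cont'])
    also have "\<dots> = K * integral {a..b} (%t. norm (M (p t + of_real x)))" by simp
    also have "\<dots> <= K * J x"
      unfolding J_def using TD(4)
      by (intro mult_left_mono integral_subset_le[OF abT])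
        (auto intro!: integrable_continuous_real continuous_intros Mc Mcont x xs)
    finally show ?thesis unfolding eq .
  qed
  have NC: "norm (N w - c) <= C * (Re w - al (Im w))" if w: "w \<in> R" for w
  proof -
    have wR: "\<bar>Im w - y0\<bar> < h" "al (Im w) < Re w" "Re w < x0 + X" using w by (auto simp: R_def)
    obtain t where t: "t \<in> ?T" "w = p t + of_real (Re w - al (Im w))" using Rrep[OF wR(1,3)] by blast
    have Imt: "Im (p t) = Im w" using arg_cong[OF t(2), of Im] by simp
    have Ret: "Re (p t) = al (Im w)" using al_p[OF t(1)] Imt by simp
    define g where "g = Re w - al (Im w)"
    have ev: "\<forall>\<^sub>F n in sequentially. norm (N w - N (p t0 + of_real (sq n))) <= C * g + K * J (sq n)"
    proof -
      have "\<forall>\<^sub>F n in sequentially. sq n < g" using order_tendstoD(2)[OF sq0, of g] wR by (simp add: g_def)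
      then show ?thesis
      proof eventually_elim
        case (elim n)
        have R1: "p t + of_real (sq n) \<in> R" by (rule inR[OF t(1)]) (use Imt wR sqp[of n] qh in auto)
        have cx: "p t + of_real x = Complex (al (Im w) + x) (Im w)" for x
          using Imt Ret by (simp add: complex_eq_iff)
        have wc: "w = Complex (al (Im w) + g) (Im w)" by (simp add: g_def)
        have "norm (N w - N (p t + of_real (sq n))) <= C * \<bar>g - sq n\<bar>"
          using horiz[of "al (Im w) + g" "Im w" "al (Im w) + sq n"] w R1 unfolding cx wc[symmetric] by simp
        also have "\<dots> <= C * g"
        proof (rule mult_left_mono)
          show "\<bar>g - sq n\<bar> <= g" using elim sqp[of n] by auto
          show "0 <= C" using RC[OF w] norm_ge_zero order_trans by blast
        qed
        finally have 1: "norm (N w - N (p t + of_real (sq n))) <= C * g" .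
        have 2: "norm (N (p t + of_real (sq n)) - N (p t0 + of_real (sq n))) <= K * J (sq n)"
        proof (cases "t0 <= t")
          case True
          show ?thesis by (rule along[OF t0T t(1) True]) (use Imt wR sqp[of n] h in \<open>auto simp: y0_def\<close>)
        next
          case False
          then show ?thesis
            using along[OF t(1) t0T, of "sq n"] Imt wR sqp[of n] h by (auto simp: y0_def norm_minus_commute)
        qed
        show ?case using norm_triangle_ineq[of "N w - N (p t + of_real (sq n))" "N (p t + of_real (sq n)) - N (p t0 + of_real (sq n))"] 1 2 by simp
      qed
    qed
    have "norm (N w - c) <= C * g + K * 0"
    proof (rule tendsto_le[OF trivial_limit_sequentially _ _ ev])
      show "(%n. C * g + K * J (sq n)) \<longlonglongrightarrow> C * g + K * 0" by (intro tendsto_intros J0)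
      show "(%n. norm (N w - N (p t0 + of_real (sq n)))) \<longlonglongrightarrow> norm (N w - c)" by (intro tendsto_intros c)
    qed
    then show ?thesis by (simp add: g_def)
  qed
  \<comment> \<open>Continuity across the arc follows from \<open>NC\<close>: the difference
    \<open>N - c\<close> is bounded by a multiple of the horizontal distance to the arc.\<close>
  define G where "G = (%w. if w \<in> R then N w - c else 0)"
  define Bx where "Bx = {w. \<bar>Im w - y0\<bar> < h \<and> Re w < x0 + X}"
  have C0: "C >= 0" using bd[OF t0T, of s0] s0 norm_ge_zero order_trans by blast
  have GB: "norm (G w) <= C * max 0 (Re w - al (Im w))" if "w \<in> Bx" for w
    using NC[of w] that C0 unfolding G_def Bx_def R_def by auto
  have Gcont: "continuous (at w) G" if w: "w \<in> Bx" for w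
  proof (cases "w \<in> R")
    case True
    have "continuous (at w) (%w. N w - c)"
      using N[OF True] by (intro continuous_intros) (auto intro: DERIV_isCont)
    moreover have "\<forall>\<^sub>F z in nhds w. G z = N z - c"
      using eventually_nhds_in_open[OF openR True] by eventually_elim (simp add: G_def)
    ultimately show ?thesis by (subst isCont_cong) auto
  next
    case False
    have openBx: "open Bx"
    proof -
      have "open {w. \<bar>Im w - y0\<bar> < h}" "open {w. Re w < x0 + X}"
        by (auto intro!: open_Collect_less continuous_intros)
      then show ?thesis unfolding Bx_def Collect_conj_eq by (rule open_Int)
    qed
    have le: "Re w - al (Im w) <= 0" using False w unfolding R_def Bx_def by auto
    have "((%z. C * max 0 (Re z - al (Im z))) \<longlongrightarrow> C * max 0 (Re w - al (Im w))) (at w)"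
    proof -
      have "continuous_on UNIV (%w. al (Im w))"
        by (rule continuous_on_compose2[OF al_cont]) (auto intro!: continuous_intros)
      then have "continuous_on UNIV (%z. C * max 0 (Re z - al (Im z)))" by (intro continuous_intros)
      then show ?thesis by (simp add: continuous_on_def)
    qed
    then have lim0: "((%z. C * max 0 (Re z - al (Im z))) \<longlongrightarrow> 0) (at w)"
      using le by (simp add: max_absorb1)
    have "(G \<longlongrightarrow> 0) (at w)"
    proof (rule Lim_null_comparison[OF _ lim0])
      show "\<forall>\<^sub>F z in at w. norm (G z) <= C * max 0 (Re z - al (Im z))"
        using eventually_at_in_open'[OF openBx w] by eventually_elim (rule GB)
    qed
    then show ?thesis using False by (simp add: isCont_def G_def)
  qed
  define x1 where "x1 = h / 6"
  have x1: "0 < x1" "3 * x1 < h" "x1 < s0"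
  proof -
    show "0 < x1" "3 * x1 < h" using h(1) by (auto simp: x1_def)
    have "h <= (4 * q + 1) * h" using qh by (simp add: algebra_simps)
    then have "h <= s0" using h(3) by linarith
    then show "x1 < s0" using h(1) by (simp add: x1_def)
  qed
  \<comment> \<open>A point on the far side of the arc. It is outside the closure of
    \<open>O1\<close>, so division by powers of \<open>w - w1\<close> is harmless, while
    \<open>p t0 + x1\<close> is at distance \<open>2 * x1\<close> and thus inside the disc of radius
    \<open>3 * x1\<close>.\<close>
  define w1 where "w1 = p t0 - of_real x1"
  have w1: "Re w1 = x0 - x1" "Im w1 = y0" by (auto simp: w1_def x0_def y0_def)
  have cbB: "cball w1 (3 * x1) \<subseteq> Bx"
  proof
    fix w assume "w \<in> cball w1 (3 * x1)"
    then have "norm (w - w1) <= 3 * x1" by (simp add: dist_norm norm_minus_commute)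
    then have "\<bar>Im (w - w1)\<bar> <= 3 * x1" "\<bar>Re (w - w1)\<bar> <= 3 * x1"
      using abs_Im_le_cmod abs_Re_le_cmod order_trans by blast+
    then show "w \<in> Bx" using x1 qh w1 unfolding Bx_def X_def by (auto simp: abs_le_iff)
  qed
  define O1 where "O1 = R \<inter> ball w1 (3 * x1)"
  have openO: "open O1" unfolding O1_def by (intro open_Int openR open_ball)
  have clO: "closure O1 \<subseteq> cball w1 (3 * x1)"
    by (rule closure_minimal) (auto simp: O1_def)
  have nw1: "w ~= w1" if "w \<in> closure O1" for w
  proof
    assume "w = w1"
    have "closed {w. al (Im w) <= Re w}"
      by (intro closed_Collect_le continuous_on_compose2[OF al_cont] continuous_intros) auto
    then have "closure O1 \<subseteq> {w. al (Im w) <= Re w}"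
      by (intro closure_minimal) (auto simp: O1_def R_def)
    then have "al (Im w1) <= Re w1" using that \<open>w = w1\<close> by auto
    then show False using x1 unfolding w1 al_y0 by simp
  qed
  define B where "B = C * s0"
  have GB': "norm (G w) <= B" if "w \<in> Bx" for w
  proof -
    have "Re w - al (Im w) <= s0" using Rrep[of w] that by (auto simp: Bx_def)
    then have "C * max 0 (Re w - al (Im w)) <= C * s0" using C0 s0 by (intro mult_left_mono) auto
    then show ?thesis using GB[OF that] unfolding B_def by linarith
  qed
  have G0: "G z = 0" if z: "z \<in> O1" for z
  proof -
    define ra where "ra = norm (z - w1) / (3 * x1)"
    have ra: "0 <= ra" "ra < 1" using z x1 by (auto simp: ra_def O1_def dist_norm norm_minus_commute)
    have "norm (G z) <= B * ra ^ k" for k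
    proof -
      \<comment> \<open>On the frontier either \<open>G\<close> vanishes or \<open>w\<close> lies on
        the circle of radius \<open>3 * x1\<close>. The maximum principle therefore gains the factor
        \<open>ra ^ k\<close>, and \<open>k\<close> is arbitrary.\<close>
      have "norm (G z / (z - w1) ^ k) <= B / (3 * x1) ^ k"
      proof (rule maximum_modulus_frontier[of "%w. G w / (w - w1) ^ k" O1])
        have "(%w. (N w - c) / (w - w1) ^ k) holomorphic_on O1"
        proof (intro holomorphic_intros)
          show "N holomorphic_on O1"
            using N openO unfolding O1_def
            by (auto simp: holomorphic_on_def field_differentiable_def intro: has_field_derivative_at_within)
          show "(w - w1) ^ k ~= 0" if "w \<in> O1" for w using nw1[of w] that closure_subset by auto
        qed
        then show "(%w. G w / (w - w1) ^ k) holomorphic_on interior O1"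
          unfolding interior_open[OF openO] by (rule holomorphic_transform) (simp add: G_def O1_def)
        show "continuous_on (closure O1) (%w. G w / (w - w1) ^ k)"
        proof (intro continuous_intros)
          show "continuous_on (closure O1) G"
            using Gcont clO cbB by (intro continuous_at_imp_continuous_on) auto
          show "\<forall>w\<in>closure O1. (w - w1) ^ k ~= 0" using nw1 by auto
        qed
        show "bounded O1" unfolding O1_def by (rule bounded_subset[of "ball w1 (3*x1)"]) auto
        fix w assume "w \<in> frontier O1"
        then have w: "w \<in> closure O1" "w \<notin> O1" using openO by (auto simp: frontier_def interior_open)
        show "norm (G w / (w - w1) ^ k) <= B / (3 * x1) ^ k"
        proof (cases "w \<in> R")
          case True
          then have "norm (w - w1) = 3 * x1"
            using w clO unfolding O1_def by (fastforce simp: dist_norm norm_minus_commute)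
          then show ?thesis
            using GB'[of w] w clO cbB x1 by (auto simp: norm_divide norm_power intro!: divide_right_mono)
        next
          case False
          then show ?thesis using C0 s0 x1 by (simp add: G_def B_def)
        qed
      qed (rule z)
      then have "norm (G z) <= B / (3 * x1) ^ k * norm (z - w1) ^ k"
        using nw1[of z] z closure_subset[of O1] by (auto simp: norm_divide norm_power field_simps)
      then show ?thesis by (simp add: ra_def power_divide)
    qed
    moreover have "(%k. B * ra ^ k) \<longlonglongrightarrow> B * 0" by (intro tendsto_intros LIMSEQ_power_zero) (use ra in auto)
    ultimately have "norm (G z) <= 0" by (intro LIMSEQ_le_const[of "%k. B * ra ^ k" 0]) auto
    then show ?thesis by simp
  qed
  have M0: "M w = 0" if w: "w \<in> O1" for w
  proof -
    have "N z = c" if "z \<in> O1" for z using G0[OF that] that by (simp add: G_def O1_def)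
    then have "\<forall>\<^sub>F z in nhds w. N z = c"
      using eventually_nhds_in_open[OF openO w] by (auto elim: eventually_mono)
    then have "(N has_field_derivative 0) (at w)"
      by (subst DERIV_cong_ev[of w w N "%_. c" 0 0]) auto
    then show ?thesis using N[of w] w DERIV_unique unfolding O1_def by blast
  qed
  have "p t0 + of_real x1 \<in> O1"
  proof -
    have "p t0 + of_real x1 \<in> R" by (rule inR[OF t0T]) (use x1 qh h in \<open>auto simp: y0_def\<close>)
    moreover have "dist w1 (p t0 + of_real x1) < 3 * x1"
    proof -
      have "w1 - (p t0 + of_real x1) = of_real (- 2 * x1)" by (simp add: w1_def)
      then show ?thesis using x1 by (simp only: dist_norm norm_of_real)
    qed
    ultimately show ?thesis by (simp add: O1_def)
  qed
  then obtain r where "r > 0" "ball (p t0 + of_real x1) r \<subseteq> O1" using openO open_contains_ball by blast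
  then show ?thesis using M0 x1 by blast
qed

end

text \<open>The antiderivative is \<open>x * arsinh ((u - t) / x)\<close>. The bound behaves like
  \<open>x * ln (1 / x)\<close> and tends to 0 with \<open>x\<close>; it governs kernels in which
  one zero of the numerator compensates one of the two poles.\<close>

lemma integral_kernel_arsinh:
  fixes t x :: real
  assumes "a <= b" "x > 0" "\<bar>b - t\<bar> <= R" "\<bar>a - t\<bar> <= R"
  shows "integral {a..b} (%u. x / sqrt ((t - u)\<^sup>2 + x\<^sup>2)) <= 2 * x * arsinh (R / x)"
proof -
  have "((%u. x / sqrt ((t - u)\<^sup>2 + x\<^sup>2)) has_integral x * arsinh ((b - t)/x) - x * arsinh ((a - t)/x)) {a..b}"
  proof (rule fundamental_theorem_of_calculus[OF assms(1)])
    fix u assume "u \<in> {a..b}"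
    have "((%u. x * arsinh ((u - t)/x)) has_real_derivative x * (1 / sqrt (((u - t)/x)\<^sup>2 + 1) * (1 / x))) (at u within {a..b})"
      by (intro DERIV_cmult DERIV_chain2[OF arsinh_real_has_field_derivative])
        (use assms(2) in \<open>auto intro!: derivative_eq_intros\<close>)
    moreover have "x * (1 / sqrt (((u - t)/x)\<^sup>2 + 1) * (1 / x)) = x / sqrt ((t - u)\<^sup>2 + x\<^sup>2)"
    proof -
      have "((u - t)/x)\<^sup>2 + 1 = ((t - u)\<^sup>2 + x\<^sup>2) / x\<^sup>2" using assms(2) by (simp add: field_simps power2_eq_square)
      then have "sqrt (((u - t)/x)\<^sup>2 + 1) = sqrt ((t - u)\<^sup>2 + x\<^sup>2) / x"
        using assms(2) by (simp add: real_sqrt_divide)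
      then show ?thesis using assms(2) by simp
    qed
    ultimately show "((%u. x * arsinh ((u - t)/x)) has_vector_derivative x / sqrt ((t - u)\<^sup>2 + x\<^sup>2)) (at u within {a..b})"
      by (simp add: has_real_derivative_iff_has_vector_derivative)
  qed
  then have "integral {a..b} (%u. x / sqrt ((t - u)\<^sup>2 + x\<^sup>2)) = x * arsinh ((b - t)/x) - x * arsinh ((a - t)/x)"
    by (rule integral_unique)
  moreover have "arsinh ((b - t)/x) <= arsinh (R/x)" "arsinh (- (R/x)) <= arsinh ((a - t)/x)"
  proof -
    have mono: "arsinh y <= arsinh z" if "y <= z" for y z :: real
      by (rule DERIV_nonneg_imp_nondecreasing[OF that])
        (auto intro!: exI arsinh_real_has_field_derivative)
    show "arsinh ((b - t)/x) <= arsinh (R/x)"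
      by (rule mono) (use assms in \<open>auto intro!: divide_right_mono\<close>)
    have "- (R/x) <= (a - t)/x"
      unfolding minus_divide_left using assms by (intro divide_right_mono) auto
    then show "arsinh (- (R/x)) <= arsinh ((a - t)/x)" by (rule mono)
  qed
  ultimately show ?thesis
    using mult_left_mono[of "arsinh ((b - t)/x)" "arsinh (R/x)" x, OF _ less_imp_le[OF assms(2)]]
      mult_left_mono[of "- arsinh (R/x)" "arsinh ((a - t)/x)" x, OF _ less_imp_le[OF assms(2)]] by (simp del: mult_le_cancel_left_pos)
qed

lemma arsinh_limit: "((%x::real. C * (2 * x * arsinh (R / x))) \<longlongrightarrow> 0) (at_right 0)" if "R > 0"
  unfolding arsinh_real_def using that by real_asymp

text \<open>The Poisson kernel of the half-plane up to normalization: its mass is bounded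
  independently of \<open>x\<close>, which is the borderline case without compensation.\<close>

lemma integral_kernel_arctan:
  fixes t x :: real
  assumes "a <= b" "x > 0"
  shows "integral {a..b} (%u. x / ((t - u)\<^sup>2 + x\<^sup>2)) <= pi"
proof -
  have "((%u. x / ((t - u)\<^sup>2 + x\<^sup>2)) has_integral arctan ((b - t)/x) - arctan ((a - t)/x)) {a..b}"
  proof (rule fundamental_theorem_of_calculus[OF assms(1)])
    fix u assume "u \<in> {a..b}"
    have "((%u. arctan ((u - t)/x)) has_real_derivative inverse (1 + ((u - t)/x)\<^sup>2) * (1 / x)) (at u within {a..b})"
      using assms(2) by (auto intro!: derivative_eq_intros)
    moreover have "inverse (1 + ((u - t)/x)\<^sup>2) * (1 / x) = x / ((t - u)\<^sup>2 + x\<^sup>2)"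
    proof -
      have "1 + ((u - t)/x)\<^sup>2 = ((t - u)\<^sup>2 + x\<^sup>2) / x\<^sup>2" using assms(2) by (simp add: field_simps power2_eq_square)
      then show ?thesis using assms(2) by (simp add: power2_eq_square)
    qed
    ultimately show "((%u. arctan ((u - t)/x)) has_vector_derivative x / ((t - u)\<^sup>2 + x\<^sup>2)) (at u within {a..b})"
      by (simp add: has_real_derivative_iff_has_vector_derivative)
  qed
  then have "integral {a..b} (%u. x / ((t - u)\<^sup>2 + x\<^sup>2)) = arctan ((b - t)/x) - arctan ((a - t)/x)"
    by (rule integral_unique)
  then show ?thesis using arctan_bounded[of "(b - t)/x"] arctan_bounded[of "(a - t)/x"] by linarith
qed

subsection \<open>Minors of Cauchy transforms\<close>

lemma cdual_kernel_L1:
  fixes k :: "real => real => complex"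
  assumes L: "cdual L" and k: "continuous_on ({0..1} \<times> {a..b}) (%(t,s). k t s)"
    and ab: "a <= b" "-1 <= a" "b <= 2"
    and C: "C > 0" "\<And>u B. continuous_on {0..1} u ==> (\<And>t. t \<in> {0..1} ==> norm (u t) <= B) ==> norm (L u) <= C * B"
    and x: "x > 0" and Q: "Q >= 0"
    and bd: "\<And>t s. t \<in> {0..1} ==> s \<in> {a..b} ==> norm (k t s) <= Q * (x / sqrt ((t - s)\<^sup>2 + x\<^sup>2))"
  shows "integral {a..b} (%s. norm (L (%t. k t s))) <= C * (Q * (2 * x * arsinh (2 / x)))"
proof (rule cdual_L1_bound[OF L k ab(1) C])
  fix t :: real assume t: "t \<in> {0..1}"
  have ks: "continuous_on {a..b} (k t)"
    using continuous_on_compose2[OF k, of "{a..b}" "%s. (t,s)"] t by (fastforce intro: continuous_intros)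
  have pos: "(t - s)\<^sup>2 + x\<^sup>2 > 0" for s using x by (simp add: add_nonneg_pos)
  have cn: "continuous_on {a..b} (%s. x / sqrt ((t - s)\<^sup>2 + x\<^sup>2))"
    by (intro continuous_intros) (use pos in \<open>metis less_irrefl real_sqrt_gt_zero\<close>)
  have "integral {a..b} (%s. norm (k t s)) <= integral {a..b} (%s. Q * (x / sqrt ((t - s)\<^sup>2 + x\<^sup>2)))"
    by (rule integral_le[OF _ _ bd[OF t]]) (intro integrable_continuous_real continuous_on_norm ks continuous_on_mult continuous_on_const cn)+
  also have "\<dots> = Q * integral {a..b} (%s. x / sqrt ((t - s)\<^sup>2 + x\<^sup>2))" by (rule integral_mult_right)
  also have "\<dots> <= Q * (2 * x * arsinh (2 / x))"
    by (intro mult_left_mono integral_kernel_arsinh Q x ab(1)) (use t ab in auto)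
  finally show "integral {a..b} (%s. norm (k t s)) <= Q * (2 * x * arsinh (2 / x))" .
qed

text \<open>The exact error when the \<open>w\<close>-derivative of \<open>u / (p - w)\<close> is
  replaced by a difference quotient; it has a factor \<open>b - a\<close>.\<close>

lemma difference_quotient_reciprocal:
  fixes a b u :: complex
  assumes "a ~= 0" "b ~= 0" "b - a ~= 0"
  shows "(u / a - u / b) / (b - a) - u / b\<^sup>2 = u * (b - a) / (a * b\<^sup>2)"
proof -
  have "u / a - u / b = u * (b - a) / (a * b)" using assms(1,2) by (simp add: divide_simps algebra_simps)
  then have "(u / a - u / b) / (b - a) = u / (a * b)" using assms(3) by simp
  moreover have "u / (a * b) - u / b\<^sup>2 = u * (b - a) / (a * b\<^sup>2)"
    using assms(1,2) by (simp add: divide_simps power2_eq_square algebra_simps)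
  ultimately show ?thesis by simp
qed

text \<open>Lipschitz bounds are required on \<open>{-1..2}\<close> rather than on the unit interval
  because the windows around an end parameter reach outside it by up to 1.\<close>

locale curve_algebra = C1_curve p p' for p p' :: "real => complex" +
  fixes P :: "(real => complex) set"
  assumes P_lip: "g \<in> P ==> \<exists>K. \<forall>s\<in>{-1..2}. \<forall>t\<in>{-1..2}. norm (g s - g t) <= K * \<bar>s - t\<bar>"
    and P_const: "(%t. c) \<in> P"
    and P_add: "g \<in> P ==> h \<in> P ==> (%t. g t + h t) \<in> P"
    and P_mult: "g \<in> P ==> h \<in> P ==> (%t. g t * h t) \<in> P"
    and P_p: "p \<in> P"
begin

lemma P_cont: assumes "g \<in> P" shows "continuous_on {-1..2} g"
proof -
  obtain K where K: "\<And>s t. s \<in> {-1..2} ==> t \<in> {-1..2} ==> norm (g s - g t) <= K * \<bar>s - t\<bar>"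
    using P_lip[OF assms] by blast
  have "(\<bar>K\<bar>)-lipschitz_on {-1..2} g"
  proof (rule lipschitz_onI)
    fix s t :: real assume "s \<in> {-1..2}" "t \<in> {-1..2}"
    then have "norm (g s - g t) <= K * \<bar>s - t\<bar>" by (rule K)
    also have "\<dots> <= \<bar>K\<bar> * \<bar>s - t\<bar>" by (intro mult_right_mono) auto
    finally show "dist (g s) (g t) <= \<bar>K\<bar> * dist s t" by (simp add: dist_norm dist_real_def)
  qed simp
  then show ?thesis by (rule lipschitz_on_continuous_on)
qed

lemma P_cont01: "g \<in> P ==> continuous_on {0..1} g"
  by (rule continuous_on_subset[OF P_cont]) auto

definition X where "X = p ` {0..1}"

lemma compact_X: "compact X" and open_nX: "open (- X)"
proof -
  show "compact X" unfolding X_def by (rule compact_continuous_image[OF cont compact_Icc])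
  then show "open (- X)" by (simp add: compact_imp_closed open_Compl)
qed

text \<open>The Cauchy transform at \<open>w\<close> of the functional \<open>u * L\<close> pushed
  forward by \<open>p\<close>.\<close>

definition phi :: "((real => complex) => complex) => complex => (real => complex) => complex" where
  "phi L w u = L (%t. u t / (p t - w))"

lemma cont_div: "continuous_on {0..1} u ==> w \<notin> X ==> continuous_on {0..1} (%t. u t / (p t - w))"
  by (intro continuous_intros cont) (auto simp: X_def)

text \<open>The derivative is \<open>L (u / (p - w)\<^sup>2)\<close>: near \<open>w\<close> the
  difference quotients of the kernel converge uniformly on the interval, with an error linear in
  \<open>z - w\<close>.\<close>

lemma phi_holomorphic:
  assumes L: "cdual L" and u: "continuous_on {0..1} u"
  shows "(%w. phi L w u) holomorphic_on (- X)"
proof -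
  obtain C where C: "C > 0" "\<And>u B. continuous_on {0..1} u ==> (\<And>t. t \<in> {0..1} ==> norm (u t) <= B) ==> norm (L u) <= C * B"
    using cdual_bound[OF L] by blast
  obtain B where B: "B > 0" "\<And>t. t \<in> {0..1} ==> norm (u t) <= B"
  proof -
    have "bounded (u ` {0..1})" by (intro compact_imp_bounded compact_continuous_image u compact_Icc)
    then show ?thesis using that unfolding bounded_pos by auto
  qed
  have "\<exists>D. ((%w. phi L w u) has_field_derivative D) (at w)" if w: "w \<in> - X" for w
  proof -
    obtain d where d: "d > 0" "ball w d \<subseteq> - X" using open_nX w open_contains_ball by blast
    have far: "norm (p t - z) >= d / 2" if "t \<in> {0..1}" "norm (z - w) < d/2" for t z
    proof (rule ccontr)
      assume "\<not> norm (p t - z) >= d / 2"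
      then have "norm (p t - w) < d"
        using norm_triangle_ineq[of "p t - z" "z - w"] that(2) by simp
      then have "p t \<in> ball w d" by (simp add: dist_norm norm_minus_commute)
      then show False using d(2) that(1) by (auto simp: X_def)
    qed
    have nX: "z \<notin> X" if "norm (z - w) < d/2" for z
      using d that by (auto simp: subset_iff dist_norm norm_minus_commute)
    define D where "D = L (%t. u t / (p t - w)\<^sup>2)"
    have cD: "continuous_on {0..1} (%t. u t / (p t - w)\<^sup>2)"
      by (intro continuous_intros u cont) (use w in \<open>auto simp: X_def\<close>)
    have est: "norm ((phi L z u - phi L w u) / (z - w) - D) <= C * (8 * B / d^3 * norm (z - w))"
      if z: "norm (z - w) < d/2" "z ~= w" for z
    proof -
      have cz: "continuous_on {0..1} (%t. u t / (p t - z))" "continuous_on {0..1} (%t. u t / (p t - w))"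
        using cont_div[OF u] nX[OF z(1)] w by auto
      define v where "v = (%t. (u t / (p t - z) - u t / (p t - w)) / (z - w) - u t / (p t - w)\<^sup>2)"
      have cv: "continuous_on {0..1} v" unfolding v_def using z(2) by (intro continuous_intros cz cD) auto
      have "L v = (1/(z - w)) * (phi L z u - phi L w u) - D"
      proof -
        have c1: "continuous_on {0..1} (%t. u t / (p t - z) - u t / (p t - w))" by (intro continuous_intros cz)
        have c2: "continuous_on {0..1} (%t. (1/(z - w)) * (u t / (p t - z) - u t / (p t - w)))"
          by (intro continuous_on_mult continuous_on_const c1)
        have "v = (%t. (1/(z - w)) * (u t / (p t - z) - u t / (p t - w)) - u t / (p t - w)\<^sup>2)"
          by (simp add: v_def)
        then have "L v = L (%t. (1/(z - w)) * (u t / (p t - z) - u t / (p t - w))) - D"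
          unfolding D_def using cdual_diff[OF L c2 cD] by simp
        then show ?thesis
          using cdual_cmult[OF L c1, of "1/(z-w)"] cdual_diff[OF L cz] by (simp add: phi_def)
      qed
      moreover have "norm (L v) <= C * (8 * B / d^3 * norm (z - w))"
      proof (rule C(2)[OF cv])
        fix t :: real assume t: "t \<in> {0..1}"
        have n: "norm (p t - z) >= d/2" "norm (p t - w) >= d/2" using far[OF t] z d by auto
        then have nz: "p t - z ~= 0" "p t - w ~= 0" using d by auto
        have "v t = u t * (z - w) / ((p t - z) * (p t - w)\<^sup>2)"
          using difference_quotient_reciprocal[of "p t - z" "p t - w" "u t"] nz z(2) by (simp add: v_def)
        then have "norm (v t) = norm (u t) * norm (z - w) / (norm (p t - z) * (norm (p t - w))\<^sup>2)"
          by (simp add: norm_mult norm_divide norm_power)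
        also have "\<dots> <= B * norm (z - w) / (d/2 * (d/2)\<^sup>2)"
          using B(2)[OF t] n d B(1) by (intro frac_le mult_mono power_mono mult_pos_pos) auto
        also have "\<dots> = 8 * B / d^3 * norm (z - w)" by (simp add: power2_eq_square power3_eq_cube mult.assoc mult.commute)
        finally show "norm (v t) <= 8 * B / d^3 * norm (z - w)" .
      qed
      ultimately show ?thesis by simp
    qed
    have "((%z. (phi L z u - phi L w u) / (z - w) - D) \<longlongrightarrow> 0) (at w)"
    proof (rule Lim_null_comparison)
      show "\<forall>\<^sub>F z in at w. norm ((phi L z u - phi L w u) / (z - w) - D) <= C * (8 * B / d^3 * norm (z - w))"
        unfolding eventually_at by (intro exI[of _ "d/2"]) (use d est in \<open>auto simp: dist_norm\<close>)
      have "((%z. C * (8 * B / d^3 * norm (z - w))) \<longlongrightarrow> C * (8 * B / d^3 * norm (w - w))) (at w)"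
        by (intro tendsto_intros)
      then show "((%z. C * (8 * B / d^3 * norm (z - w))) \<longlongrightarrow> 0) (at w)" by simp
    qed
    then have "((%w. phi L w u) has_field_derivative D) (at w)"
      unfolding has_field_derivative_iff by (rule LIM_zero_cancel)
    then show ?thesis by blast
  qed
  then show ?thesis
    unfolding holomorphic_on_def field_differentiable_def by (metis has_field_derivative_at_within)
qed

definition minor :: "((real => complex) => complex) => nat => (nat => real => complex) => (nat => real => complex) => complex => complex" where
  "minor L n g h w = detf n (%i j. phi L w (%t. g i t * h j t))"

lemma minor_holomorphic:
  assumes "cdual L" "\<And>i. g i \<in> P" "\<And>i. h i \<in> P"
  shows "minor L n g h holomorphic_on (- X)"
  unfolding minor_def
  by (intro detf_holomorphic phi_holomorphic assms(1) P_cont01 P_mult assms(2,3))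

text \<open>The identity theorem on the component of the complement of the curve that contains
  \<open>S\<close>.\<close>

lemma minor_continuation:
  assumes "cdual L" "\<And>i. g i \<in> P" "\<And>i. h i \<in> P"
    and zero: "r > 0" "\<And>z. z \<in> ball w r ==> minor L n g h z = 0"
    and conn: "connected S" "S \<subseteq> - X" "w \<in> S" "v \<in> S"
  shows "minor L n g h v = 0"
proof -
  define U where "U = connected_component_set (- X) w"
  have U: "open U" "connected U" "U \<subseteq> - X" "S \<subseteq> U"
    unfolding U_def using open_nX conn
    by (simp_all add: open_connected_component connected_component_maximal connected_component_subset)
  have wU: "w \<in> U" "v \<in> U" using U conn by auto
  have hol: "minor L n g h holomorphic_on U"
    using minor_holomorphic[OF assms(1-3)] U(3) by (rule holomorphic_on_subset)
  show ?thesis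
  proof (rule analytic_continuation[OF hol U(1,2)])
    show "ball w r \<inter> U \<subseteq> U" by auto
    show "w \<in> U" by fact
    show "w islimpt (ball w r \<inter> U)"
    proof -
      have "open (ball w r \<inter> U)" using U(1) by auto
      moreover have "w \<in> ball w r \<inter> U" using zero(1) wU by auto
      ultimately show ?thesis using interior_limit_point[of w "ball w r \<inter> U"] by (simp only: interior_open)
    qed
    show "minor L n g h z = 0" if "z \<in> ball w r \<inter> U" for z using zero(2) that by auto
    show "v \<in> U" by fact
  qed
qed

end

context curve_algebra begin

lemma P_bounds:
  assumes "g \<in> P"
  obtains K where "K >= 0" "\<And>s. s \<in> {-1..2} ==> norm (g s) <= K"
    "\<And>s t. s \<in> {-1..2} ==> t \<in> {-1..2} ==> norm (g s - g t) <= K * \<bar>s - t\<bar>"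
proof -
  obtain K where K: "\<And>s t. s \<in> {-1..2} ==> t \<in> {-1..2} ==> norm (g s - g t) <= K * \<bar>s - t\<bar>"
    using P_lip[OF assms] by blast
  have "bounded (g ` {-1..2})"
    by (intro compact_imp_bounded compact_continuous_image P_cont assms compact_Icc)
  then obtain B where B: "\<And>s. s \<in> {-1..2} ==> norm (g s) <= B" unfolding bounded_iff by blast
  show ?thesis
  proof (rule that[of "\<bar>K\<bar> + \<bar>B\<bar>"])
    fix s t :: real assume s: "s \<in> {-1..2}" 
    show "norm (g s) <= \<bar>K\<bar> + \<bar>B\<bar>" using B[OF s] by linarith
    assume t: "t \<in> {-1..2}"
    have "norm (g s - g t) <= K * \<bar>s - t\<bar>" by (rule K[OF s t])
    also have "\<dots> <= (\<bar>K\<bar> + \<bar>B\<bar>) * \<bar>s - t\<bar>" by (intro mult_right_mono) auto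
    finally show "norm (g s - g t) <= (\<bar>K\<bar> + \<bar>B\<bar>) * \<bar>s - t\<bar>" .
  qed auto
qed

lemma P_frame_bounds:
  fixes g h :: "nat => real => complex"
  assumes "\<And>i. g i \<in> P" "\<And>i. h i \<in> P"
  shows "\<exists>K\<ge>1. \<forall>i<n. \<forall>s\<in>{-1..2}. norm (g i s) <= K \<and> norm (h i s) <= K \<and>
    (\<forall>t\<in>{-1..2}. norm (g i s - g i t) <= K * \<bar>s - t\<bar> \<and> norm (h i s - h i t) <= K * \<bar>s - t\<bar>)"
proof -
  define Q where "Q = (%(f :: real => complex) K. K >= 0 \<and> (\<forall>s\<in>{-1..2}. norm (f s) <= K) \<and>
    (\<forall>s\<in>{-1..2}. \<forall>t\<in>{-1..2}. norm (f s - f t) <= K * \<bar>s - t\<bar>))"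
  have ex: "\<exists>K. Q f K" if "f \<in> P" for f using P_bounds[OF that] unfolding Q_def by metis
  have "\<exists>A. \<forall>i. Q (g i) (A i)" using ex[OF assms(1)] by metis
  then obtain A where A: "\<And>i. Q (g i) (A i)" by blast
  have "\<exists>A. \<forall>i. Q (h i) (A i)" using ex[OF assms(2)] by metis
  then obtain B where B: "\<And>i. Q (h i) (B i)" by blast
  define K where "K = 1 + (\<Sum>i<n. A i + B i)"
  have nn: "A i >= 0" "B i >= 0" for i using A B by (auto simp: Q_def)
  have AK: "A i <= K" "B i <= K" if "i < n" for i
  proof -
    have "A i + B i <= (\<Sum>i<n. A i + B i)"
      by (rule member_le_sum) (use that nn in \<open>auto intro: add_nonneg_nonneg\<close>)
    then show "A i <= K" "B i <= K" using nn[of i] by (auto simp: K_def)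
  qed
  have Qm: "Q f K" if Q: "Q f a" and a: "a <= K" for f a
    unfolding Q_def
  proof (intro conjI ballI)
    show "0 <= K" using Q a by (simp add: Q_def)
    fix s :: real assume s: "s \<in> {-1..2}"
    have "norm (f s) <= a" using Q s by (simp add: Q_def)
    then show "norm (f s) <= K" using a by linarith
    fix t :: real assume t: "t \<in> {-1..2}"
    have "norm (f s - f t) <= a * \<bar>s - t\<bar>" using Q s t by (simp add: Q_def)
    also have "\<dots> <= K * \<bar>s - t\<bar>" using a by (intro mult_right_mono) auto
    finally show "norm (f s - f t) <= K * \<bar>s - t\<bar>" .
  qed
  have K1: "K >= 1" unfolding K_def using nn by (simp add: sum_nonneg)
  have "Q (g i) K" "Q (h i) K" if "i < n" for i
    using Qm[OF A AK(1)[OF that]] Qm[OF B AK(2)[OF that]] by auto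
  then show ?thesis using K1 by (intro exI[of _ K]) (auto simp: Q_def)
qed

text \<open>Crossing the curve changes the matrix of Cauchy transforms by a rank-one term, up to a remainder that
  tends to 0 in the mean. Bordering removes the rank-one term, so if all minors of order \<open>k\<close> vanish on the
  left, the minors of order \<open>k + 1\<close> have mean boundary values 0 on the right.\<close>

lemma crossing:
  assumes L: "cdual L" and T: "transversal t0 d m K0 s0" and t0: "t0 \<in> {0..1}" and c: "c > 0"
    and KB: "\<And>t a x. t \<in> {0..1} ==> a \<in> {t0-d..t0+d} ==> \<bar>x\<bar> <= d ==>
       c * sqrt ((t - a)\<^sup>2 + x\<^sup>2) <= norm (p t - p a - of_real x)"
    and left: "\<And>t x g h. t \<in> {t0-d..t0+d} ==> 0 < x ==> x <= d ==> (\<And>i. g i \<in> P) ==> (\<And>i. h i \<in> P)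
       ==> minor L k g h (p t - of_real x) = 0"
    and gh: "\<And>i. g i \<in> P" "\<And>i. h i \<in> P"
  shows "\<exists>x1 r. 0 < x1 \<and> x1 < d \<and> 0 < r \<and> (\<forall>w\<in>ball (p t0 + of_real x1) r. minor L (Suc k) g h w = 0)"
proof -
  define n where "n = Suc k"
  define T where "T = {t0-d..t0+d}"
  note TD = transversalD[OF T]
  have T12: "s \<in> {-1..2}" if "s \<in> T" for s using that TD(1,2) t0 by (auto simp: T_def)
  have t12: "t \<in> {-1..2}" if "t \<in> {0..1}" for t :: real using that by auto
  obtain K where K1: "K >= 1" and K': "\<forall>i<n. \<forall>s\<in>{-1..2}. norm (g i s) <= K \<and> norm (h i s) <= K \<and>
    (\<forall>t\<in>{-1..2}. norm (g i s - g i t) <= K * \<bar>s - t\<bar> \<and> norm (h i s - h i t) <= K * \<bar>s - t\<bar>)"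
    using P_frame_bounds[of g h n] gh by blast
  have K: "K >= 1"
    "\<And>i s. i < n ==> s \<in> {-1..2} ==> norm (g i s) <= K"
    "\<And>i s. i < n ==> s \<in> {-1..2} ==> norm (h i s) <= K"
    "\<And>i s t. i < n ==> s \<in> {-1..2} ==> t \<in> {-1..2} ==> norm (g i s - g i t) <= K * \<bar>s - t\<bar>"
    "\<And>i s t. i < n ==> s \<in> {-1..2} ==> t \<in> {-1..2} ==> norm (h i s - h i t) <= K * \<bar>s - t\<bar>"
    using K1 K' by blast+
  obtain C where C: "C > 0" "\<And>u B. continuous_on {0..1} u ==> (\<And>t. t \<in> {0..1} ==> norm (u t) <= B) ==> norm (L u) <= C * B"
    using cdual_bound[OF L] by blast
  define r where "r = (%t s x. sqrt ((t - s)\<^sup>2 + x\<^sup>2) :: real)"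
  have rp: "r t s x > 0" "r t s x >= x" "r t s x >= \<bar>t - s\<bar>" if "x > 0" for t s x
  proof -
    show "r t s x > 0" unfolding r_def using that by (simp add: add_nonneg_pos)
    show "r t s x >= x" unfolding r_def by (rule real_le_rsqrt) simp
    show "r t s x >= \<bar>t - s\<bar>" unfolding r_def by (rule real_le_rsqrt) simp
  qed
  have KBp: "c * r t s x <= norm (p t - (p s + of_real x))" and KBm: "c * r t s x <= norm (p t - (p s - of_real x))"
    if "t \<in> {0..1}" "s \<in> T" "0 < x" "x <= d" for t s x
    using KB[of t s x] KB[of t s "-x"] that unfolding T_def r_def by (auto simp: algebra_simps)
  have nz: "p t - (p s + of_real x) ~= 0" "p t - (p s - of_real x) ~= 0"
    if "t \<in> {0..1}" "s \<in> T" "0 < x" "x <= d" for t s x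
  proof -
    have "c * r t s x > 0" using c rp(1)[OF that(3)] by simp
    then have "norm (p t - (p s + of_real x)) > 0" "norm (p t - (p s - of_real x)) > 0"
      using KBp[OF that] KBm[OF that] by linarith+
    then show "p t - (p s + of_real x) ~= 0" "p t - (p s - of_real x) ~= 0" using zero_less_norm_iff by blast+
  qed
  have nX: "p s + of_real x \<notin> X" "p s - of_real x \<notin> X" if "s \<in> T" "0 < x" "x <= d" for s x
    using nz[OF _ that] unfolding X_def by force+
  \<comment> \<open>The difference of the Cauchy kernels on the two sides of the curve. By
    \<open>KBp\<close> and \<open>KBm\<close> it is of size \<open>x / r\<^sup>2\<close>.\<close>
  define kk where "kk = (%x t s. 1 / (p t - (p s + of_real x)) - 1 / (p t - (p s - of_real x)))"
  have kkb: "norm (kk x t s) <= 2 * x / (c * r t s x)\<^sup>2" if "t \<in> {0..1}" "s \<in> T" "0 < x" "x <= d" for x t s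
  proof -
    have "kk x t s = of_real (2 * x) / ((p t - (p s + of_real x)) * (p t - (p s - of_real x)))"
      unfolding kk_def using nz[OF that] by (simp add: diff_frac_eq)
    then have "norm (kk x t s) = 2 * x / (norm (p t - (p s + of_real x)) * norm (p t - (p s - of_real x)))"
      using that by (simp only: norm_divide norm_mult norm_of_real)
    also have "\<dots> <= 2 * x / ((c * r t s x) * (c * r t s x))"
    proof (rule divide_left_mono)
      have cr: "0 < c * r t s x" using c rp(1)[OF that(3)] by simp
      then show "c * r t s x * (c * r t s x) <= norm (p t - (p s + of_real x)) * norm (p t - (p s - of_real x))"
        using KBp[OF that] KBm[OF that] by (intro mult_mono) auto
      have "0 < norm (p t - (p s + of_real x))" "0 < norm (p t - (p s - of_real x))"
        using cr KBp[OF that] KBm[OF that] by linarith+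
      then show "0 < norm (p t - (p s + of_real x)) * norm (p t - (p s - of_real x)) * (c * r t s x * (c * r t s x))"
        using cr mult_pos_pos by metis
      show "0 <= 2 * x" using that by simp
    qed
    finally show ?thesis by (simp add: power2_eq_square)
  qed
  define De where "De = (%x i j s. L (%t. (g i t * h j t - g i s * h j s) * kk x t s))"
  define Rr where "Rr = (%x i j s. L (%t. (g i t - g i s) * (h j t - h j s) * kk x t s))"
  define al where "al = (%x i s. L (%t. (g i t - g i s) * kk x t s))"
  define be where "be = (%x j s. L (%t. (h j t - h j s) * kk x t s))"
  define Cp where "Cp = (%x i j s. L (%t. (g i t * h j t - g i s * h j s) / (p t - (p s + of_real x))))"
  define Cm where "Cm = (%x i j s. L (%t. (g i t * h j t - g i s * h j s) / (p t - (p s - of_real x))))"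
  define fp where "fp = (%x s. L (%t. 1 / (p t - (p s + of_real x))))"
  define fm where "fm = (%x s. L (%t. 1 / (p t - (p s - of_real x))))"
  have gc: "continuous_on {0..1} (g i)" "continuous_on {0..1} (h i)" for i using P_cont01 gh by auto
  have cp: "continuous_on {0..1} (%t. u t / (p t - (p s + of_real x)))" 
    and cm: "continuous_on {0..1} (%t. u t / (p t - (p s - of_real x)))"
    if "continuous_on {0..1} u" "s \<in> T" "0 < x" "x <= d" for u s x
    using cont_div[OF that(1)] nX[OF that(2-)] by auto
  have ckk: "continuous_on {0..1} (%t. kk x t s)" if "s \<in> T" "0 < x" "x <= d" for s x
    unfolding kk_def by (intro continuous_on_diff continuous_on_const cp cm that)
  have phip: "phi L (p s + of_real x) (%t. g i t * h j t) = Cp x i j s + fp x s * g i s * h j s"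
    if s: "s \<in> T" "0 < x" "x <= d" for s x i j
  proof -
    have "Cp x i j s + (g i s * h j s) * fp x s
        = L (%t. (g i t * h j t - g i s * h j s) / (p t - (p s + of_real x)) + (g i s * h j s) * (1 / (p t - (p s + of_real x))))"
      unfolding Cp_def fp_def
      unfolding cdual_cmult[OF L cp[OF continuous_on_const s], symmetric]
      by (rule cdual_add[OF L, symmetric]) (intro cp s continuous_on_mult continuous_on_diff continuous_on_const gc)+
    also have "\<dots> = L (%t. (g i t * h j t) / (p t - (p s + of_real x)))"
      by (rule arg_cong[where f = L]) (auto simp: diff_divide_distrib)
    finally show ?thesis unfolding phi_def by (simp add: mult.commute mult.left_commute)
  qed
  have phim: "phi L (p s - of_real x) (%t. g i t * h j t) = Cm x i j s + fm x s * g i s * h j s"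
    if s: "s \<in> T" "0 < x" "x <= d" for s x i j
  proof -
    have "Cm x i j s + (g i s * h j s) * fm x s
        = L (%t. (g i t * h j t - g i s * h j s) / (p t - (p s - of_real x)) + (g i s * h j s) * (1 / (p t - (p s - of_real x))))"
      unfolding Cm_def fm_def
      unfolding cdual_cmult[OF L cm[OF continuous_on_const s], symmetric]
      by (rule cdual_add[OF L, symmetric]) (intro cm s continuous_on_mult continuous_on_diff continuous_on_const gc)+
    also have "\<dots> = L (%t. (g i t * h j t) / (p t - (p s - of_real x)))"
      by (rule arg_cong[where f = L]) (auto simp: diff_divide_distrib)
    finally show ?thesis unfolding phi_def by (simp add: mult.commute mult.left_commute)
  qed
  have CpCm: "Cp x i j s - Cm x i j s = De x i j s" if s: "s \<in> T" "0 < x" "x <= d" for s x i j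
  proof -
    have "Cp x i j s - Cm x i j s = L (%t. (g i t * h j t - g i s * h j s) / (p t - (p s + of_real x))
        - (g i t * h j t - g i s * h j s) / (p t - (p s - of_real x)))"
      unfolding Cp_def Cm_def
      by (rule cdual_diff[OF L, symmetric]) (intro cp cm s continuous_on_mult continuous_on_diff continuous_on_const gc)+
    then show ?thesis unfolding De_def kk_def by (simp add: right_diff_distrib)
  qed
  have Desplit: "De x i j s = Rr x i j s + g i s * be x j s + al x i s * h j s"
    if s: "s \<in> T" "0 < x" "x <= d" for s x i j
  proof -
    have "Rr x i j s + g i s * be x j s + h j s * al x i s
       = L (%t. (g i t - g i s) * (h j t - h j s) * kk x t s + g i s * ((h j t - h j s) * kk x t s)
          + h j s * ((g i t - g i s) * kk x t s))"
      unfolding Rr_def be_def al_def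
      by (simp only: cdual_add[OF L] cdual_cmult[OF L] continuous_on_add continuous_on_mult continuous_on_diff continuous_on_const gc ckk[OF s])
    also have "\<dots> = De x i j s" unfolding De_def by (rule arg_cong[where f = L]) (auto simp: algebra_simps)
    finally show ?thesis by (simp add: mult.commute)
  qed
  have ghlip: "norm (g i t * h j t - g i s * h j s) <= 2 * K\<^sup>2 * \<bar>t - s\<bar>"
    if "i < n" "j < n" "t \<in> {0..1}" "s \<in> T" for i j t s
  proof -
    have eq: "g i t * h j t - g i s * h j s = (g i t - g i s) * h j t + g i s * (h j t - h j s)" by (simp add: algebra_simps)
    have "norm (g i t * h j t - g i s * h j s) <= (K * \<bar>t - s\<bar>) * K + K * (K * \<bar>t - s\<bar>)"
      unfolding eq
    proof (intro norm_triangle_mono)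
      have K0: "0 <= K" using K(1) by simp
      show "norm ((g i t - g i s) * h j t) <= (K * \<bar>t - s\<bar>) * K"
        unfolding norm_mult using K(4)[OF that(1) t12[OF that(3)] T12[OF that(4)]] K(3)[OF that(2) t12[OF that(3)]] K0
        by (intro mult_mono) auto
      show "norm (g i s * (h j t - h j s)) <= K * (K * \<bar>t - s\<bar>)"
        unfolding norm_mult using K(5)[OF that(2) t12[OF that(3)] T12[OF that(4)]] K(2)[OF that(1) T12[OF that(4)]] K0
        by (intro mult_mono) auto
    qed
    then show ?thesis by (simp add: power2_eq_square algebra_simps)
  qed
  \<comment> \<open>The numerator is \<open>O (\<bar>t - s\<bar>)\<close> and cancels the simple
    pole, so the subtracted transforms stay bounded up to the curve.\<close>
  have Cb: "norm (Cp x i j s) <= C * (2 * K\<^sup>2 / c)" "norm (Cm x i j s) <= C * (2 * K\<^sup>2 / c)"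
    if ij: "i < n" "j < n" and s: "s \<in> T" "0 < x" "x <= d" for x i j s
  proof -
    have est: "norm ((g i t * h j t - g i s * h j s) / z) <= 2 * K\<^sup>2 / c"
      if t: "t \<in> {0..1}" and z: "c * r t s x <= norm z" for t z
    proof -
      have "norm (g i t * h j t - g i s * h j s) <= 2 * K\<^sup>2 * r t s x"
        using ghlip[OF ij t s(1)] rp(3)[OF s(2), of t s] mult_left_mono[of "\<bar>t - s\<bar>" "r t s x" "2 * K\<^sup>2"] by simp
      then have "norm (g i t * h j t - g i s * h j s) / norm z <= (2 * K\<^sup>2 * r t s x) / (c * r t s x)"
        using z c rp(1)[OF s(2), of t s] by (intro frac_le) auto
      also have "\<dots> = 2 * K\<^sup>2 / c" using rp(1)[OF s(2), of t s] by simp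
      finally show ?thesis by (simp add: norm_divide)
    qed
    show "norm (Cp x i j s) <= C * (2 * K\<^sup>2 / c)"
      unfolding Cp_def by (rule C(2)) (intro cp s continuous_on_mult continuous_on_diff continuous_on_const gc, rule est, assumption, intro KBp s)
    show "norm (Cm x i j s) <= C * (2 * K\<^sup>2 / c)"
      unfolding Cm_def by (rule C(2)) (intro cm s continuous_on_mult continuous_on_diff continuous_on_const gc, rule est, assumption, intro KBm s)
  qed
  \<comment> \<open>Two first-order zeros cancel \<open>r\<^sup>2\<close> in the jump kernel, so the
    factor \<open>x\<close> survives pointwise. It has to compensate the unbounded \<open>fp\<close>
    later.\<close>
  have Rb: "norm (Rr x i j s) <= C * (2 * K\<^sup>2 / c\<^sup>2 * x)"
    if ij: "i < n" "j < n" and s: "s \<in> T" "0 < x" "x <= d" for x i j s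
    unfolding Rr_def
  proof (rule C(2))
    show "continuous_on {0..1} (%t. (g i t - g i s) * (h j t - h j s) * kk x t s)"
      by (intro continuous_on_mult continuous_on_diff continuous_on_const gc ckk s)
    fix t :: real assume t: "t \<in> {0..1}"
    have "norm ((g i t - g i s) * (h j t - h j s) * kk x t s) <= ((K * r t s x) * (K * r t s x)) * (2 * x / (c * r t s x)\<^sup>2)"
      unfolding norm_mult
    proof (intro mult_mono kkb t s mult_nonneg_nonneg norm_ge_zero)
      have "K * \<bar>t - s\<bar> <= K * r t s x" using rp(3)[OF s(2)] K(1) by (intro mult_left_mono) auto
      then show "norm (g i t - g i s) <= K * r t s x" "norm (h j t - h j s) <= K * r t s x"
        using K(4)[OF ij(1) t12[OF t] T12[OF s(1)]] K(5)[OF ij(2) t12[OF t] T12[OF s(1)]] by linarith+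
      show "0 <= K" "0 <= r t s x" using K(1) rp(1)[OF s(2), of t s] by auto
      then show "0 <= K" "0 <= r t s x" "0 <= K" "0 <= r t s x" by auto
    qed
    also have "\<dots> = 2 * K\<^sup>2 / c\<^sup>2 * x" using rp(1)[OF s(2), of t s] by (simp add: power2_eq_square)
    finally show "norm ((g i t - g i s) * (h j t - h j s) * kk x t s) <= 2 * K\<^sup>2 / c\<^sup>2 * x" .
  qed
  \<comment> \<open>Only one zero is available here, so the bound \<open>x / r\<close> is small
    merely in the mean.\<close>
  have Dker: "norm ((g i t * h j t - g i s * h j s) * kk x t s) <= 4 * K\<^sup>2 / c\<^sup>2 * (x / r t s x)"
    if ij: "i < n" "j < n" and t: "t \<in> {0..1}" and s: "s \<in> T" "0 < x" "x <= d" for x i j t s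
  proof -
    have "norm ((g i t * h j t - g i s * h j s) * kk x t s) <= (2 * K\<^sup>2 * r t s x) * (2 * x / (c * r t s x)\<^sup>2)"
      unfolding norm_mult
    proof (intro mult_mono kkb t s norm_ge_zero)
      show "norm (g i t * h j t - g i s * h j s) <= 2 * K\<^sup>2 * r t s x"
        using ghlip[OF ij t s(1)] rp(3)[OF s(2), of t s] mult_left_mono[of "\<bar>t - s\<bar>" "r t s x" "2 * K\<^sup>2"] by simp
      show "0 <= 2 * K\<^sup>2 * r t s x" using rp(1)[OF s(2), of t s] by simp
    qed
    also have "\<dots> = 4 * K\<^sup>2 / c\<^sup>2 * (x / r t s x)" using rp(1)[OF s(2), of t s] by (simp add: power2_eq_square)
    finally show ?thesis .
  qed
  have fker: "norm (of_real x * (1 / (p t - (p s + of_real x)))) <= 1 / c * (x / r t s x)"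
    if t: "t \<in> {0..1}" and s: "s \<in> T" "0 < x" "x <= d" for x t s
  proof -
    have "norm (of_real x * (1 / (p t - (p s + of_real x)))) = x / norm (p t - (p s + of_real x))"
      using s by (simp add: norm_mult norm_divide)
    also have "\<dots> <= x / (c * r t s x)"
    proof (rule divide_left_mono)
      have cr: "0 < c * r t s x" using c rp(1)[OF s(2)] by simp
      show "c * r t s x <= norm (p t - (p s + of_real x))" by (rule KBp[OF t s])
      then have "0 < norm (p t - (p s + of_real x))" using cr by linarith
      then show "0 < norm (p t - (p s + of_real x)) * (c * r t s x)" using cr mult_pos_pos by metis
      show "0 <= x" using s by simp
    qed
    finally show ?thesis by simp
  qed
  \<comment> \<open>A common bound for all entries of the plain and the bordered matrices, as
    \<open>detf_lipschitz\<close> requires.\<close>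
  define B where "B = K + C * (2 * K\<^sup>2 / c) + C * (2 * K\<^sup>2 / c\<^sup>2 * d)"
  have Bge: "B >= 1" "K <= B" "C * (2 * K\<^sup>2 / c) <= B"
    "C * (2 * K\<^sup>2 / c) + C * (2 * K\<^sup>2 / c\<^sup>2 * d) <= B"
  proof -
    have "0 <= C * (2 * K\<^sup>2 / c)" "0 <= C * (2 * K\<^sup>2 / c\<^sup>2 * d)"
      using C(1) c TD(1) by (auto intro!: mult_nonneg_nonneg divide_nonneg_nonneg)
    then show "B >= 1" "K <= B" "C * (2 * K\<^sup>2 / c) <= B"
      "C * (2 * K\<^sup>2 / c) + C * (2 * K\<^sup>2 / c\<^sup>2 * d) <= B"
      using K(1) unfolding B_def by linarith+
  qed
  define F1 where "F1 = fact n * B ^ n"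
  define F3 where "F3 = fact (Suc n) * B ^ Suc n * (real n * (real n * (C * (2 * K\<^sup>2 / c\<^sup>2))))"
  have F: "F1 >= 0" "F3 >= 0" using Bge(1) C(1) c by (auto simp: F1_def F3_def)
  have main: "norm (minor L n g h (p s + of_real x)) <= F1 * (\<Sum>i<n. \<Sum>j<n. norm (De x i j s)) + F3 * norm (of_real x * fp x s)"
    if s: "s \<in> T" "0 < x" "x <= d" for s x
  proof -
    let ?e = "%i. g i s" and ?f = "%j. h j s"
    let ?Cp = "%i j. Cp x i j s" and ?Cm = "%i j. Cm x i j s" and ?R = "%i j. Rr x i j s"
    let ?bd = "%Y. detf (Suc n) (bordered n Y ?e ?f 0)"
    have 1: "minor L n g h (p s + of_real x) = detf n ?Cp - fp x s * ?bd ?Cp"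
      unfolding minor_def phip[OF s] by (rule detf_rank_one_update)
    have 2: "?bd ?Cp = ?bd (%i j. ?Cm i j + ?R i j)"
    proof -
      have "Cp x i j s = (?Cm i j + ?R i j) + ?e i * be x j s + al x i s * ?f j" for i j
        using CpCm[OF s, of i j] Desplit[OF s, of i j] by (simp add: diff_eq_eq add.assoc add.commute add.left_commute)
      then have "?Cp = (%i j. (?Cm i j + ?R i j) + ?e i * be x j s + al x i s * ?f j)" by presburger
      then show ?thesis by (simp only: detf_bordered_invariant)
    qed
    \<comment> \<open>Deleting a row and a column only renumbers the families \<open>g\<close> and
      \<open>h\<close>, so the hypothesis on the left side must hold for all families.\<close>
    have m0: "detf k (dele a b (%i j. phi L (p s - of_real x) (%t. g i t * h j t))) = 0" for a b
      using left[of s x "%i. g (if i < a then i else Suc i)" "%j. h (if j < b then j else Suc j)"] s gh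
      unfolding minor_def dele_def T_def by simp
    have 3: "?bd ?Cm = 0"
    proof -
      have "(%i j. phi L (p s - of_real x) (%t. g i t * h j t)) = (%i j. ?Cm i j + ?e i * (fm x s * ?f j) + 0 * ?f j)"
        unfolding phim[OF s] by (simp add: mult.commute mult.left_commute)
      then have "?bd (%i j. phi L (p s - of_real x) (%t. g i t * h j t)) = ?bd ?Cm"
        using detf_bordered_invariant[of n ?Cm ?e "%j. fm x s * ?f j" "%_. 0" ?f] by simp
      moreover have "?bd (%i j. phi L (p s - of_real x) (%t. g i t * h j t)) = 0"
        by (rule detf_bordered_minors_zero) (use m0 in \<open>simp add: n_def\<close>)
      ultimately show ?thesis by simp
    qed
    have 4: "detf n ?Cm = 0"
    proof -
      have "detf n (%i j. phi L (p s - of_real x) (%t. g i t * h j t)) = detf n ?Cm - fm x s * ?bd ?Cm"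
        unfolding phim[OF s] by (rule detf_rank_one_update)
      moreover have "detf n (%i j. phi L (p s - of_real x) (%t. g i t * h j t)) = 0"
        unfolding n_def by (subst detf_row[of 0]) (auto simp: m0)
      ultimately show ?thesis using 3 by simp
    qed
    have 5: "norm (detf n ?Cp - detf n ?Cm) <= F1 * (\<Sum>i<n. \<Sum>j<n. norm (De x i j s))"
    proof -
      have "norm (detf n ?Cp - detf n ?Cm) <= fact n * B ^ n * (\<Sum>i<n. \<Sum>j<n. norm (?Cp i j - ?Cm i j))"
        by (rule detf_lipschitz[OF Bge(1)]) (rule order_trans[OF Cb(1)[OF _ _ s] Bge(3)] order_trans[OF Cb(2)[OF _ _ s] Bge(3)], assumption+)+
      then show ?thesis by (simp add: CpCm[OF s] F1_def)
    qed
    have 6: "norm (?bd (%i j. ?Cm i j + ?R i j) - ?bd ?Cm) <= F3 * x"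
    proof -
      have Rd: "norm (?R i j) <= C * (2 * K\<^sup>2 / c\<^sup>2 * d)" if "i < n" "j < n" for i j
      proof -
        have "C * (2 * K\<^sup>2 / c\<^sup>2 * x) <= C * (2 * K\<^sup>2 / c\<^sup>2 * d)"
          using s(3) C(1) by (intro mult_left_mono) auto
        then show ?thesis using Rb[OF that s] by linarith
      qed
      have eB: "norm (?e i) <= B" and fB: "norm (?f i) <= B" if "i < n" for i
        using order_trans[OF K(2)[OF that T12[OF s(1)]] Bge(2)] order_trans[OF K(3)[OF that T12[OF s(1)]] Bge(2)] by auto
      have b1: "norm (bordered n (%i j. ?Cm i j + ?R i j) ?e ?f 0 i j) <= B" for i j
      proof -
        have "norm (?Cm i j + ?R i j) <= B" if "i < n" "j < n"
          using norm_triangle_ineq[of "?Cm i j" "?R i j"] Cb(2)[OF that s] Rd[OF that] Bge(4) by linarith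
        then show ?thesis using eB[of i] fB[of j] Bge(1) by (simp add: bordered_def)
      qed
      have b2: "norm (bordered n ?Cm ?e ?f 0 i j) <= B" for i j
        using eB[of i] fB[of j] Bge(1) order_trans[OF Cb(2)[OF _ _ s] Bge(3), of i j] by (simp add: bordered_def)
      have lip: "norm (?bd (%i j. ?Cm i j + ?R i j) - ?bd ?Cm) <= fact (Suc n) * B ^ Suc n *
          (\<Sum>i<Suc n. \<Sum>j<Suc n. norm (bordered n (%i j. ?Cm i j + ?R i j) ?e ?f 0 i j - bordered n ?Cm ?e ?f 0 i j))"
        by (rule detf_lipschitz[OF Bge(1)]) (rule b1, rule b2)
      have "(\<Sum>i<Suc n. \<Sum>j<Suc n. norm (bordered n (%i j. ?Cm i j + ?R i j) ?e ?f 0 i j - bordered n ?Cm ?e ?f 0 i j))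
          = (\<Sum>i<n. \<Sum>j<n. norm (?R i j))"
      proof -
        have "bordered n (%i j. ?Cm i j + ?R i j) ?e ?f 0 i j - bordered n ?Cm ?e ?f 0 i j = (if i < n \<and> j < n then ?R i j else 0)" for i j
          by (simp add: bordered_def)
        then show ?thesis by (simp add: sum.lessThan_Suc)
      qed
      also have "\<dots> <= (\<Sum>i<n. \<Sum>j<n. C * (2 * K\<^sup>2 / c\<^sup>2 * x))"
        by (intro sum_mono Rb s) auto
      also have "\<dots> = (real n * (real n * (C * (2 * K\<^sup>2 / c\<^sup>2)))) * x" by simp
      finally have "norm (?bd (%i j. ?Cm i j + ?R i j) - ?bd ?Cm)
          <= fact (Suc n) * B ^ Suc n * ((real n * (real n * (C * (2 * K\<^sup>2 / c\<^sup>2)))) * x)"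
        by (rule order_trans[OF lip mult_left_mono]) (use Bge(1) in simp)
      then show ?thesis by (simp only: F3_def mult.assoc)
    qed
    \<comment> \<open>All terms of the right-hand minor are now differences from quantities that
      vanish on the left. The first is controlled by \<open>De\<close>, the second by
      \<open>fp\<close> times a factor \<open>x\<close>; both tend to 0 in the mean.\<close>
    have eq: "minor L n g h (p s + of_real x) = (detf n ?Cp - detf n ?Cm) - fp x s * (?bd (%i j. ?Cm i j + ?R i j) - ?bd ?Cm)"
      unfolding 1 2 3 4 by simp
    have "norm (minor L n g h (p s + of_real x)) <= norm (detf n ?Cp - detf n ?Cm) + norm (fp x s) * norm (?bd (%i j. ?Cm i j + ?R i j) - ?bd ?Cm)"
      unfolding eq by (rule order_trans[OF norm_triangle_ineq4]) (simp add: norm_mult)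
    also have "\<dots> <= F1 * (\<Sum>i<n. \<Sum>j<n. norm (De x i j s)) + norm (fp x s) * (F3 * x)"
      using 5 6 by (intro add_mono mult_left_mono) auto
    also have "\<dots> = F1 * (\<Sum>i<n. \<Sum>j<n. norm (De x i j s)) + F3 * norm (of_real x * fp x s)"
      using s by (simp add: norm_mult)
    finally show ?thesis .
  qed
  have pc: "continuous_on (({0..1}::real set) \<times> T) (%z. p (fst z))" "continuous_on (({0..1}::real set) \<times> T) (%z. p (snd z))"
    by (rule continuous_on_compose2[OF cont[of UNIV]]; auto intro!: continuous_intros)+
  have gcc: "continuous_on (({0..1}::real set) \<times> T) (%z. g i (fst z))" "continuous_on (({0..1}::real set) \<times> T) (%z. g i (snd z))"
     "continuous_on (({0..1}::real set) \<times> T) (%z. h i (fst z))" "continuous_on (({0..1}::real set) \<times> T) (%z. h i (snd z))" for i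
    by (rule continuous_on_compose2[OF P_cont]; use gh T12 t12 in \<open>force intro!: continuous_intros\<close>)+
  have kkc: "continuous_on ({0..1} \<times> T) (%(t,s). (g i t * h j t - g i s * h j s) * kk x t s)" if x: "0 < x" "x <= d" for i j x
    unfolding kk_def case_prod_beta
    by (intro continuous_intros pc gcc) (use nz x in auto)
  have fc: "continuous_on ({0..1} \<times> T) (%(t,s). of_real x * (1 / (p t - (p s + of_real x))))" if x: "0 < x" "x <= d" for x
    unfolding case_prod_beta
    by (intro continuous_intros pc) (use nz x in auto)
  have Tab: "t0 - d <= t0 + d" "-1 <= t0 - d" "t0 + d <= 2" using TD(1,2) t0 by auto
  have De_int: "integral T (%s. norm (De x i j s)) <= C * (4 * K\<^sup>2 / c\<^sup>2 * (2 * x * arsinh (2 / x)))"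
    "continuous_on T (De x i j)" if ij: "i < n" "j < n" and x: "0 < x" "x <= d" for x i j
  proof -
    show "integral T (%s. norm (De x i j s)) <= C * (4 * K\<^sup>2 / c\<^sup>2 * (2 * x * arsinh (2 / x)))"
      unfolding De_def T_def
      by (rule cdual_kernel_L1[OF L kkc[OF x, unfolded T_def] Tab C x(1)])
        (use c Dker[OF ij _ _ x, unfolded T_def r_def] in auto)
    show "continuous_on T (De x i j)"
      unfolding De_def T_def by (rule cdual_integral(1)[OF L kkc[OF x, unfolded T_def]])
  qed
  have fpm: "of_real x * fp x s = L (%t. of_real x * (1 / (p t - (p s + of_real x))))" if s: "s \<in> T" "0 < x" "x <= d" for x s
    unfolding fp_def using cdual_cmult[OF L cp[OF continuous_on_const s], of "of_real x" 1] by simp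
  have fp_int: "integral T (%s. norm (of_real x * fp x s)) <= C * (1 / c * (2 * x * arsinh (2 / x)))"
    "continuous_on T (%s. of_real x * fp x s)" if x: "0 < x" "x <= d" for x
  proof -
    have "integral T (%s. norm (of_real x * fp x s)) = integral T (%s. norm (L (%t. of_real x * (1 / (p t - (p s + of_real x))))))"
      by (rule integral_cong) (simp only: fpm[OF _ x])
    also have "\<dots> <= C * (1 / c * (2 * x * arsinh (2 / x)))"
      unfolding T_def
      by (rule cdual_kernel_L1[OF L fc[OF x, unfolded T_def] Tab C x(1)])
        (use c fker[OF _ _ x, unfolded T_def r_def] in auto)
    finally show "integral T (%s. norm (of_real x * fp x s)) <= C * (1 / c * (2 * x * arsinh (2 / x)))" .
    have "continuous_on T (%s. L (%t. of_real x * (1 / (p t - (p s + of_real x)))))"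
      unfolding T_def by (rule cdual_integral(1)[OF L fc[OF x, unfolded T_def]])
    then show "continuous_on T (%s. of_real x * fp x s)" by (rule continuous_on_eq) (simp only: fpm[OF _ x])
  qed
  define Z where "Z = F1 * (real n * (real n * (C * (4 * K\<^sup>2 / c\<^sup>2)))) + F3 * (C * (1 / c))"
  have mc: "continuous_on T (%s. minor L n g h (p s + of_real x))" if x: "0 < x" "x <= d" for x
    by (rule continuous_on_compose2[OF holomorphic_on_imp_continuous_on[OF minor_holomorphic[OF L gh]]])
      (use nX x in \<open>auto intro!: continuous_intros cont\<close>)
  have Jle: "integral T (%s. norm (minor L n g h (p s + of_real x))) <= Z * (2 * x * arsinh (2 / x))" if x: "0 < x" "x <= d" for x
  proof -
    have ci: "(%s. norm (De x i j s)) integrable_on T" if "i < n" "j < n" for i j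
      unfolding T_def using De_int(2)[OF that x] by (intro integrable_continuous_real continuous_intros) (simp add: T_def)
    have cf: "(%s. norm (of_real x * fp x s)) integrable_on T"
      unfolding T_def using fp_int(2)[OF x] by (intro integrable_continuous_real continuous_on_norm) (simp add: T_def)
    have cs: "(%s. \<Sum>i<n. \<Sum>j<n. norm (De x i j s)) integrable_on T"
      by (intro integrable_sum finite_lessThan ci) auto
    have "integral T (%s. norm (minor L n g h (p s + of_real x)))
        <= integral T (%s. F1 * (\<Sum>i<n. \<Sum>j<n. norm (De x i j s)) + F3 * norm (of_real x * fp x s))"
    proof (rule integral_le)
      show "(%s. norm (minor L n g h (p s + of_real x))) integrable_on T"
        unfolding T_def using mc[OF x] by (intro integrable_continuous_real continuous_on_norm) (simp add: T_def)
      show "(%s. F1 * (\<Sum>i<n. \<Sum>j<n. norm (De x i j s)) + F3 * norm (of_real x * fp x s)) integrable_on T"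
        by (intro integrable_add integrable_on_mult_right cs cf)
    qed (rule main[OF _ x])
    also have "\<dots> = F1 * (\<Sum>i<n. \<Sum>j<n. integral T (%s. norm (De x i j s))) + F3 * integral T (%s. norm (of_real x * fp x s))"
    proof -
      have "integral T (%s. \<Sum>i<n. \<Sum>j<n. norm (De x i j s)) = (\<Sum>i<n. \<Sum>j<n. integral T (%s. norm (De x i j s)))"
        using ci by (subst integral_sum) (auto intro!: integrable_sum sum.cong integral_sum)
      then show ?thesis
        by (subst integral_add) (auto intro!: integrable_on_mult_right cs cf)
    qed
    also have "\<dots> <= F1 * (\<Sum>i<n. \<Sum>j<n. C * (4 * K\<^sup>2 / c\<^sup>2 * (2 * x * arsinh (2 / x)))) + F3 * (C * (1 / c * (2 * x * arsinh (2 / x))))"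
      by (intro add_mono mult_left_mono sum_mono De_int(1) fp_int(1) x F) auto
    also have "\<dots> = Z * (2 * x * arsinh (2 / x))" by (simp add: Z_def algebra_simps)
    finally show ?thesis .
  qed
  show ?thesis
    unfolding n_def[symmetric]
  proof (rule boundary_uniqueness[OF T TD(1) minor_holomorphic[OF L gh] open_nX])
    show "p t + of_real x \<in> - X" if "t \<in> {t0-d..t0+d}" "0 < x" "x <= d" for t x
      using nX(1)[of t x] that by (simp add: T_def)
    show "norm (minor L n g h (p t + of_real x)) <= F1 * (real n * (real n * (2 * (C * (2 * K\<^sup>2 / c))))) + F3 * (C * (1 / c))"
      if t: "t \<in> {t0-d..t0+d}" and x: "0 < x" "x <= d" for t x
    proof -
      have tT: "t \<in> T" using t by (simp add: T_def)
      have "norm (De x i j t) <= 2 * (C * (2 * K\<^sup>2 / c))" if "i < n" "j < n" for i j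
        using norm_triangle_ineq4[of "Cp x i j t" "Cm x i j t"] Cb[OF that tT x] unfolding CpCm[OF tT x] by linarith
      then have "(\<Sum>i<n. \<Sum>j<n. norm (De x i j t)) <= (\<Sum>i<n. \<Sum>j<n. 2 * (C * (2 * K\<^sup>2 / c)))"
        by (intro sum_mono) auto
      moreover have "norm (of_real x * fp x t) <= C * (1 / c)"
        unfolding fpm[OF tT x]
      proof (rule C(2))
        show "continuous_on {0..1} (%ta. of_real x * (1 / (p ta - (p t + of_real x))))"
          by (intro continuous_on_mult continuous_on_const cp tT x)
        fix u :: real assume u: "u \<in> {0..1}"
        have "x / r u t x <= 1" using rp[OF x(1), of u t] by simp
        then have "1 / c * (x / r u t x) <= 1 / c * 1" using c by (intro mult_left_mono) auto
        then show "norm (of_real x * (1 / (p u - (p t + of_real x)))) <= 1 / c" using fker[OF u tT x] by linarith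
      qed
      ultimately have "F1 * (\<Sum>i<n. \<Sum>j<n. norm (De x i j t)) + F3 * norm (of_real x * fp x t)
          <= F1 * (\<Sum>i<n. \<Sum>j<n. 2 * (C * (2 * K\<^sup>2 / c))) + F3 * (C * (1 / c))"
        using F by (intro add_mono mult_left_mono) auto
      then show ?thesis using main[OF tT x] by simp
    qed
    show "((%x. integral {t0-d..t0+d} (%t. norm (minor L n g h (p t + of_real x)))) \<longlongrightarrow> 0) (at_right 0)"
    proof (rule tendsto_sandwich[of "%_. 0" _ _ "%x. Z * (2 * x * arsinh (2 / x))"])
      have ev: "\<forall>\<^sub>F x in at_right (0::real). 0 < x \<and> x <= d"
        using TD(1) eventually_at_right_less[of 0] eventually_at_right_real[of 0 d] by (auto elim: eventually_mono)
      then show "\<forall>\<^sub>F x in at_right 0. integral {t0-d..t0+d} (%t. norm (minor L n g h (p t + of_real x))) <= Z * (2 * x * arsinh (2 / x))"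
        by (rule eventually_mono) (use Jle in \<open>auto simp: T_def\<close>)
      show "\<forall>\<^sub>F x in at_right 0. 0 <= integral {t0-d..t0+d} (%t. norm (minor L n g h (p t + of_real x)))"
        using ev
      proof eventually_elim
        case (elim x)
        have "(%t. norm (minor L n g h (p t + of_real x))) integrable_on {t0-d..t0+d}"
          using mc[of x] elim by (intro integrable_continuous_real continuous_on_norm) (simp add: T_def)
        then show ?case by (rule integral_nonneg) simp
      qed
      show "((%x. Z * (2 * x * arsinh (2 / x))) \<longlongrightarrow> 0) (at_right 0)" by (rule arsinh_limit) simp
    qed simp
  qed
qed

end

subsection \<open>The rank bound\<close>

context C1_curve begin

lemma Im_p_continuous: "continuous_on S (%t. Im (p t))" and Im_p'_continuous: "continuous_on S (%t. Im (p' t))"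
  by (intro continuous_intros cont continuous_on_subset[OF cont'] subset_UNIV)+

text \<open>Sard's theorem in dimension one. On a piece of length \<open>1 / n\<close> containing a
  critical point the derivative of \<open>Im p\<close> is at most \<open>e / 2\<close>, so the image
  lies in an interval of length \<open>e / n\<close>, and there are \<open>n\<close> pieces.\<close>

lemma critical_values_negligible: "negligible ((%t. Im (p t)) ` {t\<in>{0..1}. Im (p' t) = 0})"
  (is "negligible (?f ` ?Z)")
  unfolding negligible_outer_le
proof (intro allI impI)
  fix e :: real assume e: "e > 0"
  have "uniformly_continuous_on {0..1} (%t. Im (p' t))"
    by (intro compact_uniformly_continuous Im_p'_continuous compact_Icc)
  then obtain d where d: "d > 0" "\<And>s t. s \<in> {0..1} ==> t \<in> {0..1} ==> dist t s < d ==> dist (Im (p' t)) (Im (p' s)) < e / 2"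
    using e unfolding uniformly_continuous_on_def by (metis half_gt_zero)
  obtain n where n: "n > 0" "1 / real n < d"
    using d(1) by (metis nat_approx_posE of_nat_0_less_iff zero_less_Suc)
  define I where "I = (%k. {real k / n .. (real k + 1) / n})"
  \<comment> \<open>For a piece without critical points the choice is arbitrary; its interval only
    enlarges the cover.\<close>
  define Y where "Y = (%k. SOME t. t \<in> I k \<and> t \<in> ?Z)"
  define T where "T = (\<Union>k<n. cball (?f (Y k)) (e / (2 * n)))"
  have "?f ` ?Z \<subseteq> T"
  proof
    fix y assume "y \<in> ?f ` ?Z"
    then obtain t where t: "t \<in> ?Z" "y = ?f t" by auto
    \<comment> \<open>The floor would assign the right end \<open>t = 1\<close> to a piece numbered
      \<open>n\<close>, which does not exist.\<close>
    define k where "k = (if t = 1 then n - 1 else nat \<lfloor>t * n\<rfloor>)"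
    have k: "k < n" "t \<in> I k"
    proof -
      have t01: "0 <= t" "t <= 1" using t by auto
      have "k < n \<and> real k <= t * n \<and> t * n <= real k + 1"
      proof (cases "t = 1")
        case True
        then show ?thesis using n(1) by (simp add: k_def of_nat_diff)
      next
        case False
        then have "t * n < n" using t01 n(1) by simp
        moreover have rk: "real k = of_int \<lfloor>t * n\<rfloor>" using t01 False by (simp add: k_def)
        moreover have "of_int \<lfloor>t * n\<rfloor> <= t * n" "t * n <= of_int \<lfloor>t * n\<rfloor> + 1" by linarith+
        ultimately have "real k < real n" "real k <= t * n" "t * n <= real k + 1" by linarith+
        then show ?thesis by simp
      qed
      then show "k < n" "t \<in> I k" using n(1) by (auto simp: I_def field_simps)
    qed
    have "Y k \<in> I k \<and> Y k \<in> ?Z" unfolding Y_def by (rule someI[of _ t]) (use k t in auto)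
    then have Yk: "Y k \<in> I k" "Y k \<in> {0..1}" "Im (p' (Y k)) = 0" by auto
    have Ik: "I k \<subseteq> {0..1}"
    proof
      fix s assume s: "s \<in> I k"
      have "(real k + 1) / n <= 1" using k(1) n(1) by (simp add: field_simps)
      then show "s \<in> {0..1}" using s unfolding I_def by (auto intro: order_trans[of 0 "real k / n"])
    qed
    have len: "\<bar>s - u\<bar> <= 1 / n" if "s \<in> I k" "u \<in> I k" for s u
      using that by (auto simp: I_def abs_le_iff add_divide_distrib)
    have "norm (?f t - ?f (Y k)) <= e / 2 * norm (t - Y k)"
    proof (rule field_differentiable_bound[of "I k" ?f "%t. Im (p' t)"])
      show "convex (I k)" by (simp add: I_def)
      fix s assume s: "s \<in> I k"
      have "((%t. Im (p t)) has_vector_derivative Im (p' s)) (at s)"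
        by (rule bounded_linear.has_vector_derivative[OF bounded_linear_Im der])
      then show "((%t. Im (p t)) has_field_derivative Im (p' s)) (at s within I k)"
        unfolding has_real_derivative_iff_has_vector_derivative[symmetric] by (rule has_field_derivative_at_within)
      have "dist (Im (p' s)) (Im (p' (Y k))) < e/2"
        using d(2)[of "Y k" s] Yk s Ik len[OF s Yk(1)] n(2) by (auto simp: dist_real_def)
      then show "norm (Im (p' s)) <= e / 2" using Yk(3) by (simp add: dist_real_def)
    qed (use k Yk in auto)
    also have "\<dots> <= e / 2 * (1 / n)" using len[OF k(2) Yk(1)] e by (intro mult_left_mono) auto
    finally have "y \<in> cball (?f (Y k)) (e / (2 * n))" using t(2) by (simp add: dist_real_def abs_minus_commute)
    then show "y \<in> T" using k(1) unfolding T_def by blast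
  qed
  moreover have "T \<in> lmeasurable" unfolding T_def by (intro fmeasurable.finite_UN) auto
  moreover have "measure lebesgue T <= e"
  proof -
    have "measure lebesgue T <= (\<Sum>k<n. measure lebesgue (cball (?f (Y k)) (e / (2 * n))))"
      unfolding T_def by (rule measure_UNION_le) auto
    also have "\<dots> = (\<Sum>k<n. e / n)"
      using e n(1) by (intro sum.cong) (auto simp: cball_eq_atLeastAtMost)
    also have "\<dots> = e" using n(1) by simp
    finally show ?thesis .
  qed
  ultimately show "\<exists>T. ?f ` ?Z \<subseteq> T \<and> T \<in> lmeasurable \<and> measure lebesgue T <= e" by blast
qed

text \<open>An accumulation point of the level set would again be a transversal parameter, and near
  such a parameter the level is attained only once.\<close>

lemma finite_level:
  assumes "\<And>t. t \<in> {0..1} ==> Im (p t) = c ==> Im (p' t) ~= 0"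
  shows "finite {t\<in>{0..1}. Im (p t) = c}"
proof (rule ccontr)
  let ?S = "{t\<in>{0..1}. Im (p t) = c}"
  assume "infinite ?S"
  then obtain x where x: "x \<in> {0..1}" "x islimpt ?S"
    using compact_eq_Bolzano_Weierstrass[of "{0..1::real}"] by (metis (no_types, lifting) compact_Icc mem_Collect_eq subsetI)
  have "closed ?S"
    using continuous_closed_preimage_constant[OF Im_p_continuous closed_atLeastAtMost, of 0 1 c] by simp
  then have xS: "x \<in> ?S" using x(2) closed_limpt by blast
  then obtain d m K s where T: "transversal x d m K s" using transversal_exists assms by blast
  obtain y where y: "y \<in> ?S" "y ~= x" "dist y x < d"
    using x(2) transversalD(1)[OF T] unfolding islimpt_approachable by blast
  have "m * \<bar>y - x\<bar> <= \<bar>Im (p y - p x)\<bar>"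
    by (rule transversalD(8)[OF T]) (use y transversalD(1)[OF T] in \<open>auto simp: dist_real_def\<close>)
  then show False using y xS transversalD(3)[OF T] by (auto simp: mult_le_0_iff)
qed

text \<open>Precisely the conditions under which every crossing of the horizontal line at height
  \<open>c\<close> is interior, transversal and simple, so that the jump argument applies to each of
  them.\<close>

definition good_height :: "real => bool" where
  "good_height c \<longleftrightarrow> (\<forall>t\<in>{0..1}. Im (p t) = c --> t \<in> {0<..<1} \<and> Im (p' t) ~= 0) \<and>
     (\<forall>s\<in>{0..1}. \<forall>t\<in>{0..1}. Im (p s) = c --> p s = p t --> s = t)"

text \<open>Regular values form an open dense set by Sard. Near one of them the level sets are finitely many branches, and the
  heights at which two branches meet form a closed set without interior, as rational parameters are simple.\<close>

lemma good_height_dense: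
  assumes simple: "\<And>a t. a \<in> \<rat> ==> a \<in> {0..1} ==> t \<in> {0..1} ==> p t = p a ==> t = a"
    and ab: "a < b"
  shows "\<exists>c\<in>{a<..<b}. good_height c"
proof -
  let ?f = "%t. Im (p t)"
  define CV where "CV = ?f ` {t\<in>{0..1}. Im (p' t) = 0} \<union> {?f 0, ?f 1}"
  have "compact {t\<in>{0..1}. Im (p' t) = 0}"
  proof -
    have "closed {t\<in>{0..1}. Im (p' t) = 0}"
      by (rule continuous_closed_preimage_constant[OF Im_p'_continuous closed_atLeastAtMost])
    moreover have "bounded {t\<in>{0..1}. Im (p' t) = 0}" by (rule bounded_subset[of "{0..1::real}"]) auto
    ultimately show ?thesis by (simp add: compact_eq_bounded_closed)
  qed
  then have "compact CV" unfolding CV_def by (intro compact_Un compact_continuous_image Im_p_continuous) auto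
  then have oCV: "open (- CV)" by (simp add: compact_imp_closed open_Compl)
  have "negligible CV" unfolding CV_def by (intro negligible_Un critical_values_negligible) auto
  then have "\<not> {a<..<b} \<subseteq> CV"
    using open_not_negligible[OF open_greaterThanLessThan, of a b] ab negligible_subset[of CV "{a<..<b}"] by auto
  then obtain c0 where c0: "c0 \<in> {a<..<b}" "c0 \<notin> CV" by blast
  have "open ({a<..<b} \<inter> - CV)" using oCV by auto
  then obtain e0 where e0: "e0 > 0" "ball c0 e0 \<subseteq> {a<..<b} \<inter> - CV"
    using c0 open_contains_ball by (metis ComplI IntI)
  define F where "F = {t\<in>{0..1}. ?f t = c0}"
  have reg0: "Im (p' t) ~= 0" "t \<in> {0<..<1}" if "t \<in> F" for t
  proof -
    show "Im (p' t) ~= 0" using that c0(2) unfolding F_def CV_def by auto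
    have "t ~= 0" "t ~= 1" using that c0(2) unfolding F_def CV_def by auto
    then show "t \<in> {0<..<1}" using that unfolding F_def by auto
  qed
  have finF: "finite F" unfolding F_def by (rule finite_level) (use reg0 in \<open>auto simp: F_def\<close>)
  have "\<exists>d>0. \<exists>m K s. transversal t d m K s" if "t \<in> F" for t
    using transversal_exists[OF reg0(1)[OF that]] transversalD(1) by metis
  then obtain D where D: "\<And>t. t \<in> F ==> D t > 0 \<and> (\<exists>m K s. transversal t (D t) m K s)" by metis
  \<comment> \<open>One radius for all branches: the windows stay transversal, lie inside the unit
    interval and are pairwise disjoint.\<close>
  obtain d where d: "d > 0" "\<And>t. t \<in> F ==> d <= D t \<and> d < t \<and> d < 1 - t"
    "\<And>s t. s \<in> F ==> t \<in> F ==> s ~= t ==> 2 * d < \<bar>s - t\<bar>"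
  proof -
    define V where "V = insert 1 ((%t. Min {D t, t/2, (1-t)/2}) ` F \<union> (%(s,t). \<bar>s - t\<bar> / 3) ` {(s,t)\<in>F\<times>F. s ~= t})"
    have finV: "finite V"
    proof -
      have "finite {(s,t)\<in>F\<times>F. s ~= t}" by (rule finite_subset[of _ "F \<times> F"]) (use finF in auto)
      then show ?thesis unfolding V_def using finF by auto
    qed
    have pos: "v > 0" if "v \<in> V" for v
      using that D reg0(2) unfolding V_def by auto
    have M: "Min V > 0" using finV pos by (subst Min_gr_iff) (auto simp: V_def)
    have le: "Min V <= v" if "v \<in> V" for v using finV that by simp
    show ?thesis
    proof (rule that[OF M])
      fix t assume t: "t \<in> F"
      have "Min V <= Min {D t, t/2, (1-t)/2}" by (rule le) (use t in \<open>auto simp: V_def\<close>)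
      then show "Min V <= D t \<and> Min V < t \<and> Min V < 1 - t" using reg0(2)[OF t] by auto
    next
      fix s t assume st: "s \<in> F" "t \<in> F" "s ~= t"
      have "Min V <= \<bar>s - t\<bar> / 3" by (rule le) (use st in \<open>auto simp: V_def image_iff\<close>)
      then show "2 * Min V < \<bar>s - t\<bar>" using st by auto
    qed
  qed
  define T where "T = (%t. {t-d..t+d})"
  have inj: "s = u" if tF: "t \<in> F" and su: "s \<in> T t" "u \<in> T t" "?f s = ?f u" for s t u
  proof -
    obtain m K q where "transversal t (D t) m K q" using D[OF tF] by blast
    then have tr: "transversal t d m K q" using transversal_mono d(1) d(2)[OF tF] by blast
    show ?thesis using transversalD(8)[OF tr, of u s] transversalD(3)[OF tr] su by (auto simp: T_def mult_le_0_iff)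
  qed
  have T01: "T t \<subseteq> {0..1}" if "t \<in> F" for t using d(2)[OF that] by (auto simp: T_def)
  have disj: "T s \<inter> T t = {}" if "s \<in> F" "t \<in> F" "s ~= t" for s t
    using d(3)[OF that] by (auto simp: T_def)
  define G where "G = {0..1} - (\<Union>t\<in>F. {t-d<..<t+d})"
  have cG: "compact G" unfolding G_def by (intro compact_diff) auto
  obtain e1 where e1: "e1 > 0" "\<And>t. t \<in> G ==> \<bar>?f t - c0\<bar> >= e1"
  proof (cases "G = {}")
    case False
    have "continuous_on G (%t. \<bar>?f t - c0\<bar>)" by (intro continuous_intros cont)
    then obtain u where u: "u \<in> G" "\<And>t. t \<in> G ==> \<bar>?f u - c0\<bar> <= \<bar>?f t - c0\<bar>"
      using continuous_attains_inf[OF cG False] by blast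
    have "u \<notin> F" using u(1) d(1) unfolding G_def by force
    then have "?f u ~= c0" using u(1) by (auto simp: F_def G_def)
    then show ?thesis using that[of "\<bar>?f u - c0\<bar>"] u(2) by simp
  qed (use that[of 1] in auto)
  define e where "e = min e0 e1"
  have e: "e > 0" using e0 e1 by (simp add: e_def)
  have inT: "\<exists>t\<in>F. s \<in> T t" if s: "s \<in> {0..1}" "\<bar>?f s - c0\<bar> < e" for s
  proof -
    have "s \<notin> G" using e1(2)[of s] s by (auto simp: e_def)
    then obtain t where "t \<in> F" "s \<in> {t-d<..<t+d}" using s(1) unfolding G_def by blast
    then show ?thesis by (intro bexI[of _ t]) (simp_all add: T_def)
  qed
  \<comment> \<open>The heights at which branches \<open>u\<close> and \<open>v\<close> meet. An
    interior point would give a whole interval of double points on branch \<open>u\<close>, and this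
    interval would contain a rational parameter.\<close>
  define E where "E = (%(u,v). (%z. ?f (fst z)) ` {z \<in> T u \<times> T v. p (fst z) = p (snd z)})"
  define I where "I = {(u,v)\<in>F\<times>F. u ~= v}"
  have finI: "finite I" unfolding I_def by (rule finite_subset[of _ "F \<times> F"]) (use finF in auto)
  have clE: "closed (E i)" if "i \<in> I" for i
  proof -
    obtain u v where uv: "i = (u,v)" by force
    have "closed {z \<in> T u \<times> T v. p (fst z) - p (snd z) = 0}"
      by (rule continuous_closed_preimage_constant)
        (auto simp: T_def intro!: continuous_intros closed_Times continuous_on_compose2[OF cont[of UNIV]])
    then have "closed {z \<in> T u \<times> T v. p (fst z) = p (snd z)}" by simp
    moreover have "bounded {z \<in> T u \<times> T v. p (fst z) = p (snd z)}"
      by (rule bounded_subset[of "T u \<times> T v"]) (auto simp: T_def intro!: bounded_Times)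
    ultimately have "compact {z \<in> T u \<times> T v. p (fst z) = p (snd z)}" by (simp add: compact_eq_bounded_closed)
    then have "compact (E i)" unfolding E_def uv prod.case
      by (rule compact_continuous_image[rotated]) (intro continuous_intros continuous_on_compose2[OF cont[of UNIV]], auto)
    then show ?thesis by (rule compact_imp_closed)
  qed
  have intE: "interior (E i) = {}" if i: "i \<in> I" for i
  proof (rule ccontr)
    obtain u v where uv: "i = (u,v)" "u \<in> F" "v \<in> F" "u ~= v" using i by (auto simp: I_def)
    assume "interior (E i) ~= {}"
    then obtain y where y: "y \<in> interior (E i)" by auto
    then have "y \<in> E i" using interior_subset by blast
    then obtain s where s: "s \<in> T u" "?f s = y" unfolding E_def uv by auto
    have "open (interior (E i))" by simp
    then have "open ((%t. ?f t) -` interior (E i))"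
      using Im_p_continuous[of UNIV] by (simp add: continuous_on_open_vimage)
    then obtain r where r: "r > 0" "ball s r \<subseteq> (%t. ?f t) -` interior (E i)"
      using y s(2) open_contains_ball by (metis vimageI)
    obtain q where q: "q \<in> \<rat>" "q \<in> T u" "\<bar>q - s\<bar> < r"
    proof -
      have "max (u - d) (s - r) < min (u + d) (s + r)" using s(1) r(1) d(1) by (auto simp: T_def)
      then obtain q where "q \<in> \<rat>" "max (u - d) (s - r) < q" "q < min (u + d) (s + r)"
        using Rats_dense_in_real by blast
      then show ?thesis using that[of q] by (auto simp: T_def)
    qed
    have "q \<in> ball s r" using q(3) by (simp add: dist_real_def abs_minus_commute)
    then have "?f q \<in> E i" using r(2) interior_subset[of "E i"] by blast
    then obtain s' t' where st: "s' \<in> T u" "t' \<in> T v" "p s' = p t'" "?f s' = ?f q" unfolding E_def uv by auto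
    have "s' = q" by (rule inj[OF uv(2) st(1) q(2) st(4)])
    then have "t' = q" using simple[OF q(1) subsetD[OF T01[OF uv(2)] q(2)] subsetD[OF T01[OF uv(3)] st(2)]] st(3) by simp
    then show False using st(2) q(2) disj[OF uv(2,3,4)] by auto
  qed
  have "interior (\<Union>i\<in>J. E i) = {}" if "finite J" "J \<subseteq> I" for J
    using that
  proof (induction J rule: finite_induct)
    case (insert i J)
    have "interior (E i \<union> (\<Union>i\<in>J. E i)) = interior (E i)"
      by (rule interior_closed_Un_empty_interior) (use insert clE in auto)
    then show ?case using insert intE by simp
  qed simp
  from this[OF finI order_refl] have "\<not> ball c0 e \<subseteq> (\<Union>i\<in>I. E i)"
    using e interior_maximal[of "ball c0 e" "\<Union>i\<in>I. E i"] by auto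
  then obtain c where c: "c \<in> ball c0 e" "c \<notin> (\<Union>i\<in>I. E i)" by blast
  have cab: "c \<in> {a<..<b}" "c \<notin> CV" using c(1) e0(2) by (auto simp: e_def)
  have "good_height c"
    unfolding good_height_def
  proof (intro conjI ballI impI)
    fix t assume t: "t \<in> {0..1}" "Im (p t) = c"
    show "Im (p' t) ~= 0" using t cab(2) unfolding CV_def by auto
    have "t ~= 0" "t ~= 1" using t cab(2) unfolding CV_def by auto
    then show "t \<in> {0<..<1}" using t by auto
  next
    fix s t assume st: "s \<in> {0..1}" "t \<in> {0..1}" "Im (p s) = c" "p s = p t"
    have ce: "\<bar>c - c0\<bar> < e" using c(1) by (simp add: dist_real_def abs_minus_commute)
    obtain u where u: "u \<in> F" "s \<in> T u" using inT[of s] st ce by auto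
    obtain v where v: "v \<in> F" "t \<in> T v" using inT[of t] st ce by auto
    show "s = t"
    proof (cases "u = v")
      case True
      show ?thesis by (rule inj[OF u]) (use v True st in auto)
    next
      case False
      have "c \<in> E (u,v)" unfolding E_def using u v st by (auto intro!: image_eqI[of _ _ "(s,t)"])
      then show ?thesis using c(2) False u v by (auto simp: I_def)
    qed
  qed
  then show ?thesis using cab(1) by blast
qed

end

section \<open>The rank along a horizontal line\<close>

context curve_algebra begin

definition annihilates where "annihilates L \<longleftrightarrow> cdual L \<and> (\<forall>g\<in>P. L g = 0)"

lemma P_power: "g \<in> P ==> (%t. g t ^ k) \<in> P"
  by (induction k) (auto intro: P_const P_mult)

lemma P_sum: "finite I ==> (\<And>i. i \<in> I ==> g i \<in> P) ==> (%t. \<Sum>i\<in>I. g i t) \<in> P"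
  by (induction I rule: finite_induct) (auto intro: P_const P_add)

text \<open>For large \<open>w\<close> the function \<open>u / (p - w)\<close> is the uniform limit
  of its geometric partial sums, which are in \<open>P\<close> and hence annihilated by
  \<open>L\<close>.\<close>

lemma phi_far:
  assumes L: "annihilates L" and u: "u \<in> P" and A: "A > 0" "\<And>t. t \<in> {0..1} ==> norm (p t) <= A" and w: "norm w > 2 * A"
  shows "phi L w u = 0"
proof -
  have cL: "cdual L" and L0: "\<And>g. g \<in> P ==> L g = 0" using L by (auto simp: annihilates_def)
  obtain C where C: "C > 0" "\<And>u B. continuous_on {0..1} u ==> (\<And>t. t \<in> {0..1} ==> norm (u t) <= B) ==> norm (L u) <= C * B"
    using cdual_bound[OF cL] by blast
  obtain B where B: "B >= 0" "\<And>s. s \<in> {-1..2} ==> norm (u s) <= B"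
    using P_bounds[OF u] by metis
  have wX: "w \<notin> X" using A w by (fastforce simp: X_def)
  have w0: "w ~= 0" using w A by auto
  define v where "v = (%n t. \<Sum>k<n. (- 1 / w ^ Suc k) * (u t * p t ^ k))"
  have vP: "v n \<in> P" for n
    unfolding v_def by (intro P_sum P_mult P_const P_power P_p u) auto
  \<comment> \<open>The exact remainder of the geometric series, by induction on the number of
    terms.\<close>
  have vcl: "u t / (p t - w) - v n t = u t * (p t / w) ^ n / (p t - w)" if t: "t \<in> {0..1}" for t n
  proof (induction n)
    case 0 then show ?case by (simp add: v_def)
  next
    case (Suc n)
    have pw: "p t - w ~= 0" using wX t by (auto simp: X_def)
    have "u t / (p t - w) - v (Suc n) t = u t * (p t / w) ^ n / (p t - w) + u t * p t ^ n / w ^ Suc n"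
      using Suc by (simp add: v_def)
    also have "u t * p t ^ n / w ^ Suc n = u t * (p t / w) ^ n * (1 / w)"
      by (simp add: power_divide)
    finally have 1: "u t / (p t - w) - v (Suc n) t = u t * (p t / w) ^ n * (1 / (p t - w) + 1 / w)"
      by (simp add: distrib_left)
    have "1 / (p t - w) + 1 / w = (p t / w) / (p t - w)"
      using pw w0 by (simp add: divide_simps)
    then show ?case unfolding 1 by simp
  qed
  have "norm (phi L w u) <= C * (B * (1/2) ^ n / A)" for n
  proof -
    have "L (%t. u t / (p t - w) - v n t) = phi L w u - L (v n)"
      unfolding phi_def by (rule cdual_diff[OF cL cont_div[OF P_cont01[OF u] wX] P_cont01[OF vP]])
    then have "phi L w u = L (%t. u t / (p t - w) - v n t)" using L0[OF vP] by simp
    moreover have "norm (L (%t. u t / (p t - w) - v n t)) <= C * (B * (1/2) ^ n / A)"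
    proof (rule C(2))
      show "continuous_on {0..1} (%t. u t / (p t - w) - v n t)"
        by (intro continuous_on_diff cont_div wX P_cont01 u vP)
      fix t :: real assume t: "t \<in> {0..1}"
      have 1: "norm (p t / w) <= 1/2" using A(2)[OF t] w by (simp add: norm_divide divide_simps) 
      have 2: "norm (p t - w) >= A" using norm_triangle_ineq2[of w "p t"] A(2)[OF t] w by (simp add: norm_minus_commute)
      have "norm (u t / (p t - w) - v n t) = norm (u t) * norm (p t / w) ^ n / norm (p t - w)"
        unfolding vcl[OF t] by (simp add: norm_mult norm_divide norm_power)
      also have "\<dots> <= B * (1/2) ^ n / A"
        using B(2)[of t] t 1 2 A(1) B(1) by (intro frac_le mult_mono power_mono) auto
      finally show "norm (u t / (p t - w) - v n t) <= B * (1/2) ^ n / A" .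
    qed
    ultimately show ?thesis by simp
  qed
  moreover have "(%n. C * (B * (1/2) ^ n / A)) \<longlonglongrightarrow> C * (B * 0 / A)"
    by (intro tendsto_intros LIMSEQ_power_zero) (use A in auto)
  ultimately have "norm (phi L w u) <= C * (B * 0 / A)"
    by (intro LIMSEQ_le_const[of "%n. C * (B * (1/2) ^ n / A)"]) auto
  then show ?thesis by simp
qed

text \<open>The parameters at which the curve meets the ray going left from
  \<open>Complex x c\<close>.\<close>

definition crossings :: "real => real => real set" where
  "crossings c x = {t\<in>{0..1}. Im (p t) = c \<and> Re (p t) < x}"

text \<open>Coming from the far left, where all Cauchy transforms vanish, the point moves right
  along the line at height \<open>c\<close>, and each crossing raises by one the order from which
  all minors vanish. The claim covers the whole component of the point, and all families
  \<open>g\<close> and \<open>h\<close>, because the crossing argument needs the left side on a full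
  strip and for deleted rows and columns.\<close>

lemma rank_on_good_height:
  assumes good: "good_height c" and L: "annihilates L"
  shows "Complex x c \<notin> X ==> card (crossings c x) = n ==> (\<And>i. g i \<in> P) ==> (\<And>i. h i \<in> P) ==>
    v \<in> connected_component_set (- X) (Complex x c) ==> minor L (Suc n) g h v = 0"
proof (induction n arbitrary: x g h v)
  case 0
  have cL: "cdual L" using L by (simp add: annihilates_def)
  have fin: "finite {t\<in>{0..1}. Im (p t) = c}" by (rule finite_level) (use good in \<open>auto simp: good_height_def\<close>)
  have "finite (crossings c x)" unfolding crossings_def by (rule finite_subset[OF _ fin]) auto
  then have empty: "crossings c x = {}" using 0 by simp
  obtain A where A: "A > 0" "\<And>t. t \<in> {0..1} ==> norm (p t) <= A"
    using compact_imp_bounded[OF compact_X] unfolding bounded_pos X_def by auto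
  \<comment> \<open>Far enough left for \<open>phi_far\<close> to apply.\<close>
  define y where "y = min x (- 2 * A) - 1"
  define S where "S = (%r. Complex r c) ` {y..x}"
  have yx: "y <= x" by (simp add: y_def)
  have "continuous_on {y..x} (%r. Complex r c)" unfolding Complex_eq by (intro continuous_intros)
  then have cS: "connected S" unfolding S_def by (rule connected_continuous_image) simp
  have SX: "S \<subseteq> - X"
  proof
    fix z assume "z \<in> S"
    then obtain r where r: "z = Complex r c" "r <= x" by (auto simp: S_def)
    show "z \<in> - X"
    proof
      assume "z \<in> X"
      then obtain t where t: "t \<in> {0..1}" "p t = z" by (auto simp: X_def)
      show False
      proof (cases "r = x")
        case True then show False using 0(1) t r \<open>z \<in> X\<close> by simp
      next
        case False
        then have "t \<in> crossings c x" using t r by (auto simp: crossings_def)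
        then show False using empty by simp
      qed
    qed
  qed
  define U where "U = connected_component_set (- X) (Complex x c)"
  have yU: "Complex y c \<in> U"
  proof -
    have "S \<subseteq> U" unfolding U_def by (rule connected_component_maximal) (use cS SX yx in \<open>auto simp: S_def\<close>)
    then show ?thesis using yx by (auto simp: S_def)
  qed
  have "norm (Complex y c) > 2 * A"
  proof -
    have "\<bar>y\<bar> > 2 * A" using A(1) by (simp add: y_def)
    then show ?thesis using abs_Re_le_cmod[of "Complex y c"] by simp
  qed
  then obtain r where r: "r > 0" "\<And>z. z \<in> ball (Complex y c) r ==> norm z > 2 * A"
  proof -
    assume *: "norm (Complex y c) > 2 * A" and th: "\<And>r. 0 < r ==> (\<And>z. z \<in> ball (Complex y c) r ==> 2 * A < cmod z) ==> thesis"
    show thesis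
    proof (rule th[of "norm (Complex y c) - 2 * A"])
      fix z assume "z \<in> ball (Complex y c) (norm (Complex y c) - 2 * A)"
      then show "2 * A < cmod z" using norm_triangle_ineq2[of "Complex y c" "Complex y c - z"]
        norm_triangle_ineq2[of "Complex y c" z] by (simp add: dist_norm)
    qed (use * in simp)
  qed
  show ?case
  proof (rule minor_continuation[OF cL 0(3,4) r(1), where S = U])
    fix z assume z: "z \<in> ball (Complex y c) r"
    have "phi L z (%t. g 0 t * h 0 t) = 0"
      by (rule phi_far[OF L P_mult[OF 0(3,4)] A r(2)[OF z]])
    then show "minor L (Suc 0) g h z = 0"
      unfolding minor_def by (subst detf_row[of 0]) auto
  next
    show "connected U" "U \<subseteq> - X" unfolding U_def by (auto simp: connected_component_subset)
    show "Complex y c \<in> U" by fact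
    show "v \<in> U" using 0(5) by (simp add: U_def)
  qed
next
  case (Suc n)
  have cL: "cdual L" using L by (simp add: annihilates_def)
  have fin: "finite {t\<in>{0..1}. Im (p t) = c}" by (rule finite_level) (use good in \<open>auto simp: good_height_def\<close>)
  have finC: "finite (crossings c y)" for y unfolding crossings_def by (rule finite_subset[OF _ fin]) auto
  have ne: "crossings c x ~= {}" using Suc.prems(2) by auto
  \<comment> \<open>The rightmost crossing left of \<open>x\<close>; to its left one crossing fewer
    is counted.\<close>
  define R where "R = Max ((%t. Re (p t)) ` crossings c x)"
  have "R \<in> (%t. Re (p t)) ` crossings c x" unfolding R_def using ne finC by (intro Max_in) auto
  then obtain t0 where t0: "t0 \<in> crossings c x" "Re (p t0) = R" by auto
  have Rmax: "Re (p t) <= R" if "t \<in> crossings c x" for t unfolding R_def using that finC by auto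
  have t0': "t0 \<in> {0..1}" "Im (p t0) = c" "R < x" using t0 by (auto simp: crossings_def)
  have reg: "Im (p' t0) ~= 0" and simple: "\<And>t. t \<in> {0..1} ==> p t = p t0 ==> t = t0"
    using good t0'(1,2) unfolding good_height_def by metis+
  have eqR: "t = t0" if "t \<in> {0..1}" "Im (p t) = c" "Re (p t) = R" for t
    by (rule simple[OF that(1)]) (use that t0 t0' in \<open>simp add: complex_eq_iff\<close>)
  have cR: "card (crossings c R) = n"
  proof -
    have "crossings c x = insert t0 (crossings c R)"
      using t0 t0' Rmax eqR unfolding crossings_def by (fastforce simp: less_le)
    moreover have "t0 \<notin> crossings c R" using t0(2) by (auto simp: crossings_def)
    ultimately show ?thesis using Suc.prems(2) finC by simp
  qed
  obtain d0 m K s where T0: "transversal t0 d0 m K s" using transversal_exists[OF reg] by blast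
  obtain d k where d: "0 < d" "d <= d0" "0 < k"
    "\<And>t a x. t \<in> {0..1} ==> a \<in> {t0-d..t0+d} ==> \<bar>x\<bar> <= d ==> k * sqrt ((t - a)\<^sup>2 + x\<^sup>2) <= norm (p t - p a - of_real x)"
    using kernel_bound[OF T0 t0'(1) simple] by blast
  have T: "transversal t0 d m K s" by (rule transversal_mono[OF T0 d(1,2)])
  have nX: "p a + of_real x \<notin> X" if "a \<in> {t0-d..t0+d}" "x ~= 0" "\<bar>x\<bar> <= d" for a x
  proof
    assume "p a + of_real x \<in> X"
    then obtain t where t: "t \<in> {0..1}" "p t = p a + of_real x" by (auto simp: X_def)
    have "k * sqrt ((t - a)\<^sup>2 + x\<^sup>2) <= 0" using d(4)[OF t(1) that(1,3)] t(2) by simp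
    moreover have "k * sqrt ((t - a)\<^sup>2 + x\<^sup>2) > 0" using d(3) that(2) by (simp add: add_nonneg_pos)
    ultimately show False by simp
  qed
  have pt0: "p t0 = Complex R c" using t0 t0' by (simp add: complex_eq_iff)
  have left: "minor L (Suc n) g' h' (p t - of_real y) = 0"
    if t: "t \<in> {t0-d..t0+d}" and y: "0 < y" "y <= d" and gh: "\<And>i. g' i \<in> P" "\<And>i. h' i \<in> P" for t y g' h'
  proof -
    \<comment> \<open>The strip immediately left of the arc is connected and avoids the curve, so
      the induction hypothesis at one of its points covers all of it.\<close>
    define V where "V = (%z. p (fst z) - of_real (snd z)) ` ({t0-d..t0+d} \<times> {0<..d})"
    have cV: "connected V" unfolding V_def
    proof (rule connected_continuous_image)
      show "continuous_on ({t0-d..t0+d} \<times> {0<..d}) (%z. p (fst z) - complex_of_real (snd z))"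
        by (intro continuous_intros continuous_on_compose2[OF cont[of UNIV]]) auto
      show "connected ({t0-d..t0+d} \<times> {0<..d})" by (intro connected_Times) auto
    qed
    have VX: "V \<subseteq> - X"
    proof
      fix z assume "z \<in> V"
      then obtain a x where "z = p a - of_real x" "a \<in> {t0-d..t0+d}" "0 < x" "x <= d" by (auto simp: V_def)
      then show "z \<in> - X" using nX[of a "- x"] by simp
    qed
    define F where "F = (%t. Re (p t)) ` crossings c R"
    obtain y1 where y1: "0 < y1" "y1 <= d" "\<And>t. t \<in> crossings c R ==> Re (p t) < R - y1"
    proof -
      define e where "e = Min (insert (2*d) ((%t. R - Re (p t)) ` crossings c R))"
      have e: "e > 0" unfolding e_def using finC d(1) by (subst Min_gr_iff) (auto simp: crossings_def)
      have ed: "e <= 2*d" unfolding e_def using finC by (intro Min_le) auto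
      have er: "e <= R - Re (p t)" if "t \<in> crossings c R" for t unfolding e_def using finC that by (intro Min_le) auto
      show ?thesis by (rule that[of "e/2"]) (use e ed er in force)+
    qed
    have z1: "p t0 - of_real y1 = Complex (R - y1) c" by (simp add: pt0 complex_eq_iff)
    have z1X: "Complex (R - y1) c \<notin> X" using nX[of t0 "- y1"] y1 d(1) z1 by simp
    have "crossings c (R - y1) = crossings c R" using y1 unfolding crossings_def by force
    then have IH: "minor L (Suc n) g' h' v = 0" if "v \<in> connected_component_set (- X) (Complex (R - y1) c)" for v
      using Suc.IH[OF z1X _ gh that] cR by simp
    have z1V: "Complex (R - y1) c \<in> V"
      unfolding V_def z1[symmetric] using y1 d(1) by (auto intro!: image_eqI[of _ _ "(t0, y1)"])
    have "p t - of_real y \<in> V" unfolding V_def using t y by (auto intro!: image_eqI[of _ _ "(t, y)"])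
    moreover have "V \<subseteq> connected_component_set (- X) (Complex (R - y1) c)"
      by (rule connected_component_maximal[OF z1V cV VX])
    ultimately show ?thesis using IH by blast
  qed
  obtain x1 r where x1: "0 < x1" "x1 < d" "0 < r" "\<And>w. w \<in> ball (p t0 + of_real x1) r ==> minor L (Suc (Suc n)) g h w = 0"
  proof -
    have "\<exists>x1 r. 0 < x1 \<and> x1 < d \<and> 0 < r \<and> (\<forall>w\<in>ball (p t0 + of_real x1) r. minor L (Suc (Suc n)) g h w = 0)"
      by (rule crossing[OF cL T t0'(1) d(3) d(4) left Suc.prems(3,4)])
    then show thesis using that by blast
  qed
  define U where "U = connected_component_set (- X) (Complex x c)"
  \<comment> \<open>Between \<open>R\<close> and \<open>x\<close> the line meets no further point of
    the curve, so the vanishing near \<open>p t0 + x1\<close> can be continued to the component of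
    \<open>Complex x c\<close>.\<close>
  have inU: "p t0 + of_real x1 \<in> U"
  proof -
    define S where "S = (%r. Complex r c) ` closed_segment (R + x1) x"
    have "continuous_on (closed_segment (R + x1) x) (%r. Complex r c)" unfolding Complex_eq by (intro continuous_intros)
    then have cS: "connected S" unfolding S_def by (rule connected_continuous_image) simp
    have SX: "S \<subseteq> - X"
    proof
      fix z assume "z \<in> S"
      then obtain y where y: "z = Complex y c" "y \<in> closed_segment (R + x1) x" by (auto simp: S_def)
      show "z \<in> - X"
      proof (cases "y <= R + d")
        case True
        have "y > R" using y(2) x1(1) t0'(3) by (auto simp: closed_segment_eq_real_ivl split: if_splits)
        then have "p t0 + of_real (y - R) \<notin> X" using nX[of t0 "y - R"] True d(1) by auto
        moreover have "p t0 + of_real (y - R) = z" by (simp add: pt0 y(1) complex_eq_iff)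
        ultimately show ?thesis by simp
      next
        case False
        then have y': "R < y" "y <= x" using y(2) x1 d(1) by (auto simp: closed_segment_eq_real_ivl split: if_splits)
        show ?thesis
        proof
          assume "z \<in> X"
          then obtain t where t: "t \<in> {0..1}" "p t = Complex y c" using y by (auto simp: X_def)
          show False
          proof (cases "y = x")
            case True then show False using Suc.prems(1) t unfolding X_def by (metis imageI)
          next
            case False
            then have "t \<in> crossings c x" using t y' by (auto simp: crossings_def)
            then show False using Rmax[of t] t y' by simp
          qed
        qed
      qed
    qed
    have "S \<subseteq> U" unfolding U_def by (rule connected_component_maximal[OF _ cS SX]) (auto simp: S_def)
    moreover have "p t0 + of_real x1 \<in> S" unfolding S_def pt0
      by (intro image_eqI[of _ _ "R + x1"]) (auto simp: complex_eq_iff)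
    ultimately show ?thesis by blast
  qed
  show ?case
  proof (rule minor_continuation[OF cL Suc.prems(3,4) x1(3,4), where S = U])
    show "connected U" "U \<subseteq> - X" unfolding U_def by (auto simp: connected_component_subset)
    show "p t0 + of_real x1 \<in> U" by fact
    show "v \<in> U" using Suc.prems(5) by (simp add: U_def)
  qed
qed

text \<open>A small vertical move inside a disc off the curve brings \<open>w\<close> to a good
  height without leaving its component. The order is one more than the number of crossings to the
  left; it depends on \<open>w\<close> but not on \<open>L\<close>.\<close>

theorem rank_bound:
  assumes simple: "\<And>a t. a \<in> \<rat> ==> a \<in> {0..1} ==> t \<in> {0..1} ==> p t = p a ==> t = a"
    and w: "w \<notin> X"
  shows "\<exists>N. \<forall>L g h. annihilates L --> (\<forall>i. g i \<in> P) --> (\<forall>i. h i \<in> P) --> minor L N g h w = 0"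
proof -
  obtain r where r: "r > 0" "ball w r \<subseteq> - X" using open_nX w open_contains_ball by (metis ComplI)
  obtain c where c: "c \<in> {Im w - r<..<Im w + r}" "good_height c"
  proof -
    have "\<exists>c\<in>{Im w - r<..<Im w + r}. good_height c"
      by (rule good_height_dense) (use r(1) in \<open>auto intro: simple\<close>)
    then show thesis using that by blast
  qed
  let ?v = "Complex (Re w) c"
  have "dist w ?v = \<bar>Im w - c\<bar>" by (simp add: dist_norm cmod_def)
  then have vb: "?v \<in> ball w r" using c(1) by auto
  have vX: "?v \<notin> X" using vb r(2) by auto
  have "w \<in> connected_component_set (- X) ?v"
    using connected_component_maximal[OF vb connected_ball r(2)] centre_in_ball[of w r] r(1) by blast
  then have "minor L (Suc (card (crossings c (Re w)))) g h w = 0"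
    if "annihilates L" "\<forall>i. g i \<in> P" "\<forall>i. h i \<in> P" for L g h
    using rank_on_good_height[OF c(2) that(1) vX refl] that by blast
  then show ?thesis by blast
qed

end

subsection \<open>Subspaces of finite codimension\<close>

text \<open>Adding the elements of \<open>A\<close> one by one, take the one that first brings
  \<open>b\<close> into the span; the roles of the two can then be exchanged.\<close>

lemma exchange_step:
  assumes "finite A" "b \<in> span (S \<union> A)" "b \<notin> span S"
  shows "\<exists>a\<in>A. a \<in> span (insert b (S \<union> (A - {a})))"
  using assms
proof (induction A arbitrary: S rule: finite_induct)
  case (insert x A)
  show ?case
  proof (cases "b \<in> span (S \<union> A)")
    case True
    then obtain a where a: "a \<in> A" "a \<in> span (insert b (S \<union> (A - {a})))" using insert by blast
    have "span (insert b (S \<union> (A - {a}))) \<subseteq> span (insert b (S \<union> (insert x A - {a})))"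
      by (rule span_mono) auto
    then show ?thesis using a by blast
  next
    case False
    have "b \<in> span (insert x (S \<union> A))" using insert.prems(1) by simp
    then have "x \<in> span (insert b (S \<union> A))" by (rule in_span_insert) (use False in auto)
    moreover have "insert x A - {x} = A" using insert.hyps by auto
    ultimately show ?thesis by (intro bexI[of _ x]) auto
  qed
qed simp

lemma steinitz_modulo:
  assumes "finite B" "finite A" "\<And>b. b \<in> B ==> b \<notin> span (M \<union> (B - {b}))" "B \<subseteq> span (M \<union> A)"
  shows "\<exists>A'\<subseteq>A. card A' + card B <= card A \<and> span (M \<union> A) \<subseteq> span (M \<union> B \<union> A')"
  using assms(1,3,4)
proof (induction B rule: finite_induct)
  case empty
  then show ?case by (intro exI[of _ A]) auto
next
  case (insert b B)
  have "\<And>c. c \<in> B ==> c \<notin> span (M \<union> (B - {c}))"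
  proof
    fix c assume c: "c \<in> B" "c \<in> span (M \<union> (B - {c}))"
    have "span (M \<union> (B - {c})) \<subseteq> span (M \<union> (insert b B - {c}))" by (rule span_mono) auto
    then show False using insert.prems(1)[of c] c by blast
  qed
  then obtain A' where A': "A' \<subseteq> A" "card A' + card B <= card A" "span (M \<union> A) \<subseteq> span (M \<union> B \<union> A')"
    using insert.IH insert.prems by blast
  have finA': "finite A'" using A'(1) assms(2) finite_subset by blast
  have "b \<in> span (M \<union> B \<union> A')" using A'(3) insert.prems(2) by blast
  moreover have "b \<notin> span (M \<union> B)"
    using insert.prems(1)[of b] insert.hyps by simp
  ultimately obtain a where a: "a \<in> A'" "a \<in> span (insert b (M \<union> B \<union> (A' - {a})))"
    using exchange_step[OF finA'] by blast
  have "span (M \<union> B \<union> A') \<subseteq> span (M \<union> insert b B \<union> (A' - {a}))"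
  proof (rule span_minimal)
    have eq: "M \<union> insert b B \<union> (A' - {a}) = insert b (M \<union> B \<union> (A' - {a}))" by auto
    show "M \<union> B \<union> A' \<subseteq> span (M \<union> insert b B \<union> (A' - {a}))"
      unfolding eq using a(2) span_superset[of "insert b (M \<union> B \<union> (A' - {a}))"] by auto
  qed simp
  moreover have "card (A' - {a}) + card (insert b B) <= card A"
    using A'(2) card_Suc_Diff1[OF finA' a(1)] insert.hyps by simp
  ultimately show ?case using A'(1,3) by (intro exI[of _ "A' - {a}"]) auto
qed

text \<open>Real codimension at most \<open>k\<close>, stated by generators so that no quotient
  spaces are needed.\<close>

definition fincodim :: "nat => 'a::real_vector set => 'a set => bool" where
  "fincodim k M H \<longleftrightarrow> (\<exists>N. finite N \<and> card N <= k \<and> N \<subseteq> H \<and> H \<subseteq> span (M \<union> N))"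

text \<open>\<open>T\<close> induces an injection of \<open>H'\<close> modulo the preimage of
  \<open>M\<close> into \<open>H\<close> modulo \<open>M\<close>. Concretely, each generator
  \<open>n\<close> of \<open>H\<close> over \<open>M\<close> requires at most one generator
  \<open>x\<close> of \<open>H'\<close> over the preimage.\<close>

lemma fincodim_vimage:
  fixes T :: "'a::real_vector => 'b::real_vector"
  assumes T: "linear T" and H': "subspace H'" and M: "subspace M" and sub: "\<And>h. h \<in> H' ==> T h \<in> H"
    and fc: "fincodim k M H"
  shows "fincodim k {h\<in>H'. T h \<in> M} H'"
proof -
  obtain N where N: "finite N" "card N <= k" "H \<subseteq> span (M \<union> N)" using fc by (auto simp: fincodim_def)
  have "\<exists>N'. finite N' \<and> card N' <= card N \<and> N' \<subseteq> H' \<and> {h\<in>H'. T h \<in> span (M \<union> N)} \<subseteq> span ({h\<in>H'. T h \<in> M} \<union> N')"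
    using N(1) M
  proof (induction N arbitrary: M rule: finite_induct)
    case empty
    then show ?case by (intro exI[of _ "{}"]) (auto simp: span_eq_iff[THEN iffD2] intro: span_base)
  next
    case (insert n N)
    define M1 where "M1 = span (insert n M)"
    have s1: "subspace M1" by (simp add: M1_def)
    have eq: "span (M \<union> insert n N) = span (M1 \<union> N)"
      unfolding M1_def
    proof (rule antisym; rule span_minimal)
      show "M \<union> insert n N \<subseteq> span (span (insert n M) \<union> N)"
        using span_superset[of "insert n M"] span_superset[of "span (insert n M) \<union> N"] by blast
      have "span (insert n M) \<subseteq> span (M \<union> insert n N)" by (rule span_mono) auto
      then show "span (insert n M) \<union> N \<subseteq> span (M \<union> insert n N)" using span_superset[of "M \<union> insert n N"] by blast
    qed auto
    obtain N' where N': "finite N'" "card N' <= card N" "N' \<subseteq> H'"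
      "{h\<in>H'. T h \<in> span (M1 \<union> N)} \<subseteq> span ({h\<in>H'. T h \<in> M1} \<union> N')"
      using insert.IH[OF s1] by blast
    show ?case
    proof (cases "\<exists>x\<in>H'. T x \<in> M1 \<and> T x \<notin> M")
      case False
      then have "{h\<in>H'. T h \<in> M1} \<subseteq> {h\<in>H'. T h \<in> M}" by blast
      then have "span ({h\<in>H'. T h \<in> M1} \<union> N') \<subseteq> span ({h\<in>H'. T h \<in> M} \<union> N')" by (intro span_mono) auto
      then show ?thesis using N' insert.hyps unfolding eq by (intro exI[of _ N']) auto
    next
      case True
      then obtain x where x: "x \<in> H'" "T x \<in> M1" "T x \<notin> M" by blast
      obtain c where c: "T x - c *\<^sub>R n \<in> span M" using x(2) unfolding M1_def by (rule span_breakdown_eq[THEN iffD1, THEN exE])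
      have sM: "span M = M" using insert.prems by simp
      have c0: "c ~= 0" using c x(3) sM by auto
      have "{h\<in>H'. T h \<in> M1} \<subseteq> span (insert x {h\<in>H'. T h \<in> M})"
      proof
        fix h assume "h \<in> {h\<in>H'. T h \<in> M1}"
        then have h: "h \<in> H'" "T h \<in> M1" by auto
        obtain e where e: "T h - e *\<^sub>R n \<in> span M" using h(2) unfolding M1_def by (rule span_breakdown_eq[THEN iffD1, THEN exE])
        have "T (h - (e/c) *\<^sub>R x) = (T h - e *\<^sub>R n) - (e/c) *\<^sub>R (T x - c *\<^sub>R n)"
          using T c0 by (simp add: linear_diff linear_scale algebra_simps)
        also have "\<dots> \<in> M" using c e insert.prems unfolding sM by (auto intro: subspace_diff subspace_scale)
        finally have "h - (e/c) *\<^sub>R x \<in> {h\<in>H'. T h \<in> M}"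
          using h(1) x(1) H' by (auto intro: subspace_diff subspace_scale)
        then show "h \<in> span (insert x {h\<in>H'. T h \<in> M})"
          unfolding span_breakdown_eq by (intro exI[of _ "e/c"]) (rule span_base)
      qed
      then have "{h\<in>H'. T h \<in> M1} \<union> N' \<subseteq> span ({h\<in>H'. T h \<in> M} \<union> insert x N')"
      proof -
        have "span (insert x {h\<in>H'. T h \<in> M}) \<subseteq> span ({h\<in>H'. T h \<in> M} \<union> insert x N')" by (rule span_mono) auto
        moreover have "N' \<subseteq> span ({h\<in>H'. T h \<in> M} \<union> insert x N')" by (auto intro: span_base)
        ultimately show ?thesis using \<open>{h\<in>H'. T h \<in> M1} \<subseteq> span (insert x {h\<in>H'. T h \<in> M})\<close> by blast
      qed
      then have "span ({h\<in>H'. T h \<in> M1} \<union> N') \<subseteq> span ({h\<in>H'. T h \<in> M} \<union> insert x N')" by (rule span_minimal) simp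
      moreover have "card (insert x N') <= card (insert n N)"
        using N' insert.hyps by (simp add: card_insert_if)
      ultimately show ?thesis using N' x(1) unfolding eq by (intro exI[of _ "insert x N'"]) auto
    qed
  qed
  then obtain N' where N': "finite N'" "card N' <= card N" "N' \<subseteq> H'" "{h\<in>H'. T h \<in> span (M \<union> N)} \<subseteq> span ({h\<in>H'. T h \<in> M} \<union> N')"
    by blast
  have "H' \<subseteq> {h\<in>H'. T h \<in> span (M \<union> N)}" using sub N(3) by blast
  then show ?thesis using N' N(2) unfolding fincodim_def by (intro exI[of _ N']) auto
qed

lemma fincodim_trans:
  assumes "fincodim j M M1" "fincodim k M1 H" "M1 \<subseteq> H"
  shows "fincodim (j + k) M H"
proof -
  obtain N where N: "finite N" "card N <= j" "N \<subseteq> M1" "M1 \<subseteq> span (M \<union> N)" using assms(1) by (auto simp: fincodim_def)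
  obtain N' where N': "finite N'" "card N' <= k" "N' \<subseteq> H" "H \<subseteq> span (M1 \<union> N')" using assms(2) by (auto simp: fincodim_def)
  have "span (M1 \<union> N') \<subseteq> span (M \<union> (N \<union> N'))"
  proof (rule span_minimal)
    have "span (M \<union> N) \<subseteq> span (M \<union> (N \<union> N'))" by (rule span_mono) auto
    then show "M1 \<union> N' \<subseteq> span (M \<union> (N \<union> N'))" using N(4) span_superset[of "M \<union> (N \<union> N')"] by blast
  qed simp
  moreover have "card (N \<union> N') <= j + k" using card_Un_le[of N N'] N(2) N'(2) by linarith
  ultimately show ?thesis
    unfolding fincodim_def using N N' assms(3) by (intro exI[of _ "N \<union> N'"]) auto
qed

lemma fincodim_mono: "fincodim k M H ==> M \<subseteq> M' ==> fincodim k M' H"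
  unfolding fincodim_def using span_mono[of "M \<union> _" "M' \<union> _"] by (meson Un_mono order_refl order_trans)

text \<open>The intersection is the preimage of \<open>M\<close> under the inclusion of
  \<open>M'\<close>.\<close>

lemma fincodim_Int:
  assumes "subspace M" "subspace M'" "M' \<subseteq> H" "fincodim j M H" "fincodim k M' H"
  shows "fincodim (j + k) (M \<inter> M') H"
proof -
  have "fincodim j {h\<in>M'. id h \<in> M} M'"
    by (rule fincodim_vimage[OF _ assms(2,1) _ assms(4)]) (use assms(3) in \<open>auto simp: id_def intro: linear_id[unfolded id_def]\<close>)
  moreover have "{h\<in>M'. id h \<in> M} = M \<inter> M'" by auto
  ultimately show ?thesis using fincodim_trans[OF _ assms(5,3), of j "M \<inter> M'"] by simp
qed

text \<open>A functional vanishing on \<open>M\<close> but not at \<open>n\<close> reads off the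
  coefficient of \<open>n\<close> continuously, so the span is the preimage of \<open>M\<close>
  under a continuous map.\<close>

lemma closed_span_insert:
  fixes M :: "'a::real_normed_vector set"
  assumes "subspace M" "closed M"
  shows "closed (span (insert n M))"
proof (cases "n \<in> M")
  case True
  then have "insert n M = M" by auto
  then show ?thesis using assms by (simp add: span_eq_iff[THEN iffD2])
next
  case False
  then obtain L :: "'a => real" where L: "bounded_linear L" "\<And>w. w \<in> M ==> L w = 0" "L n ~= 0"
    using hahn_banach_separation[OF assms] by blast
  have sM: "span M = M" using assms by simp
  have "span (insert n M) = (%x. x - (L x / L n) *\<^sub>R n) -` M"
  proof (intro equalityI subsetI)
    fix x assume "x \<in> span (insert n M)"
    then obtain c where c: "x - c *\<^sub>R n \<in> M" unfolding span_breakdown_eq sM by auto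
    have "L x = c * L n"
      using L(2)[OF c] L(1) by (simp add: bounded_linear.linear linear_diff linear_scale)
    then show "x \<in> (%x. x - (L x / L n) *\<^sub>R n) -` M" using c L(3) by simp
  next
    fix x assume "x \<in> (%x. x - (L x / L n) *\<^sub>R n) -` M"
    then show "x \<in> span (insert n M)" unfolding span_breakdown_eq sM by auto
  qed
  moreover have "continuous_on UNIV (%x. x - (L x / L n) *\<^sub>R n)"
    using L(3) by (intro continuous_intros linear_continuous_on L(1)) auto
  ultimately show ?thesis using closed_vimage[OF assms(2)] by simp
qed

lemma closed_span_Un:
  fixes M :: "'a::real_normed_vector set"
  assumes "subspace M" "closed M" "finite N"
  shows "closed (span (M \<union> N))"
  using assms(3)
proof (induction N rule: finite_induct)
  case empty
  then show ?case using assms by (simp add: span_eq_iff[THEN iffD2])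
next
  case (insert n N)
  have "closed (span (insert n (span (M \<union> N))))" by (rule closed_span_insert[OF subspace_span insert.IH])
  moreover have "span (insert n (span (M \<union> N))) = span (M \<union> insert n N)"
  proof (rule antisym; rule span_minimal)
    have "span (M \<union> N) \<subseteq> span (M \<union> insert n N)" by (rule span_mono) auto
    then show "insert n (span (M \<union> N)) \<subseteq> span (M \<union> insert n N)" by (auto intro: span_base)
    show "M \<union> insert n N \<subseteq> span (insert n (span (M \<union> N)))"
      using span_superset[of "M \<union> N"] span_superset[of "insert n (span (M \<union> N))"] by blast
  qed auto
  ultimately show ?case by simp
qed

text \<open>Complement vectors are split off one at a time. Each is chosen almost orthogonal to
  \<open>M\<close> in the sense of Riesz's lemma, which costs a factor 3 and gives
  \<open>3 ^ c\<close> after \<open>c\<close> steps. That the constant depends on the codimension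
  alone is what later allows many small steps with the same bound.\<close>

lemma bounded_complement:
  fixes M H :: "'a::real_normed_vector set"
  assumes "subspace H" "subspace M" "closed M" "M \<subseteq> H" "fincodim c M H"
  shows "\<exists>N. finite N \<and> card N <= c \<and> N \<subseteq> H \<and> (\<forall>h\<in>H. \<exists>m\<in>M. \<exists>n\<in>span N. h = m + n \<and> norm m <= 3 ^ c * norm h)"
  using assms(2-)
proof (induction c arbitrary: M)
  case 0
  then have "H \<subseteq> M" by (auto simp: fincodim_def span_eq_iff[THEN iffD2])
  then show ?case by (intro exI[of _ "{}"]) (auto intro!: bexI[where x = "_"])
next
  case (Suc c)
  show ?case
  proof (cases "H \<subseteq> M")
    case True
    have "norm h <= 3 ^ Suc c * norm h" for h :: 'a
      using mult_right_mono[of 1 "3 ^ Suc c" "norm h"] by (simp add: one_le_power del: power_Suc)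
    then show ?thesis using True by (intro exI[of _ "{}"]) (auto intro!: bexI[where x = "_"])
  next
    case False
    then obtain y where y: "y \<in> H" "y \<notin> M" by auto
    define d where "d = infdist y M"
    have Mne: "M ~= {}" using Suc.prems(1) subspace_0 by auto
    have d: "d > 0" unfolding d_def using in_closed_iff_infdist_zero[OF Suc.prems(2) Mne, of y] y infdist_nonneg[of y M] by linarith
    obtain m0 where m0: "m0 \<in> M" "norm (y - m0) < 2 * d"
    proof -
      have "(INF a\<in>M. dist y a) < 2 * d" using d Mne unfolding d_def by (simp add: infdist_notempty)
      then show ?thesis using that Mne
        by (subst (asm) cINF_less_iff) (auto simp: dist_norm intro!: bdd_belowI2[where m=0])
    qed
    define n where "n = y - m0"
    have nH: "n \<in> H" "n \<notin> M"
      using y m0 Suc.prems(1,3) assms(1) subspace_add[OF Suc.prems(1), of n m0] unfolding n_def by (auto intro: subspace_diff)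
    have dn: "norm (n - m) >= d" if "m \<in> M" for m
    proof -
      have "m0 + m \<in> M" using m0 that Suc.prems(1) subspace_add by blast
      then have "d <= dist y (m0 + m)" unfolding d_def by (rule infdist_le)
      then show ?thesis by (simp add: n_def dist_norm algebra_simps)
    qed
    define M1 where "M1 = span (insert n M)"
    have sM: "span M = M" using Suc.prems(1) by simp
    have M1: "subspace M1" "closed M1" "M1 \<subseteq> H"
      unfolding M1_def using closed_span_insert[OF Suc.prems(1,2)] Suc.prems(3) nH assms(1) span_minimal[of "insert n M" H]
      by auto
    \<comment> \<open>Steinitz: \<open>n\<close> replaces one of the given generators, so the
      codimension really drops.\<close>
    have fc1: "fincodim c M1 H"
    proof -
      obtain N where N: "finite N" "card N <= Suc c" "N \<subseteq> H" "H \<subseteq> span (M \<union> N)"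
        using Suc.prems(4) by (auto simp: fincodim_def)
      have "n \<in> span (M \<union> N)" "n \<notin> span M" using nH N(4) unfolding sM by auto
      then obtain a where a: "a \<in> N" "a \<in> span (insert n (M \<union> (N - {a})))" using exchange_step[OF N(1)] by blast
      have "span (M \<union> N) \<subseteq> span (M1 \<union> (N - {a}))"
      proof (rule span_minimal)
        have "insert n (M \<union> (N - {a})) \<subseteq> span (M1 \<union> (N - {a}))"
          unfolding M1_def using span_superset[of "insert n M"] span_superset[of "span (insert n M) \<union> (N - {a})"] by blast
        then have "span (insert n (M \<union> (N - {a}))) \<subseteq> span (M1 \<union> (N - {a}))" by (rule span_minimal) simp
        then show "M \<union> N \<subseteq> span (M1 \<union> (N - {a}))"
          using a \<open>insert n (M \<union> (N - {a})) \<subseteq> span (M1 \<union> (N - {a}))\<close> by blast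
      qed simp
      moreover have "card (N - {a}) <= c" using N(1,2) a(1) by simp
      ultimately show ?thesis unfolding fincodim_def using N by (intro exI[of _ "N - {a}"]) auto
    qed
    obtain N where N: "finite N" "card N <= c" "N \<subseteq> H"
      "\<And>h. h \<in> H ==> \<exists>m\<in>M1. \<exists>n\<in>span N. h = m + n \<and> norm m <= 3 ^ c * norm h"
      using Suc.IH[OF M1 fc1] by blast
    have "\<exists>m\<in>M. \<exists>n'\<in>span (insert n N). h = m + n' \<and> norm m <= 3 ^ Suc c * norm h" if h: "h \<in> H" for h
    proof -
      obtain m1 n1 where m1: "m1 \<in> M1" "n1 \<in> span N" "h = m1 + n1" "norm m1 <= 3 ^ c * norm h" using N(4)[OF h] by blast
      obtain t where t: "m1 - t *\<^sub>R n \<in> M" using m1(1) unfolding M1_def span_breakdown_eq sM by auto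
      have "norm (t *\<^sub>R n) <= 2 * norm m1"
      proof (cases "t = 0")
        case False
        have mm: "- ((1/t) *\<^sub>R (m1 - t *\<^sub>R n)) \<in> M" using t Suc.prems(1) subspace_scale subspace_neg by metis
        have "n - (- ((1/t) *\<^sub>R (m1 - t *\<^sub>R n))) = (1/t) *\<^sub>R m1" using False by (simp add: algebra_simps)
        then have "d <= norm ((1/t) *\<^sub>R m1)" using dn[OF mm] by simp
        then have "\<bar>t\<bar> * d <= norm m1" using False by (simp add: field_simps)
        moreover have "\<bar>t\<bar> * norm n <= \<bar>t\<bar> * (2 * d)" using m0(2) unfolding n_def by (intro mult_left_mono) auto
        ultimately show ?thesis by simp
      qed simp
      \<comment> \<open>The distance of \<open>n\<close> from \<open>M\<close> is more than half its
        norm, so \<open>t *\<^sub>R n\<close> is at most \<open>2 * norm m1\<close>; this gives the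
        factor 3.\<close>
      then have "norm (m1 - t *\<^sub>R n) <= 3 * norm m1" using norm_triangle_ineq4[of m1 "t *\<^sub>R n"] by linarith
      then have "norm (m1 - t *\<^sub>R n) <= 3 ^ Suc c * norm h" using m1(4) by simp
      moreover have "t *\<^sub>R n + n1 \<in> span (insert n N)"
        using m1(2) span_mono[of N "insert n N", OF subset_insertI] span_base[of n "insert n N"] by (auto intro!: span_add span_scale)
      moreover have "h = (m1 - t *\<^sub>R n) + (t *\<^sub>R n + n1)" using m1(3) by simp
      ultimately show ?thesis using t by blast
    qed
    moreover have "card (insert n N) <= Suc c" using N by (simp add: card_insert_if)
    ultimately show ?thesis using N nH by (intro exI[of _ "insert n N"]) auto
  qed
qed

text \<open>A Neumann series: decompose along a bounded complement of \<open>M\<close> and iterate on the error.\<close>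

lemma fincodim_small_step:
  fixes M H :: "'a::banach set"
  assumes H: "subspace H" and M: "subspace M" "closed M" "M \<subseteq> H" "fincodim c M H"
    and T: "bounded_linear T" "\<And>m. m \<in> M ==> T m \<in> H" "\<And>m. m \<in> M ==> norm (T m - m) <= e * norm m"
    and e: "e >= 0" "e * 3 ^ c <= 1/2"
  shows "fincodim c (T ` M) H"
proof -
  obtain N where N: "finite N" "card N <= c" "N \<subseteq> H"
    "\<And>h. h \<in> H ==> \<exists>m\<in>M. \<exists>n\<in>span N. h = m + n \<and> norm m <= 3 ^ c * norm h"
    using bounded_complement[OF H M] by blast
  define K where "K = (3::real) ^ c"
  have "\<exists>mm nn. \<forall>h\<in>H. mm h \<in> M \<and> nn h \<in> span N \<and> h = mm h + nn h \<and> norm (mm h) <= K * norm h"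
    using N(4) unfolding K_def by metis
  then obtain mm nn where D: "\<And>h. h \<in> H ==> mm h \<in> M \<and> nn h \<in> span N \<and> h = mm h + nn h \<and> norm (mm h) <= K * norm h" by blast
  have "h \<in> span (T ` M \<union> N)" if h: "h \<in> H" for h
  proof -
    \<comment> \<open>The successive errors: the \<open>M\<close>-part of the current error is
      replaced by its discrepancy under \<open>T\<close>, and \<open>e * 3 ^ c <= 1/2\<close> makes
      the errors halve.\<close>
    define x where "x = rec_nat h (%_ y. mm y - T (mm y))"
    have xS: "x (Suc k) = mm (x k) - T (mm (x k))" and x0: "x 0 = h" for k by (auto simp: x_def)
    have xH: "x k \<in> H" for k
    proof (induction k)
      case 0 then show ?case using h x0 by simp
    next
      case (Suc k)
      have "mm (x k) \<in> M" using D[OF Suc] by blast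
      then show ?case unfolding xS using M(3) T(2) H by (auto intro: subspace_diff)
    qed
    have xn: "norm (x k) <= norm h * (1/2) ^ k" for k
    proof (induction k)
      case 0 then show ?case using x0 by simp
    next
      case (Suc k)
      have m: "mm (x k) \<in> M" "norm (mm (x k)) <= K * norm (x k)" using D[OF xH] by blast+
      have "norm (x (Suc k)) <= e * norm (mm (x k))" unfolding xS using T(3)[OF m(1)] by (simp add: norm_minus_commute)
      also have "\<dots> <= e * (K * norm (x k))" using m(2) e(1) by (rule mult_left_mono)
      also have "\<dots> <= 1/2 * norm (x k)" using mult_right_mono[OF e(2), of "norm (x k)"] by (simp add: K_def)
      finally show ?case using Suc by simp
    qed
    have summ: "summable (%k. mm (x k))"
    proof (rule summable_comparison_test')
      show "summable (%k. K * (norm h * (1/2) ^ k))" by (intro summable_mult summable_geometric) simp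
      fix k
      have "norm (mm (x k)) <= K * norm (x k)" using D[OF xH] by blast
      also have "\<dots> <= K * (norm h * (1/2) ^ k)" using xn by (intro mult_left_mono) (auto simp: K_def)
      finally show "norm (mm (x k)) <= K * (norm h * (1/2) ^ k)" .
    qed
    define S where "S = (%n. \<Sum>k<n. mm (x k))"
    define m where "m = suminf (%k. mm (x k))"
    have Sm: "S \<longlonglongrightarrow> m" unfolding S_def m_def by (rule summable_LIMSEQ[OF summ])
    have SM: "S n \<in> M" for n unfolding S_def using D[OF xH] M(1) by (auto intro: subspace_sum)
    have mM: "m \<in> M" by (rule closed_sequentially[OF M(2) SM Sm])
    have lin: "linear T" using T(1) by (rule bounded_linear.linear)
    \<comment> \<open>The complementary parts stay in the fixed finite-dimensional space
      \<open>span N\<close>, which is closed, so the limit \<open>h - T m\<close> lies there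
      too.\<close>
    have part: "h - T (S n) - x n = (\<Sum>k<n. nn (x k))" for n
    proof (induction n)
      case 0 then show ?case using x0 lin by (simp add: S_def linear_0)
    next
      case (Suc n)
      have "x n = mm (x n) + nn (x n)" using D[OF xH] by blast
      then have "h - T (S (Suc n)) - x (Suc n) = (h - T (S n) - x n) + nn (x n)"
        unfolding xS S_def using lin by (simp add: linear_add algebra_simps)
      then show ?case using Suc by simp
    qed
    have "(%n. h - T (S n) - x n) \<longlonglongrightarrow> h - T m - 0"
    proof (intro tendsto_intros bounded_linear.tendsto[OF T(1)] Sm)
      have "(%k. norm h * (1/2) ^ k) \<longlonglongrightarrow> norm h * 0" by (intro tendsto_intros LIMSEQ_power_zero) simp
      then show "x \<longlonglongrightarrow> 0" using Lim_null_comparison[of x "%k. norm h * (1/2) ^ k" sequentially] xn by (auto intro: always_eventually)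
    qed
    moreover have "h - T (S n) - x n \<in> span N" for n unfolding part using D[OF xH] by (intro span_sum) blast
    moreover have "closed (span N)"
      using closed_span_Un[of "{0}" N] N(1) by (simp add: subspace_single_0 span_insert_0)
    ultimately have "h - T m - 0 \<in> span N" using closed_sequentially[of "span N" "%n. h - T (S n) - x n" "h - T m - 0"] by blast
    then have "h - T m \<in> span (T ` M \<union> N)" using span_mono[of N "T ` M \<union> N"] by auto
    moreover have "T m \<in> span (T ` M \<union> N)" using mM by (intro span_base) auto
    ultimately have "(h - T m) + T m \<in> span (T ` M \<union> N)" by (rule span_add)
    then show ?thesis by simp
  qed
  then show ?thesis unfolding fincodim_def using N by blast
qed

text \<open>An index count. \<open>T\<close> carries \<open>H\<close> modulo \<open>I\<close>
  isomorphically to \<open>T\<close> H\<open>modulo\<close>T \<open>I\<close>, which thus already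
  has dimension \<open>c\<close>; as \<open>H\<close> modulo \<open>T\<close>
  I\<open>has dimension at most\<close>c\<open>, nothing is left. In the proof the\<close>c\<open>independent vectors\<close>T
  \<open>N\<close> use up all of \<open>A\<close> by exchange.\<close>

lemma fincodim_equal_imp_onto:
  fixes T :: "'a::real_vector => 'a"
  assumes T: "linear T" "inj_on T H" and H: "subspace H" and I: "subspace I" "I \<subseteq> H"
    and sub: "T ` H \<subseteq> H" and fcI: "fincodim c I H" and least: "\<And>k. fincodim k I H ==> c <= k"
    and fcT: "fincodim c (T ` I) H"
  shows "T ` H = H"
proof -
  obtain N where N: "finite N" "card N <= c" "N \<subseteq> H" "H \<subseteq> span (I \<union> N)" using fcI by (auto simp: fincodim_def)
  have cN: "card N = c"
  proof -
    have "fincodim (card N) I H" using N unfolding fincodim_def by blast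
    then have "c <= card N" by (rule least)
    then show ?thesis using N(2) by simp
  qed
  have HN: "H = span (I \<union> N)" by (rule antisym[OF N(4) span_minimal[OF Un_least[OF I(2) N(3)] H]])
  have indep: "T b \<notin> span (T ` I \<union> (T ` N - {T b}))" if b: "b \<in> N" for b
  proof
    assume a: "T b \<in> span (T ` I \<union> (T ` N - {T b}))"
    have "T ` N - {T b} \<subseteq> T ` (N - {b})" by auto
    then have "span (T ` I \<union> (T ` N - {T b})) \<subseteq> span (T ` (I \<union> (N - {b})))" by (intro span_mono) auto
    then have "T b \<in> T ` span (I \<union> (N - {b}))" using a linear_span_image[OF T(1)] by blast
    then obtain y where y: "y \<in> span (I \<union> (N - {b}))" "T y = T b" by auto
    have "span (I \<union> (N - {b})) \<subseteq> H" using N I H by (intro span_minimal) auto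
    then have "y = b" using T(2) y b N(3) by (auto dest: inj_onD)
    then have "b \<in> span (I \<union> (N - {b}))" using y by simp
    then have "I \<union> N \<subseteq> span (I \<union> (N - {b}))" using span_superset[of "I \<union> (N - {b})"] by blast
    then have "H \<subseteq> span (I \<union> (N - {b}))" unfolding HN by (rule span_minimal) simp
    then have "fincodim (card (N - {b})) I H" using N unfolding fincodim_def by blast
    then have "c <= card (N - {b})" by (rule least)
    moreover have "card (N - {b}) < card N" using b N(1) by (rule card_Diff1_less[rotated])
    ultimately show False using cN by simp
  qed
  obtain A where A: "finite A" "card A <= c" "A \<subseteq> H" "H \<subseteq> span (T ` I \<union> A)" using fcT by (auto simp: fincodim_def)
  have "\<exists>A'\<subseteq>A. card A' + card (T ` N) <= card A \<and> span (T ` I \<union> A) \<subseteq> span (T ` I \<union> T ` N \<union> A')"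
  proof (rule steinitz_modulo)
    show "finite (T ` N)" "finite A" using N A by auto
    show "T ` N \<subseteq> span (T ` I \<union> A)" using N(3) A(4) sub by blast
    show "b \<notin> span (T ` I \<union> (T ` N - {b}))" if "b \<in> T ` N" for b using indep that by blast
  qed
  then obtain A' where A': "A' \<subseteq> A" "card A' + card (T ` N) <= card A" "span (T ` I \<union> A) \<subseteq> span (T ` I \<union> T ` N \<union> A')" by blast
  have "card (T ` N) = c" using cN N(3) T(2) by (simp add: card_image inj_on_subset)
  then have "card A' = 0" using A'(2) A(2) by simp
  then have "A' = {}" using finite_subset[OF A'(1) A(1)] by simp
  then have "H \<subseteq> span (T ` (I \<union> N))" using A' A(4) by (simp add: image_Un)
  also have "\<dots> = T ` H" unfolding HN by (rule linear_span_image[OF T(1)])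
  finally show ?thesis using sub by auto
qed

subsection \<open>Divisors in the uniform closure\<close>

context curve_algebra begin

definition H where "H = closure (ext ` P)"

lemma P_zero: "(%t. 0) \<in> P" using P_const[of 0] .

lemma P_cmult: "u \<in> P ==> (%t. c * u t) \<in> P" using P_mult[OF P_const] .

lemma subspace_ext_P: "subspace (ext ` P)"
  unfolding subspace_def
proof (intro conjI ballI allI)
  have "ext (%t. 0) = 0" by (rule bcontfun_eqI) (simp add: apply_ext)
  then show "0 \<in> ext ` P" using P_zero by (metis imageI)
  fix x assume "x \<in> ext ` P"
  then obtain u where u: "x = ext u" "u \<in> P" by auto
  { fix y assume "y \<in> ext ` P"
    then obtain v where v: "y = ext v" "v \<in> P" by auto
    have "x + y = ext (%t. u t + v t)" unfolding u(1) v(1) by (rule ext_add[OF P_cont01[OF u(2)] P_cont01[OF v(2)], symmetric])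
    then show "x + y \<in> ext ` P" using P_add[OF u(2) v(2)] by blast }
  fix c :: real
  have "c *\<^sub>R x = ext (%t. c *\<^sub>R u t)" unfolding u(1) by (rule ext_scaleR[OF P_cont01[OF u(2)], symmetric])
  moreover have "(%t. c *\<^sub>R u t) \<in> P" using P_cmult[OF u(2), of "of_real c"] by (simp add: scaleR_conv_of_real)
  ultimately show "c *\<^sub>R x \<in> ext ` P" by blast
qed

lemma subspace_H: "subspace H" and closed_H: "closed H" and ext_in_H: "u \<in> P ==> ext u \<in> H"
  unfolding H_def using subspace_closure'[OF subspace_ext_P] closure_subset[of "ext ` P"] by auto

lemma bm_P_H:
  assumes "u \<in> P" "x \<in> H"
  shows "bm (ext u) x \<in> H"
proof -
  have "bm (ext u) ` closure (ext ` P) \<subseteq> closure (bm (ext u) ` ext ` P)"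
    by (rule image_closure_subset)
      (auto intro: closure_subset[THEN subsetD] linear_continuous_on bounded_bilinear.bounded_linear_right[OF bounded_bilinear_bm])
  also have "\<dots> \<subseteq> closure (ext ` P)"
  proof (rule closure_mono, clarify)
    fix v assume v: "v \<in> P"
    have "bm (ext u) (ext v) = ext (%t. u t * v t)" by (rule ext_mult[OF P_cont01[OF assms(1)] P_cont01[OF v], symmetric])
    then show "bm (ext u) (ext v) \<in> ext ` P" using P_mult[OF assms(1) v] by blast
  qed
  finally show ?thesis using assms(2) unfolding H_def by blast
qed

lemma separation_from_H:
  assumes v: "continuous_on {0..1} v" "ext v \<notin> H"
  shows "\<exists>L. annihilates L \<and> L v ~= 0"
proof -
  obtain d where d: "d > 0" "\<And>q. q \<in> P ==> d <= dist (ext q) (ext v)"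
    using v(2) unfolding H_def closure_approachable by (metis imageI not_le)
  have "\<exists>t\<in>{0..1}. norm (v t - q t) >= d/2" if q: "q \<in> P" for q
  proof (rule ccontr)
    assume "\<not> ?thesis"
    then have "norm (v t - q t) <= d/2" if "t \<in> {0..1}" for t using that by force
    then have "norm (ext (%t. v t - q t)) <= d/2"
      by (intro norm_ext_le continuous_on_diff v P_cont01[OF q])
    then have "norm (ext v - ext q) <= d/2" by (simp add: ext_diff[OF v(1) P_cont01[OF q]])
    then show False using d(2)[OF q] d(1) by (simp add: dist_norm norm_minus_commute)
  qed
  then have "\<exists>L. cdual L \<and> (\<forall>u\<in>P. L u = 0) \<and> L v ~= 0"
    by (intro cdual_separation[where d = "d/2"] P_cont01 P_zero P_add P_cmult v) (use d in auto)
  then show ?thesis unfolding annihilates_def by blast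
qed

text \<open>The functionals that vanish on the ideal generated by \<open>p - w\<close>, in other
  words functionals on the fibre algebra of \<open>P\<close> over \<open>w\<close>.\<close>

definition killers :: "complex => ((real => complex) => complex) set" where
  "killers w = {\<kappa>. cdual \<kappa> \<and> (\<forall>v\<in>P. \<kappa> (%t. (p t - w) * v t) = 0)}"

lemma pw_P: "(%t. p t - w) \<in> P"
  using P_add[OF P_p P_const[of "-w"]] by simp

text \<open>Multiplication by \<open>p - w\<close> turns a functional on the fibre into an
  annihilator of \<open>P\<close> whose Cauchy transform at \<open>w\<close> is the functional
  itself. The rank bound thereby becomes a bound for the forms
  \<open>(g, h) \<mapsto> \<kappa> (g * h)\<close>.\<close>

lemma killers_phi:
  assumes "\<kappa> \<in> killers w" "w \<notin> X"
  shows "annihilates (%u. \<kappa> (%t. (p t - w) * u t))"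
    and "continuous_on {0..1} u ==> phi (%u. \<kappa> (%t. (p t - w) * u t)) w u = \<kappa> u"
proof -
  have \<kappa>: "cdual \<kappa>" "\<And>v. v \<in> P ==> \<kappa> (%t. (p t - w) * v t) = 0" using assms(1) by (auto simp: killers_def)
  show "annihilates (%u. \<kappa> (%t. (p t - w) * u t))"
    unfolding annihilates_def using \<kappa>(2) cdual_multiplier[OF \<kappa>(1) P_cont01[OF pw_P]] by blast
  assume u: "continuous_on {0..1} u"
  show "phi (%u. \<kappa> (%t. (p t - w) * u t)) w u = \<kappa> u"
    unfolding phi_def
    by (rule cdual_cong[OF \<kappa>(1) u, symmetric]) (use assms(2) in \<open>auto simp: X_def\<close>)
qed

lemma killers_lincomb: "\<kappa> \<in> killers w ==> \<kappa>' \<in> killers w ==> (%u. \<kappa> u + c * \<kappa>' u) \<in> killers w"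
  unfolding killers_def using cdual_lincomb[of \<kappa> \<kappa>' c] by simp

definition gram :: "((real => complex) => complex) => (nat => real => complex) => (nat => real => complex) => nat => nat => complex" where
  "gram \<kappa> g h = (%i j. \<kappa> (%t. g i t * h j t))"

text \<open>Take \<open>\<kappa>0\<close> with a nonzero minor of maximal order \<open>r\<close>. Elements of its kernel ideal \<open>I\<close> are cut out by
  \<open>r\<close> linear equations, so powers of \<open>z\<close> satisfy a monic relation modulo \<open>I\<close>. Dividing the vanishing bordered minors of
  \<open>\<kappa>0 + s * \<kappa>\<close> by \<open>s\<close> and letting \<open>s\<close> tend to 0 shows that \<open>\<kappa>\<close> vanishes on products of elements of \<open>I\<close>.\<close>

lemma square_of_relation_killed:
  assumes simple: "\<And>a t. a \<in> \<rat> ==> a \<in> {0..1} ==> t \<in> {0..1} ==> p t = p a ==> t = a"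
    and w: "w \<notin> X"
  shows "\<forall>z\<in>P. \<exists>(d::nat) c. \<forall>u\<in>P. \<forall>\<kappa>\<in>killers w.
     \<kappa> (%t. (z t ^ d + (\<Sum>k<d. c k * z t ^ k)) * ((z t ^ d + (\<Sum>k<d. c k * z t ^ k)) * u t)) = 0"
proof -
  define Z where "Z = (%n. \<forall>\<kappa>\<in>killers w. \<forall>g h. (\<forall>i. g i \<in> P) --> (\<forall>i. h i \<in> P) --> detf n (gram \<kappa> g h) = 0)"
  obtain N where N: "\<And>L g h. annihilates L ==> \<forall>i. g i \<in> P ==> \<forall>i. h i \<in> P ==> minor L N g h w = 0"
    using rank_bound[OF simple w] by blast
  have ZN: "Z N"
    unfolding Z_def
  proof (intro ballI allI impI)
    fix \<kappa> and g h :: "nat => real => complex" assume \<kappa>: "\<kappa> \<in> killers w" and gh: "\<forall>i. g i \<in> P" "\<forall>i. h i \<in> P"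
    have "gram \<kappa> g h = (%i j. phi (%u. \<kappa> (%t. (p t - w) * u t)) w (%t. g i t * h j t))"
      unfolding gram_def using killers_phi(2)[OF \<kappa> w P_cont01[OF P_mult]] gh by auto
    then show "detf N (gram \<kappa> g h) = 0"
      using N[OF killers_phi(1)[OF \<kappa> w] gh] by (simp add: minor_def)
  qed
  define n where "n = (LEAST n. Z n)"
  have Zn: "Z n" unfolding n_def using ZN by (rule LeastI)
  \<comment> \<open>The empty determinant is 1 and the zero functional is a killer, so order 0
    cannot occur and \<open>r = n - 1\<close> makes sense.\<close>
  have n0: "n ~= 0"
  proof
    assume "n = 0"
    moreover have "cdual (%u. 0)" unfolding cdual_def by (auto intro!: exI[of _ "%u. 0"])
    then have "(%u. 0) \<in> killers w" unfolding killers_def by simp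
    moreover have "detf 0 Y = 1" for Y by (simp add: detf_leibniz)
    ultimately show False using Zn P_zero unfolding Z_def by (metis one_neq_zero)
  qed
  then obtain r where r: "n = Suc r" by (cases n) auto
  have "\<not> Z r" using not_less_Least[of r Z] r unfolding n_def by simp
  then obtain \<kappa>0 g h where k0: "\<kappa>0 \<in> killers w" and gh: "\<And>i. g i \<in> P" "\<And>i. h i \<in> P" and det0: "detf r (gram \<kappa>0 g h) ~= 0"
    unfolding Z_def by blast
  have c0: "cdual \<kappa>0" using k0 by (simp add: killers_def)
  define I where "I = {a\<in>P. \<forall>b\<in>P. \<kappa>0 (%t. a t * b t) = 0}"
  have bord: "detf (Suc r) (bordered r (gram \<kappa> g h) (%i. \<kappa> (%t. g i t * b t)) (%j. \<kappa> (%t. a t * h j t)) (\<kappa> (%t. a t * b t))) = 0"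
    if \<kappa>: "\<kappa> \<in> killers w" and ab: "a \<in> P" "b \<in> P" for \<kappa> a b
  proof -
    define g' where "g' = (%i. if i < r then g i else a)"
    define h' where "h' = (%i. if i < r then h i else b)"
    have "\<forall>i. g' i \<in> P" "\<forall>i. h' i \<in> P" using gh ab by (auto simp: g'_def h'_def)
    then have "detf (Suc r) (gram \<kappa> g' h') = 0" using Zn \<kappa> unfolding Z_def r by blast
    moreover have "gram \<kappa> g' h' = bordered r (gram \<kappa> g h) (%i. \<kappa> (%t. g i t * b t)) (%j. \<kappa> (%t. a t * h j t)) (\<kappa> (%t. a t * b t))"
      by (auto simp: gram_def bordered_def g'_def h'_def fun_eq_iff)
    ultimately show ?thesis by simp
  qed
  \<comment> \<open>By maximality of \<open>r\<close> the bordered determinant vanishes; with a zero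
    border row it equals \<open>\<kappa>0 (a * b)\<close> times the nonzero minor. So
    \<open>r\<close> equations suffice for membership in \<open>I\<close>.\<close>
  have II: "a \<in> I" if a: "a \<in> P" and z: "\<And>j. j < r ==> \<kappa>0 (%t. a t * h j t) = 0" for a
    unfolding I_def
  proof (intro CollectI conjI a ballI)
    fix b assume b: "b \<in> P"
    have "detf (Suc r) (bordered r (gram \<kappa>0 g h) (%i. \<kappa>0 (%t. g i t * b t)) (%j. \<kappa>0 (%t. a t * h j t)) (\<kappa>0 (%t. a t * b t)))
       = detf (Suc r) (bordered r (gram \<kappa>0 g h) (%i. \<kappa>0 (%t. g i t * b t)) (%j. 0) (\<kappa>0 (%t. a t * b t)))"
      by (rule detf_cong) (simp add: bordered_def z)
    then show "\<kappa>0 (%t. a t * b t) = 0" using bord[OF k0 a b] det0 by (simp add: detf_bordered_zero_row)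
  qed
  have Ikill: "\<kappa> (%t. a t * b t) = 0" if \<kappa>: "\<kappa> \<in> killers w" and a: "a \<in> I" and b: "b \<in> I" for \<kappa> a b
  proof -
    define e where "e = (%i. \<kappa> (%t. g i t * b t))"
    define f where "f = (%j. \<kappa> (%t. a t * h j t))"
    define c where "c = \<kappa> (%t. a t * b t)"
    define A where "A = (%s i j. gram \<kappa>0 g h i j + s * gram \<kappa> g h i j)"
    define F where "F = (%s. detf (Suc r) (bordered r (A s) e (%j. s * f j) 0) + c * detf r (A s))"
    have aP: "a \<in> P" "b \<in> P" using a b by (auto simp: I_def)
    \<comment> \<open>Since \<open>\<kappa>0\<close> contributes nothing to the border, all border
      entries of \<open>\<kappa>0 + s * \<kappa>\<close> have a factor \<open>s\<close>. It is
      divided out of the column only; the border row keeps its factor and disappears at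
      \<open>s = 0\<close>.\<close>
    have z: "\<kappa>0 (%t. g i t * b t) = 0" "\<kappa>0 (%t. a t * h i t) = 0" "\<kappa>0 (%t. a t * b t) = 0" for i
    proof -
      have "\<kappa>0 (%t. b t * g i t) = 0" using b gh by (simp add: I_def)
      then show "\<kappa>0 (%t. g i t * b t) = 0" by (simp add: mult.commute)
    qed (use a gh aP in \<open>auto simp: I_def\<close>)
    have F0: "F s = 0" if "s ~= 0" for s
    proof -
      have "detf (Suc r) (bordered r (A s) (%i. s * e i) (%j. s * f j) (s * c)) = 0"
        using bord[OF killers_lincomb[OF k0 \<kappa>, of s] aP] z unfolding A_def gram_def e_def f_def c_def by simp
      then have "s * F s = 0" unfolding detf_bordered_split F_def by (simp add: algebra_simps)
      then show ?thesis using that by simp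
    qed
    have "(%s. bordered r (A s) e (%j. s * f j) 0 i j) holomorphic_on UNIV" "(%s. A s i j) holomorphic_on UNIV" for i j
      unfolding bordered_def A_def by (cases "i < r"; cases "j < r"; auto intro!: holomorphic_intros)+
    then have "F holomorphic_on UNIV"
      unfolding F_def
      by (intro holomorphic_on_add holomorphic_on_mult holomorphic_on_const detf_holomorphic) auto
    then have "isCont F 0"
      using holomorphic_on_imp_continuous_on continuous_on_eq_continuous_at open_UNIV by blast
    then have "(F \<longlongrightarrow> F 0) (at 0)" by (simp add: isCont_def)
    moreover have "(F \<longlongrightarrow> 0) (at 0)"
      by (rule tendsto_eventually) (use F0 in \<open>auto simp: eventually_at_filter\<close>)
    ultimately have "F 0 = 0" by (rule tendsto_unique[rotated 1]) simp
    moreover have "F 0 = c * detf r (gram \<kappa>0 g h)"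
      unfolding F_def by (simp add: detf_bordered_zero_row A_def)
    ultimately show ?thesis using det0 unfolding c_def by simp
  qed
  show ?thesis
  proof
    fix z assume z: "z \<in> P"
    obtain c where c: "\<exists>l\<le>r. c l ~= 0" "\<And>j. j < r ==> (\<Sum>l\<le>r. c l * \<kappa>0 (%t. z t ^ l * h j t)) = 0"
      using linear_dependence[of r "%l j. \<kappa>0 (%t. z t ^ l * h j t)"] by blast
    \<comment> \<open>Dividing by the last nonzero coefficient makes the relation monic of degree
      \<open>d\<close>.\<close>
    define d where "d = Max {l. l <= r \<and> c l ~= 0}"
    have fin: "finite {l. l <= r \<and> c l ~= 0}" by simp
    have d: "d <= r" "c d ~= 0" using Max_in[OF fin] c(1) unfolding d_def by auto
    have cz: "c l = 0" if "d < l" "l <= r" for l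
    proof (rule ccontr)
      assume "c l ~= 0"
      then have "l <= d" unfolding d_def by (intro Max_ge fin) (use that in simp)
      then show False using that by simp
    qed
    define c' where "c' = (%k. c k / c d)"
    define a where "a = (%t. z t ^ d + (\<Sum>k<d. c' k * z t ^ k))"
    have aP: "a \<in> P" unfolding a_def by (intro P_add P_sum P_cmult P_power z) auto
    have aeq: "a t = (\<Sum>k\<le>r. (c k / c d) * z t ^ k)" for t
    proof -
      have "(\<Sum>k\<le>r. (c k / c d) * z t ^ k) = (\<Sum>k\<le>d. (c k / c d) * z t ^ k)"
        by (rule sum.mono_neutral_right) (use d cz in \<open>auto simp: not_le\<close>)
      also have "\<dots> = a t" using d(2) by (simp add: a_def c'_def lessThan_Suc_atMost[symmetric] add.commute)
      finally show ?thesis by simp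
    qed
    have "a \<in> I"
    proof (rule II[OF aP])
      fix j assume j: "j < r"
      have "\<kappa>0 (%t. a t * h j t) = \<kappa>0 (%t. \<Sum>k\<le>r. (c k / c d) * (z t ^ k * h j t))"
        unfolding aeq by (simp add: sum_distrib_right mult.assoc)
      also have "\<dots> = (\<Sum>k\<le>r. \<kappa>0 (%t. (c k / c d) * (z t ^ k * h j t)))"
        by (rule cdual_sum[OF c0]) (simp, intro P_cont01 P_cmult P_mult P_power z gh)
      also have "\<dots> = (\<Sum>k\<le>r. (c k / c d) * \<kappa>0 (%t. z t ^ k * h j t))"
        by (intro sum.cong refl cdual_cmult[OF c0] P_cont01 P_mult P_power z gh)
      also have "\<dots> = (1 / c d) * (\<Sum>k\<le>r. c k * \<kappa>0 (%t. z t ^ k * h j t))"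
        by (simp add: sum_distrib_left)
      finally show "\<kappa>0 (%t. a t * h j t) = 0" using c(2)[OF j] by simp
    qed
    moreover have "(%t. a t * u t) \<in> I" if "u \<in> P" for u
      using \<open>a \<in> I\<close> that P_mult unfolding I_def by (auto simp: mult.assoc)
    ultimately have "\<forall>u\<in>P. \<forall>\<kappa>\<in>killers w. \<kappa> (%t. a t * (a t * u t)) = 0" using Ikill by blast
    then show "\<exists>d c. \<forall>u\<in>P. \<forall>\<kappa>\<in>killers w.
        \<kappa> (%t. (z t ^ d + (\<Sum>k<d. c k * z t ^ k)) * ((z t ^ d + (\<Sum>k<d. c k * z t ^ k)) * u t)) = 0"
      unfolding a_def by blast
  qed
qed

text \<open>If \<open>v / (p - w)\<close> were outside \<open>H\<close>, a separating annihilator of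
  \<open>P\<close>, composed with division by \<open>p - w\<close>, would be a killer that does not
  vanish at \<open>v\<close>.\<close>

lemma in_divisor_space:
  assumes w: "w \<notin> X" and v: "v \<in> P" and kill: "\<And>\<kappa>. \<kappa> \<in> killers w ==> \<kappa> v = 0"
  shows "bm (ext (%t. 1 / (p t - w))) (ext v) \<in> H"
proof -
  have ci: "continuous_on {0..1} (%t. 1 / (p t - w))" by (rule cont_div[OF continuous_on_const w])
  have "ext (%t. 1 / (p t - w) * v t) \<in> H"
  proof (rule ccontr)
    assume "\<not> ?thesis"
    then obtain L where L: "annihilates L" "L (%t. 1 / (p t - w) * v t) ~= 0"
      using separation_from_H[OF continuous_on_mult[OF ci P_cont01[OF v]]] by blast
    have cL: "cdual L" using L by (simp add: annihilates_def)
    have "(%u. L (%t. 1 / (p t - w) * u t)) \<in> killers w"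
      unfolding killers_def
    proof (intro CollectI conjI ballI cdual_multiplier[OF cL ci])
      fix v assume v: "v \<in> P"
      have "L v = L (%t. 1 / (p t - w) * ((p t - w) * v t))"
        by (rule cdual_cong[OF cL P_cont01[OF v]]) (use w in \<open>auto simp: X_def\<close>)
      then show "L (%t. 1 / (p t - w) * ((p t - w) * v t)) = 0" using L v by (simp add: annihilates_def)
    qed
    then show False using kill L(2) by blast
  qed
  then show ?thesis by (simp only: ext_mult[OF ci P_cont01[OF v]])
qed

end

section \<open>Finitely generated algebras: finite codimension of the divisors\<close>

inductive_set palg :: "('n => real => complex) => (real => complex) set" for Z where
  const: "(%t. c) \<in> palg Z"
| gen: "Z i \<in> palg Z"
| add: "u \<in> palg Z ==> v \<in> palg Z ==> (%t. u t + v t) \<in> palg Z"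
| mult: "u \<in> palg Z ==> v \<in> palg Z ==> (%t. u t * v t) \<in> palg Z"

text \<open>The divisor space \<open>M\<close> is a closed module over the algebra and contains, for
  each generator, every multiple of a monic polynomial \<open>b i\<close> in \<open>Z i\<close>.
  Modulo \<open>M\<close> the algebra is therefore spanned by the monomials in a finite box of
  exponents.\<close>

theorem divisor_fincodim:
  fixes Z :: "'n::finite => real => complex"
  assumes ca: "curve_algebra p p' (palg Z)"
    and simple: "\<And>a t. a \<in> \<rat> ==> a \<in> {0..1} ==> t \<in> {0..1} ==> p t = p a ==> t = a"
    and w: "w \<notin> p ` {0..1}"
  shows "\<exists>k. fincodim k {h\<in>curve_algebra.H (palg Z). bm (ext (%t. 1 / (p t - w))) h \<in> curve_algebra.H (palg Z)} (curve_algebra.H (palg Z))"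
proof -
  interpret curve_algebra p p' "palg Z" by fact
  have wX: "w \<notin> X" using w by (simp add: X_def)
  define M where "M = {h\<in>H. bm (ext (%t. 1 / (p t - w))) h \<in> H}"
  have blm: "bounded_linear (bm a)" for a by (rule bounded_bilinear.bounded_linear_right[OF bounded_bilinear_bm])
  have subM: "subspace M"
    unfolding M_def subspace_def using subspace_H
    by (auto simp: subspace_def linear_0[OF bounded_linear.linear[OF blm]] linear_add[OF bounded_linear.linear[OF blm]] linear_scale[OF bounded_linear.linear[OF blm]])
  have clM: "closed M"
  proof -
    have "M = H \<inter> bm (ext (%t. 1 / (p t - w))) -` H" by (auto simp: M_def)
    moreover have "closed (bm (ext (%t. 1 / (p t - w))) -` H)"
      by (rule closed_vimage[OF closed_H linear_continuous_on[OF blm]])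
    ultimately show ?thesis using closed_H by auto
  qed
  have PM: "bm (ext u) x \<in> M" if "u \<in> palg Z" "x \<in> M" for u x
  proof -
    have "bm a (bm (ext u) x) = bm (ext u) (bm a x)" for a by (rule bcontfun_eqI) (simp add: apply_bm)
    then show ?thesis using that bm_P_H[OF that(1)] unfolding M_def by simp
  qed
  define Pr where "Pr = (%i d c. \<forall>u\<in>palg Z. \<forall>\<kappa>\<in>killers w.
      \<kappa> (%t. (Z i t ^ d + (\<Sum>k<d. c k * Z i t ^ k)) * ((Z i t ^ d + (\<Sum>k<d. c k * Z i t ^ k)) * u t)) = 0)"
  have "\<exists>d c. Pr i d c" for i
    unfolding Pr_def by (rule bspec[OF square_of_relation_killed[OF simple wX] palg.gen])
  then have "\<exists>d. \<forall>i. \<exists>c. Pr i (d i) c" by (intro choice) blast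
  then obtain d where "\<And>i. \<exists>c. Pr i (d i) c" by blast
  then have "\<exists>c. \<forall>i. Pr i (d i) (c i)" by (intro choice) blast
  then obtain c where "\<And>i. Pr i (d i) (c i)" by blast
  then have dc: "\<kappa> (%t. (Z i t ^ d i + (\<Sum>k<d i. c i k * Z i t ^ k)) * ((Z i t ^ d i + (\<Sum>k<d i. c i k * Z i t ^ k)) * u t)) = 0"
    if "u \<in> palg Z" "\<kappa> \<in> killers w" for i u \<kappa>
    using that unfolding Pr_def by blast
  \<comment> \<open>The relation is squared because only products of two kernel elements are known
    to be killed. The extra factor \<open>z\<close> keeps the degree positive even for
    \<open>d i = 0\<close>, so that the constant monomial lies in the box \<open>E\<close>.\<close>
  have "\<exists>e. \<forall>z::complex. z * (z ^ d i + (\<Sum>k<d i. c i k * z ^ k))\<^sup>2 = z ^ (Suc (2 * d i)) + (\<Sum>k<Suc (2 * d i). e k * z ^ k)" for i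
  proof -
    define q where "q = monom 1 (d i) + (\<Sum>k<d i. monom (c i k) k)"
    have dq: "degree q = d i" "lead_coeff q = 1"
    proof -
      have lo: "degree (\<Sum>k<d i. monom (c i k) k) < d i \<or> d i = 0"
      proof (cases "d i")
        case (Suc m)
        have "degree (\<Sum>k<d i. monom (c i k) k) <= m"
          by (rule degree_le) (use Suc in \<open>auto simp: coeff_sum intro!: sum.neutral\<close>)
        then show ?thesis using Suc by simp
      qed simp
      show "degree q = d i"
      proof (cases "d i = 0")
        case False
        then show ?thesis unfolding q_def using lo by (subst degree_add_eq_left) (auto simp: degree_monom_eq)
      qed (simp add: q_def)
      then show "lead_coeff q = 1" unfolding q_def by (simp add: coeff_sum)
    qed
    define Q where "Q = [:0, 1:] * q^2"
    have q0: "q ~= 0" using dq(2) by auto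
    have dQ: "degree Q = Suc (2 * d i)" unfolding Q_def using q0 dq(1) by (simp add: degree_mult_eq degree_power_eq)
    have "lead_coeff Q = 1" unfolding Q_def lead_coeff_mult lead_coeff_power dq(2) by simp
    then have "poly Q z = z ^ (Suc (2 * d i)) + (\<Sum>k<Suc (2 * d i). coeff Q k * z ^ k)" for z
      unfolding poly_altdef dQ lessThan_Suc_atMost[symmetric] by (simp only: sum.lessThan_Suc[of _ "Suc (2 * d i)"] add.commute) simp
    moreover have "poly Q z = z * (z ^ d i + (\<Sum>k<d i. c i k * z ^ k))\<^sup>2" for z
      unfolding Q_def q_def by (simp add: poly_monom poly_sum)
    ultimately show ?thesis by metis
  qed
  then obtain e where e: "\<And>i (z::complex). z * (z ^ d i + (\<Sum>k<d i. c i k * z ^ k))\<^sup>2 = z ^ (Suc (2 * d i)) + (\<Sum>k<Suc (2 * d i). e i k * z ^ k)"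
    by metis
  define D where "D = (%i. Suc (2 * d i))"
  define b where "b = (%i t. Z i t ^ D i + (\<Sum>k<D i. e i k * Z i t ^ k))"
  have bM: "ext (%t. b i t * u t) \<in> M" if u: "u \<in> palg Z" for i u
  proof -
    let ?a = "%t. Z i t ^ d i + (\<Sum>k<d i. c i k * Z i t ^ k)"
    have beq: "(%t. b i t * u t) = (%t. ?a t * (?a t * (Z i t * u t)))"
      unfolding b_def D_def e[symmetric] by (simp add: power2_eq_square mult_ac)
    have "?a \<in> palg Z" by (intro palg.add P_sum P_cmult P_power palg.gen) auto
    then have bP: "(%t. b i t * u t) \<in> palg Z" unfolding beq by (intro palg.mult palg.gen u)
    have "\<kappa> (%t. b i t * u t) = 0" if "\<kappa> \<in> killers w" for \<kappa>
      unfolding beq by (rule dc[OF palg.mult[OF palg.gen u] that])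
    then show ?thesis unfolding M_def using in_divisor_space[OF wX bP] ext_in_H[OF bP] by blast
  qed
  define mono where "mono = (%a t. \<Prod>i\<in>UNIV. Z i t ^ (a i))"
  have monoP: "mono a \<in> palg Z" for a
  proof -
    have "(%t. \<Prod>i\<in>I. Z i t ^ (a i)) \<in> palg Z" if "finite I" for I
      using that
    proof (induction I rule: finite_induct)
      case (insert i I)
      have "(%t. Z i t ^ a i * (\<Prod>i\<in>I. Z i t ^ a i)) \<in> palg Z" by (intro palg.mult P_power palg.gen insert.IH)
      then show ?case using insert.hyps by simp
    qed (simp add: palg.const)
    then show ?thesis unfolding mono_def by simp
  qed
  define E where "E = PiE UNIV (%i. {..<D i})"
  have finE: "finite E" unfolding E_def by (rule finite_PiE) auto
  \<comment> \<open>Spans are real, so each monomial is listed together with its multiple by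
    \<open>\<i>\<close>.\<close>
  define N where "N = (%a. ext (mono a)) ` E \<union> (%a. ext (%t. \<i> * mono a t)) ` E"
  have finN: "finite N" using finE by (simp add: N_def)
  have NH: "N \<subseteq> H" unfolding N_def using ext_in_H monoP P_cmult by auto
  define S where "S = span (M \<union> N)"
  have sS: "subspace S" by (simp add: S_def)
  have MS: "M \<subseteq> S" and NS: "N \<subseteq> S" unfolding S_def using span_superset[of "M \<union> N"] by auto
  have lin: "bm a x \<in> S" if gens: "\<And>y. y \<in> M \<union> N ==> bm a y \<in> S" and x: "x \<in> S" for a x
  proof -
    have "bm a ` S = span (bm a ` (M \<union> N))"
      unfolding S_def by (rule linear_span_image[OF bounded_linear.linear[OF blm], symmetric])
    also have "\<dots> \<subseteq> S" by (rule span_minimal) (use gens sS in auto)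
    finally show ?thesis using x by blast
  qed
  have em: "ext (%t. u t * v t) = bm (ext u) (ext v)" if "u \<in> palg Z" "v \<in> palg Z" for u v
    by (rule ext_mult[OF P_cont01[OF that(1)] P_cont01[OF that(2)]])
  have iS: "bm (ext (%t. \<i>)) x \<in> S" if "x \<in> S" for x
  proof (rule lin[OF _ that])
    fix y assume "y \<in> M \<union> N"
    then consider "y \<in> M" | a where "a \<in> E" "y = ext (mono a)" | a where "a \<in> E" "y = ext (%t. \<i> * mono a t)"
      by (auto simp: N_def)
    then show "bm (ext (%t. \<i>)) y \<in> S"
    proof cases
      case 1 then show ?thesis using PM[OF palg.const] MS by blast
    next
      case 2
      then have "bm (ext (%t. \<i>)) y = ext (%t. \<i> * mono a t)" using em[OF palg.const monoP] by simp
      then show ?thesis using 2(1) NS by (auto simp: N_def)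
    next
      case 3
      then have "bm (ext (%t. \<i>)) y = ext (%t. \<i> * (\<i> * mono a t))" by (simp only: em[OF palg.const P_cmult[OF monoP]])
      also have "\<dots> = ext (%t. (-1) *\<^sub>R mono a t)" by (rule arg_cong[where f = ext]) (simp add: mult.assoc[symmetric])
      also have "\<dots> = (-1) *\<^sub>R ext (mono a)" by (rule ext_scaleR[OF P_cont01[OF monoP]])
      finally show ?thesis using 3(1) NS sS by (auto simp: N_def intro!: subspace_neg)
    qed
  qed
  have cS: "ext (%t. c * u t) \<in> S" if u: "u \<in> palg Z" "ext u \<in> S" for c u
  proof -
    have "(%t. c * u t) = (%t. Re c *\<^sub>R u t + Im c *\<^sub>R (\<i> * u t))"
      by (auto simp: complex_eq_iff algebra_simps)
    then have "ext (%t. c * u t) = Re c *\<^sub>R ext u + Im c *\<^sub>R ext (%t. \<i> * u t)"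
      using P_cont01[OF u(1)] P_cont01[OF P_cmult[OF u(1), of \<i>]]
      by (simp only: ext_add[OF continuous_on_scaleR[OF continuous_on_const] continuous_on_scaleR[OF continuous_on_const]] ext_scaleR)
    moreover have "ext (%t. \<i> * u t) \<in> S" using iS[OF u(2)] em[OF palg.const u(1)] by simp
    ultimately show ?thesis using u(2) sS by (auto intro: subspace_add subspace_scale)
  qed
  have addS: "ext (%t. u t + v t) \<in> S" if "u \<in> palg Z" "v \<in> palg Z" "ext u \<in> S" "ext v \<in> S" for u v
    using that sS by (simp add: ext_add P_cont01 subspace_add)
  have sumS: "ext (%t. \<Sum>k\<in>K. f k t) \<in> S" if "finite K" "\<And>k. k \<in> K ==> f k \<in> palg Z \<and> ext (f k) \<in> S" for K :: "nat set" and f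
    using that
  proof (induction K rule: finite_induct)
    case empty
    have "ext (%t. 0) = 0" by (rule bcontfun_eqI) (simp add: apply_ext)
    then show ?case using sS by (simp add: subspace_0)
  next
    case (insert k K)
    have "ext (%t. f k t + (\<Sum>k\<in>K. f k t)) \<in> S" by (rule addS) (use insert in \<open>auto intro!: P_sum\<close>)
    then show ?case using insert by simp
  qed
  \<comment> \<open>Multiplication by \<open>Z i\<close> leaves the box only when the exponent
    reaches \<open>D i\<close>; then \<open>b i\<close>, whose multiples are in \<open>M\<close>,
    rewrites the power by lower ones.\<close>
  have ZE: "ext (%t. Z i t * mono a t) \<in> S" if a: "a \<in> E" for i a
  proof -
    define R where "R = (%t. \<Prod>j\<in>UNIV-{i}. Z j t ^ a j)"
    have m: "mono (a(i:=k)) t = Z i t ^ k * R t" for k t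
      unfolding mono_def R_def by (subst prod.remove[of UNIV i]) auto
    have m0: "mono a t = Z i t ^ (a i) * R t" for t using m[of "a i" t] by simp
    have up: "a(i:=k) \<in> E" if "k < D i" for k using a that by (auto simp: E_def PiE_iff)
    have ai: "a i < D i" using a by (auto simp: E_def PiE_iff)
    show ?thesis
    proof (cases "Suc (a i) < D i")
      case True
      have "(%t. Z i t * mono a t) = mono (a(i:=Suc (a i)))" by (auto simp: fun_eq_iff m m0)
      then show ?thesis using up[OF True] NS by (auto simp: N_def)
    next
      case False
      then have ai': "Suc (a i) = D i" using ai by simp
      have "(%t. Z i t * mono a t) = (%t. b i t * mono (a(i:=0)) t + (\<Sum>k<D i. (- e i k) * mono (a(i:=k)) t))"
      proof
        fix t
        have "Z i t * mono a t = Z i t ^ D i * R t" unfolding m0 ai'[symmetric] by simp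
        then show "Z i t * mono a t = b i t * mono (a(i:=0)) t + (\<Sum>k<D i. (- e i k) * mono (a(i:=k)) t)"
          unfolding m b_def by (simp add: distrib_right sum_distrib_right sum_negf mult.assoc)
      qed
      moreover have "ext (%t. b i t * mono (a(i:=0)) t + (\<Sum>k<D i. (- e i k) * mono (a(i:=k)) t)) \<in> S"
      proof (rule addS)
        show "ext (%t. b i t * mono (a(i:=0)) t) \<in> S" using bM[OF monoP] MS by blast
        show "(%t. b i t * mono (a(i:=0)) t) \<in> palg Z"
          unfolding b_def by (intro palg.mult palg.add P_sum P_cmult P_power palg.gen monoP) auto
        show "(%t. \<Sum>k<D i. - e i k * mono (a(i:=k)) t) \<in> palg Z" by (intro P_sum P_cmult monoP) auto
        show "ext (%t. \<Sum>k<D i. - e i k * mono (a(i:=k)) t) \<in> S"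
        proof (rule sumS)
          fix k assume k: "k \<in> {..<D i}"
          have "ext (mono (a(i:=k))) \<in> S" using up[of k] k NS by (auto simp: N_def)
          then show "(%t. - e i k * mono (a(i:=k)) t) \<in> palg Z \<and> ext (%t. - e i k * mono (a(i:=k)) t) \<in> S"
            using cS[OF monoP] P_cmult[OF monoP] by blast
        qed simp
      qed
      ultimately show ?thesis by simp
    qed
  qed
  have ZS: "bm (ext (Z i)) x \<in> S" if "x \<in> S" for i x
  proof (rule lin[OF _ that])
    fix y assume "y \<in> M \<union> N"
    then consider "y \<in> M" | a where "a \<in> E" "y = ext (mono a)" | a where "a \<in> E" "y = ext (%t. \<i> * mono a t)"
      by (auto simp: N_def)
    then show "bm (ext (Z i)) y \<in> S"
    proof cases
      case 1 then show ?thesis using PM[OF palg.gen] MS by blast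
    next
      case 2 then show ?thesis using ZE[of a i] em[OF palg.gen monoP] by simp
    next
      case 3
      have "bm (ext (Z i)) y = ext (%t. \<i> * (Z i t * mono a t))"
        using em[OF palg.gen[of Z i] P_cmult[OF monoP[of a], of \<i>]] 3(2) by (simp add: mult.left_commute)
      then show ?thesis using cS[OF palg.mult[OF palg.gen monoP] ZE[OF 3(1)]] by simp
    qed
  qed
  have mulS: "\<forall>v. v \<in> palg Z --> ext v \<in> S --> ext (%t. u t * v t) \<in> S" if "u \<in> palg Z" for u
    using that
  proof (induction rule: palg.induct)
    case (const c) then show ?case using cS by blast
  next
    case (gen i) then show ?case using ZS em[OF palg.gen] by metis
  next
    case (add u u')
    show ?case
    proof (intro allI impI)
      fix v assume v: "v \<in> palg Z" "ext v \<in> S"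
      have "ext (%t. u t * v t + u' t * v t) \<in> S"
        by (rule addS) (use add v in \<open>auto intro: palg.mult\<close>)
      then show "ext (%t. (u t + u' t) * v t) \<in> S" by (simp add: distrib_right)
    qed
  next
    case (mult u u')
    show ?case
    proof (intro allI impI)
      fix v assume v: "v \<in> palg Z" "ext v \<in> S"
      have "ext (%t. u t * (u' t * v t)) \<in> S" using mult v palg.mult by blast
      then show "ext (%t. (u t * u' t) * v t) \<in> S" by (simp add: mult.assoc)
    qed
  qed
  have oneS: "ext (%t. 1) \<in> S"
  proof -
    have "(%_. 0) \<in> E" by (auto simp: E_def D_def)
    moreover have "mono (%_. 0) = (%t. 1)" by (simp add: mono_def)
    ultimately show ?thesis using NS by (force simp: N_def)
  qed
  have "ext u \<in> S" if "u \<in> palg Z" for u using mulS[OF that] oneS palg.const[of 1 Z] by force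
  \<comment> \<open>A finite extension of the closed space \<open>M\<close> is closed, so
    \<open>S\<close> contains the closure of the algebra and not just the algebra.\<close>
  then have "H \<subseteq> S" unfolding H_def by (intro closure_minimal) (auto simp: S_def intro!: closed_span_Un subM clM finN)
  then have "fincodim (card N) M H" unfolding fincodim_def using finN NH by (auto simp: S_def)
  then show ?thesis unfolding M_def by blast
qed

subsection \<open>The jump relation\<close>

text \<open>The horizontal shift stays in a half-plane that avoids the branch cut, where the
  derivative of \<open>Ln\<close> is at most \<open>1 / \<mu>\<close>.\<close>

lemma Ln_shift_bound:
  fixes z :: complex and x \<mu> :: real
  assumes "\<mu> > 0" "\<mu> <= \<bar>Im z\<bar>" "x >= 0"
  shows "norm (Ln (z + of_real x) - Ln z) <= x / \<mu>"
proof -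
  define S where "S = (if Im z > 0 then {w. Im w >= \<mu>} else {w. Im w <= - \<mu>})"
  have cS: "convex S"
    unfolding S_def by (auto simp: convex_halfspace_Im_ge convex_halfspace_Im_le)
  have S: "\<bar>Im w\<bar> >= \<mu>" if "w \<in> S" for w using that assms(1) unfolding S_def by (auto split: if_splits)
  have "norm (Ln (z + of_real x) - Ln z) <= (1 / \<mu>) * norm (z + of_real x - z)"
  proof (rule field_differentiable_bound[OF cS])
    fix w assume w: "w \<in> S"
    then have "Im w ~= 0" using S[OF w] assms(1) by auto
    then have "w \<notin> \<real>\<^sub>\<le>\<^sub>0" by (auto simp: complex_nonpos_Reals_iff)
    then show "(Ln has_field_derivative inverse w) (at w within S)"
      by (rule has_field_derivative_at_within[OF has_field_derivative_Ln])
    have "\<mu> <= norm w" using S[OF w] abs_Im_le_cmod[of w] by linarith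
    then show "norm (inverse w) <= 1 / \<mu>" using assms(1) by (simp only: norm_inverse inverse_eq_divide norm_divide norm_one) (intro divide_left_mono mult_pos_pos; linarith)
  next
    show "z + of_real x \<in> S" "z \<in> S" using assms unfolding S_def by auto
  qed
  then show ?thesis using assms(3) by simp
qed

lemma Ln_jump:
  fixes z :: complex
  assumes "Im z ~= 0"
  shows "Ln z - Ln (- z) = of_real (sgn (Im z) * pi) * \<i>"
proof -
  have "z ~= 0" using assms by auto
  then show ?thesis using assms Ln_minus[of z] by (auto simp: sgn_if mult.commute)
qed

lemma Ln_jump_limit:
  fixes z :: complex and x \<mu> :: real
  assumes "\<mu> > 0" "\<mu> <= \<bar>Im z\<bar>" "x >= 0"
  shows "norm (Ln (z + of_real x) - Ln (- z + of_real x) - of_real (sgn (Im z) * pi) * \<i>) <= 2 * x / \<mu>"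
proof -
  have eq: "Ln (z + of_real x) - Ln (- z + of_real x) - of_real (sgn (Im z) * pi) * \<i>
      = (Ln (z + of_real x) - Ln z) - (Ln (- z + of_real x) - Ln (- z))"
    using Ln_jump[of z] assms by (simp add: algebra_simps)
  have "norm (Ln (z + of_real x) - Ln z) <= x / \<mu>" "norm (Ln (- z + of_real x) - Ln (- z)) <= x / \<mu>"
    using Ln_shift_bound[of \<mu> z x] Ln_shift_bound[of \<mu> "- z" x] assms by auto
  then show ?thesis unfolding eq
    using norm_triangle_ineq4[of "Ln (z + of_real x) - Ln z" "Ln (- z + of_real x) - Ln (- z)"] by simp
qed

context C1_curve begin

text \<open>The integral of the two-sided Cauchy kernel over the window is explicit in logarithms.
  As \<open>x\<close> tends to 0 each end of the window contributes \<open>- s * pi * \<i>\<close>,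
  whence the jump \<open>- 2 * pi * s * \<i>\<close>.\<close>

lemma cauchy_kernel_integral:
  assumes T: "transversal t0 d m K s" and t: "t \<in> {t0-d..t0+d}" "\<bar>t - t0\<bar> <= d/2" and x: "x > 0"
  shows "((%a. p' a * (1 / (p t - p a - of_real x) - 1 / (p t - p a + of_real x))) has_integral
      (Ln (p t - p (t0+d) + of_real x) - Ln (- (p t - p (t0+d)) + of_real x)) +
      (Ln (p (t0-d) - p t + of_real x) - Ln (- (p (t0-d) - p t) + of_real x))) {t0-d..t0+d}"
    and "norm ((Ln (p t - p (t0+d) + of_real x) - Ln (- (p t - p (t0+d)) + of_real x)) +
      (Ln (p (t0-d) - p t + of_real x) - Ln (- (p (t0-d) - p t) + of_real x)) - of_real (- 2 * pi * s) * \<i>) <= 8 * x / (m * d)"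
proof -
  note TD = transversalD[OF T]
  \<comment> \<open>The second logarithm has its argument reversed, so that both arguments equal
    \<open>x > 0\<close> at \<open>a = t\<close>. For all other \<open>a\<close> the imaginary part
    is nonzero, and the branch cut is never met.\<close>
  define F where "F = (%a. Ln (p t - p a + of_real x) - Ln (p a - p t + of_real x))"
  have "((%a. p' a * (1 / (p t - p a - of_real x) - 1 / (p t - p a + of_real x))) has_integral (F (t0+d) - F (t0-d))) {t0-d..t0+d}"
  proof (rule fundamental_theorem_of_calculus)
    fix a assume a: "a \<in> {t0-d..t0+d}"
    have ne: "p t - p a + of_real x \<notin> \<real>\<^sub>\<le>\<^sub>0" "p a - p t + of_real x \<notin> \<real>\<^sub>\<le>\<^sub>0"
    proof -
      have "Im (p t) ~= Im (p a) \<or> a = t" using TD(8)[OF a t(1)] TD(3) by (auto simp: mult_le_0_iff)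
      then show "p t - p a + of_real x \<notin> \<real>\<^sub>\<le>\<^sub>0" "p a - p t + of_real x \<notin> \<real>\<^sub>\<le>\<^sub>0"
        using x by (auto simp: complex_nonpos_Reals_iff)
    qed
    then have nz: "p t - p a + of_real x ~= 0" "p a - p t + of_real x ~= 0" by auto
    have 1: "((%a. p t - p a + of_real x) has_vector_derivative - p' a) (at a)"
      by (auto intro!: derivative_eq_intros der)
    have 2: "((%a. p a - p t + of_real x) has_vector_derivative p' a) (at a)"
      by (auto intro!: derivative_eq_intros der)
    have "((%a. Ln (p t - p a + of_real x)) has_vector_derivative - p' a * inverse (p t - p a + of_real x)) (at a)"
      using field_vector_diff_chain_at[OF 1 has_field_derivative_Ln[OF ne(1)]] by (simp add: o_def)
    moreover have "((%a. Ln (p a - p t + of_real x)) has_vector_derivative p' a * inverse (p a - p t + of_real x)) (at a)"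
      using field_vector_diff_chain_at[OF 2 has_field_derivative_Ln[OF ne(2)]] by (simp add: o_def)
    ultimately have "(F has_vector_derivative - p' a * inverse (p t - p a + of_real x) - p' a * inverse (p a - p t + of_real x)) (at a)"
      unfolding F_def by (rule has_vector_derivative_diff)
    moreover have "- p' a * inverse (p t - p a + of_real x) - p' a * inverse (p a - p t + of_real x)
        = p' a * (1 / (p t - p a - of_real x) - 1 / (p t - p a + of_real x))"
    proof -
      have "inverse (p a - p t + of_real x) = - (1 / (p t - p a - of_real x))"
      proof -
        have "p a - p t + of_real x = - (p t - p a - of_real x)" by simp
        then show ?thesis by (simp only: inverse_eq_divide divide_minus_right)
      qed
      then show ?thesis by (simp add: inverse_eq_divide algebra_simps)
    qed
    ultimately show "(F has_vector_derivative p' a * (1 / (p t - p a - of_real x) - 1 / (p t - p a + of_real x))) (at a within {t0-d..t0+d})"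
      by (metis has_vector_derivative_at_within)
  qed (use TD(1) in simp)
  then show "((%a. p' a * (1 / (p t - p a - of_real x) - 1 / (p t - p a + of_real x))) has_integral
      (Ln (p t - p (t0+d) + of_real x) - Ln (- (p t - p (t0+d)) + of_real x)) +
      (Ln (p (t0-d) - p t + of_real x) - Ln (- (p (t0-d) - p t) + of_real x))) {t0-d..t0+d}"
    unfolding F_def by (simp add: algebra_simps)
  define \<mu> where "\<mu> = m * d / 2"
  have \<mu>: "\<mu> > 0" using TD(1,3) by (simp add: \<mu>_def)
  have b: "\<mu> <= s * Im (p (t0+d) - p t)" and a: "\<mu> <= s * Im (p t - p (t0-d))"
  proof -
    have "m * (d/2) <= m * (t0 + d - t)" "m * (d/2) <= m * (t - (t0 - d))"
      using t(2) TD(3) by (intro mult_left_mono; linarith)+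
    then show "\<mu> <= s * Im (p (t0+d) - p t)" "\<mu> <= s * Im (p t - p (t0-d))"
      using TD(7)[of t "t0+d"] TD(7)[of "t0-d" t] t(1) TD(1) unfolding \<mu>_def by auto
  qed
  have sg: "\<mu> <= \<bar>Im (p t - p (t0+d))\<bar>" "sgn (Im (p t - p (t0+d))) = - s" "\<mu> <= \<bar>Im (p (t0-d) - p t)\<bar>" "sgn (Im (p (t0-d) - p t)) = - s"
    using a b \<mu> TD(5) by (auto simp: sgn_if)
  have n1: "norm (Ln (p t - p (t0+d) + of_real x) - Ln (- (p t - p (t0+d)) + of_real x) - of_real (- s * pi) * \<i>) <= 2 * x / \<mu>"
    using Ln_jump_limit[OF \<mu> sg(1), of x] x unfolding sg(2) by simp
  have n2: "norm (Ln (p (t0-d) - p t + of_real x) - Ln (- (p (t0-d) - p t) + of_real x) - of_real (- s * pi) * \<i>) <= 2 * x / \<mu>"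
    using Ln_jump_limit[OF \<mu> sg(3), of x] x unfolding sg(4) by simp
  have split: "of_real (- 2 * pi * s) * \<i> = of_real (- s * pi) * \<i> + of_real (- s * pi) * \<i>" by (simp add: algebra_simps)
  have arr: "(u + v) - (c + c) = (u - c) + (v - c)" for u v c :: complex by simp
  have "2 * x / \<mu> + 2 * x / \<mu> = 8 * x / (m * d)" by (simp add: \<mu>_def)
  then show "norm ((Ln (p t - p (t0+d) + of_real x) - Ln (- (p t - p (t0+d)) + of_real x)) +
      (Ln (p (t0-d) - p t + of_real x) - Ln (- (p (t0-d) - p t) + of_real x)) - of_real (- 2 * pi * s) * \<i>) <= 8 * x / (m * d)"
    unfolding split arr using norm_triangle_mono[OF n1 n2] by simp
qed

text \<open>Integrating the two-sided kernel against \<open>\<theta> * p'\<close> gives functions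
  killed by \<open>L\<close>, since \<open>L\<close> kills every Cauchy kernel. As \<open>x\<close>
  tends to 0 they converge uniformly to a nonzero multiple of \<open>\<theta>\<close>.\<close>

lemma plemelj:
  assumes t0: "t0 \<in> {0..1}" and simple: "\<And>t. t \<in> {0..1} ==> p t = p t0 ==> t = t0" and reg: "Im (p' t0) ~= 0"
  shows "\<exists>r>0. \<forall>L \<theta>. cdual L --> (\<forall>w. w \<notin> p ` {0..1} --> L (%t. 1 / (p t - w)) = 0) -->
    continuous_on UNIV \<theta> --> (\<forall>t\<in>{0..1}. r <= \<bar>t - t0\<bar> --> \<theta> t = 0) --> L \<theta> = 0"
proof -
  obtain d0 m K s where T0: "transversal t0 d0 m K s" using transversal_exists[OF reg] by blast
  obtain d k where d: "0 < d" "d <= d0" "0 < k"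
    "\<And>t a x. t \<in> {0..1} ==> a \<in> {t0-d..t0+d} ==> \<bar>x\<bar> <= d ==> k * sqrt ((t - a)\<^sup>2 + x\<^sup>2) <= norm (p t - p a - of_real x)"
    using kernel_bound[OF T0 t0 simple] by blast
  have T: "transversal t0 d m K s" by (rule transversal_mono[OF T0 d(1,2)])
  note TD = transversalD[OF T]
  define R where "R = {t0-d..t0+d}"
  have R12: "a \<in> {-1..2}" if "a \<in> R" for a using that t0 TD(1,2) by (auto simp: R_def)
  define kern where "kern = (%x t a. 1 / (p t - p a - of_real x) - 1 / (p t - p a + of_real x))"
  have nz: "p t - p a - of_real x ~= 0" "p t - p a + of_real x ~= 0"
    "k\<^sup>2 * ((t - a)\<^sup>2 + x\<^sup>2) <= norm (p t - p a - of_real x) * norm (p t - p a + of_real x)"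
    if "t \<in> {0..1}" "a \<in> R" "0 < x" "x <= d" for t a x
  proof -
    have pos: "0 < k * sqrt ((t - a)\<^sup>2 + x\<^sup>2)" using d(3) that by (simp add: add_nonneg_pos)
    have 1: "k * sqrt ((t - a)\<^sup>2 + x\<^sup>2) <= norm (p t - p a - of_real x)" "k * sqrt ((t - a)\<^sup>2 + x\<^sup>2) <= norm (p t - p a + of_real x)"
      using d(4)[of t a x] d(4)[of t a "-x"] that by (auto simp: R_def)
    then show "p t - p a - of_real x ~= 0" "p t - p a + of_real x ~= 0" using pos by (auto simp del: diff_eq_eq)
    have "(k * sqrt ((t - a)\<^sup>2 + x\<^sup>2)) * (k * sqrt ((t - a)\<^sup>2 + x\<^sup>2)) <= norm (p t - p a - of_real x) * norm (p t - p a + of_real x)"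
      using 1 pos by (intro mult_mono) auto
    moreover have "(k * sqrt ((t - a)\<^sup>2 + x\<^sup>2)) * (k * sqrt ((t - a)\<^sup>2 + x\<^sup>2)) = k\<^sup>2 * ((t - a)\<^sup>2 + x\<^sup>2)"
      by (simp add: power2_eq_square mult_ac)
    ultimately show "k\<^sup>2 * ((t - a)\<^sup>2 + x\<^sup>2) <= norm (p t - p a - of_real x) * norm (p t - p a + of_real x)" by simp
  qed
  have kb: "norm (kern x t a) <= 2 / k\<^sup>2 * (x / ((t - a)\<^sup>2 + x\<^sup>2))" if h: "t \<in> {0..1}" "a \<in> R" "0 < x" "x <= d" for t a x
  proof -
    have "kern x t a = of_real (2 * x) / ((p t - p a - of_real x) * (p t - p a + of_real x))"
      unfolding kern_def using nz[OF h] by (simp add: diff_frac_eq)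
    then have "norm (kern x t a) = 2 * x / (norm (p t - p a - of_real x) * norm (p t - p a + of_real x))"
      using h by (simp only: norm_divide norm_mult norm_of_real)
    also have "\<dots> <= 2 * x / (k\<^sup>2 * ((t - a)\<^sup>2 + x\<^sup>2))"
    proof (rule divide_left_mono[OF nz(3)[OF h]])
      have "0 < k\<^sup>2 * ((t - a)\<^sup>2 + x\<^sup>2)" using d(3) h by (simp add: add_nonneg_pos)
      moreover then have "0 < norm (p t - p a - of_real x) * norm (p t - p a + of_real x)" using nz(3)[OF h] by linarith
      ultimately show "0 < norm (p t - p a - of_real x) * norm (p t - p a + of_real x) * (k\<^sup>2 * ((t - a)\<^sup>2 + x\<^sup>2))"
        using mult_pos_pos by metis
    qed (use h in simp)
    finally show ?thesis by simp
  qed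
  have "L \<theta> = 0" if L: "cdual L" and ann: "\<And>w. w \<notin> p ` {0..1} ==> L (%t. 1 / (p t - w)) = 0"
    and \<theta>: "continuous_on UNIV \<theta>" "\<And>t. t \<in> {0..1} ==> d/2 <= \<bar>t - t0\<bar> ==> \<theta> t = 0" for L and \<theta> :: "real => complex"
  proof -
    define c where "c = of_real (- 2 * pi * s) * \<i>"
    define k' where "k' = (%x t a. \<theta> a * p' a * kern x t a)"
    define KK where "KK = (%x t. integral R (k' x t))"
    have co: "continuous_on ({0..1} \<times> R) (%(t,a). k' x t a)" if x: "0 < x" "x <= d" for x
      unfolding k'_def kern_def case_prod_beta
      by (intro continuous_intros continuous_on_compose2[OF cont[of UNIV]] continuous_on_compose2[OF cont'] continuous_on_compose2[OF \<theta>(1)])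
        (use nz[OF _ _ x] in auto)
    have LK: "L (KK x) = 0" if x: "0 < x" "x <= d" for x
    proof -
      have "L (KK x) = integral R (%a. L (%t. k' x t a))"
        using cdual_integral(2)[OF L co[OF x, unfolded R_def]] unfolding KK_def R_def by simp
      also have "\<dots> = integral R (%a. 0)"
      proof (rule integral_cong)
        fix a assume a: "a \<in> R"
        have w: "p a + of_real x \<notin> p ` {0..1}" "p a - of_real x \<notin> p ` {0..1}"
          using nz(1,2)[OF _ a x] by (force simp: algebra_simps)+
        have ct: "continuous_on {0..1} (%t. 1 / (p t - (p a + of_real x)))" "continuous_on {0..1} (%t. 1 / (p t - (p a - of_real x)))"
          by (intro continuous_intros cont; use w in force)+
        have "(%t. k' x t a) = (%t. (\<theta> a * p' a) * (1 / (p t - (p a + of_real x)) - 1 / (p t - (p a - of_real x))))"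
          unfolding k'_def kern_def by (simp add: algebra_simps)
        then have "L (%t. k' x t a) = (\<theta> a * p' a) * L (%t. 1 / (p t - (p a + of_real x)) - 1 / (p t - (p a - of_real x)))"
          by (simp only: cdual_cmult[OF L continuous_on_diff[OF ct]])
        then show "L (%t. k' x t a) = 0" using ann[OF w(1)] ann[OF w(2)] unfolding cdual_diff[OF L ct] by simp
      qed
      finally show ?thesis by simp
    qed
    obtain B where B: "B > 0" "\<And>t. t \<in> {-1..2} ==> norm (\<theta> t) <= B"
    proof -
      have "bounded (\<theta> ` {-1..2})" by (intro compact_imp_bounded compact_continuous_image continuous_on_subset[OF \<theta>(1)]) auto
      then show thesis using that unfolding bounded_pos by auto
    qed
    have uc: "uniformly_continuous_on {-1..2} \<theta>"
      by (intro compact_uniformly_continuous continuous_on_subset[OF \<theta>(1)]) auto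
    have approx: "\<exists>x. 0 < x \<and> x <= d \<and> (\<forall>t\<in>{0..1}. norm (KK x t - c * \<theta> t) <= e)" if e: "e > 0" for e
    proof -
      define A where "A = K * (2 / k\<^sup>2)"
      have A: "A > 0" using TD(4) d(3) by (simp add: A_def)
      define \<epsilon> where "\<epsilon> = e / (3 * A * pi)"
      have \<epsilon>: "\<epsilon> > 0" "A * (\<epsilon> * pi) = e / 3" using e A by (auto simp: \<epsilon>_def)
      obtain \<delta> where \<delta>: "\<delta> > 0" "\<And>a t. a \<in> {-1..2} ==> t \<in> {-1..2} ==> dist a t < \<delta> ==> dist (\<theta> a) (\<theta> t) < \<epsilon>"
        using uc \<epsilon>(1) unfolding uniformly_continuous_on_def by metis
      define M where "M = 2 * B / \<delta>\<^sup>2"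
      have M: "M > 0" using B \<delta> by (simp add: M_def)
      \<comment> \<open>A modulus of continuity with a quadratic tail. Against the kernel
        \<open>x / ((t - a)\<^sup>2 + x\<^sup>2)\<close> the quadratic term is at most
        \<open>M * x\<close> pointwise, so the integral need not be split into near and far
        parts.\<close>
      have osc: "norm (\<theta> a - \<theta> t) <= \<epsilon> + M * (t - a)\<^sup>2" if at: "a \<in> {-1..2}" "t \<in> {-1..2}" for a t
      proof (cases "dist a t < \<delta>")
        case True
        have "0 <= M * (t - a)\<^sup>2" using M by simp
        then show ?thesis using \<delta>(2)[OF at True] by (simp add: dist_norm)
      next
        case False
        then have "\<delta> <= \<bar>t - a\<bar>" by (simp add: dist_real_def)
        then have "\<delta>\<^sup>2 <= (t - a)\<^sup>2" using \<delta>(1) power_mono[of \<delta> "\<bar>t - a\<bar>" 2] by simp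
        then have "M * \<delta>\<^sup>2 <= M * (t - a)\<^sup>2" using M by (intro mult_left_mono) auto
        then have "2 * B <= M * (t - a)\<^sup>2" using \<delta>(1) by (simp add: M_def)
        moreover have "norm (\<theta> a - \<theta> t) <= 2 * B" using norm_triangle_ineq4[of "\<theta> a" "\<theta> t"] B(2)[OF at(1)] B(2)[OF at(2)] by linarith
        ultimately show ?thesis using \<epsilon>(1) by linarith
      qed
      define Q where "Q = 8 * B / (m * d)"
      have Q: "Q >= 0" using B TD(1,3) by (simp add: Q_def)
      \<comment> \<open>The first error term is made small by \<open>\<epsilon>\<close>;
        \<open>x\<close> takes care of the quadratic tail and of the error in the explicit integral,
        with \<open>e / 3\<close> for each.\<close>
      define x where "x = min d (min (e / (3 * (A * M * 2))) (e / (3 * (Q + 1))))"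
      have x: "0 < x" "x <= d" using e A M Q d(1) by (auto simp: x_def)
      have x1: "A * M * 2 * x <= e / 3"
      proof -
        have "x <= e / (3 * (A * M * 2))" by (simp add: x_def)
        then have "x * (3 * (A * M * 2)) <= e" using A M by (simp add: pos_le_divide_eq)
        then show ?thesis by (simp add: mult_ac)
      qed
      have x2: "Q * x <= e / 3"
      proof -
        have "x <= e / (3 * (Q + 1))" by (simp add: x_def)
        then have "x * (3 * (Q + 1)) <= e" using Q by (simp add: pos_le_divide_eq)
        moreover have "3 * (Q * x) <= x * (3 * (Q + 1))" using x by (simp add: algebra_simps)
        ultimately show ?thesis by simp
      qed
      have "norm (KK x t - c * \<theta> t) <= e" if t: "t \<in> {0..1}" for t
      proof -
        have t12: "t \<in> {-1..2}" using t by auto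
        define I where "I = integral R (%a. p' a * kern x t a)"
        have ck: "continuous_on R (%a. kern x t a)"
          unfolding kern_def using nz[OF t _ x] by (intro continuous_intros cont) auto
        have cp': "continuous_on R p'" by (rule continuous_on_subset[OF cont']) simp
        have c\<theta>: "continuous_on R \<theta>" by (rule continuous_on_subset[OF \<theta>(1)]) simp
        have i1: "(%a. (\<theta> a - \<theta> t) * (p' a * kern x t a)) integrable_on R"
          unfolding R_def by (intro integrable_continuous_real continuous_intros; use ck cp' c\<theta> in \<open>simp add: R_def\<close>)
        have i2: "(%a. \<theta> t * (p' a * kern x t a)) integrable_on R"
          unfolding R_def by (intro integrable_continuous_real continuous_intros; use ck cp' c\<theta> in \<open>simp add: R_def\<close>)
        have "KK x t = integral R (%a. (\<theta> a - \<theta> t) * (p' a * kern x t a) + \<theta> t * (p' a * kern x t a))"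
          unfolding KK_def k'_def by (simp add: algebra_simps)
        also have "\<dots> = integral R (%a. (\<theta> a - \<theta> t) * (p' a * kern x t a)) + integral R (%a. \<theta> t * (p' a * kern x t a))"
          by (rule integral_add[OF i1 i2])
        finally have K1: "KK x t = integral R (%a. (\<theta> a - \<theta> t) * (p' a * kern x t a)) + integral R (%a. \<theta> t * (p' a * kern x t a))" .
        have K2: "integral R (%a. \<theta> t * (p' a * kern x t a)) = \<theta> t * I" unfolding I_def by (rule integral_mult_right)
        have eq: "KK x t - c * \<theta> t = integral R (%a. (\<theta> a - \<theta> t) * (p' a * kern x t a)) + \<theta> t * (I - c)"
          unfolding K1 K2 by (simp add: right_diff_distrib mult.commute)
        have pos: "(t - a)\<^sup>2 + x\<^sup>2 > 0" for a using x by (simp add: add_nonneg_pos)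
        have cx: "continuous_on R (%a. x / ((t - a)\<^sup>2 + x\<^sup>2))"
          by (intro continuous_intros) (use pos in \<open>metis less_irrefl\<close>)
        have i3: "(%a. A * \<epsilon> * (x / ((t - a)\<^sup>2 + x\<^sup>2)) + A * M * x) integrable_on R"
          unfolding R_def by (intro integrable_continuous_real continuous_on_add continuous_on_mult continuous_on_const; use cx in \<open>simp add: R_def\<close>)
        define q where "q = (%a. x / ((t - a)\<^sup>2 + x\<^sup>2))"
        have bd: "norm ((\<theta> a - \<theta> t) * (p' a * kern x t a)) <= A * \<epsilon> * q a + A * M * x" if a: "a \<in> R" for a
        proof -
          have kb: "norm (kern x t a) <= 2 / k\<^sup>2 * q a" using kb[OF t a x] by (simp only: q_def)
          have q0: "q a >= 0" using pos[of a] x by (simp add: q_def)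
          have "norm ((\<theta> a - \<theta> t) * (p' a * kern x t a)) <= (\<epsilon> + M * (t - a)\<^sup>2) * (K * (2 / k\<^sup>2 * q a))"
            unfolding norm_mult using osc[OF R12[OF a] t12] TD(6)[of a] kb q0 a M \<epsilon>(1) TD(4)
            by (intro mult_mono) (auto simp: R_def)
          also have "\<dots> = A * \<epsilon> * q a + A * M * ((t - a)\<^sup>2 * q a)" unfolding A_def by (simp only: distrib_left distrib_right mult_ac)
          also have "\<dots> <= A * \<epsilon> * q a + A * M * x"
          proof -
            have "(t - a)\<^sup>2 * x <= x * ((t - a)\<^sup>2 + x\<^sup>2)" using x by (simp add: algebra_simps)
            then have "(t - a)\<^sup>2 * q a <= x" using pos[of a] unfolding q_def by (simp add: pos_divide_le_eq)
            then have "A * M * ((t - a)\<^sup>2 * q a) <= A * M * x" using A M by (intro mult_left_mono) auto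
            then show ?thesis by simp
          qed
          finally show ?thesis .
        qed
        have "norm (integral R (%a. (\<theta> a - \<theta> t) * (p' a * kern x t a))) <= integral R (%a. A * \<epsilon> * (x / ((t - a)\<^sup>2 + x\<^sup>2)) + A * M * x)"
          by (rule integral_norm_bound_integral[OF i1 i3 bd[unfolded q_def]])
        also have "\<dots> = A * \<epsilon> * integral R (%a. x / ((t - a)\<^sup>2 + x\<^sup>2)) + A * M * x * (2 * d)"
        proof -
          have "(%a. A * \<epsilon> * (x / ((t - a)\<^sup>2 + x\<^sup>2))) integrable_on R"
            unfolding R_def by (intro integrable_continuous_real continuous_on_mult continuous_on_const; use cx in \<open>simp add: R_def\<close>)
          moreover have "(%a. A * M * x) integrable_on R" unfolding R_def by (intro integrable_continuous_real continuous_on_const)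
          ultimately have "integral R (%a. A * \<epsilon> * (x / ((t - a)\<^sup>2 + x\<^sup>2)) + A * M * x)
             = integral R (%a. A * \<epsilon> * (x / ((t - a)\<^sup>2 + x\<^sup>2))) + integral R (%a. A * M * x)" by (rule integral_add)
          moreover have "integral R (%a. A * M * x) = A * M * x * (2 * d)" using TD(1) by (simp add: R_def)
          ultimately show ?thesis by (simp only: integral_mult_right)
        qed
        also have "\<dots> <= A * \<epsilon> * pi + A * M * x * 2"
          using integral_kernel_arctan[of "t0-d" "t0+d" x t] x TD(1,2) A M \<epsilon>(1) unfolding R_def
          by (intro add_mono mult_left_mono) auto
        also have "\<dots> <= e / 3 + e / 3" using \<epsilon>(2) x1 by (simp add: mult_ac)
        finally have p1: "norm (integral R (%a. (\<theta> a - \<theta> t) * (p' a * kern x t a))) <= e / 3 + e / 3" .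
        have p2: "norm (\<theta> t * (I - c)) <= e / 3"
        \<comment> \<open>The explicit integral is controlled only for \<open>t\<close> away from
          the ends of the window; elsewhere \<open>\<theta>\<close> vanishes. This is why the radius
          of support is \<open>d/2\<close>.\<close>
        proof (cases "d/2 <= \<bar>t - t0\<bar>")
          case True then show ?thesis using \<theta>(2)[OF t True] e by simp
        next
          case False
          have tR: "t \<in> {t0-d..t0+d}" "\<bar>t - t0\<bar> <= d/2" using False TD(1) by (auto simp: abs_if split: if_splits)
          have "norm (I - c) <= 8 * x / (m * d)"
            using cauchy_kernel_integral(2)[OF T tR x(1)] integral_unique[OF cauchy_kernel_integral(1)[OF T tR x(1)]]
            unfolding I_def kern_def R_def c_def by simp
          then have "norm (\<theta> t * (I - c)) <= B * (8 * x / (m * d))"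
            unfolding norm_mult using B(2)[OF t12] B(1) by (intro mult_mono) auto
          also have "\<dots> = Q * x" by (simp add: Q_def)
          finally show ?thesis using x2 by linarith
        qed
        have "norm (KK x t - c * \<theta> t) <= (e / 3 + e / 3) + e / 3" unfolding eq by (rule norm_triangle_mono[OF p1 p2])
        then show ?thesis by simp
      qed
      then show ?thesis using x by blast
    qed
    obtain C where C: "C > 0" "\<And>u B. continuous_on {0..1} u ==> (\<And>t. t \<in> {0..1} ==> norm (u t) <= B) ==> norm (L u) <= C * B"
      using cdual_bound[OF L] by blast
    have c01: "continuous_on {0..1} \<theta>" by (rule continuous_on_subset[OF \<theta>(1)]) simp
    have small: "norm (c * L \<theta>) <= C * e" if e: "e > 0" for e
    proof -
      obtain x where x: "0 < x" "x <= d" and ap: "\<And>t. t \<in> {0..1} ==> norm (KK x t - c * \<theta> t) <= e"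
        using approx[OF e] by blast
      have cK: "continuous_on {0..1} (KK x)"
        using ext_integral(3)[OF co[OF x, unfolded R_def]] unfolding KK_def R_def .
      have cc: "continuous_on {0..1} (%t. c * \<theta> t)" by (intro continuous_intros c01)
      have "L (%t. KK x t - c * \<theta> t) = L (KK x) - L (%t. c * \<theta> t)" by (rule cdual_diff[OF L cK cc])
      also have "\<dots> = - (c * L \<theta>)" unfolding LK[OF x] cdual_cmult[OF L c01] by simp
      finally have "norm (c * L \<theta>) = norm (L (%t. KK x t - c * \<theta> t))" by simp
      also have "\<dots> <= C * e" by (rule C(2)[OF continuous_on_diff[OF cK cc] ap])
      finally show ?thesis .
    qed
    have "norm (c * L \<theta>) <= 0"
    proof (rule field_le_epsilon)
      fix e :: real assume "e > 0"
      then show "norm (c * L \<theta>) <= 0 + e" using small[of "e / C"] C(1) by simp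
    qed
    moreover have "c ~= 0" using TD(5) by (auto simp: c_def)
    ultimately show ?thesis by simp
  qed
  then show ?thesis using d(1) by (intro exI[of _ "d/2"]) auto
qed

end

subsection \<open>Generic linear forms\<close>

lemma curve_image_negligible:
  fixes g :: "real => complex"
  assumes "\<And>t. t \<in> S ==> g differentiable (at t)"
  shows "negligible (g ` S)"
proof (rule negligible_differentiable_image_lowdim)
  show "g differentiable_on S"
    unfolding differentiable_on_def using assms differentiable_at_withinI by blast
qed simp

text \<open>Coefficients are chosen one at a time. For a fixed \<open>a\<close> the coefficients
  that create a new coincidence form the image of a curve, a null set in the plane; countably many
  such sets and one further point can be avoided. A continuum of parameters could not be treated
  like this, hence the restriction to countable \<open>C\<close>.\<close>

lemma generic_combination:
  fixes Z Z' :: "'n::finite => real => complex"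
  assumes der: "\<And>i t. (Z i has_vector_derivative Z' i t) (at t)" and C: "countable C" and J: "finite J"
  shows "\<exists>c. (\<forall>a\<in>C. \<forall>t. (\<Sum>i\<in>J. c i * (Z i t - Z i a)) = 0 --> (\<forall>i\<in>J. Z i t = Z i a)) \<and>
    ((\<Sum>i\<in>J. c i * Z' i t0) = 0 --> (\<forall>i\<in>J. Z' i t0 = 0))"
  using J
proof (induction J rule: finite_induct)
  case (insert j J)
  then obtain c where c: "\<And>a t i. a \<in> C ==> (\<Sum>i\<in>J. c i * (Z i t - Z i a)) = 0 ==> i \<in> J ==> Z i t = Z i a"
    "\<And>i. (\<Sum>i\<in>J. c i * Z' i t0) = 0 ==> i \<in> J ==> Z' i t0 = 0" by blast
  have dZ: "Z i differentiable (at t)" for i t using der differentiableI_vector by blast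
  define bad where "bad = (%a. (%t. - (\<Sum>i\<in>J. c i * (Z i t - Z i a)) / (Z j t - Z j a)) ` {t. Z j t ~= Z j a})"
  have "negligible (bad a)" for a
    unfolding bad_def
    by (rule curve_image_negligible) (auto intro!: differentiable_divide differentiable_minus differentiable_sum differentiable_mult differentiable_diff differentiable_const dZ insert.hyps(1))
  then have "negligible (\<Union>a\<in>C. bad a)" using C by (intro negligible_countable_Union) (auto intro: countable_image)
  \<comment> \<open>The added point is the coefficient that would make the derivative at
    \<open>t0\<close> cancel. If \<open>Z' j t0 = 0\<close> the quotient is 0 by convention, and
    excluding 0 does no harm.\<close>
  then have "negligible ((\<Union>a\<in>C. bad a) \<union> {- (\<Sum>i\<in>J. c i * Z' i t0) / Z' j t0})" by (intro negligible_Un) auto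
  then have "(\<Union>a\<in>C. bad a) \<union> {- (\<Sum>i\<in>J. c i * Z' i t0) / Z' j t0} ~= UNIV" by (metis non_negligible_UNIV)
  then obtain \<mu> where \<mu>: "\<And>a. a \<in> C ==> \<mu> \<notin> bad a" "\<mu> ~= - (\<Sum>i\<in>J. c i * Z' i t0) / Z' j t0" by blast
  define c' where "c' = c(j := \<mu>)"
  have s: "(\<Sum>i\<in>insert j J. c' i * f i) = \<mu> * f j + (\<Sum>i\<in>J. c i * f i)" for f
  proof -
    have "(\<Sum>i\<in>J. c' i * f i) = (\<Sum>i\<in>J. c i * f i)" using insert.hyps by (intro sum.cong) (auto simp: c'_def)
    then show ?thesis using insert.hyps by (simp add: c'_def)
  qed
  show ?case
  proof (intro exI[of _ c'] conjI ballI allI impI)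
    fix a t i assume a: "a \<in> C" and z: "(\<Sum>i\<in>insert j J. c' i * (Z i t - Z i a)) = 0" and i: "i \<in> insert j J"
    have "Z j t = Z j a"
    proof (rule ccontr)
      assume ne: "Z j t ~= Z j a"
      then have "\<mu> = - (\<Sum>i\<in>J. c i * (Z i t - Z i a)) / (Z j t - Z j a)"
        using z unfolding s by (intro eq_divide_imp) (simp_all add: add_eq_0_iff2)
      then have "\<mu> \<in> bad a" unfolding bad_def using ne by blast
      then show False using \<mu>(1)[OF a] by blast
    qed
    then show "Z i t = Z i a" using z i c(1)[OF a, of t i] unfolding s by auto
  next
    fix i assume z: "(\<Sum>i\<in>insert j J. c' i * Z' i t0) = 0" and i: "i \<in> insert j J"
    have "Z' j t0 = 0"
    proof (rule ccontr)
      assume ne: "Z' j t0 ~= 0"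
      then have "\<mu> = - (\<Sum>i\<in>J. c i * Z' i t0) / Z' j t0"
        using z unfolding s by (intro eq_divide_imp) (simp_all add: add_eq_0_iff2)
      then show False using \<mu>(2) by simp
    qed
    then show "Z' i t0 = 0" using z i c(2)[of i] unfolding s by auto
  qed
qed simp

subsection \<open>Density of polynomials on an arc\<close>

lemma bm_left_cancel:
  assumes a: "continuous_on {0..1} a" "\<And>t. t \<in> {0..1} ==> a t ~= 0" and eq: "bm (ext a) x = bm (ext a) y"
  shows "x = y"
proof (rule bcontfun_eqI)
  fix t
  have "a (clamp01 t) * apply_bcontfun x t = a (clamp01 t) * apply_bcontfun y t"
    using arg_cong[OF eq, of "%z. apply_bcontfun z t"] by (simp add: apply_bm apply_ext[OF a(1)])
  then show "apply_bcontfun x t = apply_bcontfun y t" using a(2) clamp01_in by simp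
qed

lemma bm_inverse:
  assumes a: "continuous_on {0..1} a" "\<And>t. t \<in> {0..1} ==> a t ~= 0" and b: "continuous_on {0..1} b"
  shows "bm (ext (%t. b t / a t)) (bm (ext a) x) = bm (ext b) x"
proof (rule bcontfun_eqI)
  fix t
  have "continuous_on {0..1} (%t. b t / a t)" using a b by (intro continuous_on_divide) auto
  then show "apply_bcontfun (bm (ext (%t. b t / a t)) (bm (ext a) x)) t = apply_bcontfun (bm (ext b) x) t"
    using a(2) clamp01_in by (simp add: apply_bm apply_ext a(1) b)
qed

lemma bounded_linear_bm: "bounded_linear (bm a)"
  by (rule bounded_bilinear.bounded_linear_right[OF bounded_bilinear_bm])

lemma linear_bm: "linear (bm a)"
  using bounded_linear_bm by (rule bounded_linear.linear)

lemma bm_one: "bm (ext (%t. 1)) x = x"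
  by (rule bcontfun_eqI) (simp add: apply_bm apply_ext)

lemma closed_bm_image:
  assumes a: "continuous_on {0..1} a" "\<And>t. t \<in> {0..1} ==> a t ~= 0" and I: "closed I"
  shows "closed (bm (ext a) ` I)"
proof -
  have inv: "bm (ext (%t. 1 / a t)) (bm (ext a) x) = x" for x
    using bm_inverse[OF a, of "%t. 1"] by (simp add: bm_one)
  have inv': "bm (ext a) (bm (ext (%t. 1 / a t)) x) = x" for x
    using inv[of x] by (metis bm_assoc bm_commute)
  have "bm (ext a) ` I = bm (ext (%t. 1 / a t)) -` I"
    using inv inv' by (auto simp: image_iff) metis
  moreover have "closed (bm (ext (%t. 1 / a t)) -` I)"
    by (rule closed_vimage[OF I linear_continuous_on[OF bounded_linear_bm]])
  ultimately show ?thesis by simp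
qed

text \<open>The segment from \<open>a\<close> to \<open>b\<close> is traversed in steps so short that the previous Neumann series argument applies
  to each of them with the same complement bound \<open>3 ^ c\<close>.\<close>

lemma index_step:
  assumes H: "subspace H" and I: "subspace I" "closed I" "I \<subseteq> H"
    and a: "continuous_on {0..1} a" "\<And>t. t \<in> {0..1} ==> a t ~= 0" "\<And>h. h \<in> I ==> bm (ext a) h \<in> H"
    and b: "continuous_on {0..1} b" "\<And>h. h \<in> I ==> bm (ext b) h \<in> H"
    and ab: "\<And>t. t \<in> {0..1} ==> norm (b t - a t) <= 1/2 * norm (a t)"
    and fc: "fincodim c (bm (ext a) ` I) H"
  shows "fincodim c (bm (ext b) ` I) H"
proof -
  \<comment> \<open>With \<open>K\<close> steps each multiplier differs from 1 by at most
    \<open>1 / K\<close>, and \<open>1 / K * 3 ^ c\<close> is exactly the admissible 1/2.\<close>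
  define K :: nat where "K = 2 * 3 ^ c"
  have K: "K > 0" by (simp add: K_def)
  define r where "r = (%l. real l / K)"
  have r01: "0 <= r l" "l <= K ==> r l <= 1" for l using K by (auto simp: r_def)
  have rS: "r (Suc l) = r l + 1 / K" for l by (simp add: r_def add_divide_distrib)
  define g where "g = (%l t. a t + of_real (r l) * (b t - a t))"
  have gc: "continuous_on {0..1} (g l)" for l unfolding g_def by (intro continuous_intros a b)
  have gl: "norm (g l t) >= 1/2 * norm (a t)" if "l <= K" "t \<in> {0..1}" for l t
  proof -
    have "norm (of_real (r l) * (b t - a t)) <= 1 * (1/2 * norm (a t))"
      unfolding norm_mult norm_of_real using that r01[of l] ab[OF that(2)] by (intro mult_mono) auto
    then show ?thesis unfolding g_def using norm_diff_ineq[of "a t" "of_real (r l) * (b t - a t)"] by simp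
  qed
  have gnz: "g l t ~= 0" if "l <= K" "t \<in> {0..1}" for l t
    using gl[OF that] a(2)[OF that(2)] by auto
  have gI: "bm (ext (g l)) h \<in> H" if "h \<in> I" for l h
  proof -
    have "bm (ext (g l)) h = bm (ext a) h + r l *\<^sub>R (bm (ext b) h - bm (ext a) h)"
    proof (rule bcontfun_eqI)
      fix t show "apply_bcontfun (bm (ext (g l)) h) t = apply_bcontfun (bm (ext a) h + r l *\<^sub>R (bm (ext b) h - bm (ext a) h)) t"
        by (simp add: apply_bm apply_ext gc a b) (simp add: g_def scaleR_conv_of_real algebra_simps)
    qed
    then show ?thesis using a(3)[OF that] b(2)[OF that] H by (auto intro: subspace_add subspace_scale subspace_diff)
  qed
  have "l <= K ==> fincodim c (bm (ext (g l)) ` I) H" for l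
  proof (induction l)
    case 0
    have "g 0 = a" by (auto simp: g_def r_def)
    then show ?case using fc by simp
  next
    case (Suc l)
    define q where "q = (%t. g (Suc l) t / g l t)"
    have lK: "l <= K" using Suc.prems by simp
    have qc: "continuous_on {0..1} q" unfolding q_def by (intro continuous_on_divide gc) (use gnz[OF lK] in auto)
    have comp: "bm (ext q) (bm (ext (g l)) h) = bm (ext (g (Suc l))) h" for h
      unfolding q_def by (rule bm_inverse[OF gc gnz[OF lK] gc]) auto
    have "fincodim c (bm (ext q) ` bm (ext (g l)) ` I) H"
    proof (rule fincodim_small_step[OF H, where e = "1 / K"])
      show "subspace (bm (ext (g l)) ` I)" by (rule linear_subspace_image[OF linear_bm I(1)])
      show "closed (bm (ext (g l)) ` I)" by (rule closed_bm_image[OF gc gnz[OF lK] I(2)])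
      show "bm (ext (g l)) ` I \<subseteq> H" using gI by auto
      show "fincodim c (bm (ext (g l)) ` I) H" using Suc.IH lK by simp
      show "bounded_linear (bm (ext q))" by (rule bounded_linear_bm)
      show "bm (ext q) m \<in> H" if "m \<in> bm (ext (g l)) ` I" for m using that comp gI by auto
      show "norm (bm (ext q) m - m) <= 1 / K * norm m" if "m \<in> bm (ext (g l)) ` I" for m
      proof -
        have q1: "norm (q t - 1) <= 1 / K" if t: "t \<in> {0..1}" for t
        proof -
          have "q t - 1 = (g (Suc l) t - g l t) / g l t" using gnz[OF lK t] by (simp add: q_def diff_divide_distrib)
          moreover have "g (Suc l) t - g l t = of_real (1 / K) * (b t - a t)" by (simp add: g_def rS distrib_right)
          ultimately have "q t - 1 = of_real (1 / K) * (b t - a t) / g l t" by simp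
          then have "norm (q t - 1) = 1 / K * norm (b t - a t) / norm (g l t)"
            by (simp only: norm_divide norm_mult norm_of_real) simp
          also have "\<dots> <= 1 / K * norm (g l t) / norm (g l t)"
            using ab[OF t] gl[OF lK t] by (intro divide_right_mono mult_left_mono) auto
          also have "\<dots> = 1 / K" using gnz[OF lK t] by simp
          finally show ?thesis .
        qed
        have c1: "continuous_on {0..1} (%t. q t - 1)" by (intro continuous_intros qc)
        have "bm (ext q) m - m = bm (ext (%t. q t - 1)) m"
          by (rule bcontfun_eqI) (simp add: apply_bm apply_ext qc c1 algebra_simps)
        then have "norm (bm (ext q) m - m) <= norm (ext (%t. q t - 1)) * norm m" using norm_bm by metis
        also have "\<dots> <= 1 / K * norm m" by (intro mult_right_mono norm_ext_le c1 q1) auto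
        finally show ?thesis .
      qed
      show "1 / real K * 3 ^ c <= 1/2" by (simp add: K_def)
    qed simp
    then show ?case by (simp add: image_image comp)
  qed
  from this[of K] have "fincodim c (bm (ext (g K)) ` I) H" by simp
  moreover have "g K = b" using K by (auto simp: g_def r_def)
  ultimately show ?thesis by simp
qed

section \<open>Regular arcs and their good linear forms\<close>

locale regular_arc =
  fixes Z Z' :: "'n::finite => real => complex"
  assumes dZ: "\<And>i t. (Z i has_vector_derivative Z' i t) (at t)" and cZ': "\<And>i. continuous_on UNIV (Z' i)"
    and inj: "\<And>s t. s \<in> {0..1} ==> t \<in> {0..1} ==> (\<And>i. Z i s = Z i t) ==> s = t"
    and reg: "\<And>t. t \<in> {0..1} ==> \<exists>i. Z' i t ~= 0"
begin

text \<open>A projection to the plane that is simple at \<open>t0\<close> and at all rational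
  parameters and crosses horizontal lines transversally at \<open>t0\<close>. A projection of the
  arc need not be injective; this is what genericity can provide.\<close>

definition good :: "real => (real => complex) => (real => complex) => bool" where
  "good t0 p p' \<longleftrightarrow> curve_algebra p p' (palg Z) \<and>
     (\<forall>a\<in>insert t0 (\<rat> \<inter> {0..1}). \<forall>t\<in>{0..1}. p t = p a --> t = a) \<and> Im (p' t0) ~= 0"

lemma palg_C1:
  assumes "u \<in> palg Z"
  shows "\<exists>u'. (\<forall>t. (u has_vector_derivative u' t) (at t)) \<and> continuous_on UNIV u'"
  using assms
proof (induction rule: palg.induct)
  case (const c) then show ?case by (intro exI[of _ "%t. 0"]) auto
next
  case (gen i) then show ?case using dZ cZ' by blast
next
  case (add u v)
  then obtain u' v' where "\<And>t. (u has_vector_derivative u' t) (at t)" "continuous_on UNIV u'"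
    "\<And>t. (v has_vector_derivative v' t) (at t)" "continuous_on UNIV v'" by blast
  then show ?case by (intro exI[of _ "%t. u' t + v' t"]) (auto intro!: derivative_intros continuous_intros)
next
  case (mult u v)
  then obtain u' v' where *: "\<And>t. (u has_vector_derivative u' t) (at t)" "continuous_on UNIV u'"
    "\<And>t. (v has_vector_derivative v' t) (at t)" "continuous_on UNIV v'" by blast
  have "continuous_on UNIV u" "continuous_on UNIV v"
    by (auto intro!: continuous_at_imp_continuous_on has_vector_derivative_continuous[OF *(1)] has_vector_derivative_continuous[OF *(3)])
  then show ?case using *
    by (intro exI[of _ "%t. u t * v' t + u' t * v t"]) (auto intro!: has_vector_derivative_mult continuous_intros)
qed

lemma curve_algebraI:
  assumes u: "u \<in> palg Z" and u': "\<And>t. (u has_vector_derivative u' t) (at t)" "continuous_on UNIV u'"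
  shows "curve_algebra u u' (palg Z)"
proof -
  interpret C1_curve u u' using u' by unfold_locales auto
  show ?thesis
  proof
    show "\<exists>K. \<forall>s\<in>{-1..2}. \<forall>t\<in>{-1..2}. norm (g s - g t) <= K * \<bar>s - t\<bar>" if g: "g \<in> palg Z" for g
    proof -
      obtain g' where g': "\<And>t. (g has_vector_derivative g' t) (at t)" "continuous_on UNIV g'" using palg_C1[OF g] by blast
      interpret g: C1_curve g g' using g' by unfold_locales auto
      obtain K where "\<And>t. t \<in> {-1..2} ==> norm (g' t) <= K" using g.derivative_bounded[of "-1" 2] by blast
      then show ?thesis using g.lipschitz[of "-1" 2 K] by blast
    qed
  qed (use u in \<open>auto intro: palg.intros\<close>)
qed

lemma good_exists:
  assumes t0: "t0 \<in> {0..1}"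
  shows "\<exists>p p'. good t0 p p'"
proof -
  let ?C = "insert t0 (\<rat> \<inter> {0..1})"
  have cC: "countable ?C" by (auto intro: countable_rat countable_subset)
  have "\<exists>c. (\<forall>a\<in>?C. \<forall>t. (\<Sum>i\<in>UNIV. c i * (Z i t - Z i a)) = 0 --> (\<forall>i\<in>UNIV. Z i t = Z i a)) \<and>
      ((\<Sum>i\<in>UNIV. c i * Z' i t0) = 0 --> (\<forall>i\<in>UNIV. Z' i t0 = 0))"
    by (rule generic_combination[OF dZ cC]) simp
  then obtain c where c: "\<And>a t. a \<in> ?C ==> (\<Sum>i\<in>UNIV. c i * (Z i t - Z i a)) = 0 ==> (\<forall>i\<in>UNIV. Z i t = Z i a)"
    "(\<Sum>i\<in>UNIV. c i * Z' i t0) = 0 ==> (\<forall>i\<in>UNIV. Z' i t0 = 0)"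
    by blast
  define S where "S = (\<Sum>i\<in>UNIV. c i * Z' i t0)"
  have S: "S ~= 0" using c(2) reg[OF t0] unfolding S_def by auto
  \<comment> \<open>A rotation and scaling after which \<open>p' t0\<close> is a positive multiple
    of \<open>\<i>\<close>.\<close>
  define l where "l = \<i> * cnj S"
  have l0: "l ~= 0" using S by (simp add: l_def)
  define p where "p = (%t. \<Sum>i\<in>UNIV. (l * c i) * Z i t)"
  define p' where "p' = (%t. \<Sum>i\<in>UNIV. (l * c i) * Z' i t)"
  have pP: "p \<in> palg Z"
  proof -
    have "(%t. \<Sum>i\<in>J. (l * c i) * Z i t) \<in> palg Z" if "finite J" for J
      using that
    proof (induction J rule: finite_induct)
      case (insert j J)
      have "(%t. (l * c j) * Z j t + (\<Sum>i\<in>J. (l * c i) * Z i t)) \<in> palg Z"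
        by (intro palg.add palg.mult[OF palg.const palg.gen] insert.IH)
      then show ?case using insert.hyps by simp
    qed (simp add: palg.const)
    then show ?thesis by (simp add: p_def)
  qed
  have ca: "curve_algebra p p' (palg Z)"
  proof (rule curve_algebraI[OF pP])
    show "(p has_vector_derivative p' t) (at t)" for t
      unfolding p_def p'_def by (intro has_vector_derivative_sum has_vector_derivative_mult_right dZ)
    show "continuous_on UNIV p'" unfolding p'_def by (intro continuous_intros cZ')
  qed
  have "t = a" if a: "a \<in> ?C" and t: "t \<in> {0..1}" and eq: "p t = p a" for a t
  proof -
    have "p t - p a = l * (\<Sum>i\<in>UNIV. c i * (Z i t - Z i a))"
      by (simp add: p_def sum_distrib_left sum_subtractf algebra_simps)
    then have "(\<Sum>i\<in>UNIV. c i * (Z i t - Z i a)) = 0" using eq l0 by simp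
    then have "\<And>i. Z i t = Z i a" using c(1)[OF a] by blast
    moreover have "a \<in> {0..1}" using a t0 by blast
    ultimately show ?thesis using inj[OF t] by blast
  qed
  moreover have "p' t0 = l * S" by (simp add: p'_def S_def sum_distrib_left mult.assoc)
  then have "p' t0 = \<i> * of_real ((norm S)\<^sup>2)" by (simp only: l_def complex_norm_square mult_ac)
  then have "Im (p' t0) = (norm S)\<^sup>2" by (simp add: Im_i_times del: of_real_power)
  then have "Im (p' t0) ~= 0" using S by simp
  ultimately show ?thesis unfolding good_def using ca by blast
qed

text \<open>Each good form makes \<open>L\<close> vanish on functions supported near its
  \<open>t0\<close>. Compactness of the interval and a partition of unity then give all continuous
  functions.\<close>

lemma vanishing_functional:
  assumes L: "cdual L" and kill: "\<And>t0 p p' w. t0 \<in> {0..1} ==> good t0 p p' ==> w \<notin> p ` {0..1} ==> L (%t. 1 / (p t - w)) = 0"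
    and u: "continuous_on {0..1} u"
  shows "L u = 0"
proof -
  have "\<exists>r>0. \<forall>\<theta>. continuous_on UNIV \<theta> --> (\<forall>t\<in>{0..1}. r <= \<bar>t - t0\<bar> --> \<theta> t = 0) --> L \<theta> = 0" if t0: "t0 \<in> {0..1}" for t0
  proof -
    obtain p p' where g: "good t0 p p'" using good_exists[OF t0] by blast
    interpret curve_algebra p p' "palg Z" using g by (simp add: good_def)
    obtain r where "r > 0" "\<And>L \<theta>. cdual L ==> (\<forall>w. w \<notin> p ` {0..1} --> L (%t. 1 / (p t - w)) = 0) ==>
       continuous_on UNIV \<theta> ==> (\<forall>t\<in>{0..1}. r <= \<bar>t - t0\<bar> --> \<theta> t = 0) ==> L \<theta> = 0"
      using plemelj[OF t0] g unfolding good_def by blast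
    then show ?thesis using L kill[OF t0 g] by blast
  qed
  then obtain r where r: "\<And>t0. t0 \<in> {0..1} ==> r t0 > 0"
    "\<And>t0 \<theta>. t0 \<in> {0..1} ==> continuous_on UNIV \<theta> ==> (\<forall>t\<in>{0..1}. r t0 <= \<bar>t - t0\<bar> --> \<theta> t = 0) ==> L \<theta> = 0"
    by metis
  have "compact {0..1::real}" by simp
  moreover have "{0..1::real} \<subseteq> (\<Union>t0\<in>{0..1}. ball t0 (r t0))" using r(1) by force
  ultimately obtain F where F: "F \<subseteq> {0..1}" "finite F" "{0..1} \<subseteq> (\<Union>t0\<in>F. ball t0 (r t0))"
    using compactE_image[of "{0..1::real}" "{0..1}" "%t0. ball t0 (r t0)"] by auto
  define \<phi> where "\<phi> = (%t0 t. max 0 (r t0 - \<bar>t - t0\<bar>))"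
  define \<Phi> where "\<Phi> = (%t. \<Sum>t0\<in>F. \<phi> t0 t)"
  have \<Phi>: "\<Phi> t > 0" if t: "t \<in> {0..1}" for t
  proof -
    obtain t0 where t0: "t0 \<in> F" "t \<in> ball t0 (r t0)" using F(3) t by blast
    show ?thesis unfolding \<Phi>_def
      by (rule sum_pos2[OF F(2) t0(1)]) (use t0(2) in \<open>auto simp: \<phi>_def dist_real_def abs_minus_commute\<close>)
  qed
  define \<theta> where "\<theta> = (%t0 t. u (clamp01 t) * of_real (\<phi> t0 (clamp01 t) / \<Phi> (clamp01 t)))"
  have cl: "continuous_on UNIV clamp01" by (rule continuous_clamp01)
  have c\<phi>: "continuous_on UNIV (%t. \<phi> t0 (clamp01 t))" for t0
    unfolding \<phi>_def by (intro continuous_intros cl)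
  have c\<theta>: "continuous_on UNIV (\<theta> t0)" for t0
    unfolding \<theta>_def
  proof (intro continuous_on_mult continuous_on_of_real continuous_on_divide c\<phi>)
    show "continuous_on UNIV (%t. u (clamp01 t))" by (rule continuous_on_compose2[OF u cl]) (use clamp01_in in blast)
    show "continuous_on UNIV (%t. \<Phi> (clamp01 t))" unfolding \<Phi>_def by (intro continuous_on_sum c\<phi>)
    show "\<forall>t\<in>UNIV. \<Phi> (clamp01 t) ~= 0" using \<Phi> clamp01_in by (metis less_irrefl)
  qed
  have "L (\<theta> t0) = 0" if "t0 \<in> F" for t0
  proof (rule r(2)[OF _ c\<theta>])
    show "t0 \<in> {0..1}" using that F(1) by auto
    show "\<forall>t\<in>{0..1}. r t0 <= \<bar>t - t0\<bar> --> \<theta> t0 t = 0"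
      by (auto simp: \<theta>_def clamp01_id \<phi>_def)
  qed
  then have "(\<Sum>t0\<in>F. L (\<theta> t0)) = 0" by simp
  then have "L (%t. \<Sum>t0\<in>F. \<theta> t0 t) = 0"
    by (subst cdual_sum[OF L F(2)]) (auto intro: continuous_on_subset[OF c\<theta>])
  moreover have "L u = L (%t. \<Sum>t0\<in>F. \<theta> t0 t)"
  proof (rule cdual_cong[OF L u])
    fix t :: real assume t: "t \<in> {0..1}"
    have "(\<Sum>t0\<in>F. \<theta> t0 t) = u t * (\<Sum>t0\<in>F. of_real (\<phi> t0 t / \<Phi> t))"
      unfolding \<theta>_def clamp01_id[OF t] by (rule sum_distrib_left[symmetric])
    also have "(\<Sum>t0\<in>F. complex_of_real (\<phi> t0 t / \<Phi> t)) = of_real (\<Phi> t / \<Phi> t)"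
      unfolding of_real_sum[symmetric] sum_divide_distrib[symmetric] by (simp add: \<Phi>_def)
    finally show "u t = (\<Sum>t0\<in>F. \<theta> t0 t)" using \<Phi>[OF t] by simp
  qed
  ultimately show ?thesis by simp
qed

section \<open>Multipliers of finite codimension and the index argument\<close>

definition HH where "HH = closure (ext ` palg Z)"

definition admissible :: "(real => complex) => bool" where
  "admissible a \<longleftrightarrow> continuous_on {0..1} a \<and> (\<exists>k. fincodim k {h\<in>HH. bm (ext a) h \<in> HH} HH)"

text \<open>\<open>HH\<close> does not mention a linear form, so whatever any single good form
  yields about its own \<open>H\<close> is a fact about \<open>HH\<close>, and all forms can be used
  together.\<close>

lemma HH_facts:
  shows sHH: "subspace HH" and cHH: "closed HH" and bmHH: "\<And>u x. u \<in> palg Z ==> x \<in> HH ==> bm (ext u) x \<in> HH"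
    and extHH: "\<And>u. u \<in> palg Z ==> ext u \<in> HH"
    and sepHH: "\<And>v. continuous_on {0..1} v ==> ext v \<notin> HH ==> \<exists>L. cdual L \<and> (\<forall>u\<in>palg Z. L u = 0) \<and> L v ~= 0"
    and divHH: "\<And>t0 p p' w. t0 \<in> {0..1} ==> good t0 p p' ==> w \<notin> p ` {0..1} ==> admissible (%t. 1 / (p t - w))"
    and contP: "\<And>u. u \<in> palg Z ==> continuous_on {0..1} u"
proof -
  obtain p p' where g: "good 0 p p'" using good_exists[of 0] by auto
  interpret curve_algebra p p' "palg Z" using g by (simp add: good_def)
  have eq: "HH = H" unfolding HH_def H_def by (rule refl)
  show "subspace HH" "closed HH" unfolding eq by (rule subspace_H closed_H)+
  show "bm (ext u) x \<in> HH" if "u \<in> palg Z" "x \<in> HH" for u x using bm_P_H that unfolding eq by blast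
  show "ext u \<in> HH" if "u \<in> palg Z" for u using ext_in_H that unfolding eq by blast
  show "continuous_on {0..1} u" if "u \<in> palg Z" for u by (rule P_cont01[OF that])
  show "\<exists>L. cdual L \<and> (\<forall>u\<in>palg Z. L u = 0) \<and> L v ~= 0" if "continuous_on {0..1} v" "ext v \<notin> HH" for v
    using separation_from_H[of v] that unfolding eq annihilates_def by blast
  fix t1 q q' w assume q: "t1 \<in> {0..1}" "good t1 q q'" and w: "w \<notin> q ` {0..1}"
  interpret q: curve_algebra q q' "palg Z" using q by (simp add: good_def)
  have eq': "HH = q.H" unfolding HH_def q.H_def by (rule refl)
  show "admissible (%t. 1 / (q t - w))"
    unfolding admissible_def eq'
  proof
    show "continuous_on {0..1} (%t. 1 / (q t - w))" by (rule q.cont_div[OF continuous_on_const]) (use w in \<open>simp add: q.X_def\<close>)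
    show "\<exists>k. fincodim k {h \<in> q.H. bm (ext (%t. 1 / (q t - w))) h \<in> q.H} q.H"
      by (rule divisor_fincodim[OF q.curve_algebra_axioms _ w]) (use q in \<open>auto simp: good_def\<close>)
  qed
qed

lemma subspace_mult_into: "subspace {h\<in>HH. bm x h \<in> HH}"
  unfolding subspace_def using sHH
  by (auto simp: subspace_def linear_0[OF linear_bm] linear_add[OF linear_bm] linear_scale[OF linear_bm])

lemma admissible_palg: assumes "u \<in> palg Z" shows "admissible u"
proof -
  have "{h\<in>HH. bm (ext u) h \<in> HH} = HH" using bmHH[OF assms] by blast
  moreover have "fincodim 0 HH HH" unfolding fincodim_def by (intro exI[of _ "{}"]) (auto intro: span_base)
  ultimately show ?thesis unfolding admissible_def using contP[OF assms] by auto
qed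

lemma admissible_add: assumes "admissible a" "admissible b" shows "admissible (%t. a t + b t)"
proof -
  obtain j k where jk: "fincodim j {h\<in>HH. bm (ext a) h \<in> HH} HH" "fincodim k {h\<in>HH. bm (ext b) h \<in> HH} HH"
    and c: "continuous_on {0..1} a" "continuous_on {0..1} b" using assms by (auto simp: admissible_def)
  have "fincodim (j + k) ({h\<in>HH. bm (ext a) h \<in> HH} \<inter> {h\<in>HH. bm (ext b) h \<in> HH}) HH"
    by (rule fincodim_Int[OF subspace_mult_into subspace_mult_into _ jk]) auto
  moreover have "{h\<in>HH. bm (ext a) h \<in> HH} \<inter> {h\<in>HH. bm (ext b) h \<in> HH} \<subseteq> {h\<in>HH. bm (ext (%t. a t + b t)) h \<in> HH}"
  proof -
    have "bm (ext (%t. a t + b t)) h = bm (ext a) h + bm (ext b) h" for h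
      unfolding ext_add[OF c] by (rule bounded_bilinear.add_left[OF bounded_bilinear_bm])
    then show ?thesis using sHH by (auto intro: subspace_add)
  qed
  ultimately have "fincodim (j + k) {h\<in>HH. bm (ext (%t. a t + b t)) h \<in> HH} HH" by (rule fincodim_mono)
  then show ?thesis unfolding admissible_def using continuous_on_add[OF c] by blast
qed

lemma admissible_mult: assumes "admissible a" "admissible b" shows "admissible (%t. a t * b t)"
proof -
  obtain j k where jk: "fincodim j {h\<in>HH. bm (ext a) h \<in> HH} HH" "fincodim k {h\<in>HH. bm (ext b) h \<in> HH} HH"
    and c: "continuous_on {0..1} a" "continuous_on {0..1} b" using assms by (auto simp: admissible_def)
  let ?H' = "{h\<in>HH. bm (ext b) h \<in> HH}"
  have "fincodim j {h\<in>?H'. bm (ext b) h \<in> {h\<in>HH. bm (ext a) h \<in> HH}} ?H'"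
    by (rule fincodim_vimage[OF linear_bm subspace_mult_into subspace_mult_into _ jk(1)]) auto
  then have "fincodim (j + k) {h\<in>?H'. bm (ext b) h \<in> {h\<in>HH. bm (ext a) h \<in> HH}} HH"
    by (rule fincodim_trans[OF _ jk(2)]) auto
  moreover have "{h\<in>?H'. bm (ext b) h \<in> {h\<in>HH. bm (ext a) h \<in> HH}} \<subseteq> {h\<in>HH. bm (ext (%t. a t * b t)) h \<in> HH}"
    unfolding ext_mult[OF c] by (auto simp: bm_assoc)
  ultimately have "fincodim (j + k) {h\<in>HH. bm (ext (%t. a t * b t)) h \<in> HH} HH" by (rule fincodim_mono)
  then show ?thesis unfolding admissible_def using continuous_on_mult[OF c] by blast
qed

text \<open>The admissible functions form an algebra containing \<open>1 / (p - w)\<close> for all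
  good forms, so a functional annihilating them vanishes by the jump relation.\<close>

lemma admissible_dense:
  assumes g: "continuous_on {0..1} g" and d: "d > 0"
  shows "\<exists>a. admissible a \<and> (\<forall>t\<in>{0..1}. norm (g t - a t) < d)"
proof (rule ccontr)
  assume "\<not> ?thesis"
  then have far: "\<exists>t\<in>{0..1}. norm (g t - a t) >= d" if "a \<in> Collect admissible" for a using that by force
  have "\<exists>L. cdual L \<and> (\<forall>u\<in>Collect admissible. L u = 0) \<and> L g ~= 0"
  proof (rule cdual_separation[OF _ _ _ _ g d far])
    show "(%t. c * u t) \<in> Collect admissible" if "u \<in> Collect admissible" for c u
      using admissible_mult[OF admissible_palg[OF palg.const]] that by simp
  qed (auto intro: admissible_palg palg.const admissible_add simp: admissible_def[THEN iffD1])
  then obtain L where "cdual L" "\<And>u. admissible u ==> L u = 0" "L g ~= 0" by auto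
  then show False using vanishing_functional[OF _ _ g, of L] divHH by blast
qed

text \<open>Multiplication by \<open>p - w\<close> on \<open>HH\<close> is injective, and it has index 0 because \<open>p - w = exp u\<close> can be deformed to 1
  through admissible multipliers.\<close>

lemma reciprocal_in_HH:
  assumes t0: "t0 \<in> {0..1}" and gd: "good t0 p p'" and w: "w \<notin> p ` {0..1}"
  shows "ext (%t. 1 / (p t - w)) \<in> HH"
proof -
  interpret curve_algebra p p' "palg Z" using gd by (simp add: good_def)
  define f where "f = (%t. p t - w)"
  have fP: "f \<in> palg Z" unfolding f_def by (rule pw_P)
  have fc: "continuous_on {0..1} f" by (rule contP[OF fP])
  have fnz: "f t ~= 0" if "t \<in> {0..1}" for t using w that by (auto simp: f_def)
  obtain u where u: "continuous_on {0..1} u" "\<And>t. t \<in> {0..1} ==> f t = exp (u t)"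
    by (rule continuous_logarithm_on_contractible[OF fc]) (use fnz in \<open>auto intro: convex_imp_contractible\<close>)
  obtain U where U: "U > 0" "\<And>t. t \<in> {0..1} ==> norm (u t) <= U"
  proof -
    have "bounded (u ` {0..1})" by (intro compact_imp_bounded compact_continuous_image u) auto
    then show thesis using that unfolding bounded_pos by auto
  qed
  have "isCont (exp :: complex => complex) 0" by simp
  then obtain \<delta> where \<delta>: "\<delta> > 0" "\<And>z::complex. norm z < \<delta> ==> norm (exp z - 1) < 1/8"
    unfolding continuous_at_eps_delta by (metis dist_0_norm dist_commute dist_norm exp_zero norm_minus_commute zero_less_divide_1_iff zero_less_numeral)
  obtain J where J: "J > 0" "U / real J < \<delta>"
  proof -
    obtain J where "U / \<delta> < real J" using reals_Archimedean2 by blast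
    moreover have "0 < U / \<delta>" using U \<delta> by simp
    ultimately have "0 < real J" "U < \<delta> * real J" using \<delta>(1) by (linarith, simp add: pos_divide_less_eq mult.commute)
    then show thesis using that[of J] by (simp add: pos_divide_less_eq)
  qed
  define g where "g = (%j t. exp (of_real (real j / J) * u t))"
  have gc: "continuous_on {0..1} (g j)" for j unfolding g_def by (intro continuous_intros u)
  \<comment> \<open>A lower bound for all \<open>exp (j / J * u)\<close> at once; approximation
    within \<open>m0 / 8\<close> is then also a relative approximation.\<close>
  define m0 where "m0 = exp (- U)"
  have m0: "m0 > 0" by (simp add: m0_def)
  have gl: "norm (g j t) >= m0" if "j <= J" "t \<in> {0..1}" for j t
  proof -
    have "norm (of_real (real j / J) * u t) <= 1 * U"
      unfolding norm_mult norm_of_real using that J(1) U by (intro mult_mono) auto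
    then have "- U <= Re (of_real (real j / J) * u t)"
      using abs_Re_le_cmod[of "of_real (real j / J) * u t"] by linarith
    then show ?thesis unfolding g_def m0_def norm_exp_eq_Re by simp
  qed
  have gs: "norm (g (Suc j) t - g j t) <= 1/8 * norm (g j t)" if "t \<in> {0..1}" for j t
  proof -
    have "norm (u t / J) < \<delta>"
    proof -
      have "norm (u t / J) <= U / J" using U(2)[OF that] J(1) by (simp add: norm_divide divide_right_mono)
      then show ?thesis using J(2) by linarith
    qed
    then have 1: "norm (exp (u t / J) - 1) <= 1/8" using \<delta>(2) by force
    have "g (Suc j) t = g j t * exp (u t / J)"
      unfolding g_def exp_add[symmetric] by (rule arg_cong[where f = exp]) (simp add: add_divide_distrib algebra_simps)
    then have "g (Suc j) t - g j t = g j t * (exp (u t / J) - 1)" by (simp add: algebra_simps)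
    then have "norm (g (Suc j) t - g j t) = norm (g j t) * norm (exp (u t / J) - 1)" by (simp add: norm_mult)
    also have "\<dots> <= norm (g j t) * (1/8)" using 1 by (intro mult_left_mono) auto
    finally show ?thesis by simp
  qed
  have "\<exists>a. admissible a \<and> (\<forall>t\<in>{0..1}. norm (g j t - a t) < m0 / 8)" for j
    by (rule admissible_dense[OF gc]) (use m0 in simp)
  then obtain a where a: "\<And>j. admissible (a j)" "\<And>j t. t \<in> {0..1} ==> norm (g j t - a j t) < m0 / 8" by metis
  \<comment> \<open>Only the intermediate multipliers are approximated; the ends 1 and
    \<open>f\<close> are admissible as they are, so the deformation connects them exactly.\<close>
  define b where "b = (%j. if j = 0 then (%t. 1) else if j = J then f else a j)"
  have bad: "admissible (b j)" for j
    unfolding b_def using a(1) admissible_palg[OF palg.const] admissible_palg[OF fP] by auto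
  have bc: "continuous_on {0..1} (b j)" for j using bad by (simp add: admissible_def)
  have bg: "norm (g j t - b j t) <= m0 / 8" if "t \<in> {0..1}" for j t
    using a(2)[OF that, of j] u(2)[OF that] m0 J(1) by (auto simp: b_def g_def)
  \<comment> \<open>Three errors of 1/8 add up to 3/8 of \<open>g j\<close>, while
    \<open>b j\<close> is at least 7/8 of it; this is within the relative step 1/2 that
    \<open>index_step\<close> allows.\<close>
  have bb: "norm (b (Suc j) t - b j t) <= 1/2 * norm (b j t)" "b j t ~= 0" if j: "Suc j <= J" and t: "t \<in> {0..1}" for j t
  proof -
    have jJ: "j <= J" using j by simp
    note G = gl[OF jJ t] gs[OF t, of j] bg[OF t, of j] bg[OF t, of "Suc j"]
    have 1: "norm (b j t) >= 7/8 * norm (g j t)" using G norm_triangle_ineq2[of "g j t" "g j t - b j t"] by simp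
    have eq: "b (Suc j) t - b j t = (g (Suc j) t - g j t) - (g (Suc j) t - b (Suc j) t) + (g j t - b j t)" by simp
    have "norm (b (Suc j) t - b j t) <= norm (g (Suc j) t - g j t) + norm (g (Suc j) t - b (Suc j) t) + norm (g j t - b j t)"
      unfolding eq by (rule order_trans[OF norm_triangle_ineq add_right_mono[OF norm_triangle_ineq4]])
    then have "norm (b (Suc j) t - b j t) <= 3/8 * norm (g j t)" using G by linarith
    then show "norm (b (Suc j) t - b j t) <= 1/2 * norm (b j t)" using 1 m0 G(1) by linarith
    show "b j t ~= 0" using 1 m0 G(1) by auto
  qed
  \<comment> \<open>A common domain: all multipliers of the chain map \<open>I\<close> into
    \<open>HH\<close>. Being a finite intersection, it is still of finite codimension.\<close>
  define I where "I = {h\<in>HH. \<forall>j\<le>J. bm (ext (b j)) h \<in> HH}"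
  have Ieq: "I = HH \<inter> (\<Inter>j\<in>{..J}. {h\<in>HH. bm (ext (b j)) h \<in> HH})" by (auto simp: I_def)
  have sI: "subspace I" unfolding Ieq by (intro subspace_inter subspace_Int sHH subspace_mult_into)
  have cI: "closed I"
  proof -
    have "closed {h\<in>HH. bm (ext (b j)) h \<in> HH}" for j
    proof -
      have "{h\<in>HH. bm (ext (b j)) h \<in> HH} = HH \<inter> bm (ext (b j)) -` HH" by auto
      then show ?thesis using cHH closed_vimage[OF cHH linear_continuous_on[OF bounded_linear_bm]] by (auto intro: closed_Int)
    qed
    then show ?thesis unfolding Ieq using cHH by (intro closed_Int closed_INT) auto
  qed
  have IH: "I \<subseteq> HH" by (auto simp: I_def)
  have "\<exists>c. fincodim c {h\<in>HH. \<forall>j<n. bm (ext (b j)) h \<in> HH} HH" for n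
  proof (induction n)
    case 0
    have "fincodim 0 HH HH" unfolding fincodim_def by (intro exI[of _ "{}"]) (auto intro: span_base)
    then show ?case by auto
  next
    case (Suc n)
    then obtain c where c: "fincodim c {h\<in>HH. \<forall>j<n. bm (ext (b j)) h \<in> HH} HH" by blast
    obtain k where k: "fincodim k {h\<in>HH. bm (ext (b n)) h \<in> HH} HH" using bad by (auto simp: admissible_def)
    have sn: "subspace {h\<in>HH. \<forall>j<n. bm (ext (b j)) h \<in> HH}"
    proof -
      have "{h\<in>HH. \<forall>j<n. bm (ext (b j)) h \<in> HH} = HH \<inter> (\<Inter>j\<in>{..<n}. {h\<in>HH. bm (ext (b j)) h \<in> HH})" by auto
      moreover have "subspace \<dots>" by (intro subspace_inter subspace_Int sHH subspace_mult_into)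
      ultimately show ?thesis by simp
    qed
    have "fincodim (c + k) ({h\<in>HH. \<forall>j<n. bm (ext (b j)) h \<in> HH} \<inter> {h\<in>HH. bm (ext (b n)) h \<in> HH}) HH"
      by (rule fincodim_Int[OF sn subspace_mult_into _ c k]) auto
    moreover have "{h\<in>HH. \<forall>j<n. bm (ext (b j)) h \<in> HH} \<inter> {h\<in>HH. bm (ext (b n)) h \<in> HH} = {h\<in>HH. \<forall>j<Suc n. bm (ext (b j)) h \<in> HH}"
      by (auto simp: less_Suc_eq)
    ultimately show ?case by auto
  qed
  from this[of "Suc J"] have ex: "\<exists>c. fincodim c I HH" by (simp add: I_def less_Suc_eq_le)
  \<comment> \<open>The exact codimension of \<open>I\<close>. The deformation transports it from
    \<open>I\<close> to \<open>f * I\<close>, and equality of the two makes multiplication by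
    \<open>f\<close> onto.\<close>
  define c where "c = (LEAST c. fincodim c I HH)"
  have c: "fincodim c I HH" unfolding c_def using ex by (rule LeastI_ex)
  have least: "c <= k" if "fincodim k I HH" for k unfolding c_def using that by (rule Least_le)
  have "j <= J ==> fincodim c (bm (ext (b j)) ` I) HH" for j
  proof (induction j)
    case 0
    have "bm (ext (b 0)) ` I = I" by (simp add: b_def bm_one)
    then show ?case using c by simp
  next
    case (Suc j)
    show ?case
      by (rule index_step[OF sHH sI cI IH bc bb(2)[OF Suc.prems] _ bc _ bb(1)[OF Suc.prems]])
        (use Suc in \<open>auto simp: I_def\<close>)
  qed
  from this[of J] have fcT: "fincodim c (bm (ext f) ` I) HH" using J(1) by (simp add: b_def)
  have "bm (ext f) ` HH = HH"
  proof (rule fincodim_equal_imp_onto[OF linear_bm _ sHH sI IH _ c least fcT])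
    show "inj_on (bm (ext f)) HH" by (rule inj_onI) (rule bm_left_cancel[OF fc fnz])
    show "bm (ext f) ` HH \<subseteq> HH" using bmHH[OF fP] by blast
  qed
  then obtain h where h: "h \<in> HH" "bm (ext f) h = ext (%t. 1)"
    using extHH[OF palg.const[of 1 Z]] by (metis imageE)
  have ci: "continuous_on {0..1} (%t. 1 / f t)" using fnz by (intro continuous_on_divide fc) auto
  have "bm (ext f) (ext (%t. 1 / f t)) = ext (%t. 1)"
    using fnz clamp01_in by (intro bcontfun_eqI) (simp add: apply_bm apply_ext fc ci)
  then have "h = ext (%t. 1 / f t)" using bm_left_cancel[OF fc fnz] h(2) by metis
  then show ?thesis using h(1) by (simp add: f_def)
qed

text \<open>A functional annihilating the polynomials annihilates their closure, hence all
  \<open>1 / (p - w)\<close> with good \<open>p\<close>; by the jump relation it is zero.\<close>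

theorem polynomials_dense:
  assumes u: "continuous_on {0..1} u" and e: "e > 0"
  shows "\<exists>v\<in>palg Z. \<forall>t\<in>{0..1}. norm (u t - v t) < e"
proof -
  have uH: "ext u \<in> HH"
  proof (rule ccontr)
    assume "ext u \<notin> HH"
    then obtain L where L: "cdual L" "\<forall>u\<in>palg Z. L u = 0" "L u ~= 0" using sepHH[OF u] by blast
    have "L v = 0" if v: "continuous_on {0..1} v" "ext v \<in> HH" for v
    proof -
      obtain \<Lambda> where \<Lambda>: "bounded_linear \<Lambda>" "\<And>u. continuous_on {0..1} u ==> L u = \<Lambda> (ext u)"
        using cdual_rep[OF L(1)] by blast
      have "closed {x. \<Lambda> x = 0}" using continuous_closed_preimage_constant[OF linear_continuous_on[OF \<Lambda>(1)] closed_UNIV, of 0] by simp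
      moreover have "ext ` palg Z \<subseteq> {x. \<Lambda> x = 0}" using L(2) \<Lambda>(2) contP by auto
      ultimately have "HH \<subseteq> {x. \<Lambda> x = 0}" unfolding HH_def by (rule closure_minimal[rotated])
      then show ?thesis using \<Lambda>(2)[OF v(1)] v(2) by auto
    qed
    then have "L (%t. 1 / (p t - w)) = 0" if "t0 \<in> {0..1}" "good t0 p p'" "w \<notin> p ` {0..1}" for t0 p p' w
      using reciprocal_in_HH[OF that] divHH[OF that] by (simp add: admissible_def)
    then have "L u = 0" by (rule vanishing_functional[OF L(1) _ u])
    then show False using L(3) by simp
  qed
  then obtain v where v: "v \<in> palg Z" "dist (ext v) (ext u) < e"
    unfolding HH_def closure_approachable using e by blast
  have "norm (u t - v t) < e" if t: "t \<in> {0..1}" for t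
  proof -
    have c: "continuous_on {0..1} (%t. u t - v t)" by (intro continuous_on_diff u contP v)
    have "norm (u t - v t) <= norm (ext (%t. u t - v t))" by (rule norm_le_norm_ext[OF c t])
    also have "\<dots> = dist (ext v) (ext u)" by (simp add: ext_diff u contP v dist_norm norm_minus_commute)
    finally show ?thesis using v(2) by simp
  qed
  then show ?thesis using v(1) by blast
qed

end

subsection \<open>Polynomial convexity of closed curves\<close>

text \<open>Polynomials by closure properties, so that membership of sums and products is immediate.
  Expansion into monomials is needed only once, to reach \<open>holo_poly\<close>.\<close>

inductive_set polyfuns :: "((complex^'n) => complex) set" where
  const: "(%z. c) \<in> polyfuns"
| coord: "(%z. vec_nth z i) \<in> polyfuns"
| add: "F \<in> polyfuns ==> G \<in> polyfuns ==> (%z. F z + G z) \<in> polyfuns"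
| mult: "F \<in> polyfuns ==> G \<in> polyfuns ==> (%z. F z * G z) \<in> polyfuns"

definition monomial :: "('n => nat) => complex^'n => complex" where
  "monomial \<alpha> z = (\<Prod>i\<in>UNIV. vec_nth z i ^ \<alpha> i)"

lemma holo_polyI:
  fixes P :: "complex^'n => complex"
  assumes A: "finite A" and P: "\<And>z. P z = (\<Sum>\<alpha>\<in>A. c \<alpha> * monomial \<alpha> z)"
  shows "holo_poly P"
proof -
  define c' where "c' = (%\<alpha>. if \<alpha> \<in> A then c \<alpha> else 0)"
  have sub: "{\<alpha>. c' \<alpha> ~= 0} \<subseteq> A" by (auto simp: c'_def)
  have "P z = (\<Sum>\<alpha>\<in>{\<alpha>. c' \<alpha> ~= 0}. c' \<alpha> * monomial \<alpha> z)" for z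
  proof -
    have "(\<Sum>\<alpha>\<in>{\<alpha>. c' \<alpha> ~= 0}. c' \<alpha> * monomial \<alpha> z) = (\<Sum>\<alpha>\<in>A. c' \<alpha> * monomial \<alpha> z)"
      by (rule sum.mono_neutral_left[OF A sub]) auto
    also have "\<dots> = P z" unfolding P by (intro sum.cong) (auto simp: c'_def)
    finally show ?thesis by simp
  qed
  then show ?thesis unfolding holo_poly_def monomial_def using finite_subset[OF sub A] by blast
qed

lemma polyfuns_expansion:
  fixes F :: "complex^'n => complex"
  assumes "F \<in> polyfuns"
  shows "\<exists>A c. finite A \<and> (\<forall>z. F z = (\<Sum>\<alpha>\<in>A. c \<alpha> * monomial \<alpha> z))"
  using assms
proof (induction rule: polyfuns.induct)
  case (const c)
  show ?case by (intro exI[of _ "{%_. 0}"] exI[of _ "%_. c"]) (simp add: monomial_def)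
next
  case (coord i)
  have "monomial (%j. if j = i then 1 else 0) z = vec_nth z i" for z :: "complex^'n"
  proof -
    have "(\<Prod>j\<in>UNIV. vec_nth z j ^ (if j = i then 1 else 0)) = (\<Prod>j\<in>UNIV. if j = i then vec_nth z j else 1)"
      by (intro prod.cong) auto
    then show ?thesis by (simp add: monomial_def)
  qed
  then show ?case by (intro exI[of _ "{%j. if j = i then 1 else 0}"] exI[of _ "%_. 1"]) simp
next
  case (add F G)
  then obtain A c B d where A: "finite A" "\<And>z. F z = (\<Sum>\<alpha>\<in>A. c \<alpha> * monomial \<alpha> z)"
    and B: "finite B" "\<And>z. G z = (\<Sum>\<alpha>\<in>B. d \<alpha> * monomial \<alpha> z)" by blast
  define e where "e = (%\<alpha>. (if \<alpha> \<in> A then c \<alpha> else 0) + (if \<alpha> \<in> B then d \<alpha> else 0))"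
  have "F z + G z = (\<Sum>\<alpha>\<in>A\<union>B. e \<alpha> * monomial \<alpha> z)" for z
  proof -
    have "F z = (\<Sum>\<alpha>\<in>A\<union>B. (if \<alpha> \<in> A then c \<alpha> else 0) * monomial \<alpha> z)"
      unfolding A(2) by (rule sum.mono_neutral_cong_left) (use A B in auto)
    moreover have "G z = (\<Sum>\<alpha>\<in>A\<union>B. (if \<alpha> \<in> B then d \<alpha> else 0) * monomial \<alpha> z)"
      unfolding B(2) by (rule sum.mono_neutral_cong_left) (use A B in auto)
    ultimately show ?thesis unfolding e_def distrib_right sum.distrib by simp
  qed
  then show ?case using A(1) B(1) by (intro exI[of _ "A \<union> B"] exI[of _ e]) simp
next
  case (mult F G)
  then obtain A c B d where A: "finite A" "\<And>z. F z = (\<Sum>\<alpha>\<in>A. c \<alpha> * monomial \<alpha> z)"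
    and B: "finite B" "\<And>z. G z = (\<Sum>\<alpha>\<in>B. d \<alpha> * monomial \<alpha> z)" by blast
  define f :: "('n => nat) \<times> ('n => nat) => 'n => nat" where "f = (%x i. fst x i + snd x i)"
  define e where "e = (%\<beta>. \<Sum>x\<in>{x\<in>A\<times>B. f x = \<beta>}. c (fst x) * d (snd x))"
  have fin: "finite (A \<times> B)" using A B by simp
  have m: "monomial (fst x) z * monomial (snd x) z = monomial (f x) z" for x and z :: "complex^'n"
    unfolding monomial_def f_def power_add prod.distrib by simp
  have "F z * G z = (\<Sum>\<beta>\<in>f ` (A\<times>B). e \<beta> * monomial \<beta> z)" for z
  proof -
    have "F z * G z = (\<Sum>\<alpha>\<in>A. \<Sum>\<beta>\<in>B. (c \<alpha> * monomial \<alpha> z) * (d \<beta> * monomial \<beta> z))"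
      unfolding A(2) B(2) by (rule sum_product)
    also have "\<dots> = (\<Sum>x\<in>A\<times>B. (c (fst x) * monomial (fst x) z) * (d (snd x) * monomial (snd x) z))"
      by (simp add: sum.cartesian_product case_prod_beta)
    also have "\<dots> = (\<Sum>x\<in>A\<times>B. c (fst x) * d (snd x) * monomial (f x) z)"
      by (intro sum.cong refl) (simp add: m[symmetric] mult_ac)
    also have "\<dots> = (\<Sum>\<beta>\<in>f ` (A\<times>B). \<Sum>x\<in>{x\<in>A\<times>B. f x = \<beta>}. c (fst x) * d (snd x) * monomial (f x) z)"
      by (rule sum.image_gen[OF fin])
    also have "\<dots> = (\<Sum>\<beta>\<in>f ` (A\<times>B). e \<beta> * monomial \<beta> z)"
      unfolding e_def sum_distrib_right by (intro sum.cong refl) auto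
    finally show ?thesis .
  qed
  then show ?case using fin by (intro exI[of _ "f ` (A\<times>B)"] exI[of _ e]) simp
qed

lemma polyfuns_holo_poly: "F \<in> polyfuns ==> holo_poly F"
  using polyfuns_expansion holo_polyI by metis

lemma holo_poly_continuous: "holo_poly P ==> continuous_on S P"
  unfolding holo_poly_def by (auto intro!: continuous_intros)

lemma polyfuns_continuous: "F \<in> polyfuns ==> continuous_on S F"
  using polyfuns_holo_poly holo_poly_continuous by blast

lemma polyfuns_diff: "F \<in> polyfuns ==> G \<in> polyfuns ==> (%z. F z - G z) \<in> polyfuns"
  using polyfuns.add[OF _ polyfuns.mult[OF polyfuns.const[of "-1"]], of F G] by simp

lemma polyfuns_sum: "finite I ==> (\<And>i. i \<in> I ==> F i \<in> polyfuns) ==> (%z. \<Sum>i\<in>I. F i z) \<in> polyfuns"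
proof (induction I rule: finite_induct)
  case (insert i I)
  have "(%z. F i z + (\<Sum>i\<in>I. F i z)) \<in> polyfuns" by (rule polyfuns.add) (use insert in auto)
  then show ?case using insert by simp
qed (simp add: polyfuns.const)

lemma polyfuns_power: "F \<in> polyfuns ==> (%z. F z ^ k) \<in> polyfuns"
  by (induction k) (auto intro: polyfuns.const polyfuns.mult)

text \<open>On a compact set a pointwise bound below 1 is attained and therefore gives a supremum
  below 1.\<close>

lemma polynomially_convexI:
  fixes X :: "(complex^'n) set"
  assumes X: "compact X" and ne: "X ~= {}"
    and sep: "\<And>q. q \<notin> X ==> \<exists>F\<in>polyfuns. F q = 1 \<and> (\<forall>x\<in>X. norm (F x) < 1)"
  shows "polynomially_convex X"
  unfolding polynomially_convex_def
proof (intro conjI X equalityI subsetI CollectI allI impI)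
  fix z and P :: "complex^'n => complex" assume z: "z \<in> X" and P: "holo_poly P"
  have "compact ((%x. norm (P x)) ` X)" by (intro compact_continuous_image continuous_intros holo_poly_continuous P X)
  then have "bdd_above ((%x. norm (P x)) ` X)" by (intro bounded_imp_bdd_above compact_imp_bounded)
  then show "norm (P z) <= (SUP x\<in>X. norm (P x))" using z by (intro cSUP_upper) auto
next
  fix q assume q: "q \<in> {z. \<forall>P. holo_poly P --> norm (P z) <= (SUP x\<in>X. norm (P x))}"
  show "q \<in> X"
  proof (rule ccontr)
    assume "q \<notin> X"
    then obtain F where F: "F \<in> polyfuns" "F q = 1" "\<And>x. x \<in> X ==> norm (F x) < 1" using sep by blast
    have "continuous_on X (%x. norm (F x))" by (intro continuous_intros polyfuns_continuous F)
    then obtain y where y: "y \<in> X" "\<And>x. x \<in> X ==> norm (F x) <= norm (F y)"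
      using continuous_attains_sup[OF X ne] by blast
    have "(SUP x\<in>X. norm (F x)) <= norm (F y)" by (rule cSUP_least[OF ne y(2)])
    moreover have "norm (F q) <= (SUP x\<in>X. norm (F x))" using q polyfuns_holo_poly[OF F(1)] by blast
    ultimately show False using F(2) F(3)[OF y(1)] by simp
  qed
qed

lemma periodic1_int:
  assumes "periodic1 f" shows "f (t + of_int k) = f t"
proof (cases k rule: int_cases2)
  case (nonneg n)
  have "f (t + real n) = f t" for n
  proof (induction n)
    case (Suc n)
    have "f (t + real (Suc n)) = f ((t + real n) + 1)" by (simp add: algebra_simps)
    then show ?case using assms Suc by (simp add: periodic1_def)
  qed simp
  then show ?thesis using nonneg by simp
next
  case (nonpos n)
  have "f (t - real n) = f t" for n
  proof (induction n)
    case (Suc n)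
    have "f ((t - real (Suc n)) + 1) = f (t - real (Suc n))" using assms by (simp only: periodic1_def)
    moreover have "(t - real (Suc n)) + 1 = t - real n" by simp
    ultimately show ?case using Suc by simp
  qed simp
  then show ?thesis using nonpos by simp
qed

lemma periodic1_frac: "periodic1 f ==> f (frac t) = f t"
  using periodic1_int[of f t "- \<lfloor>t\<rfloor>"] by (simp add: frac_def)

lemma periodic1_range:
  assumes "periodic1 f"
  shows "f ` {0..1} = range f"
proof
  show "range f \<subseteq> f ` {0..1}"
  proof clarify
    fix t :: real
    have "frac t \<in> {0..1}" using frac_ge_0[of t] frac_lt_1[of t] by simp
    then show "f t \<in> f ` {0..1}" using periodic1_frac[OF assms, of t] by (metis imageI)
  qed
qed auto

lemma periodic1_inj:
  assumes "periodic1 f" "inj_on f {0..<1}" "f s = f t"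
  shows "\<exists>k::int. s = t + of_int k"
proof -
  have "f (frac s) = f (frac t)" using periodic1_frac assms by metis
  then have "frac s = frac t" using inj_onD[OF assms(2)] frac_ge_0 frac_lt_1 by (metis atLeastLessThan_iff)
  then have "s = t + of_int (\<lfloor>s\<rfloor> - \<lfloor>t\<rfloor>)" unfolding frac_def by simp
  then show ?thesis by blast
qed

lemma shift_into_period: "\<exists>k::int. a < t + of_int k \<and> t + of_int k <= a + 1" for a t :: real
proof (intro exI[of _ "1 - \<lceil>t - a\<rceil>"] conjI)
  show "a < t + of_int (1 - \<lceil>t - a\<rceil>)" "t + of_int (1 - \<lceil>t - a\<rceil>) <= a + 1"
    unfolding of_int_diff of_int_1 using ceiling_correct[of "t - a"] by linarith+
qed

section \<open>Closed curves with an arc in the zero set of a polynomial\<close>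

locale closed_curve =
  fixes \<gamma> \<gamma>' :: "real => complex^'n"
  assumes periodic: "periodic1 \<gamma>" and der: "\<And>t. (\<gamma> has_vector_derivative \<gamma>' t) (at t)"
    and cont': "continuous_on UNIV \<gamma>'" and inj: "inj_on \<gamma> {0..<1}" and reg: "\<And>t. \<gamma>' t ~= 0"
begin

lemma cont: "continuous_on S \<gamma>"
  by (auto intro!: continuous_at_imp_continuous_on has_vector_derivative_continuous[OF der])

text \<open>After an affine change of parameter the subarc is a \<open>regular_arc\<close>; a length
  below the period 1 makes it injective including its end points.\<close>

lemma arc_approximation:
  fixes u :: "real => complex"
  assumes l: "0 < l" "l < 1" and u: "continuous_on {a..a+l} u" and e: "e > 0"
  shows "\<exists>Q\<in>polyfuns. \<forall>t\<in>{a..a+l}. norm (u t - Q (\<gamma> t)) < e"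
proof -
  define Z where "Z = (%i s. vec_nth (\<gamma> (a + l * s)) i)"
  define Z' where "Z' = (%i s. l *\<^sub>R vec_nth (\<gamma>' (a + l * s)) i)"
  interpret regular_arc Z Z'
  proof
    show "(Z i has_vector_derivative Z' i t) (at t)" for i t
    proof -
      have "((%s. a + l * s) has_real_derivative l) (at t)" by (auto intro!: derivative_eq_intros)
      then have "((%s. a + l * s) has_vector_derivative l) (at t)" by (simp add: has_real_derivative_iff_has_vector_derivative)
      then have "(\<gamma> \<circ> (%s. a + l * s) has_vector_derivative l *\<^sub>R \<gamma>' (a + l * t)) (at t)"
        by (rule vector_diff_chain_at[OF _ der])
      then have "((%s. vec_nth (\<gamma> (a + l * s)) i) has_vector_derivative vec_nth (l *\<^sub>R \<gamma>' (a + l * t)) i) (at t)"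
        unfolding o_def by (rule bounded_linear.has_vector_derivative[OF bounded_linear_vec_nth])
      then show ?thesis by (simp add: Z_def Z'_def)
    qed
    show "continuous_on UNIV (Z' i)" for i
      unfolding Z'_def by (intro continuous_intros continuous_on_compose2[OF cont']) auto
    show "s = t" if st: "s \<in> {0..1}" "t \<in> {0..1}" and eq: "\<And>i. Z i s = Z i t" for s t
    proof -
      have "\<gamma> (a + l * s) = \<gamma> (a + l * t)" using eq by (simp add: Z_def Finite_Cartesian_Product.vec_eq_iff)
      then obtain k :: int where k: "a + l * s = a + l * t + of_int k" using periodic1_inj[OF periodic inj] by blast
      have "\<bar>l * (s - t)\<bar> < 1"
      proof -
        have "\<bar>l * (s - t)\<bar> = l * \<bar>s - t\<bar>" using l by (simp add: abs_mult)
        also have "\<dots> <= l * 1" using st l by (intro mult_left_mono) auto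
        finally show ?thesis using l by simp
      qed
      moreover have "of_int k = l * (s - t)" using k by (simp add: algebra_simps)
      ultimately have "\<bar>real_of_int k\<bar> < 1" by simp
      then have "k = 0" by linarith
      then show ?thesis using k l by simp
    qed
    show "\<exists>i. Z' i t ~= 0" for t
      using reg[of "a + l * t"] l by (auto simp: Z'_def Finite_Cartesian_Product.vec_eq_iff)
  qed
  have poly: "\<exists>Q\<in>polyfuns. v = (%s. Q (\<gamma> (a + l * s)))" if "v \<in> palg Z" for v
    using that
  proof (induction rule: palg.induct)
    case (const c) then show ?case by (intro bexI[OF _ polyfuns.const[of c]]) simp
  next
    case (gen i) then show ?case by (intro bexI[OF _ polyfuns.coord[of i]]) (simp add: Z_def)
  next
    case (add v w)
    then obtain Q R where "Q \<in> polyfuns" "v = (%s. Q (\<gamma> (a + l * s)))" "R \<in> polyfuns" "w = (%s. R (\<gamma> (a + l * s)))" by blast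
    then show ?case by (intro bexI[OF _ polyfuns.add[of Q R]]) simp_all
  next
    case (mult v w)
    then obtain Q R where "Q \<in> polyfuns" "v = (%s. Q (\<gamma> (a + l * s)))" "R \<in> polyfuns" "w = (%s. R (\<gamma> (a + l * s)))" by blast
    then show ?case by (intro bexI[OF _ polyfuns.mult[of Q R]]) simp_all
  qed
  have "continuous_on {0..1} (%s. u (a + l * s))"
    by (rule continuous_on_compose2[OF u]) (use l in \<open>auto intro!: continuous_intros simp: mult_le_cancel_left1\<close>)
  then obtain v where v: "v \<in> palg Z" "\<And>s. s \<in> {0..1} ==> norm (u (a + l * s) - v s) < e"
    using polynomials_dense[OF _ e] by blast
  obtain Q where Q: "Q \<in> polyfuns" "v = (%s. Q (\<gamma> (a + l * s)))" using poly[OF v(1)] by blast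
  have "norm (u t - Q (\<gamma> t)) < e" if t: "t \<in> {a..a+l}" for t
  proof -
    have eq: "a + l * ((t - a) / l) = t" using l by simp
    have "(t - a) / l \<in> {0..1}" using t l by (auto simp: divide_le_eq)
    then have "norm (u (a + l * ((t - a) / l)) - v ((t - a) / l)) < e" by (rule v(2))
    then show ?thesis unfolding Q(2) eq .
  qed
  then show ?thesis using Q(1) by blast
qed

text \<open>On the arc the constant 1 is a combination of the functions \<open>z_i - q_i\<close>
  with continuous coefficients \<open>u i\<close>. Replacing the coefficients by polynomials gives a
  combination that is close to 1 on the arc and vanishes at \<open>q\<close>; \<open>g\<close> is
  its complement to 1.\<close>

lemma peak_off_arc:
  assumes l: "0 < l" "l < 1" and q: "q \<notin> \<gamma> ` {a..a+l}"
  shows "\<exists>g\<in>polyfuns. g q = 1 \<and> (\<forall>t\<in>{a..a+l}. norm (g (\<gamma> t)) <= 1/2)"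
proof -
  define D where "D = (%t. \<Sum>i\<in>UNIV. (norm (vec_nth (\<gamma> t) i - vec_nth q i))\<^sup>2)"
  have D: "D t ~= 0" if "t \<in> {a..a+l}" for t
  proof
    assume "D t = 0"
    then have "\<forall>i\<in>UNIV. (norm (vec_nth (\<gamma> t) i - vec_nth q i))\<^sup>2 = 0"
      unfolding D_def by (subst (asm) sum_nonneg_eq_0_iff) auto
    then have "\<gamma> t = q" by (simp add: Finite_Cartesian_Product.vec_eq_iff)
    then show False using q that by blast
  qed
  define u where "u = (%i t. cnj (vec_nth (\<gamma> t) i - vec_nth q i) / of_real (D t))"
  have cg: "continuous_on {a..a+l} (%t. vec_nth (\<gamma> t) i)" for i by (intro continuous_intros cont)
  have Dc: "continuous_on {a..a+l} D" unfolding D_def by (intro continuous_intros cont)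
  have uc: "continuous_on {a..a+l} (u i)" for i
    unfolding u_def by (intro continuous_on_divide continuous_on_cnj continuous_on_of_real continuous_on_diff continuous_on_const cg Dc) (use D in auto)
  have u1: "(\<Sum>i\<in>UNIV. (vec_nth (\<gamma> t) i - vec_nth q i) * u i t) = 1" if "t \<in> {a..a+l}" for t
  proof -
    have "(vec_nth (\<gamma> t) i - vec_nth q i) * u i t = of_real ((norm (vec_nth (\<gamma> t) i - vec_nth q i))\<^sup>2) / of_real (D t)" for i
      unfolding u_def complex_norm_square by simp
    then have "(\<Sum>i\<in>UNIV. (vec_nth (\<gamma> t) i - vec_nth q i) * u i t) = of_real (D t) / of_real (D t)"
      by (simp only: sum_divide_distrib[symmetric] of_real_sum[symmetric] D_def)
    then show ?thesis using D[OF that] by simp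
  qed
  obtain B where B: "B > 0" "\<And>t i. t \<in> {a..a+l} ==> norm (vec_nth (\<gamma> t) i - vec_nth q i) <= B"
  proof -
    have "bounded ((%t. \<gamma> t - q) ` {a..a+l})" by (intro compact_imp_bounded compact_continuous_image continuous_intros cont) auto
    then obtain B where B: "B > 0" "\<And>t. t \<in> {a..a+l} ==> norm (\<gamma> t - q) <= B" unfolding bounded_pos by auto
    have "norm (vec_nth (\<gamma> t) i - vec_nth q i) <= B" if "t \<in> {a..a+l}" for t i
      using Finite_Cartesian_Product.norm_nth_le[of "\<gamma> t - q" i] B(2)[OF that] by simp
    then show thesis using that B(1) by blast
  qed
  define n where "n = real (CARD('n))"
  have n: "n > 0" by (simp add: n_def)
  define e where "e = 1 / (2 * n * B)"
  have e: "e > 0" using n B by (simp add: e_def)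
  have "\<exists>Q\<in>polyfuns. \<forall>t\<in>{a..a+l}. norm (u i t - Q (\<gamma> t)) < e" for i by (rule arc_approximation[OF l uc e])
  then have "\<exists>Q. \<forall>i. Q i \<in> polyfuns \<and> (\<forall>t\<in>{a..a+l}. norm (u i t - Q i (\<gamma> t)) < e)" by (intro choice) blast
  then obtain Q where Q: "\<And>i. Q i \<in> polyfuns" "\<And>i t. t \<in> {a..a+l} ==> norm (u i t - Q i (\<gamma> t)) < e" by blast
  define g where "g = (%z. 1 - (\<Sum>i\<in>UNIV. (vec_nth z i - vec_nth q i) * Q i z))"
  have "g \<in> polyfuns" unfolding g_def
    by (intro polyfuns_diff polyfuns.const polyfuns_sum polyfuns.mult polyfuns.coord Q) simp
  moreover have "g q = 1" by (simp add: g_def)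
  moreover have "norm (g (\<gamma> t)) <= 1/2" if t: "t \<in> {a..a+l}" for t
  proof -
    have "g (\<gamma> t) = (\<Sum>i\<in>UNIV. (vec_nth (\<gamma> t) i - vec_nth q i) * (u i t - Q i (\<gamma> t)))"
      unfolding g_def u1[OF t, symmetric] by (simp add: sum_subtractf right_diff_distrib)
    then have "norm (g (\<gamma> t)) <= (\<Sum>i\<in>UNIV. norm ((vec_nth (\<gamma> t) i - vec_nth q i) * (u i t - Q i (\<gamma> t))))"
      by (simp only: norm_sum)
    also have "\<dots> <= (\<Sum>i\<in>(UNIV :: 'n set). B * e)"
      unfolding norm_mult using B(1) B(2)[OF t] Q(2)[OF t] by (intro sum_mono mult_mono) (auto intro: less_imp_le)
    also have "\<dots> = n * B * e" by (simp add: n_def)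
    also have "\<dots> = 1/2" using n B by (simp add: e_def)
    finally show ?thesis .
  qed
  ultimately show ?thesis by blast
qed

theorem polynomially_convex_image:
  assumes G: "G \<in> polyfuns" and ab: "a < b" "b < a + 1" and zero: "\<And>t. t \<in> {a<..<b} ==> G (\<gamma> t) = 0"
    and t1: "G (\<gamma> t1) ~= 0"
  shows "polynomially_convex (\<gamma> ` {0..1})"
proof (rule polynomially_convexI)
  define X where "X = \<gamma> ` {0..1}"
  have Xr: "X = range \<gamma>" unfolding X_def by (rule periodic1_range[OF periodic])
  have cX: "compact X" unfolding X_def by (intro compact_continuous_image cont) simp
  then show "compact (\<gamma> ` {0..1})" by (simp add: X_def)
  show "\<gamma> ` {0..1} ~= {}" by simp
  have bound: "\<exists>M>0. \<forall>t. norm (F (\<gamma> t)) <= M" if F: "F \<in> polyfuns" for F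
  proof -
    have "bounded (F ` X)" by (intro compact_imp_bounded compact_continuous_image polyfuns_continuous F cX)
    then show ?thesis unfolding bounded_pos Xr by auto
  qed
  obtain M where M: "M > 0" "\<And>t. norm (G (\<gamma> t)) <= M" using bound[OF G] by blast
  \<comment> \<open>One period splits into the arc where \<open>G\<close> vanishes and the
    complementary closed arc of length \<open>a + 1 - b < 1\<close>.\<close>
  have cases1: "\<exists>t'. \<gamma> t' = \<gamma> t \<and> (t' \<in> {a<..<b} \<or> t' \<in> {b..b+(a+1-b)})" for t
  proof -
    obtain k :: int where k: "a < t + of_int k" "t + of_int k <= a + 1" using shift_into_period by blast
    then show ?thesis using periodic1_int[OF periodic, of t k] by (intro exI[of _ "t + of_int k"]) auto
  qed
  fix q assume "q \<notin> \<gamma> ` {0..1}"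
  then have q: "q \<notin> range \<gamma>" using Xr by (simp add: X_def)
  have qa: "q \<notin> \<gamma> ` S" for S using q by blast
  have l1: "0 < a + 1 - b" "a + 1 - b < 1" using ab by auto
  have "\<exists>F\<in>polyfuns. F q = 1 \<and> (\<forall>t. norm (F (\<gamma> t)) < 1)"
  proof (cases "G q = 0")
    case False
    obtain g where g: "g \<in> polyfuns" "g q = 1" "\<And>t. t \<in> {b..b+(a+1-b)} ==> norm (g (\<gamma> t)) <= 1/2"
      using peak_off_arc[OF l1 qa] by blast
    obtain k where k: "(1/2::real) ^ k < norm (G q) / M"
      using real_arch_pow_inv[of "norm (G q) / M" "1/2"] M(1) False by auto
    define F where "F = (%z. (1 / G q) * (G z * g z ^ k))"
    have "F \<in> polyfuns" unfolding F_def by (intro polyfuns.mult polyfuns.const G polyfuns_power g)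
    moreover have "F q = 1" using False g(2) by (simp add: F_def)
    moreover have "norm (F (\<gamma> t)) < 1" for t
    proof -
      obtain t' where t': "\<gamma> t' = \<gamma> t" "t' \<in> {a<..<b} \<or> t' \<in> {b..b+(a+1-b)}" using cases1 by blast
      have "norm (F (\<gamma> t')) < 1"
      proof (cases "t' \<in> {a<..<b}")
        case True then show ?thesis using zero by (simp add: F_def)
      next
        case nt: False
        then have "norm (g (\<gamma> t')) <= 1/2" using t' g(3) by blast
        then have "norm (g (\<gamma> t')) ^ k <= (1/2) ^ k" by (intro power_mono) auto
        then have "norm (G (\<gamma> t')) * norm (g (\<gamma> t')) ^ k <= M * (1/2) ^ k"
          using M by (intro mult_mono) auto
        also have "\<dots> < norm (G q)" using k M(1) by (simp add: pos_less_divide_eq mult.commute)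
        finally have "norm (G (\<gamma> t') * g (\<gamma> t') ^ k) < norm (G q)" by (simp add: norm_mult norm_power)
        then show ?thesis using False unfolding F_def by (simp add: norm_mult norm_divide)
      qed
      then show ?thesis using t'(1) by simp
    qed
    ultimately show ?thesis by blast
  next
    case True
    define m where "m = norm (G (\<gamma> t1)) / 2"
    have m: "m > 0" using t1 by (simp add: m_def)
    have "continuous_on UNIV (%t. G (\<gamma> t))"
      by (rule continuous_on_compose2[OF polyfuns_continuous[OF G, of UNIV] cont]) simp
    then obtain d0 where d0: "d0 > 0" "\<And>t. dist t t1 < d0 ==> dist (G (\<gamma> t)) (G (\<gamma> t1)) < m"
      using m unfolding continuous_on_iff by (metis UNIV_I)
    define d where "d = min (d0/2) (1/4)"
    have d: "0 < d" "d < 1/2" "d < d0" using d0 by (auto simp: d_def)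
    have Gm: "norm (G (\<gamma> t)) >= m" if "t \<in> {t1-d..t1+d}" for t
    proof -
      have "dist t t1 < d0" using that d by (auto simp: dist_real_def)
      then have "norm (G (\<gamma> t) - G (\<gamma> t1)) < m" using d0(2) by (simp add: dist_norm)
      moreover have "norm (G (\<gamma> t1)) = 2 * m" by (simp add: m_def)
      ultimately show ?thesis using norm_triangle_ineq2[of "G (\<gamma> t1)" "G (\<gamma> t1) - G (\<gamma> t)"] by (simp add: norm_minus_commute)
    qed
    have l2: "0 < 1 - 2 * d" "1 - 2 * d < 1" using d by auto
    \<comment> \<open>The arc omits only a neighbourhood of \<open>t1\<close> on which
      \<open>G\<close> is at least \<open>m\<close> in modulus, so it contains all zeros of
      \<open>G\<close> on the curve.\<close>
    obtain g where g: "g \<in> polyfuns" "g q = 1" "\<And>t. t \<in> {t1+d..t1+d+(1-2*d)} ==> norm (g (\<gamma> t)) <= 1/2"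
      using peak_off_arc[OF l2 qa] by blast
    have cases2: "norm (G (\<gamma> t)) >= m \<or> norm (g (\<gamma> t)) <= 1/2" for t
    proof -
      obtain k :: int where k: "t1 - d < t + of_int k" "t + of_int k <= t1 - d + 1" using shift_into_period by blast
      then show ?thesis using periodic1_int[OF periodic, of t k] Gm[of "t + of_int k"] g(3)[of "t + of_int k"]
        by (cases "t + of_int k <= t1 + d") auto
    qed
    obtain M2 where M2: "M2 > 0" "\<And>t. norm (g (\<gamma> t)) <= M2" using bound[OF g(1)] by blast
    \<comment> \<open>Where \<open>G\<close> is at least \<open>m\<close> in modulus,
      \<open>\<eta> / m\<^sup>2\<close> is then \<open>1 / (4 * (M2 + 1))\<close>, small enough to
      compensate the size of \<open>g\<close>.\<close>
    define \<eta> where "\<eta> = m\<^sup>2 / (4 * (M2 + 1))"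
    have \<eta>: "\<eta> > 0" using m M2 by (simp add: \<eta>_def)
    \<comment> \<open>Chosen so that the approximation error contributes at most 1/4 after
      multiplication by \<open>G\<close> and \<open>g\<close>.\<close>
    define e where "e = 1 / (4 * (M + 1) * (M2 + 1))"
    have e: "e > 0" using M M2 by (simp add: e_def)
    have Mpos: "(norm (G (\<gamma> t)))\<^sup>2 + \<eta> > 0" for t using \<eta> by (simp add: add_nonneg_pos)
    \<comment> \<open>A regularized reciprocal of \<open>G\<close>. The summand
      \<open>\<eta>\<close> keeps it continuous at zeros of \<open>G\<close>, and
      \<open>1 - G * v = \<eta> / (\<bar>G\<bar>\<^sup>2 + \<eta>)\<close> lies between 0 and 1
      everywhere.\<close>
    define v where "v = (%t. cnj (G (\<gamma> t)) / of_real ((norm (G (\<gamma> t)))\<^sup>2 + \<eta>))"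
    have Gc: "continuous_on S (%t. G (\<gamma> t))" for S
      by (rule continuous_on_compose2[OF polyfuns_continuous[OF G, of UNIV] cont]) simp
    have vc: "continuous_on S v" for S
      unfolding v_def by (intro continuous_intros Gc) (use Mpos in \<open>metis less_irrefl of_real_eq_0_iff\<close>)
    obtain s where s: "s \<in> polyfuns" "\<And>t. t \<in> {b..b+(a+1-b)} ==> norm (v t - s (\<gamma> t)) < e"
      using arc_approximation[OF l1 vc e] by blast
    define F where "F = (%z. g z * (1 - G z * s z))"
    have "F \<in> polyfuns" unfolding F_def by (intro polyfuns.mult polyfuns_diff polyfuns.const G g s)
    moreover have "F q = 1" using True g(2) by (simp add: F_def)
    moreover have "norm (F (\<gamma> t)) < 1" for t
    proof -
      obtain t' where t': "\<gamma> t' = \<gamma> t" "t' \<in> {a<..<b} \<or> t' \<in> {b..b+(a+1-b)}" using cases1 by blast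
      have "norm (F (\<gamma> t')) < 1"
      proof (cases "t' \<in> {a<..<b}")
        case True
        then have "G (\<gamma> t') = 0" by (rule zero)
        then have "norm (g (\<gamma> t')) <= 1/2" using cases2[of t'] m by auto
        then show ?thesis using \<open>G (\<gamma> t') = 0\<close> by (simp add: F_def)
      next
        case False
        then have "norm (v t' - s (\<gamma> t')) < e" using t' s(2) by blast
        then have Me: "norm (G (\<gamma> t') * (v t' - s (\<gamma> t'))) <= M * e"
          unfolding norm_mult using M(2)[of t'] M(1) by (intro mult_mono) auto
        let ?x = "(norm (G (\<gamma> t')))\<^sup>2"
        have Gv: "1 - G (\<gamma> t') * v t' = of_real (\<eta> / (?x + \<eta>))"
        proof -
          have "G (\<gamma> t') * v t' = of_real ?x / of_real (?x + \<eta>)" unfolding v_def complex_norm_square by simp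
          then have "1 - G (\<gamma> t') * v t' = of_real (1 - ?x / (?x + \<eta>))" by simp
          also have "1 - ?x / (?x + \<eta>) = \<eta> / (?x + \<eta>)" using Mpos[of t'] by (simp add: field_simps)
          finally show ?thesis .
        qed
        have h: "1 - G (\<gamma> t') * s (\<gamma> t') = (1 - G (\<gamma> t') * v t') + G (\<gamma> t') * (v t' - s (\<gamma> t'))" by (simp add: algebra_simps)
        have nv: "norm (1 - G (\<gamma> t') * v t') = \<eta> / (?x + \<eta>)"
          unfolding Gv norm_of_real using \<eta> Mpos[of t'] by simp
        have tot: "norm (1 - G (\<gamma> t') * s (\<gamma> t')) <= \<eta> / (?x + \<eta>) + M * e"
          unfolding h using norm_triangle_mono[OF eq_refl[OF nv] Me] .
        have Mec: "M * e * (M2 + 1) <= 1/4"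
        proof -
          have "M * e * (M2 + 1) = M / (4 * (M + 1))" using M2 by (simp add: e_def)
          also have "\<dots> <= 1/4" using M(1) by (simp add: divide_le_eq)
          finally show ?thesis .
        qed
        have Me0: "0 <= M * e" using M e by simp
        show ?thesis
        proof (cases "norm (g (\<gamma> t')) <= 1/2")
          case True
          have "\<eta> / (?x + \<eta>) <= 1" using Mpos[of t'] by (simp add: divide_le_eq_1_pos)
          moreover have "M * e <= M * e * (M2 + 1)" using Me0 M2 mult_left_mono[of 1 "M2 + 1" "M * e"] by simp
          ultimately have "norm (1 - G (\<gamma> t') * s (\<gamma> t')) <= 5/4" using tot Mec by linarith
          then have "norm (F (\<gamma> t')) <= 1/2 * (5/4)" unfolding F_def norm_mult using True by (intro mult_mono) auto
          then show ?thesis by simp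
        next
          case False
          then have "m <= norm (G (\<gamma> t'))" using cases2[of t'] by simp
          then have "m\<^sup>2 <= ?x" using m by (intro power_mono) auto
          then have "m\<^sup>2 <= ?x + \<eta>" using \<eta> by linarith
          moreover have "0 < (?x + \<eta>) * m\<^sup>2" using m by (intro mult_pos_pos Mpos) simp
          ultimately have "\<eta> / (?x + \<eta>) <= \<eta> / m\<^sup>2" using \<eta> by (intro divide_left_mono) auto
          also have "\<dots> = 1 / (4 * (M2 + 1))" using m by (simp add: \<eta>_def)
          finally have "norm (1 - G (\<gamma> t') * s (\<gamma> t')) <= 1 / (4 * (M2 + 1)) + M * e" using tot by linarith
          then have "norm (F (\<gamma> t')) <= (M2 + 1) * (1 / (4 * (M2 + 1)) + M * e)"
            unfolding F_def norm_mult using M2(2)[of t'] M2(1) by (intro mult_mono) auto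
          also have "\<dots> = 1/4 + M * e * (M2 + 1)" 
          proof -
            have "(M2 + 1) * (1 / (4 * (M2 + 1))) = 1/4" using M2(1) by (simp add: divide_simps)
            then show ?thesis by (simp only: distrib_left mult.commute)
          qed
          also have "\<dots> < 1" using Mec by simp
          finally show ?thesis .
        qed
      qed
      then show ?thesis using t'(1) by simp
    qed
    ultimately show ?thesis by blast
  qed
  then show "\<exists>F\<in>polyfuns. F q = 1 \<and> (\<forall>x\<in>\<gamma> ` {0..1}. norm (F x) < 1)" by blast
qed

end

subsection \<open>Calculus of iterated derivatives\<close>

lemma iter_vderiv_Suc_left: "iter_vderiv (Suc k) f = iter_vderiv k (%t. vector_derivative f (at t))"
  by (induction k) auto

lemma iter_vderiv_Suc_eq:
  assumes "\<And>t. (f has_vector_derivative g t) (at t)"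
  shows "iter_vderiv (Suc k) f = iter_vderiv k g"
proof -
  have "(%t. vector_derivative f (at t)) = g" using vector_derivative_at[OF assms] by auto
  then show ?thesis by (simp only: iter_vderiv_Suc_left)
qed

lemma C_k_0: "C_k 0 f \<longleftrightarrow> continuous_on UNIV f"
  by (simp add: C_k_def)

lemma C_k_SucI:
  assumes f: "\<And>t. (f has_vector_derivative g t) (at t)" and g: "C_k k g"
  shows "C_k (Suc k) f"
  unfolding C_k_def
proof (intro conjI allI impI)
  show "continuous_on UNIV (iter_vderiv (Suc k) f)" using g unfolding iter_vderiv_Suc_eq[OF f] C_k_def by blast
  fix j t assume j: "j < Suc k"
  show "(iter_vderiv j f has_vector_derivative iter_vderiv (Suc j) f t) (at t)"
  proof (cases j)
    case 0
    then show ?thesis using f iter_vderiv_Suc_eq[OF f, of 0] by simp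
  next
    case (Suc i)
    then show ?thesis using g j unfolding Suc iter_vderiv_Suc_eq[OF f] C_k_def by simp
  qed
qed

lemma C_k_SucD:
  assumes "C_k (Suc k) f"
  shows "(f has_vector_derivative vector_derivative f (at t)) (at t)" "C_k k (%t. vector_derivative f (at t))"
proof -
  have d: "\<And>j t. j < Suc k ==> (iter_vderiv j f has_vector_derivative iter_vderiv (Suc j) f t) (at t)"
    and c: "continuous_on UNIV (iter_vderiv (Suc k) f)" using assms unfolding C_k_def by blast+
  show "(f has_vector_derivative vector_derivative f (at t)) (at t)" using d[of 0 t] by simp
  show "C_k k (%t. vector_derivative f (at t))"
    unfolding C_k_def iter_vderiv_Suc_left[symmetric]
  proof (intro conjI allI impI)
    show "(iter_vderiv (Suc j) f has_vector_derivative iter_vderiv (Suc (Suc j)) f t) (at t)" if "j < k" for j t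
      by (rule d) (use that in simp)
  qed (rule c)
qed

lemma C_k_SucE:
  assumes "C_k (Suc k) f"
  obtains g where "\<And>t. (f has_vector_derivative g t) (at t)" "C_k k g"
  by (rule that[OF C_k_SucD(1)[OF assms] C_k_SucD(2)[OF assms]])

lemma C_k_pred: "C_k (Suc k) f ==> C_k k f"
proof (induction k arbitrary: f)
  case 0
  obtain g where "\<And>t. (f has_vector_derivative g t) (at t)" using C_k_SucE[OF 0] by blast
  then show ?case unfolding C_k_0
    by (auto intro!: continuous_at_imp_continuous_on has_vector_derivative_continuous)
next
  case (Suc k)
  obtain g where "\<And>t. (f has_vector_derivative g t) (at t)" "C_k (Suc k) g" using C_k_SucE[OF Suc.prems] by blast
  then show ?case using C_k_SucI Suc.IH by blast
qed

lemma C_k_mono: "C_k k f ==> j <= k ==> C_k j f"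
proof (induction k)
  case (Suc k)
  then show ?case using C_k_pred[OF Suc.prems(1)] by (cases "j = Suc k") auto
qed simp

lemma C_k_iter_continuous: "C_k k f ==> j <= k ==> continuous_on S (iter_vderiv j f)"
  using C_k_mono[of k f j] continuous_on_subset[of UNIV _ S] unfolding C_k_def by blast

lemma C_k_const: "C_k k (%t. c)"
proof (induction k arbitrary: c)
  case 0 then show ?case by (simp add: C_k_0)
next
  case (Suc k)
  show ?case by (rule C_k_SucI[of _ "%t. 0"]) (auto intro: Suc)
qed

lemma C_k_linear:
  assumes T: "bounded_linear T" and f: "C_k k f"
  shows "C_k k (%t. T (f t))" and "j <= k ==> iter_vderiv j (%t. T (f t)) = (%t. T (iter_vderiv j f t))"
proof -
  have "C_k k (%t. T (f t)) \<and> (\<forall>j\<le>k. iter_vderiv j (%t. T (f t)) = (%t. T (iter_vderiv j f t)))"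
    using f
  proof (induction k arbitrary: f)
    case 0
    then show ?case by (simp add: C_k_0 bounded_linear.continuous_on[OF T])
  next
    case (Suc k)
    obtain g where g: "\<And>t. (f has_vector_derivative g t) (at t)" "C_k k g" using C_k_SucE[OF Suc.prems] by blast
    have d: "((%t. T (f t)) has_vector_derivative T (g t)) (at t)" for t
      by (rule bounded_linear.has_vector_derivative[OF T g(1)])
    have IH: "C_k k (%t. T (g t))" "\<And>j. j <= k ==> iter_vderiv j (%t. T (g t)) = (%t. T (iter_vderiv j g t))"
      using Suc.IH[OF g(2)] by auto
    show ?case
    proof (intro conjI allI impI C_k_SucI[OF d IH(1)])
      fix j assume "j <= Suc k"
      then show "iter_vderiv j (%t. T (f t)) = (%t. T (iter_vderiv j f t))"
        by (cases j) (simp_all only: iter_vderiv.simps(1) iter_vderiv_Suc_eq[OF d] iter_vderiv_Suc_eq[OF g(1)] IH(2) Suc_le_mono)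
    qed
  qed
  then show "C_k k (%t. T (f t))" "j <= k ==> iter_vderiv j (%t. T (f t)) = (%t. T (iter_vderiv j f t))" by auto
qed

lemma C_k_add:
  assumes f: "C_k k f" "C_k k g"
  shows "C_k k (%t. f t + g t)" and "j <= k ==> iter_vderiv j (%t. f t + g t) = (%t. iter_vderiv j f t + iter_vderiv j g t)"
proof -
  have "C_k k (%t. f t + g t) \<and> (\<forall>j\<le>k. iter_vderiv j (%t. f t + g t) = (%t. iter_vderiv j f t + iter_vderiv j g t))"
    using f
  proof (induction k arbitrary: f g)
    case 0
    then show ?case by (simp add: C_k_0 continuous_on_add)
  next
    case (Suc k)
    obtain f' where f': "\<And>t. (f has_vector_derivative f' t) (at t)" "C_k k f'" using C_k_SucE[OF Suc.prems(1)] by blast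
    obtain g' where g': "\<And>t. (g has_vector_derivative g' t) (at t)" "C_k k g'" using C_k_SucE[OF Suc.prems(2)] by blast
    have d: "((%t. f t + g t) has_vector_derivative f' t + g' t) (at t)" for t
      by (rule has_vector_derivative_add[OF f'(1) g'(1)])
    have IH: "C_k k (%t. f' t + g' t)" "\<And>j. j <= k ==> iter_vderiv j (%t. f' t + g' t) = (%t. iter_vderiv j f' t + iter_vderiv j g' t)"
      using Suc.IH[OF f'(2) g'(2)] by auto
    show ?case
    proof (intro conjI allI impI C_k_SucI[OF d IH(1)])
      fix j assume "j <= Suc k"
      then show "iter_vderiv j (%t. f t + g t) = (%t. iter_vderiv j f t + iter_vderiv j g t)"
        by (cases j) (simp_all only: iter_vderiv.simps(1) iter_vderiv_Suc_eq[OF d] iter_vderiv_Suc_eq[OF f'(1)] iter_vderiv_Suc_eq[OF g'(1)] IH(2) Suc_le_mono)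
    qed
  qed
  then show "C_k k (%t. f t + g t)" "j <= k ==> iter_vderiv j (%t. f t + g t) = (%t. iter_vderiv j f t + iter_vderiv j g t)" by auto
qed

lemma C_k_diff:
  assumes f: "C_k k f" "C_k k g"
  shows "C_k k (%t. f t - g t)" and "j <= k ==> iter_vderiv j (%t. f t - g t) = (%t. iter_vderiv j f t - iter_vderiv j g t)"
proof -
  have m: "bounded_linear (%x. - x)" by (rule bounded_linear_minus[OF bounded_linear_ident])
  note n = C_k_linear[OF m f(2)]
  show "C_k k (%t. f t - g t)" using C_k_add(1)[OF f(1) n(1)] by simp
  show "iter_vderiv j (%t. f t - g t) = (%t. iter_vderiv j f t - iter_vderiv j g t)" if "j <= k"
    using C_k_add(2)[OF f(1) n(1) that] n(2)[OF that] by simp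
qed

lemma C_k_mult:
  fixes f g :: "real => 'a::real_normed_algebra"
  shows "C_k k f ==> C_k k g ==> C_k k (%t. f t * g t)"
proof (induction k arbitrary: f g)
  case 0
  then show ?case by (simp add: C_k_0 continuous_on_mult)
next
  case (Suc k)
  obtain f' where f': "\<And>t. (f has_vector_derivative f' t) (at t)" "C_k k f'" using C_k_SucE[OF Suc.prems(1)] by blast
  obtain g' where g': "\<And>t. (g has_vector_derivative g' t) (at t)" "C_k k g'" using C_k_SucE[OF Suc.prems(2)] by blast
  show ?case
  proof (rule C_k_SucI)
    show "((%t. f t * g t) has_vector_derivative f t * g' t + f' t * g t) (at t)" for t
      by (rule has_vector_derivative_mult[OF f'(1) g'(1)])
    show "C_k k (%t. f t * g' t + f' t * g t)"
      by (intro C_k_add(1) Suc.IH f'(2) g'(2) C_k_pred[OF Suc.prems(1)] C_k_pred[OF Suc.prems(2)])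
  qed
qed

lemma C_k_power:
  fixes f :: "real => 'a::real_normed_algebra_1"
  shows "C_k k f ==> C_k k (%t. f t ^ m)"
  by (induction m) (auto intro: C_k_const C_k_mult)

lemma C_k_sum:
  assumes "finite I" "\<And>i. i \<in> I ==> C_k k (f i)"
  shows "C_k k (%t. \<Sum>i\<in>I. f i t)"
  using assms
proof (induction I rule: finite_induct)
  case (insert i I)
  have "C_k k (%t. f i t + (\<Sum>i\<in>I. f i t))" by (rule C_k_add(1)) (use insert in auto)
  then show ?case using insert by simp
qed (simp add: C_k_const)

lemma C_k_compose:
  fixes f g :: "real => real"
  shows "C_k k f ==> C_k k g ==> C_k k (%t. f (g t))"
proof (induction k arbitrary: f)
  case 0
  then show ?case using continuous_on_compose2[of UNIV f UNIV g] by (simp add: C_k_0)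
next
  case (Suc k)
  obtain f' where f': "\<And>t. (f has_vector_derivative f' t) (at t)" "C_k k f'" using C_k_SucE[OF Suc.prems(1)] by blast
  obtain g' where g': "\<And>t. (g has_vector_derivative g' t) (at t)" "C_k k g'" using C_k_SucE[OF Suc.prems(2)] by blast
  show ?case
  proof (rule C_k_SucI)
    show "((%t. f (g t)) has_vector_derivative f' (g t) * g' t) (at t)" for t
      using vector_diff_chain_at[OF g'(1) f'(1), of t] by (simp add: o_def mult.commute)
    show "C_k k (%t. f' (g t) * g' t)"
      by (rule C_k_mult[OF Suc.IH[OF f'(2) C_k_pred[OF Suc.prems(2)]] g'(2)])
  qed
qed

lemma C_k_inverse:
  fixes f :: "real => real"
  assumes nz: "\<And>t. f t ~= 0"
  shows "C_k k f ==> C_k k (%t. inverse (f t))"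
proof (induction k)
  case 0
  then show ?case using nz by (simp add: C_k_0 continuous_on_inverse)
next
  case (Suc k)
  obtain f' where f': "\<And>t. (f has_vector_derivative f' t) (at t)" "C_k k f'" using C_k_SucE[OF Suc.prems(1)] by blast
  have I: "C_k k (%t. inverse (f t))" using Suc.IH C_k_pred[OF Suc.prems] by blast
  show ?case
  proof (rule C_k_SucI)
    show "((%t. inverse (f t)) has_vector_derivative (-1) * (inverse (f t) * f' t * inverse (f t))) (at t)" for t
      using DERIV_inverse'[OF f'(1)[of t, folded has_real_derivative_iff_has_vector_derivative] nz]
      by (simp add: has_real_derivative_iff_has_vector_derivative)
    show "C_k k (%t. (-1) * (inverse (f t) * f' t * inverse (f t)))" by (intro C_k_mult C_k_const I f'(2))
  qed
qed

lemma iter_vderiv_local_zero: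
  assumes "open S" "\<And>t. t \<in> S ==> f t = 0" "t \<in> S"
  shows "iter_vderiv k f t = 0"
  using assms(2,3)
proof (induction k arbitrary: f t)
  case (Suc k)
  have vd: "vector_derivative f (at t) = 0" if t: "t \<in> S" for t
  proof -
    have "((%t. 0) has_vector_derivative 0) (at t)" by simp
    then have "(f has_vector_derivative 0) (at t)"
      by (rule has_vector_derivative_transform_within_open[OF _ assms(1) t]) (use Suc.prems(1) in auto)
    then show ?thesis by (rule vector_derivative_at)
  qed
  show ?case unfolding iter_vderiv_Suc_left by (rule Suc.IH[OF vd Suc.prems(2)])
qed simp

text \<open>Bounds of geometric type are stable under products: a derivative of order
  \<open>k\<close> of a product has \<open>2 ^ k\<close> terms, each bounded by
  \<open>A * E * D ^ k\<close>.\<close>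

lemma leibniz_bound:
  fixes f u :: "real => 'a::real_normed_algebra"
  assumes "C_k k f" "C_k k u" "A >= 0" "E >= 0" "D >= 0"
    "\<And>i. i <= k ==> norm (iter_vderiv i f t) <= A * D ^ i" "\<And>i. i <= k ==> norm (iter_vderiv i u t) <= E * D ^ i"
  shows "norm (iter_vderiv k (%t. f t * u t) t) <= A * E * (2 * D) ^ k"
  using assms
proof (induction k arbitrary: f u A E)
  case 0
  have "norm (f t * u t) <= norm (f t) * norm (u t)" by (rule norm_mult_ineq)
  also have "\<dots> <= A * E" using 0(6)[of 0] 0(7)[of 0] 0(3) by (intro mult_mono) auto
  finally show ?case by simp
next
  case (Suc k)
  obtain f' where f': "\<And>t. (f has_vector_derivative f' t) (at t)" "C_k k f'" using C_k_SucE[OF Suc.prems(1)] by blast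
  obtain u' where u': "\<And>t. (u has_vector_derivative u' t) (at t)" "C_k k u'" using C_k_SucE[OF Suc.prems(2)] by blast
  have fk: "C_k k f" "C_k k u" using C_k_pred Suc.prems(1,2) by auto
  have d: "((%t. f t * u t) has_vector_derivative f t * u' t + f' t * u t) (at t)" for t
    by (rule has_vector_derivative_mult[OF f'(1) u'(1)])
  have eq: "iter_vderiv (Suc k) (%t. f t * u t) t = iter_vderiv k (%t. f t * u' t) t + iter_vderiv k (%t. f' t * u t) t"
    unfolding iter_vderiv_Suc_eq[OF d] using C_k_add(2)[OF C_k_mult[OF fk(1) u'(2)] C_k_mult[OF f'(2) fk(2)], of k] by simp
  have b: "norm (iter_vderiv i f' t) <= (A * D) * D ^ i" "norm (iter_vderiv i u' t) <= (E * D) * D ^ i"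
    "norm (iter_vderiv i f t) <= A * D ^ i" "norm (iter_vderiv i u t) <= E * D ^ i" if "i <= k" for i
    using Suc.prems(6)[of "Suc i"] Suc.prems(7)[of "Suc i"] Suc.prems(6)[of i] Suc.prems(7)[of i] that
    unfolding iter_vderiv_Suc_eq[OF f'(1)] iter_vderiv_Suc_eq[OF u'(1)] by (auto simp: mult.assoc)
  have 1: "norm (iter_vderiv k (%t. f t * u' t) t) <= A * (E * D) * (2 * D) ^ k"
    by (rule Suc.IH[OF fk(1) u'(2)]) (use Suc.prems b in auto)
  have 2: "norm (iter_vderiv k (%t. f' t * u t) t) <= (A * D) * E * (2 * D) ^ k"
    by (rule Suc.IH[OF f'(2) fk(2)]) (use Suc.prems b in auto)
  have "A * (E * D) * (2 * D) ^ k + (A * D) * E * (2 * D) ^ k = A * E * (2 * D) ^ Suc k"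
    by (simp add: algebra_simps)
  then show ?case unfolding eq using norm_triangle_mono[OF 1 2] by (simp only:)
qed

text \<open>The factor \<open>2 ^ k\<close> comes from applying the Leibniz bound once per derivative.\<close>

lemma compose_bound:
  fixes f g :: "real => real"
  assumes "C_k k f" "C_k k g" "A >= 0" "D >= 0"
    "\<And>i x. i <= k ==> norm (iter_vderiv i f x) <= A" "\<And>i t. 0 < i ==> i <= k ==> norm (iter_vderiv i g t) <= D ^ i"
  shows "\<forall>i\<le>k. norm (iter_vderiv i (%t. f (g t)) t) <= A * (2 ^ k * D) ^ i"
  using assms
proof (induction k arbitrary: f)
  case 0
  then show ?case by simp
next
  case (Suc k)
  obtain f' where f': "\<And>t. (f has_vector_derivative f' t) (at t)" "C_k k f'" using C_k_SucE[OF Suc.prems(1)] by blast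
  obtain g' where g': "\<And>t. (g has_vector_derivative g' t) (at t)" "C_k k g'" using C_k_SucE[OF Suc.prems(2)] by blast
  have gk: "C_k k g" using C_k_pred Suc.prems(2) by blast
  have d: "((%t. f (g t)) has_vector_derivative f' (g t) * g' t) (at t)" for t
    using vector_diff_chain_at[OF g'(1) f'(1), of t] by (simp add: o_def mult.commute)
  have fb: "norm (iter_vderiv i f' x) <= A" if "i <= k" for i x
    using Suc.prems(5)[of "Suc i" x] that unfolding iter_vderiv_Suc_eq[OF f'(1)] by simp
  have IH: "\<forall>i\<le>k. norm (iter_vderiv i (%t. f' (g t)) t) <= A * (2 ^ k * D) ^ i"
    by (rule Suc.IH[OF f'(2) gk Suc.prems(3,4) fb]) (use Suc.prems(6) in auto)
  have gb: "norm (iter_vderiv i g' t) <= D * (2 ^ k * D) ^ i" if "i <= k" for i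
  proof -
    have "norm (iter_vderiv i g' t) <= D * D ^ i"
      using Suc.prems(6)[of "Suc i" t] that unfolding iter_vderiv_Suc_eq[OF g'(1)] by simp
    also have "\<dots> <= D * (2 ^ k * D) ^ i"
      using Suc.prems(4) mult_right_mono[of 1 "2 ^ k" D] by (intro mult_left_mono power_mono) auto
    finally show ?thesis .
  qed
  show ?case
  proof (intro allI impI)
    fix i assume i: "i <= Suc k"
    show "norm (iter_vderiv i (%t. f (g t)) t) <= A * (2 ^ Suc k * D) ^ i"
    proof (cases i)
      case 0
      then show ?thesis using Suc.prems(5)[of 0 "g t"] by simp
    next
      case (Suc j)
      then have jk: "j <= k" using i by simp
      have "norm (iter_vderiv j (%t. f' (g t) * g' t) t) <= A * D * (2 * (2 ^ k * D)) ^ j"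
      proof (rule leibniz_bound)
        show "C_k j (%t. f' (g t))" by (rule C_k_mono[OF C_k_compose[OF f'(2) gk] jk])
        show "C_k j g'" by (rule C_k_mono[OF g'(2) jk])
      qed (use IH gb jk Suc.prems(3,4) in auto)
      also have "\<dots> <= A * (2 ^ Suc k * D) * (2 ^ Suc k * D) ^ j"
      proof -
        have "D <= 2 ^ Suc k * D" using Suc.prems(4) mult_right_mono[of 1 "2 ^ Suc k" D] one_le_power[of "2::real" "Suc k"] by simp
        then show ?thesis using Suc.prems(3,4) by (intro mult_mono) (auto simp: mult.assoc)
      qed
      also have "\<dots> = A * (2 ^ Suc k * D) ^ i" by (simp add: Suc)
      finally show ?thesis unfolding Suc iter_vderiv_Suc_eq[OF d] .
    qed
  qed
qed

text \<open>Differentiation multiplies the amplitude by \<open>w\<close> and shifts the phase by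
  \<open>pi/2\<close>, so the family is closed under derivatives.\<close>

lemma sin_smooth: "C_k k (%t. c * sin (w * t + \<phi>))" and sin_derivative_bound: "norm (iter_vderiv k (%t. c * sin (w * t + \<phi>)) t) <= \<bar>c\<bar> * \<bar>w\<bar> ^ k"
  for c w \<phi> t :: real
proof -
  have d: "((%t. c * sin (w * t + \<phi>)) has_vector_derivative (c * w) * sin (w * t + (\<phi> + pi/2))) (at t)" for c \<phi> t
  proof -
    have "sin (w * t + (\<phi> + pi/2)) = cos (w * t + \<phi>)" unfolding add.assoc[symmetric] by (subst sin_add) simp
    moreover have "((%t. c * sin (w * t + \<phi>)) has_real_derivative (c * w) * cos (w * t + \<phi>)) (at t)"
      by (auto intro!: derivative_eq_intros)
    ultimately show ?thesis by (simp add: has_real_derivative_iff_has_vector_derivative)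
  qed
  have "C_k k (%t. c * sin (w * t + \<phi>)) \<and> norm (iter_vderiv k (%t. c * sin (w * t + \<phi>)) t) <= \<bar>c\<bar> * \<bar>w\<bar> ^ k"
  proof (induction k arbitrary: c \<phi>)
    case 0
    have "continuous_on UNIV (%t. c * sin (w * t + \<phi>))" by (intro continuous_intros)
    moreover have "\<bar>c\<bar> * \<bar>sin (w * t + \<phi>)\<bar> <= \<bar>c\<bar> * 1" by (intro mult_left_mono) auto
    ultimately show ?case by (simp add: C_k_0 abs_mult)
  next
    case (Suc k)
    have IH: "C_k k (%t. (c * w) * sin (w * t + (\<phi> + pi/2)))"
      "norm (iter_vderiv k (%t. (c * w) * sin (w * t + (\<phi> + pi/2))) t) <= \<bar>c * w\<bar> * \<bar>w\<bar> ^ k"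
      using Suc[of "c * w" "\<phi> + pi/2"] by auto
    show ?case
      unfolding iter_vderiv_Suc_eq[OF d] using C_k_SucI[OF d IH(1)] IH(2) by (simp only: abs_mult mult.assoc power_Suc)
  qed
  then show "C_k k (%t. c * sin (w * t + \<phi>))" "norm (iter_vderiv k (%t. c * sin (w * t + \<phi>)) t) <= \<bar>c\<bar> * \<bar>w\<bar> ^ k" by auto
qed

text \<open>The derivative of \<open>w ^ (m + 1) * f\<close> is \<open>w ^ m\<close> times a
  function \<open>g\<close> whose value at \<open>t1\<close> is
  \<open>(m + 1) * w' t1 * f t1\<close>. Only derivatives up to order \<open>m\<close> of
  \<open>w\<close> and \<open>f\<close> are required.\<close>

lemma power_times_vanishing:
  fixes w f :: "real => complex"
  assumes "C_k m w" "C_k m f" "w t1 = 0" "\<And>t. (w has_vector_derivative w' t) (at t)"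
  shows "(\<forall>j<m. iter_vderiv j (%t. w t ^ m * f t) t1 = 0) \<and> iter_vderiv m (%t. w t ^ m * f t) t1 = fact m * w' t1 ^ m * f t1"
  using assms(1,2)
proof (induction m arbitrary: f)
  case 0
  then show ?case by simp
next
  case (Suc m)
  obtain f' where f': "\<And>t. (f has_vector_derivative f' t) (at t)" "C_k m f'" using C_k_SucE[OF Suc.prems(2)] by blast
  have w'C: "C_k m w'"
  proof -
    have "w' = (%t. vector_derivative w (at t))" using vector_derivative_at[OF assms(4)] by auto
    then show ?thesis using C_k_SucD(2)[OF Suc.prems(1)] by simp
  qed
  define g where "g = (%t. of_nat (Suc m) * w' t * f t + w t * f' t)"
  have wm: "((%t. w t ^ Suc m) has_vector_derivative of_nat (Suc m) * w t ^ m * w' t) (at t)" for t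
  proof -
    have "((%z. z ^ Suc m) has_field_derivative of_nat (Suc m) * (1 * w t ^ (Suc m - Suc 0))) (at (w t))"
      by (rule DERIV_power[OF DERIV_ident])
    from field_vector_diff_chain_at[OF assms(4) this]
    have "((%t. w t ^ Suc m) has_vector_derivative w' t * (of_nat (Suc m) * (1 * w t ^ (Suc m - Suc 0)))) (at t)"
      by (simp only: o_def)
    then show ?thesis by (simp only: mult_1 diff_Suc_Suc diff_zero mult_ac)
  qed
  have d: "((%t. w t ^ Suc m * f t) has_vector_derivative w t ^ m * g t) (at t)" for t
    using has_vector_derivative_mult[OF wm f'(1), of t] by (simp add: g_def algebra_simps)
  have gC: "C_k m g" unfolding g_def
    by (intro C_k_add(1) C_k_mult C_k_const w'C f'(2) C_k_pred[OF Suc.prems(1)] C_k_pred[OF Suc.prems(2)])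
  have IH: "\<forall>j<m. iter_vderiv j (%t. w t ^ m * g t) t1 = 0" "iter_vderiv m (%t. w t ^ m * g t) t1 = fact m * w' t1 ^ m * g t1"
    using Suc.IH[OF C_k_pred[OF Suc.prems(1)] gC] by auto
  show ?case
  proof (intro conjI allI impI)
    fix j assume j: "j < Suc m"
    show "iter_vderiv j (%t. w t ^ Suc m * f t) t1 = 0"
    proof (cases j)
      case 0 then show ?thesis using assms(3) by simp
    next
      case (Suc i)
      then have "i < m" using j by simp
      then show ?thesis unfolding Suc iter_vderiv_Suc_eq[OF d] using IH(1) by blast
    qed
  next
    show "iter_vderiv (Suc m) (%t. w t ^ Suc m * f t) t1 = fact (Suc m) * w' t1 ^ Suc m * f t1"
    proof -
      have "g t1 = of_nat (Suc m) * w' t1 * f t1" by (simp add: g_def assms(3))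
      then show ?thesis unfolding iter_vderiv_Suc_eq[OF d] IH(2) by (simp add: algebra_simps)
    qed
  qed
qed

text \<open>A Taylor expansion in powers of \<open>w\<close> instead of \<open>t - t1\<close>. The
  new power does not disturb lower derivatives, and its own derivative of that order is a nonzero
  multiple of a power of \<open>w' t1\<close>, so its coefficient can be solved for.\<close>

lemma flat_correction:
  fixes w f :: "real => complex"
  assumes w: "C_k N w" "w t1 = 0" "\<And>t. (w has_vector_derivative w' t) (at t)" "w' t1 ~= 0" and f: "C_k N f"
  shows "n <= N ==> \<exists>\<alpha>. \<forall>j\<le>n. iter_vderiv j (%t. f t - (\<Sum>m\<le>n. \<alpha> m * w t ^ m)) t1 = 0"
proof (induction n)
  case 0
  show ?case by (intro exI[of _ "%_. f t1"]) simp
next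
  case (Suc n)
  then obtain \<alpha> where \<alpha>: "\<And>j. j <= n ==> iter_vderiv j (%t. f t - (\<Sum>m\<le>n. \<alpha> m * w t ^ m)) t1 = 0" by auto
  define u where "u = (%t. f t - (\<Sum>m\<le>n. \<alpha> m * w t ^ m))"
  have uC: "C_k (Suc n) u"
    unfolding u_def by (intro C_k_diff(1) C_k_sum C_k_mult C_k_const C_k_power C_k_mono[OF w(1)] C_k_mono[OF f]) (use Suc.prems in auto)
  define v where "v = (%t. w t ^ Suc n * 1)"
  have wS: "C_k (Suc n) w" using C_k_mono[OF w(1)] Suc.prems by simp
  have vC: "C_k (Suc n) v" unfolding v_def by (intro C_k_mult C_k_power C_k_const wS)
  have v: "\<And>j. j < Suc n ==> iter_vderiv j v t1 = 0" "iter_vderiv (Suc n) v t1 = fact (Suc n) * w' t1 ^ Suc n"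
    using power_times_vanishing[OF wS C_k_const w(2,3), of 1] unfolding v_def by auto
  have v0: "iter_vderiv (Suc n) v t1 ~= 0" unfolding v(2) using w(4) by (simp del: fact_Suc power_Suc)
  define a where "a = iter_vderiv (Suc n) u t1 / iter_vderiv (Suc n) v t1"
  define \<beta> where "\<beta> = \<alpha>(Suc n := a)"
  have eq: "(%t. f t - (\<Sum>m\<le>Suc n. \<beta> m * w t ^ m)) = (%t. u t - a * v t)"
  proof
    fix t
    have "(\<Sum>m\<le>n. \<beta> m * w t ^ m) = (\<Sum>m\<le>n. \<alpha> m * w t ^ m)" by (intro sum.cong) (auto simp: \<beta>_def)
    then show "f t - (\<Sum>m\<le>Suc n. \<beta> m * w t ^ m) = u t - a * v t" by (simp add: u_def v_def \<beta>_def)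
  qed
  have av: "C_k (Suc n) (%t. a * v t)" "\<And>j. j <= Suc n ==> iter_vderiv j (%t. a * v t) = (%t. a * iter_vderiv j v t)"
    using C_k_linear[OF bounded_linear_mult_right vC] by auto
  have "iter_vderiv j (%t. u t - a * v t) t1 = 0" if j: "j <= Suc n" for j
  proof -
    have "iter_vderiv j (%t. u t - a * v t) t1 = iter_vderiv j u t1 - a * iter_vderiv j v t1"
      using C_k_diff(2)[OF uC av(1) j] av(2)[OF j] by simp
    also have "\<dots> = 0"
    proof (cases "j = Suc n")
      case True then show ?thesis using v0 by (simp add: a_def)
    next
      case False then show ?thesis using j v(1) \<alpha>[of j] by (simp add: u_def)
    qed
    finally show ?thesis .
  qed
  then show ?case unfolding eq[symmetric] by blast
qed

text \<open>Downward from order \<open>N\<close>, where continuity alone gives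
  \<open>\<eta>\<close>: each application of the mean value inequality from \<open>t1\<close> gains
  a factor \<open>\<delta>\<close>.\<close>

lemma flat_bound:
  fixes u :: "real => complex"
  assumes u: "C_k N u" "\<And>j. j <= N ==> iter_vderiv j u t1 = 0" and \<eta>: "\<eta> > 0"
  shows "\<exists>\<delta>0>0. \<forall>\<delta> t i. 0 < \<delta> --> \<delta> <= \<delta>0 --> \<bar>t - t1\<bar> <= \<delta> --> i <= N --> norm (iter_vderiv i u t) <= \<eta> * \<delta> ^ (N - i)"
proof -
  have "continuous_on UNIV (iter_vderiv N u)" using u(1) by (simp add: C_k_def)
  then obtain d where d: "d > 0" "\<And>t. dist t t1 < d ==> dist (iter_vderiv N u t) (iter_vderiv N u t1) < \<eta>"
    using \<eta> unfolding continuous_on_iff by (metis UNIV_I)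
  have main: "norm (iter_vderiv (N - k) u t) <= \<eta> * \<delta> ^ k"
    if \<delta>: "0 < \<delta>" "\<delta> <= d/2" and k: "k <= N" and t: "\<bar>t - t1\<bar> <= \<delta>" for \<delta> t k
    using k t
  proof (induction k arbitrary: t)
    case 0
    have "dist t t1 < d" using 0 \<delta> by (simp add: dist_real_def)
    then show ?case using d(2)[of t] u(2)[of N] by simp
  next
    case (Suc k)
    define i where "i = N - Suc k"
    have iN: "Suc i = N - k" "i < N" using Suc.prems by (auto simp: i_def)
    interpret C1_curve "iter_vderiv i u" "iter_vderiv (Suc i) u"
    proof
      show "(iter_vderiv i u has_vector_derivative iter_vderiv (Suc i) u t) (at t)" for t
        using u(1) iN(2) unfolding C_k_def by blast
      show "continuous_on UNIV (iter_vderiv (Suc i) u)" by (rule C_k_iter_continuous[OF u(1)]) (use iN in simp)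
    qed
    have K: "norm (iter_vderiv (Suc i) u x) <= \<eta> * \<delta> ^ k" if "x \<in> {t1-\<delta>..t1+\<delta>}" for x
      unfolding iN(1) by (rule Suc.IH) (use Suc.prems that in auto)
    have "norm (iter_vderiv i u t - iter_vderiv i u t1) <= (\<eta> * \<delta> ^ k) * \<bar>t - t1\<bar>"
      by (rule lipschitz[OF K]) (use Suc.prems \<delta> in auto)
    also have "\<dots> <= (\<eta> * \<delta> ^ k) * \<delta>" using Suc.prems(2) \<eta> \<delta> by (intro mult_left_mono) auto
    finally show ?case using u(2)[of i] iN by (simp add: i_def mult_ac)
  qed
  show ?thesis
  proof (intro exI[of _ "d/2"] conjI allI impI)
    fix \<delta> t i assume "0 < \<delta>" "\<delta> <= d/2" "\<bar>t - t1\<bar> <= \<delta>" "i <= N"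
    then show "norm (iter_vderiv i u t) <= \<eta> * \<delta> ^ (N - i)" using main[of \<delta> "N - i" t] by simp
  qed (use d in simp)
qed

subsection \<open>Smooth cutoff functions\<close>

lemma C_k_ident: "C_k k (%t. t)"
proof (cases k)
  case 0 then show ?thesis by (simp add: C_k_0)
next
  case (Suc j)
  show ?thesis unfolding Suc by (rule C_k_SucI[of _ "%t. 1"]) (auto intro: C_k_const has_vector_derivative_id)
qed

text \<open>The classical flat function \<open>exp (- 1 / x)\<close> with polynomial factors in
  \<open>1 / x\<close>, a family closed under differentiation.\<close>

definition flat_exp :: "real poly => real => real" where
  "flat_exp p x = (if x > 0 then poly p (1 / x) * exp (- (1 / x)) else 0)"

lemma poly_times_exp_tendsto_0:
  fixes p :: "real poly"
  shows "((%y. poly p y * exp (- y)) \<longlongrightarrow> 0) at_top"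
proof -
  have "((%y. \<Sum>i\<le>degree p. coeff p i * (y ^ i / exp y)) \<longlongrightarrow> (\<Sum>i\<le>degree p. coeff p i * 0)) at_top"
    by (intro tendsto_sum tendsto_mult tendsto_const tendsto_power_div_exp_0)
  moreover have "(%y. \<Sum>i\<le>degree p. coeff p i * (y ^ i / exp y)) = (%y. poly p y * exp (- y))"
    by (simp add: poly_altdef exp_minus sum_distrib_right divide_inverse mult.assoc)
  ultimately show ?thesis by simp
qed

text \<open>With \<open>y = 1 / x\<close> the derivative in \<open>x\<close> is
  \<open>- y\<^sup>2\<close> times that in \<open>y\<close>, which turns \<open>p\<close> into
  \<open>y\<^sup>2 * (p - p')\<close>. At 0 the exponential beats every power of
  \<open>1 / x\<close>.\<close>

lemma flat_exp_derivative:
  "(flat_exp p has_real_derivative flat_exp ([:0, 0, 1:] * (p - pderiv p)) x) (at x)"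
proof -
  consider "x > 0" | "x < 0" | "x = 0" by linarith
  then show ?thesis
  proof cases
    case 1
    have "((%x. poly p (1 / x) * exp (- (1 / x))) has_real_derivative
        poly p (1 / x) * (exp (- (1 / x)) * (1 / x\<^sup>2)) + (poly (pderiv p) (1 / x) * (- (1 / x\<^sup>2))) * exp (- (1 / x))) (at x)"
    proof (rule DERIV_mult')
      have i: "((%x. 1 / x) has_real_derivative - (1 / x\<^sup>2)) (at x)"
        using 1 by (auto intro!: derivative_eq_intros simp: power2_eq_square)
      show "((%x. poly p (1 / x)) has_real_derivative poly (pderiv p) (1 / x) * (- (1 / x\<^sup>2))) (at x)"
        by (rule DERIV_chain2[OF poly_DERIV i])
      have "((%x. - (1 / x)) has_real_derivative 1 / x\<^sup>2) (at x)" using DERIV_minus[OF i] by simp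
      then show "((%x. exp (- (1 / x))) has_real_derivative exp (- (1 / x)) * (1 / x\<^sup>2)) (at x)"
        by (rule DERIV_chain2[OF DERIV_exp])
    qed
    moreover have "poly p (1 / x) * (exp (- (1 / x)) * (1 / x\<^sup>2)) + (poly (pderiv p) (1 / x) * (- (1 / x\<^sup>2))) * exp (- (1 / x))
        = flat_exp ([:0, 0, 1:] * (p - pderiv p)) x"
      using 1 by (simp add: flat_exp_def power2_eq_square algebra_simps)
    ultimately have d: "((%x. poly p (1 / x) * exp (- (1 / x))) has_real_derivative flat_exp ([:0, 0, 1:] * (p - pderiv p)) x) (at x)"
      by simp
    show ?thesis
      by (rule has_field_derivative_transform_within_open[OF d open_greaterThan[of 0]]) (use 1 in \<open>auto simp: flat_exp_def\<close>)
  next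
    case 2
    have d: "((%x. 0) has_real_derivative flat_exp ([:0, 0, 1:] * (p - pderiv p)) x) (at x)" using 2 by (simp add: flat_exp_def)
    show ?thesis
      by (rule has_field_derivative_transform_within_open[OF d open_lessThan[of 0]]) (use 2 in \<open>auto simp: flat_exp_def\<close>)
  next
    case 3
    have "((%h. flat_exp p h / h) \<longlongrightarrow> 0) (at 0)"
    proof (rule filterlim_split_at)
      have "\<forall>\<^sub>F h in at_left (0::real). flat_exp p h / h = 0"
        using eventually_at_left_real[of "-1" "0::real"] by (auto elim!: eventually_mono simp: flat_exp_def)
      then show "((%h. flat_exp p h / h) \<longlongrightarrow> 0) (at_left 0)" by (rule tendsto_eventually)
      have "((%h. poly ([:0, 1:] * p) (inverse h) * exp (- inverse h)) \<longlongrightarrow> 0) (at_right (0::real))"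
        by (rule filterlim_compose[OF poly_times_exp_tendsto_0 filterlim_inverse_at_top_right])
      moreover have "\<forall>\<^sub>F h in at_right (0::real). poly ([:0, 1:] * p) (inverse h) * exp (- inverse h) = flat_exp p h / h"
        using eventually_at_right_less[of 0] by (rule eventually_mono) (auto simp: flat_exp_def field_simps)
      ultimately show "((%h. flat_exp p h / h) \<longlongrightarrow> 0) (at_right 0)" by (rule Lim_transform_eventually)
    qed
    then have "(flat_exp p has_real_derivative 0) (at 0)" by (simp add: DERIV_def flat_exp_def)
    then show ?thesis using 3 by (simp add: flat_exp_def)
  qed
qed

lemma flat_exp_smooth: "C_k k (flat_exp p)"
proof (induction k arbitrary: p)
  case 0
  then show ?case unfolding C_k_0
    by (auto intro!: continuous_at_imp_continuous_on DERIV_isCont[OF flat_exp_derivative])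
next
  case (Suc k)
  show ?case
    by (rule C_k_SucI[OF _ Suc]) (use flat_exp_derivative in \<open>simp add: has_real_derivative_iff_has_vector_derivative\<close>)
qed

definition step :: "real => real" where
  "step x = flat_exp 1 x * inverse (flat_exp 1 x + flat_exp 1 (1 - x))"

lemma step_denominator: "flat_exp 1 x + flat_exp 1 (1 - x) ~= 0"
  by (cases "x > 0"; cases "1 - x > 0") (auto simp: flat_exp_def add_pos_pos less_imp_neq[symmetric])

lemma step_smooth: "C_k k step"
proof -
  have r: "C_k k (%x. flat_exp 1 (1 - x))"
    by (rule C_k_compose[OF flat_exp_smooth C_k_diff(1)[OF C_k_const C_k_ident]])
  show ?thesis unfolding step_def
    by (rule C_k_mult[OF flat_exp_smooth C_k_inverse[OF step_denominator C_k_add(1)[OF flat_exp_smooth r]]])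
qed

lemma step_values: "x >= 1 ==> step x = 1" "x <= 0 ==> step x = 0"
  by (auto simp: step_def flat_exp_def)

definition cutoff :: "real => real" where "cutoff x = step (2 - 2 * x) * step (2 + 2 * x)"

lemma cutoff_smooth: "C_k k cutoff"
proof -
  have l: "C_k k (%x. 2 * x :: real)" by (rule C_k_mult[OF C_k_const C_k_ident])
  show ?thesis unfolding cutoff_def
    by (rule C_k_mult[OF C_k_compose[OF step_smooth C_k_diff(1)[OF C_k_const l]] C_k_compose[OF step_smooth C_k_add(1)[OF C_k_const l]]])
qed

lemma cutoff_values: "\<bar>x\<bar> <= 1/2 ==> cutoff x = 1" "\<bar>x\<bar> >= 1 ==> cutoff x = 0" "cutoff (- x) = cutoff x"
proof -
  show "cutoff x = 1" if "\<bar>x\<bar> <= 1/2" using that by (simp add: cutoff_def step_values abs_le_iff)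
  show "cutoff x = 0" if "\<bar>x\<bar> >= 1" using that step_values(2)[of "2 - 2 * x"] step_values(2)[of "2 + 2 * x"]
    by (auto simp: cutoff_def abs_if split: if_splits)
  show "cutoff (- x) = cutoff x" by (simp add: cutoff_def mult.commute)
qed

lemma cutoff_derivatives_bounded: "\<exists>A\<ge>0. \<forall>i\<le>N. \<forall>x. norm (iter_vderiv i cutoff x) <= A"
proof -
  have "\<exists>A\<ge>0. \<forall>x. norm (iter_vderiv i cutoff x) <= A" for i
  proof -
    have "compact (iter_vderiv i cutoff ` {-1..1})"
      by (intro compact_continuous_image C_k_iter_continuous[OF cutoff_smooth[of i]]) auto
    then have "bounded (iter_vderiv i cutoff ` {-1..1})" by (rule compact_imp_bounded)
    then obtain A where A: "A > 0" "\<And>x. x \<in> {-1..1} ==> norm (iter_vderiv i cutoff x) <= A" unfolding bounded_pos by auto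
    have op: "open {x::real. 1 < \<bar>x\<bar>}" by (intro open_Collect_less continuous_intros)
    have "norm (iter_vderiv i cutoff x) <= A" for x
    proof (cases "x \<in> {-1..1}")
      case False
      then have "x \<in> {x. 1 < \<bar>x\<bar>}" by auto
      then have "iter_vderiv i cutoff x = 0" by (rule iter_vderiv_local_zero[OF op, rotated]) (auto intro: cutoff_values(2))
      then show ?thesis using A(1) by simp
    qed (rule A(2))
    then show ?thesis using A(1) by (intro exI[of _ A]) auto
  qed
  then obtain A where A: "\<And>i. A i >= 0" "\<And>i x. norm (iter_vderiv i cutoff x) <= A i" by metis
  have "norm (iter_vderiv i cutoff x) <= (\<Sum>i\<le>N. A i)" if "i <= N" for i x
    using A(2)[of i x] member_le_sum[of i "{..N}" A] A(1) that by fastforce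
  then show ?thesis using A(1) by (intro exI[of _ "\<Sum>i\<le>N. A i"]) (auto intro: sum_nonneg)
qed

text \<open>The sine makes the cutoff periodic without gluing: passing to \<open>t + 1\<close>
  changes its sign, and \<open>cutoff\<close> is even.\<close>

definition pcut :: "real => real => real => real" where
  "pcut t1 \<delta> t = cutoff (sin (pi * (t - t1)) / \<delta>)"

lemma pcut_eq: "pcut t1 \<delta> = (%t. cutoff ((1 / \<delta>) * sin (pi * t + (- (pi * t1)))))"
  by (auto simp: pcut_def right_diff_distrib)

lemma pcut_smooth: "C_k k (pcut t1 \<delta>)"
  unfolding pcut_eq by (rule C_k_compose[OF cutoff_smooth sin_smooth])

lemma pcut_periodic: "pcut t1 \<delta> (t + 1) = pcut t1 \<delta> t"
proof -
  have "sin (pi * (t + 1 - t1)) = - sin (pi * (t - t1))"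
    using sin_periodic_pi[of "pi * (t - t1)"] by (simp add: algebra_simps)
  then show ?thesis by (simp add: pcut_def cutoff_values(3))
qed

text \<open>Each derivative costs a factor of order \<open>1 / \<delta>\<close>. Neither
  \<open>A\<close> nor \<open>D\<close> depends on \<open>\<delta>\<close>, so the loss can be
  balanced against flatness.\<close>

lemma pcut_bound:
  "\<exists>A D. A >= 0 \<and> D >= 1 \<and> (\<forall>t1 \<delta> t i. 0 < \<delta> --> \<delta> <= 1 --> i <= N --> norm (iter_vderiv i (pcut t1 \<delta>) t) <= A * (D / \<delta>) ^ i)"
proof -
  obtain A where A: "A >= 0" "\<And>i x. i <= N ==> norm (iter_vderiv i cutoff x) <= A" using cutoff_derivatives_bounded by blast
  have pi1: "(1::real) <= 2 ^ N * pi"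
  proof -
    have "1 * 1 <= (2::real) ^ N * pi" using pi_ge_two by (intro mult_mono one_le_power) auto
    then show ?thesis by simp
  qed
  have "norm (iter_vderiv i (pcut t1 \<delta>) t) <= A * (2 ^ N * pi / \<delta>) ^ i" if \<delta>: "0 < \<delta>" "\<delta> <= 1" and i: "i <= N" for t1 \<delta> t i
  proof -
    have "norm (iter_vderiv j (%t. (1 / \<delta>) * sin (pi * t + (- (pi * t1)))) s) <= (pi / \<delta>) ^ j" if j: "0 < j" for j s
    proof -
      have "norm (iter_vderiv j (%t. (1 / \<delta>) * sin (pi * t + (- (pi * t1)))) s) <= \<bar>1 / \<delta>\<bar> * \<bar>pi\<bar> ^ j"
        by (rule sin_derivative_bound)
      also have "\<dots> = (1 / \<delta>) * pi ^ j" using \<delta> by simp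
      also have "\<dots> <= (1 / \<delta>) ^ j * pi ^ j"
        using \<delta> j power_increasing[of 1 j "1 / \<delta>"] by (intro mult_right_mono) auto
      also have "\<dots> = (pi / \<delta>) ^ j" by (simp add: power_divide)
      finally show ?thesis .
    qed
    then have "\<forall>i\<le>N. norm (iter_vderiv i (%t. cutoff ((1 / \<delta>) * sin (pi * t + (- (pi * t1))))) t) <= A * (2 ^ N * (pi / \<delta>)) ^ i"
      using \<delta> by (intro compose_bound cutoff_smooth sin_smooth A) auto
    then show ?thesis unfolding pcut_eq using i by simp
  qed
  then show ?thesis using A(1) pi1 by (intro exI[of _ A] exI[of _ "2 ^ N * pi"]) auto
qed

lemma pcut_one: "0 < \<delta> ==> \<bar>sin (pi * (t - t1))\<bar> <= \<delta> / 2 ==> pcut t1 \<delta> t = 1"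
  unfolding pcut_def by (intro cutoff_values(1)) (simp add: abs_divide pos_divide_le_eq)

lemma pcut_zero: "0 < \<delta> ==> \<delta> <= \<bar>sin (pi * (t - t1))\<bar> ==> pcut t1 \<delta> t = 0"
  unfolding pcut_def by (intro cutoff_values(2)) (simp add: abs_divide pos_le_divide_eq)

text \<open>Jordan's inequality: on \<open>[0, pi/2]\<close> the concave sine lies above its
  chord.\<close>

lemma abs_sin_pi_ge:
  fixes x :: real
  assumes "\<bar>x\<bar> <= 1/2"
  shows "2 * \<bar>x\<bar> <= \<bar>sin (pi * x)\<bar>"
proof -
  have pos: "2 * y <= sin (pi * y)" if y: "0 <= y" "y <= 1/2" for y
  proof -
    have "concave_on {0..pi/2} sin"
      by (rule f''_le0_imp_concave[where f' = cos and f'' = "%x. - sin x"])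
        (auto intro!: derivative_eq_intros sin_ge_zero)
    then have "(1 - 2 * y) * sin 0 + (2 * y) * sin (pi/2) <= sin ((1 - 2 * y) *\<^sub>R 0 + (2 * y) *\<^sub>R (pi/2))"
      by (rule concave_onD) (use y in auto)
    then show ?thesis by (simp add: mult.commute)
  qed
  show ?thesis
  proof (cases "x >= 0")
    case True
    then show ?thesis using pos[of x] assms by simp
  next
    case False
    then show ?thesis using pos[of "- x"] assms by simp
  qed
qed

text \<open>The sine is also small near \<open>t1 + 1\<close> and \<open>t1 - 1\<close>; the margin
  \<open>\<tau>\<close> excludes these zeros.\<close>

lemma sin_pi_small_imp_near:
  fixes t t1 \<tau> \<delta> :: real
  assumes "\<bar>t - t1\<bar> <= 1 - \<tau>" "\<bar>sin (pi * (t - t1))\<bar> <= \<delta>" "\<delta> < 2 * \<tau>"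
  shows "\<bar>t - t1\<bar> <= \<delta>"
proof (cases "\<bar>t - t1\<bar> <= 1/2")
  case True
  have "2 * \<bar>t - t1\<bar> <= \<delta>" by (rule order_trans[OF abs_sin_pi_ge[OF True] assms(2)])
  moreover have "\<bar>t - t1\<bar> <= 2 * \<bar>t - t1\<bar>" by simp
  ultimately show ?thesis by (rule order_trans[rotated])
next
  case False
  define x where "x = 1 - \<bar>t - t1\<bar>"
  have "\<bar>sin (pi * x)\<bar> = \<bar>sin (pi * (t - t1))\<bar>"
  proof -
    have "sin (pi * x) = sin (pi * \<bar>t - t1\<bar>)"
      unfolding x_def right_diff_distrib mult_1_right by (simp add: sin_diff)
    moreover have "\<bar>sin (pi * \<bar>t - t1\<bar>)\<bar> = \<bar>sin (pi * (t - t1))\<bar>"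
    proof (cases "t - t1 >= 0")
      case False
      then have "pi * \<bar>t - t1\<bar> = - (pi * (t - t1))" by (simp add: algebra_simps)
      then show ?thesis by (simp only: sin_minus abs_minus_cancel)
    qed simp
    ultimately show ?thesis by simp
  qed
  moreover have "2 * \<bar>x\<bar> <= \<bar>sin (pi * x)\<bar>" by (rule abs_sin_pi_ge) (use False assms(1,2,3) in \<open>auto simp: x_def\<close>)
  ultimately show ?thesis using assms by (simp add: x_def)
qed

subsection \<open>Perturbation of closed curves\<close>

lemma norm_axis: "norm (axis i x) = norm x" for x :: "'a::real_normed_vector"
proof -
  have "(\<Sum>j\<in>UNIV. (norm (if j = i then x else 0))\<^sup>2) = (norm x)\<^sup>2" by (simp add: if_distrib[of "%y. (norm y)\<^sup>2"] cong: if_cong)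
  then show ?thesis unfolding norm_vec_def L2_set_def axis_def by simp
qed

lemma bounded_linear_axis: "bounded_linear (axis i :: complex => complex^'n)"
proof (rule bounded_linear_intro)
  show "axis i (x + y) = axis i x + axis i y" for x y :: complex
    unfolding Finite_Cartesian_Product.vec_eq_iff by (simp add: axis_def)
  show "axis i (r *\<^sub>R x) = r *\<^sub>R axis i x" for r and x :: complex
    unfolding Finite_Cartesian_Product.vec_eq_iff by (simp add: axis_def)
  show "norm (axis i x) <= norm x * 1" for x :: complex by (simp add: norm_axis)
qed

lemma vector_derivative_periodic:
  assumes p: "periodic1 f" and d: "\<And>t. (f has_vector_derivative f' t) (at t)"
  shows "periodic1 f'"
  unfolding periodic1_def
proof
  fix t
  have "((%x. x + 1) has_vector_derivative 1) (at t)"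
    by (auto intro!: derivative_eq_intros simp: has_real_derivative_iff_has_vector_derivative[symmetric])
  then have "(f \<circ> (%x. x + 1) has_vector_derivative 1 *\<^sub>R f' (t + 1)) (at t)"
    by (rule vector_diff_chain_at) (rule d)
  moreover have "f \<circ> (%x. x + 1) = f" using p by (auto simp: periodic1_def)
  ultimately have "(f has_vector_derivative f' (t + 1)) (at t)" by simp
  then show "f' (t + 1) = f' t" using d[of t] by (rule vector_derivative_unique_at)
qed

lemma Ck_norm_le:
  assumes "\<And>j t. j <= k ==> t \<in> {0..1} ==> norm (iter_vderiv j h t) <= e"
  shows "Ck_norm k h <= real (Suc k) * e"
proof -
  have "Ck_norm k h <= (\<Sum>j\<le>k. e)" unfolding Ck_norm_def
    by (intro sum_mono cSUP_least) (use assms in auto)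
  then show ?thesis by simp
qed

lemma Ck_norm_nonneg:
  assumes "C_k k h" shows "0 <= Ck_norm k h"
  unfolding Ck_norm_def
proof (rule sum_nonneg)
  fix j assume "j \<in> {..k}"
  then have "continuous_on {0..1} (%t. norm (iter_vderiv j h t))"
    using C_k_iter_continuous[OF assms, of j] by (intro continuous_intros) auto
  then have "compact ((%t. norm (iter_vderiv j h t)) ` {0..1})" by (rule compact_continuous_image) simp
  then have "bdd_above ((%t. norm (iter_vderiv j h t)) ` {0..1})"
    by (intro bounded_imp_bdd_above compact_imp_bounded)
  then have "norm (iter_vderiv j h 0) <= (SUP t\<in>{0..1}. norm (iter_vderiv j h t))" by (intro cSUP_upper) auto
  then show "0 <= (SUP t\<in>{0..1}. norm (iter_vderiv j h t))" using norm_ge_zero order_trans by blast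
qed

text \<open>For \<open>s = \<infinity>\<close> the series beyond order \<open>N\<close> is at most
  \<open>(1/2) ^ N\<close> whatever the functions are, so finitely many derivatives decide. For
  finite \<open>s\<close> the order itself serves as \<open>N\<close>.\<close>

lemma dist_Cs_control:
  assumes s: "1 <= s" and \<epsilon>: "\<epsilon> > 0"
  shows "\<exists>N e. 1 <= N \<and> enat N <= s \<and> e > 0 \<and> (\<forall>f g :: real => 'a::real_normed_vector. C_s s (%t. f t - g t) -->
     (\<forall>j\<le>N. \<forall>t\<in>{0..1}. norm (iter_vderiv j (%t. f t - g t) t) <= e) --> dist_Cs s f g < \<epsilon>)"
proof (cases s)
  case (enat k)
  define e where "e = \<epsilon> / (2 * real (Suc k))"
  have "real (Suc k) * e = \<epsilon> / 2" by (simp add: e_def del: of_nat_Suc)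
  then have e: "e > 0" "real (Suc k) * e < \<epsilon>" using \<epsilon> by (auto simp: e_def simp del: of_nat_Suc)
  have "dist_Cs s f g < \<epsilon>" if "\<forall>j\<le>k. \<forall>t\<in>{0..1}. norm (iter_vderiv j (%t. f t - g t) t) <= e" for f g :: "real => 'a"
    using Ck_norm_le[of k "%t. f t - g t" e] that e(2) unfolding enat dist_Cs_def by simp
  then show ?thesis using s e(1) unfolding enat by (intro exI[of _ k] exI[of _ e]) (auto simp: one_enat_def)
next
  case infinity
  obtain N0 where N0: "(1/2::real) ^ N0 < \<epsilon> / 2" using real_arch_pow_inv[of "\<epsilon> / 2" "1/2"] \<epsilon> by auto
  define N where "N = Suc N0"
  have N: "(1/2::real) ^ N < \<epsilon> / 2"
  proof -
    have "(1/2::real) ^ N <= (1/2) ^ N0" unfolding N_def by (rule power_decreasing) auto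
    then show ?thesis using N0 by linarith
  qed
  \<comment> \<open>The head of the series is then at most \<open>\<epsilon> / 4\<close>, and the
    tail is below \<open>\<epsilon> / 2\<close>.\<close>
  define e where "e = \<epsilon> / (8 * real (Suc N))"
  have e: "e > 0" "2 * (real (Suc N) * e) = \<epsilon> / 4" using \<epsilon> by (auto simp: e_def field_simps)
  have "dist_Cs s f g < \<epsilon>" if C: "C_s s (%t. f t - g t)"
    and b: "\<forall>j\<le>N. \<forall>t\<in>{0..1}. norm (iter_vderiv j (%t. f t - g t) t) <= e" for f g :: "real => 'a"
  proof -
    define h where "h = (%t. f t - g t)"
    define a where "a = (%k. (1/2) ^ k * min 1 (Ck_norm k h))"
    have Ck: "C_k k h" for k using C unfolding infinity C_s_def h_def by simp
    have a0: "0 <= a k" "a k <= (1/2) ^ k" for k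
      unfolding a_def using Ck_norm_nonneg[OF Ck[of k]] by (auto intro!: mult_nonneg_nonneg mult_left_le)
    have g: "summable (%k. (1/2::real) ^ k)" by (rule summable_geometric) simp
    have sa: "summable a" by (rule summable_comparison_test'[OF g]) (use a0 in auto)
    have fin: "a k <= (1/2) ^ k * (real (Suc N) * e)" if "k <= N" for k
    proof -
      have "Ck_norm k h <= real (Suc k) * e" by (rule Ck_norm_le) (use b that in \<open>auto simp: h_def\<close>)
      also have "\<dots> <= real (Suc N) * e" using that e(1) by (intro mult_right_mono) auto
      finally show ?thesis unfolding a_def by (intro mult_left_mono) auto
    qed
    have "suminf a = (\<Sum>k. a (k + Suc N)) + (\<Sum>k<Suc N. a k)" by (rule suminf_split_initial_segment[OF sa])
    also have "(\<Sum>k. a (k + Suc N)) <= (\<Sum>k. (1/2::real) ^ k * (1/2) ^ Suc N)"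
    proof (rule suminf_le)
      show "a (k + Suc N) <= (1/2::real) ^ k * (1/2) ^ Suc N" for k using a0(2)[of "k + Suc N"] by (simp only: power_add)
      show "summable (%k. a (k + Suc N))" by (rule summable_ignore_initial_segment[OF sa])
      show "summable (%k. (1/2::real) ^ k * (1/2) ^ Suc N)" by (rule summable_mult2[OF g])
    qed
    also have "(\<Sum>k. (1/2::real) ^ k * (1/2) ^ Suc N) = (1/2) ^ N"
      by (subst suminf_mult2[OF g, symmetric]) (simp add: suminf_geometric)
    finally have 1: "suminf a <= (1/2) ^ N + (\<Sum>k<Suc N. a k)" by simp
    have "(\<Sum>k<Suc N. a k) <= (\<Sum>k<Suc N. (1/2) ^ k * (real (Suc N) * e))" by (rule sum_mono) (use fin in auto)
    also have "\<dots> = (\<Sum>k<Suc N. (1/2) ^ k) * (real (Suc N) * e)" by (rule sum_distrib_right[symmetric])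
    also have "\<dots> <= 2 * (real (Suc N) * e)"
    proof (rule mult_right_mono)
      have "(\<Sum>k<Suc N. (1/2::real) ^ k) <= (\<Sum>k. (1/2::real) ^ k)" by (rule sum_le_suminf[OF g]) auto
      then show "(\<Sum>k<Suc N. (1/2::real) ^ k) <= 2" using suminf_geometric[of "1/2::real"] by simp
    qed (use e in simp)
    finally have "suminf a < \<epsilon>" using 1 N e(2) \<epsilon> by linarith
    then show ?thesis unfolding infinity dist_Cs_def a_def h_def by simp
  qed
  then show ?thesis using e(1) unfolding infinity by (intro exI[of _ N] exI[of _ e]) (auto simp: N_def)
qed

section \<open>Stability of simple closed curves under small perturbations\<close>

context closed_curve begin

lemma periodic_derivative: "periodic1 \<gamma>'"
  by (rule vector_derivative_periodic[OF periodic der])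

lemma speed_bound: obtains m where "m > 0" "\<And>t. m <= norm (\<gamma>' t)"
proof -
  have "continuous_on {0..1} (%t. norm (\<gamma>' t))" by (intro continuous_intros continuous_on_subset[OF cont']) simp
  then have "\<exists>x\<in>{0..1}. \<forall>y\<in>{0..1}. norm (\<gamma>' x) <= norm (\<gamma>' y)" by (intro continuous_attains_inf) auto
  then obtain t0 where t0: "\<And>t. t \<in> {0..1} ==> norm (\<gamma>' t0) <= norm (\<gamma>' t)" by blast
  have "norm (\<gamma>' t0) <= norm (\<gamma>' t)" for t
    using t0[of "frac t"] periodic1_frac[OF periodic_derivative, of t] frac_ge_0[of t] frac_lt_1[of t] by simp
  then show thesis using that[of "norm (\<gamma>' t0)"] reg by simp
qed

text \<open>For short chords the derivative is nearly constant and bounded below; for the others,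
  injectivity and compactness apply. Chords of parameter length at most 1/2 suffice by
  periodicity.\<close>

lemma chord_bound: "\<exists>c>0. \<forall>s d. 0 <= d --> d <= 1/2 --> c * d <= norm (\<gamma> (s + d) - \<gamma> s)"
proof -
  obtain m where m: "m > 0" "\<And>t. m <= norm (\<gamma>' t)" using speed_bound by blast
  have "uniformly_continuous_on {0..2} \<gamma>'"
    by (intro compact_uniformly_continuous continuous_on_subset[OF cont']) auto
  then obtain d0 where d0: "d0 > 0" "\<And>x y. x \<in> {0..2} ==> y \<in> {0..2} ==> dist y x < d0 ==> dist (\<gamma>' y) (\<gamma>' x) < m/2"
    using m(1) unfolding uniformly_continuous_on_def by (metis half_gt_zero)
  define d1 where "d1 = min (d0/2) (1/2)"
  have d1: "0 < d1" "d1 < d0" "d1 <= 1/2" using d0 by (auto simp: d1_def)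
  have near: "m/2 * d <= norm (\<gamma> (s + d) - \<gamma> s)" if s: "s \<in> {0..1}" and d: "0 <= d" "d <= d1" for s d
  proof -
    have "norm (\<gamma> (s + d) - \<gamma> s - ((s + d) - s) *\<^sub>R \<gamma>' s) <= norm ((s + d) - s) * (m/2)"
    proof (rule vector_differentiable_bound_linearization[where S = "{s..s+d}"])
      show "(\<gamma> has_vector_derivative \<gamma>' x) (at x within {s..s+d})" for x by (rule has_vector_derivative_at_within[OF der])
      show "closed_segment s (s + d) \<subseteq> {s..s+d}" using d by (simp add: closed_segment_eq_real_ivl)
      show "s \<in> {s..s+d}" using d by simp
      fix x assume x: "x \<in> {s..s+d}"
      have "dist (\<gamma>' x) (\<gamma>' s) < m/2" using d0(2)[of s x] x s d d1 by (auto simp: dist_real_def)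
      then show "norm (\<gamma>' x - \<gamma>' s) <= m/2" by (simp add: dist_norm)
    qed
    then have 1: "norm (\<gamma> (s + d) - \<gamma> s - d *\<^sub>R \<gamma>' s) <= d * (m/2)" using d by simp
    have "d * m <= d * norm (\<gamma>' s)" using m(2)[of s] d by (intro mult_left_mono) auto
    then have "d * m <= norm (d *\<^sub>R \<gamma>' s)" using d by simp
    then show ?thesis using 1 norm_triangle_ineq2[of "d *\<^sub>R \<gamma>' s" "d *\<^sub>R \<gamma>' s - (\<gamma> (s + d) - \<gamma> s)"]
      by (simp add: norm_minus_commute mult.commute)
  qed
  obtain m2 where m2: "m2 > 0" "\<And>s d. s \<in> {0..1} ==> d \<in> {d1..1/2} ==> m2 <= norm (\<gamma> (s + d) - \<gamma> s)"
  proof -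
    let ?K = "{0..1::real} \<times> {d1..1/2}"
    have "continuous_on ?K (%z. norm (\<gamma> (fst z + snd z) - \<gamma> (fst z)))"
      by (intro continuous_intros continuous_on_compose2[OF cont[of UNIV]]) auto
    moreover have "?K ~= {}" using d1 by auto
    moreover have "compact ?K" by (intro compact_Times) auto
    ultimately obtain z where z: "z \<in> ?K" "\<And>y. y \<in> ?K ==> norm (\<gamma> (fst z + snd z) - \<gamma> (fst z)) <= norm (\<gamma> (fst y + snd y) - \<gamma> (fst y))"
      using continuous_attains_inf[of ?K "%z. norm (\<gamma> (fst z + snd z) - \<gamma> (fst z))"] by blast
    have "\<gamma> (fst z + snd z) ~= \<gamma> (fst z)"
    proof
      assume "\<gamma> (fst z + snd z) = \<gamma> (fst z)"
      then obtain k :: int where "fst z + snd z = fst z + of_int k" using periodic1_inj[OF periodic inj] by blast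
      then have "snd z = of_int k" by simp
      moreover have "0 < snd z" "snd z <= 1/2" using z(1) d1 by auto
      ultimately have "0 < real_of_int k" "real_of_int k < 1" by auto
      then show False by simp
    qed
    then show thesis using that[of "norm (\<gamma> (fst z + snd z) - \<gamma> (fst z))"] z(2) by force
  qed
  define c where "c = min (m/2) m2"
  have c: "c > 0" using m m2 by (simp add: c_def)
  have base: "c * d <= norm (\<gamma> (s + d) - \<gamma> s)" if s: "s \<in> {0..1}" and d: "0 <= d" "d <= 1/2" for s d
  proof (cases "d <= d1")
    case True
    have "c * d <= m/2 * d" using d by (intro mult_right_mono) (auto simp: c_def)
    then show ?thesis using near[OF s d(1) True] by linarith
  next
    case False
    have "c * d <= m2 * 1" using d c m2 by (intro mult_mono) (auto simp: c_def)
    then show ?thesis using m2(2)[OF s, of d] False d by auto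
  qed
  have "c * d <= norm (\<gamma> (s + d) - \<gamma> s)" if d: "0 <= d" "d <= 1/2" for s d
  proof -
    have "\<gamma> (frac s + d) = \<gamma> (s + d)" using periodic1_int[OF periodic, of "s + d" "- \<lfloor>s\<rfloor>"] by (simp add: frac_def algebra_simps)
    then show ?thesis using base[of "frac s" d] d periodic1_frac[OF periodic, of s] frac_ge_0[of s] frac_lt_1[of s] by simp
  qed
  then show ?thesis using c by blast
qed

text \<open>If the Lipschitz constant of \<open>h\<close> is below the chord constant, two points
  cannot be made to coincide; if it is below the minimal speed, the derivative cannot
  vanish.\<close>

lemma small_perturbation:
  "\<exists>e>0. \<forall>h h'. periodic1 h --> (\<forall>t. (h has_vector_derivative h' t) (at t)) --> continuous_on UNIV h' -->
     (\<forall>t\<in>{0..1}. norm (h' t) <= e) --> closed_curve (%t. \<gamma> t - h t) (%t. \<gamma>' t - h' t)"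
proof -
  obtain m where m: "m > 0" "\<And>t. m <= norm (\<gamma>' t)" using speed_bound by blast
  obtain c where c: "c > 0" "\<And>s d. 0 <= d ==> d <= 1/2 ==> c * d <= norm (\<gamma> (s + d) - \<gamma> s)" using chord_bound by blast
  define e where "e = min (m/2) (c/2)"
  have e: "e > 0" "e < m" "e < c" using m(1) c(1) by (auto simp: e_def)
  have "closed_curve (%t. \<gamma> t - h t) (%t. \<gamma>' t - h' t)"
    if h: "periodic1 h" "\<And>t. (h has_vector_derivative h' t) (at t)" "continuous_on UNIV h'" and b0: "\<And>t. t \<in> {0..1} ==> norm (h' t) <= e" for h h'
  proof
    have b: "norm (h' t) <= e" for t
      using b0[of "frac t"] periodic1_frac[OF vector_derivative_periodic[OF h(1,2)], of t] frac_ge_0[of t] frac_lt_1[of t] by simp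
    show "periodic1 (%t. \<gamma> t - h t)" using periodic h(1) by (simp add: periodic1_def)
    show "((%t. \<gamma> t - h t) has_vector_derivative \<gamma>' t - h' t) (at t)" for t
      by (rule has_vector_derivative_diff[OF der h(2)])
    show "continuous_on UNIV (%t. \<gamma>' t - h' t)" by (intro continuous_intros cont' h(3))
    show "\<gamma>' t - h' t ~= 0" for t
    proof
      assume "\<gamma>' t - h' t = 0"
      then have "norm (\<gamma>' t) = norm (h' t)" by simp
      then show False using m(2)[of t] b[of t] e by simp
    qed
    have lip: "norm (h (s + d) - h s) <= e * d" if d: "0 <= d" for s d
    proof -
      have "norm (h (s + d) - h s) <= e * norm ((s + d) - s)"
      proof (rule differentiable_bound[of UNIV h "%t x. x *\<^sub>R h' t"])
        fix x
        show "(h has_derivative (%y. y *\<^sub>R h' x)) (at x within UNIV)"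
          using h(2)[of x] unfolding has_vector_derivative_def .
        have "onorm (%y. y *\<^sub>R h' x) <= norm (h' x)" by (rule onorm_le) simp
        then show "onorm (%y. y *\<^sub>R h' x) <= e" using b[of x] by linarith
      qed auto
      then show ?thesis using d by simp
    qed
    have key: False if d: "0 < d" "d <= 1/2" and eq: "\<gamma> (s + d) - h (s + d) = \<gamma> s - h s" for s d
    proof -
      have "\<gamma> (s + d) - \<gamma> s = h (s + d) - h s" using eq by (simp add: algebra_simps)
      then have "norm (\<gamma> (s + d) - \<gamma> s) = norm (h (s + d) - h s)" by simp
      then have "c * d <= e * d" using c(2)[of d s] lip[of d s] d by linarith
      then show False using e(3) d(1) by simp
    qed
    have ord: False if st: "0 <= s" "s < t" "t < 1" and eq: "\<gamma> s - h s = \<gamma> t - h t" for s t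
    proof (cases "t - s <= 1/2")
      case True
      show False by (rule key[of "t - s" s]) (use st True eq in auto)
    next
      case False
      have "\<gamma> (s + 1) = \<gamma> s" "h (s + 1) = h s" using periodic h(1) by (auto simp: periodic1_def)
      then show False using key[of "1 - (t - s)" t] st False eq by (simp add: algebra_simps)
    qed
    show "inj_on (%t. \<gamma> t - h t) {0..<1}"
    proof (rule inj_onI)
      fix s t assume st: "s \<in> {0..<1}" "t \<in> {0..<1}" and eq: "\<gamma> s - h s = \<gamma> t - h t"
      show "s = t"
      proof (rule ccontr)
        assume "s ~= t"
        then consider "s < t" | "t < s" by linarith
        then show False by cases (use ord[of s t] ord[of t s] st eq in auto)
      qed
    qed
  qed
  then show ?thesis using e(1) by (intro exI[of _ e]) blast
qed

end

lemma simple_closed_curve_closed_curve: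
  assumes "simple_closed_curve s \<gamma>" "1 <= s"
  shows "closed_curve \<gamma> (%t. vector_derivative \<gamma> (at t))"
proof -
  have g: "periodic1 \<gamma>" "C_s s \<gamma>" "inj_on \<gamma> {0..<1}" "\<And>t. vector_derivative \<gamma> (at t) ~= 0"
    using assms(1) unfolding simple_closed_curve_def by auto
  have "C_k (Suc 0) \<gamma>" using g(2) assms(2) unfolding C_s_def by (simp add: one_enat_def)
  from C_k_SucD[OF this] show ?thesis using g by unfold_locales (auto simp: C_k_0)
qed

theorem theorem3p7:
  fixes s :: enat and \<gamma> :: "real \<Rightarrow> complex^'n" and \<epsilon> :: real
    and c :: "complex^'n" and r :: real
  assumes "1 \<le> s"
    and "CARD('n) \<ge> 2"
    and "simple_closed_curve s \<gamma>"
    and "\<epsilon> > 0"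
    and "ball c r \<inter> \<gamma> ` {0..1} \<noteq> {}"
  shows "\<exists>\<gamma>a :: real \<Rightarrow> complex^'n. simple_closed_curve s \<gamma>a
           \<and> polynomially_convex (\<gamma>a ` {0..1})
           \<and> dist_Cs s \<gamma> \<gamma>a < \<epsilon>
           \<and> \<gamma> ` {0..1} - ball c r = \<gamma>a ` {0..1} - ball c r"
proof -
  define \<gamma>' where "\<gamma>' = (%t. vector_derivative \<gamma> (at t))"
  interpret closed_curve \<gamma> \<gamma>' unfolding \<gamma>'_def by (rule simple_closed_curve_closed_curve[OF assms(3,1)])
  have Cs: "C_s s \<gamma>" using assms(3) by (simp add: simple_closed_curve_def)
  have Cg: "C_k k (%t. vec_nth (\<gamma> t) i)" if "enat k <= s" for k i
    using Cs that C_k_linear(1)[OF bounded_linear_vec_nth, of k \<gamma> i] unfolding C_s_def by blast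
  obtain N e0 where N: "1 <= N" "enat N <= s" and e0: "e0 > 0"
    and close: "\<And>f g :: real => complex^'n. C_s s (%t. f t - g t) ==>
       (\<forall>j\<le>N. \<forall>t\<in>{0..1}. norm (iter_vderiv j (%t. f t - g t) t) <= e0) ==> dist_Cs s f g < \<epsilon>"
    using dist_Cs_control[OF assms(1,4), where 'a = "complex^'n"] by blast
  obtain e1 where e1: "e1 > 0" and pert: "\<And>h h'. periodic1 h ==> (\<And>t. (h has_vector_derivative h' t) (at t)) ==> continuous_on UNIV h' ==>
     (\<And>t. t \<in> {0..1} ==> norm (h' t) <= e1) ==> closed_curve (%t. \<gamma> t - h t) (%t. \<gamma>' t - h' t)"
    using small_perturbation by blast
  obtain t1 \<tau> where \<tau>: "\<tau> > 0" and t1: "\<tau> <= t1" "t1 <= 1 - \<tau>" and inball: "\<And>t. \<bar>t - t1\<bar> <= \<tau> ==> \<gamma> t \<in> ball c r"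
  proof -
    obtain t0 where t0: "t0 \<in> {0..1}" "\<gamma> t0 \<in> ball c r" using assms(5) by blast
    have "open (\<gamma> -` ball c r)" using cont[of UNIV] by (intro open_vimage) auto
    then obtain \<rho> where \<rho>: "\<rho> > 0" "ball t0 \<rho> \<subseteq> \<gamma> -` ball c r" using t0(2) open_contains_ball by (metis vimageI)
    define q where "q = min (\<rho>/4) (1/8)"
    \<comment> \<open>Shifted by \<open>2 * q\<close> away from the nearer end, so that the whole
      window of radius \<open>q\<close> lies in the unit interval and still maps into the
      ball.\<close>
    define t1 where "t1 = (if t0 <= 1/2 then t0 + 2 * q else t0 - 2 * q)"
    have q: "q > 0" "q <= 1/8" "4 * q <= \<rho>" using \<rho> by (auto simp: q_def)
    show thesis
    proof (rule that[of q t1])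
      show "q <= t1" "t1 <= 1 - q" using q t0 by (auto simp: t1_def)
      fix t assume "\<bar>t - t1\<bar> <= q"
      then have "t \<in> ball t0 \<rho>" using q by (auto simp: t1_def dist_real_def split: if_splits)
      then show "\<gamma> t \<in> ball c r" using \<rho>(2) by blast
    qed (rule q)
  qed
  obtain \<mu> where \<mu>: "\<mu> > 0" and margin: "\<And>t y. \<bar>t - t1\<bar> <= \<tau> ==> norm (y - \<gamma> t) < \<mu> ==> y \<in> ball c r"
  proof -
    have "continuous_on {t1-\<tau>..t1+\<tau>} (%t. dist c (\<gamma> t))" by (intro continuous_intros cont)
    then obtain t0 where t0: "t0 \<in> {t1-\<tau>..t1+\<tau>}" "\<And>t. t \<in> {t1-\<tau>..t1+\<tau>} ==> dist c (\<gamma> t) <= dist c (\<gamma> t0)"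
      using continuous_attains_sup[of "{t1-\<tau>..t1+\<tau>}" "%t. dist c (\<gamma> t)"] \<tau> by auto
    have "dist c (\<gamma> t0) < r" using inball[of t0] t0(1) by auto
    moreover have "y \<in> ball c r" if "\<bar>t - t1\<bar> <= \<tau>" "norm (y - \<gamma> t) < r - dist c (\<gamma> t0)" for t y
    proof -
      have "t \<in> {t1-\<tau>..t1+\<tau>}" using that(1) by (auto simp: abs_le_iff)
      then have "dist c (\<gamma> t) <= dist c (\<gamma> t0)" by (rule t0(2))
      then show ?thesis using dist_triangle[of c y "\<gamma> t"] that(2) by (simp add: dist_norm norm_minus_commute)
    qed
    ultimately show thesis using that[of "r - dist c (\<gamma> t0)"] by simp
  qed
  obtain a where a: "vec_nth (\<gamma>' t1) a ~= 0" using reg[of t1] by (auto simp: Finite_Cartesian_Product.vec_eq_iff)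
  obtain b where b: "b ~= a"
  proof -
    have "UNIV ~= {a}" using assms(2) by (metis card.empty card_insert_if empty_iff finite.emptyI not_less_eq_eq numeral_2_eq_2 order_refl)
    then show thesis using that by blast
  qed
  define w where "w = (%t. vec_nth (\<gamma> t) a - vec_nth (\<gamma> t1) a)"
  define w' where "w' = (%t. vec_nth (\<gamma>' t) a)"
  have wC: "C_k k w" if "enat k <= s" for k unfolding w_def by (intro C_k_diff(1) C_k_const Cg that)
  have wd: "(w has_vector_derivative w' t) (at t)" for t
    unfolding w_def w'_def
    using has_vector_derivative_diff[OF bounded_linear.has_vector_derivative[OF bounded_linear_vec_nth der] has_vector_derivative_const] by simp
  have w1: "w t1 = 0" "w' t1 ~= 0" using a by (auto simp: w_def w'_def)
  \<comment> \<open>A parameter at which the polynomial \<open>G\<close> will be nonzero. It exists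
    because \<open>w\<close> has a simple zero at \<open>t1\<close>.\<close>
  obtain t2 where t2: "0 < t2" "t2 < 1" "t2 ~= t1" "w t2 ~= 0"
  proof -
    have "\<exists>t2. \<bar>t2 - t1\<bar> < \<tau> \<and> t2 ~= t1 \<and> w t2 ~= 0"
    proof (rule ccontr)
      assume "\<not> ?thesis"
      then have z: "w t = 0" if "t \<in> ball t1 \<tau>" for t using that w1(1) by (auto simp: dist_real_def abs_minus_commute)
      have "((%t. 0) has_vector_derivative 0) (at t1)" by simp
      then have "(w has_vector_derivative 0) (at t1)"
        by (rule has_vector_derivative_transform_within_open[of _ _ _ "ball t1 \<tau>"]) (use z \<tau> in auto)
      then show False using vector_derivative_unique_at[OF wd] w1(2) by blast
    qed
    then obtain t2 where "\<bar>t2 - t1\<bar> < \<tau>" "t2 ~= t1" "w t2 ~= 0" by blast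
    then show thesis using that[of t2] t1 by (simp add: abs_less_iff)
  qed
  obtain \<alpha> where \<alpha>: "\<And>j. j <= N ==> iter_vderiv j (%t. vec_nth (\<gamma> t) b - (\<Sum>m\<le>N. \<alpha> m * w t ^ m)) t1 = 0"
    using flat_correction[OF wC[OF N(2)] w1(1) wd w1(2) Cg[OF N(2), of b], of N] by auto
  define u0 where "u0 = (%t. vec_nth (\<gamma> t) b - (\<Sum>m\<le>N. \<alpha> m * w t ^ m))"
  \<comment> \<open>If \<open>u0\<close> happens to vanish at \<open>t2\<close>, the term of degree
    \<open>N + 1\<close> makes \<open>u\<close> nonzero there without affecting flatness up to order
    \<open>N\<close>.\<close>
  define \<beta> where "\<beta> = (if u0 t2 = 0 then 1 else 0 :: complex)"
  define u where "u = (%t. u0 t - \<beta> * (w t ^ Suc N))"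
  have u0C: "C_k k u0" if "enat k <= s" for k
    unfolding u0_def by (intro C_k_diff(1) C_k_sum C_k_mult C_k_const C_k_power Cg wC that) auto
  have uC: "C_k k u" if "enat k <= s" for k
    unfolding u_def by (intro C_k_diff(1) C_k_mult C_k_const C_k_power u0C wC that)
  have u2: "u t2 ~= 0" using t2(4) by (simp add: u_def \<beta>_def)
  have flat: "iter_vderiv j u t1 = 0" if j: "j <= N" for j
  proof -
    have "C_k N (%t. \<beta> * (w t ^ Suc N))" by (intro C_k_mult C_k_const C_k_power wC N)
    then have "iter_vderiv j u t1 = iter_vderiv j u0 t1 - iter_vderiv j (%t. \<beta> * (w t ^ Suc N)) t1"
      unfolding u_def using C_k_diff(2)[OF u0C[OF N(2)] _ j] by metis
    \<comment> \<open>Writing the term as \<open>w ^ N\<close> times a function vanishing at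
      \<open>t1\<close> settles the derivative of order \<open>N\<close> as well, using only
      \<open>N\<close> derivatives of \<open>w\<close>.\<close>
    moreover have "iter_vderiv j (%t. w t ^ N * (\<beta> * w t)) t1 = 0"
    proof (cases "j < N")
      case True
      then show ?thesis using power_times_vanishing[OF wC[OF N(2)] C_k_mult[OF C_k_const wC[OF N(2)]] w1(1) wd, of \<beta>] by blast
    next
      case False
      then have "j = N" using j by simp
      then show ?thesis using power_times_vanishing[OF wC[OF N(2)] C_k_mult[OF C_k_const wC[OF N(2)]] w1(1) wd, of \<beta>] w1(1) by simp
    qed
    moreover have "(%t. \<beta> * (w t ^ Suc N)) = (%t. w t ^ N * (\<beta> * w t))" by (auto simp: mult_ac)
    ultimately show ?thesis using \<alpha>[OF j] unfolding u0_def by simp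
  qed
  have up: "periodic1 u" using periodic unfolding u_def u0_def w_def periodic1_def by simp
  obtain A D where A: "A >= 0" and D: "D >= 1" and cut: "\<And>t1 \<delta> t i. 0 < \<delta> ==> \<delta> <= 1 ==> i <= N ==> norm (iter_vderiv i (pcut t1 \<delta>) t) <= A * (D / \<delta>) ^ i"
    using pcut_bound[of N] by blast
  define e where "e = min e0 (min e1 (\<mu>/2))"
  have e: "e > 0" "e <= e0" "e <= e1" "e < \<mu>" using e0 e1 \<mu> by (auto simp: e_def)
  \<comment> \<open>Absorbs the constants \<open>A\<close> of the cutoff and
    \<open>(2 * D) ^ N\<close> of the Leibniz bound.\<close>
  define \<eta> where "\<eta> = e / ((A + 1) * (2 * D) ^ N)"
  have DN: "(2 * D) ^ N > 0" using D by simp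
  have \<eta>: "\<eta> > 0" using e A DN by (simp add: \<eta>_def)
  have \<eta>e: "A * \<eta> * (2 * D) ^ N <= e"
  proof -
    have "A * \<eta> * (2 * D) ^ N = A / (A + 1) * e" 
    proof -
      have "A * (e / ((A + 1) * P)) * P = A / (A + 1) * e" if "P ~= 0" for P :: real using that by simp
      then show ?thesis unfolding \<eta>_def using DN by (metis less_irrefl)
    qed
    also have "\<dots> <= 1 * e" using A e by (intro mult_right_mono) auto
    finally show ?thesis by simp
  qed
  obtain \<delta>0 where \<delta>0: "\<delta>0 > 0" "\<And>\<delta> t i. 0 < \<delta> ==> \<delta> <= \<delta>0 ==> \<bar>t - t1\<bar> <= \<delta> ==> i <= N ==> norm (iter_vderiv i u t) <= \<eta> * \<delta> ^ (N - i)"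
    using flat_bound[OF uC[OF N(2)] flat \<eta>] by blast
  have s2: "sin (pi * (t2 - t1)) ~= 0"
  proof
    assume "sin (pi * (t2 - t1)) = 0"
    then obtain k :: int where k: "pi * (t2 - t1) = of_int k * pi" by (auto simp: sin_zero_iff_int2)
    then have "t2 - t1 = of_int k" by simp
    moreover have "\<bar>t2 - t1\<bar> < 1" using t2 t1 \<tau> by auto
    ultimately have "\<bar>real_of_int k\<bar> < 1" by simp
    then have "k = 0" by linarith
    then show False using k t2(3) by simp
  qed
  \<comment> \<open>Small enough for the flatness estimate and for the window inside the ball; the
    last bound makes the cutoff vanish at \<open>t2\<close>.\<close>
  define \<delta> where "\<delta> = Min {\<delta>0, 1, \<tau>, \<bar>sin (pi * (t2 - t1))\<bar>}"
  have \<delta>: "0 < \<delta>" "\<delta> <= \<delta>0" "\<delta> <= 1" "\<delta> <= \<tau>" "\<delta> <= \<bar>sin (pi * (t2 - t1))\<bar>"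
    using \<delta>0(1) \<tau> s2 by (auto simp: \<delta>_def)
  have near: "\<bar>t - t1\<bar> <= \<delta>" if "t \<in> {0..1}" "\<bar>sin (pi * (t - t1))\<bar> <= \<delta>" for t
    by (rule sin_pi_small_imp_near[where \<tau> = \<tau>]) (use that t1 \<tau> \<delta> in auto)
  define \<psi> where "\<psi> = (%t. of_real (pcut t1 \<delta> t) * u t)"
  have pcC: "C_k k (%t. complex_of_real (pcut t1 \<delta> t))"
    and pci: "j <= k ==> iter_vderiv j (%t. complex_of_real (pcut t1 \<delta> t)) = (%t. of_real (iter_vderiv j (pcut t1 \<delta>) t))" for k j
    using C_k_linear[OF bounded_linear_of_real pcut_smooth] by blast+
  have \<psi>C: "C_k k \<psi>" if "enat k <= s" for k unfolding \<psi>_def by (intro C_k_mult pcC uC that)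
  have \<psi>p: "periodic1 \<psi>" using up unfolding \<psi>_def periodic1_def by (simp add: pcut_periodic)
  have \<psi>b: "norm (iter_vderiv j \<psi> t) <= e" if j: "j <= N" and t: "t \<in> {0..1}" for j t
  proof (cases "\<bar>sin (pi * (t - t1))\<bar> <= \<delta>")
    case True
    then have tn: "\<bar>t - t1\<bar> <= \<delta>" by (rule near[OF t])
    have jC: "enat j <= s" using j N(2) by (meson enat_ord_simps(1) order_trans)
    \<comment> \<open>The loss \<open>(D / \<delta>) ^ j\<close> through the cutoff is compensated
      by the gain \<open>\<delta> ^ N\<close> through flatness, for all
      \<open>j <= N\<close>.\<close>
    have "norm (iter_vderiv j \<psi> t) <= A * (\<eta> * \<delta> ^ N) * (2 * (D / \<delta>)) ^ j"
      unfolding \<psi>_def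
    proof (rule leibniz_bound[OF pcC uC[OF jC] A])
      show "0 <= \<eta> * \<delta> ^ N" "0 <= D / \<delta>" using \<eta> \<delta> D by auto
      fix i assume i: "i <= j"
      show "norm (iter_vderiv i (%t. complex_of_real (pcut t1 \<delta> t)) t) <= A * (D / \<delta>) ^ i"
        using cut[OF \<delta>(1,3), of i t1 t] i j by (simp add: pci[OF order_refl])
      have "norm (iter_vderiv i u t) <= \<eta> * \<delta> ^ (N - i)" by (rule \<delta>0(2)[OF \<delta>(1,2) tn]) (use i j in simp)
      also have "\<dots> = \<eta> * \<delta> ^ N * (1 / \<delta>) ^ i"
      proof -
        have "\<delta> ^ N = \<delta> ^ (N - i) * \<delta> ^ i" using i j by (simp add: power_add[symmetric])
        then show ?thesis using \<delta>(1) by (simp add: power_divide)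
      qed
      also have "\<dots> <= \<eta> * \<delta> ^ N * (D / \<delta>) ^ i"
        using \<eta> \<delta> D by (intro mult_left_mono power_mono divide_right_mono) auto
      finally show "norm (iter_vderiv i u t) <= \<eta> * \<delta> ^ N * (D / \<delta>) ^ i" .
    qed
    also have "\<dots> = A * \<eta> * (2 * D) ^ j * \<delta> ^ (N - j)"
    proof -
      have "\<delta> ^ N = \<delta> ^ (N - j) * \<delta> ^ j" using j by (simp add: power_add[symmetric])
      then show ?thesis using \<delta>(1) by (simp add: power_divide)
    qed
    also have "\<dots> <= A * \<eta> * (2 * D) ^ N * 1"
      using A \<eta> D \<delta> j by (intro mult_mono mult_left_mono power_increasing power_le_one) auto
    also have "\<dots> <= e" using \<eta>e by simp
    finally show ?thesis .
  next
    case False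
    define S where "S = {t. \<delta> < \<bar>sin (pi * (t - t1))\<bar>}"
    have "open S" unfolding S_def by (intro open_Collect_less continuous_intros)
    moreover have "\<psi> t = 0" if "t \<in> S" for t using pcut_zero[OF \<delta>(1), of t t1] that by (simp add: \<psi>_def S_def)
    moreover have "t \<in> S" using False by (simp add: S_def not_le)
    ultimately have "iter_vderiv j \<psi> t = 0" by (rule iter_vderiv_local_zero)
    then show ?thesis using e by simp
  qed
  define h where "h = (%t. axis b (\<psi> t) :: complex^'n)"
  define \<gamma>a where "\<gamma>a = (%t. \<gamma> t - h t)"
  have hC: "C_k k h" and hi: "j <= k ==> iter_vderiv j h = (%t. axis b (iter_vderiv j \<psi> t))" if "enat k <= s" for k j
    using C_k_linear[OF bounded_linear_axis[of b] \<psi>C[OF that]] unfolding h_def by auto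
  have hb: "norm (iter_vderiv j h t) <= e" if "j <= N" "t \<in> {0..1}" for j t
    using \<psi>b[OF that] hi[OF N(2) that(1)] by (simp add: norm_axis)
  have h1: "C_k (Suc 0) h" using hC[of "Suc 0"] assms(1) by (simp add: one_enat_def)
  interpret new: closed_curve \<gamma>a "%t. \<gamma>' t - vector_derivative h (at t)"
    unfolding \<gamma>a_def
  proof (rule pert)
    show "periodic1 h" using \<psi>p by (simp add: h_def periodic1_def)
    show "(h has_vector_derivative vector_derivative h (at t)) (at t)" for t by (rule C_k_SucD(1)[OF h1])
    show "continuous_on UNIV (%t. vector_derivative h (at t))" using C_k_SucD(2)[OF h1] by (simp add: C_k_0)
    show "norm (vector_derivative h (at t)) <= e1" if "t \<in> {0..1}" for t
      using hb[of "Suc 0" t] N(1) that e(3) by simp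
  qed
  have scc: "simple_closed_curve s \<gamma>a"
    unfolding simple_closed_curve_def
  proof (intro conjI allI)
    show "periodic1 \<gamma>a" "inj_on \<gamma>a {0..<1}" by (rule new.periodic new.inj)+
    show "C_s s \<gamma>a" unfolding C_s_def \<gamma>a_def using Cs hC by (auto intro: C_k_diff(1) simp: C_s_def)
    show "vector_derivative \<gamma>a (at t) ~= 0" for t using vector_derivative_at[OF new.der, of t] new.reg[of t] by simp
  qed
  have diff: "(%t. \<gamma> t - \<gamma>a t) = h" by (simp add: \<gamma>a_def)
  have dist: "dist_Cs s \<gamma> \<gamma>a < \<epsilon>"
    by (rule close; unfold diff) (use hC hb e(2) in \<open>force simp: C_s_def\<close>)+
  have supp: "\<gamma> t = \<gamma>a t \<or> (\<gamma> t \<in> ball c r \<and> \<gamma>a t \<in> ball c r)" if t: "t \<in> {0..1}" for t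
  proof (cases "\<bar>sin (pi * (t - t1))\<bar> <= \<delta>")
    case True
    then have tn: "\<bar>t - t1\<bar> <= \<tau>" using near[OF t] \<delta>(4) by linarith
    have "norm (\<gamma>a t - \<gamma> t) < \<mu>" using hb[of 0 t] t e(4) by (simp add: \<gamma>a_def)
    then show ?thesis using margin[OF tn] inball[OF tn] by blast
  next
    case False
    then have "\<psi> t = 0" using pcut_zero[OF \<delta>(1), of t t1] by (simp add: \<psi>_def)
    then show ?thesis using norm_axis[of b "\<psi> t"] by (simp add: \<gamma>a_def h_def)
  qed
  have outside: "\<gamma> ` {0..1} - ball c r = \<gamma>a ` {0..1} - ball c r"
  proof (intro equalityI subsetI)
    fix x assume "x \<in> \<gamma> ` {0..1} - ball c r"
    then obtain t where "t \<in> {0..1}" "x = \<gamma> t" "x \<notin> ball c r" by blast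
    then show "x \<in> \<gamma>a ` {0..1} - ball c r" using supp[of t] by auto
  next
    fix x assume "x \<in> \<gamma>a ` {0..1} - ball c r"
    then obtain t where t: "t \<in> {0..1}" "x = \<gamma>a t" "x \<notin> ball c r" by blast
    then have "x = \<gamma> t" using supp[of t] by auto
    then show "x \<in> \<gamma> ` {0..1} - ball c r" using t by blast
  qed
  define G where "G = (%z :: complex^'n. vec_nth z b - ((\<Sum>m\<le>N. \<alpha> m * (vec_nth z a - vec_nth (\<gamma> t1) a) ^ m) + \<beta> * (vec_nth z a - vec_nth (\<gamma> t1) a) ^ Suc N))"
  have G: "G \<in> polyfuns" unfolding G_def
    by (intro polyfuns_diff polyfuns.add polyfuns_sum polyfuns.mult polyfuns.const polyfuns.coord polyfuns_power) simp
  \<comment> \<open>Coordinate \<open>a\<close> is unchanged, so subtracting \<open>\<psi>\<close>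
    from coordinate \<open>b\<close> turns \<open>u\<close> into \<open>(1 - cutoff) * u\<close>:
    zero near \<open>t1\<close> and nonzero at \<open>t2\<close>.\<close>
  have Ga: "G (\<gamma>a t) = (1 - of_real (pcut t1 \<delta> t)) * u t" for t
  proof -
    have "vec_nth (\<gamma>a t) a = vec_nth (\<gamma> t) a" "vec_nth (\<gamma>a t) b = vec_nth (\<gamma> t) b - \<psi> t"
      using b by (auto simp: \<gamma>a_def h_def axis_def)
    then show ?thesis unfolding G_def u_def u0_def w_def \<psi>_def by (simp add: algebra_simps)
  qed
  have "polynomially_convex (\<gamma>a ` {0..1})"
  proof (rule new.polynomially_convex_image[OF G, of "t1 - \<delta> / (2 * pi)" "t1 + \<delta> / (2 * pi)" t2])
    \<comment> \<open>Within \<open>\<delta> / (2 * pi)\<close> of \<open>t1\<close> the sine is at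
      most \<open>\<delta> / 2\<close>, where the cutoff is identically 1.\<close>
    have pd: "0 < \<delta> / (2 * pi)" "\<delta> / (2 * pi) < 1/2"
      using \<delta> pi_gt3 by (auto simp: divide_simps)
    then show "t1 - \<delta> / (2 * pi) < t1 + \<delta> / (2 * pi)" "t1 + \<delta> / (2 * pi) < t1 - \<delta> / (2 * pi) + 1" by linarith+
    show "G (\<gamma>a t) = 0" if t: "t \<in> {t1 - \<delta> / (2 * pi)<..<t1 + \<delta> / (2 * pi)}" for t
    proof -
      have "\<bar>t - t1\<bar> <= \<delta> / (2 * pi)" using t by auto
      then have "pi * \<bar>t - t1\<bar> <= pi * (\<delta> / (2 * pi))" by (intro mult_left_mono) auto
      then have "\<bar>pi * (t - t1)\<bar> <= \<delta> / 2" by (simp add: abs_mult)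
      then have "\<bar>sin (pi * (t - t1))\<bar> <= \<delta> / 2" using abs_sin_x_le_abs_x[of "pi * (t - t1)"] by linarith
      then have "pcut t1 \<delta> t = 1" by (rule pcut_one[OF \<delta>(1)])
      then show ?thesis by (simp add: Ga)
    qed
    have "pcut t1 \<delta> t2 = 0" by (rule pcut_zero[OF \<delta>(1,5)])
    then show "G (\<gamma>a t2) ~= 0" using u2 by (simp add: Ga)
  qed
  then show ?thesis using scc dist outside by blast
qed

end
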